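(* Let $p\ge5$ be a prime, $n\ge3$, $k=\mathbf F_p$, $N\ge3$, and let $\mathcal L_s$, $\mathcal X_s$, $\mathsf L_s$, $\mathsf E_s$ be as defined in the context. For every $3\le d<N$, $$[\mathcal L_2,\mathcal L_{d-1}]=\mathcal X_d,$$ where $\mathcal X_d\subseteq\mathcal L_d$ is the subspace corresponding to $\mathsf E_d$ under the leading-field identification $\mathcal L_d\cong\mathsf L_d$. Hence $$\mathcal L_d/[\mathcal L_2,\mathcal L_{d-1}]\cong\mathsf L_d/\mathsf E_d.$$ Equivalently, this quotient is the component coming from $\mathcal L_d$ of the Lie abelianization $Q(\mathcal L_{<N})=\mathcal L_{<N}/[\mathcal L_{<N},\mathcal L_{<N}]$, where $\mathcal L_{<N}=\bigoplus_{2\le s<N}\mathcal L_s$. This quotient vanishes unless $d=d_r=(p-1)(n-1)+pr$ for some integer $r\ge0$. If $d_r<N$, the leading-field identification gives the quotient a rational $\mathrm{GL}(V)$-module structure and an isomorphism of rational $\mathrm{GL}(V)$-modules $$\mathcal L_{d_r}/[\mathcal L_2,\mathcal L_{d_r-1}]\cong\delta_1\otimes W_r^{(1)},$$ where $V=k^n$, $W_r=\operatorname{Sym}^r(V^* )\otimes V$, $\delta_1=(\det V^* )^{\otimes(p-1)}$, and $(\cdot)^{(1)}$ is the Frobenius twist.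
   Context: Let $A=k[[x_1,\ldots,x_n]]$, $\mathfrak m=(x_1,\ldots,x_n)$, $\operatorname{vol}=dx_1\wedge\cdots\wedge dx_n$. $G$ is the group (under composition, $gh=g\circ h$) of continuous $k$-algebra automorphisms $g$ of $A$ with $g(x_j)-x_j\in\mathfrak m^2$ for all $j$ and preserving $\operatorname{vol}$ (Jacobian determinant $1$). For $s\ge2$, $G_s=\{g\in G:g(x_j)-x_j\in\mathfrak m^s\ \forall j\}$, a normal subgroup. $T_N=G/G_N$, and $G_s/G_N$ denotes the image of $G_s$ in $T_N$. $T_N$ acts on $B_N=A/\mathfrak m^N$, filtered by $F^qB_N=(\mathfrak m^q+\mathfrak m^N)/\mathfrak m^N$; let $\rho_{\mathbf Z}:\mathbf Z[T_N]\to\operatorname{End}_k(B_N)$ be the induced ring homomorphism and, for $a\ge1$, let $\mathcal I_a$ be the set of $z$ in the augmentation ideal $\Delta_{\mathbf Z}(T_N)$ with $\rho_{\mathbf Z}(z)(F^qB_N)\subseteq F^{q+a}B_N$ for all $q\ge0$. These are two-sided ideals with $\mathcal I_a\mathcal I_b\subseteq\mathcal I_{a+b}$, $\mathcal I_1=\Delta_{\mathbf Z}(T_N)$ and $p\,\mathcal I_a\subseteq\mathcal I_{a+1}$, so $\bigoplus_a\mathcal I_a/\mathcal I_{a+1}$ is a graded (non-unital) associative $k$-algebra. For $2\le s<N$, $\mathcal L_s=\{(g-1)+\mathcal I_s: g\in G_s/G_N\}\subseteq\mathcal I_{s-1}/\mathcal I_s$, a $k$-subspace. Placing $\mathcal L_s$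 in graded degree $s-1$, $\mathcal L_{<N}=\bigoplus_{2\le s<N}\mathcal L_s$ is a graded Lie algebra under the associative commutator of $\bigoplus_a\mathcal I_a/\mathcal I_{a+1}$ (brackets landing in $\mathcal I_{s-1}/\mathcal I_s$ with $s\ge N$ are zero on group symbols). Thus $[\mathcal L_a,\mathcal L_b]\subseteq\mathcal L_{a+b-1}$; $[\mathcal L_a,\mathcal L_b]$ denotes the $k$-span of brackets. Let $R=k[x_1,\ldots,x_n]=\operatorname{Sym}(V^* )$, $R_s$ its degree-$s$ part, and $$\mathsf L_s=\Bigl\{\sum_i f_i\partial_i: f_i\in R_s,\ \sum_i\partial_if_i=0\Bigr\}\subseteq R_s\otimes V.$$ $\mathsf E_s\subseteq\mathsf L_s$ is the subspace of those $D$ for which the $(n-1)$-form $\iota_D\operatorname{vol}$ is exact in the polynomial de Rham complex of $R$. Leading-field identification: for $g\in G_s$ with $g(x_i)=x_i+f_i+O(\mathfrak m^{s+1})$, $f_i\in R_s$, put $\ell_s(g)=\sum_if_i\partial_i$; the assignment $(g-1)+\mathcal I_s\mapsto\ell_s(g)$ is the identification $\mathcal L_s\cong\mathsf L_s$. $\mathrm{GL}(V)$ (as an algebraic group over $k$) acts on $R$ by $(a\cdot f)(v)=f(a^{-1}v)$ and on polynomial vector fields by the induced action; $\mathcal L_s$ carries the rational module structure transported from $\mathsf L_s$ through the leading-field identification. The Frobenius twist $M^{(1)}$ of a rational module $M$ is $M$ with the action precomposed with the Frobenius endomorphism of $\mathrm{GL}(V)$ (entrywise $p$-th powers). *)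

theory Defs
  imports
    "HOL-Library.Poly_Mapping"
    "HOL-Computational_Algebra.Primes"
    "HOL-Algebra.Module"
    "HOL-Algebra.QuotRing"
    "HOL-Algebra.Ideal_Product"
    "HOL-Algebra.Algebraic_Closure_Type"
    "HOL-Analysis.Determinants"
begin

text \<open>The variables \<open>x\<^sub>1, \<dots>, x\<^sub>n\<close> are indexed by a finite, linearly ordered type \<open>'n\<close>; the
  order is used only for the signs in the exterior algebra.  The field \<open>k\<close> is the type \<open>'k\<close>.\<close>

section \<open>Polynomials and power series\<close>

abbreviation "lookup \<equiv> Poly_Mapping.lookup"
abbreviation "keys \<equiv> Poly_Mapping.keys"

type_synonym 'n mono = "'n \<Rightarrow>\<^sub>0 nat"
type_synonym ('n, 'k) pol = "'n mono \<Rightarrow>\<^sub>0 'k"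

definition pconst :: "'k::comm_ring_1 \<Rightarrow> ('n, 'k) pol" where
  "pconst c = Poly_Mapping.single 0 c"

definition pvar :: "'n \<Rightarrow> ('n, 'k::comm_ring_1) pol" where
  "pvar i = Poly_Mapping.single (Poly_Mapping.single i 1) 1"

definition mdeg :: "'n::finite mono \<Rightarrow> nat" where
  "mdeg m = (\<Sum>i\<in>UNIV. lookup m i)"

definition homog :: "nat \<Rightarrow> ('n::finite, 'k::comm_ring_1) pol set" where
  "homog s = {f. \<forall>m\<in>keys f. mdeg m = s}"

definition pdiff :: "'n \<Rightarrow> ('n, 'k::comm_ring_1) pol \<Rightarrow> ('n, 'k) pol" where
  "pdiff i f = (\<Sum>m\<in>keys f.
     Poly_Mapping.single (m - Poly_Mapping.single i 1) (of_nat (lookup m i) * lookup f m))"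

definition psubst :: "('n::finite \<Rightarrow> ('m, 'k::comm_ring_1) pol) \<Rightarrow> ('n, 'k) pol \<Rightarrow> ('m, 'k) pol" where
  "psubst \<sigma> f = (\<Sum>m\<in>keys f. pconst (lookup f m) * (\<Prod>i\<in>UNIV. \<sigma> i ^ lookup m i))"

typedef ('n, 'k) mfps = "UNIV :: ('n mono \<Rightarrow> 'k) set"
  morphisms mcoeff Mfps ..

setup_lifting type_definition_mfps

lemma mfps_eqI: "(\<And>m. mcoeff f m = mcoeff g m) \<Longrightarrow> f = g"
  by (metis ext mcoeff_inject)

definition splits :: "'n mono \<Rightarrow> ('n mono \<times> 'n mono) set" where
  "splits m = {(a, b). a + b = m}"

lemma finite_le_mono: "finite {a :: 'n::finite mono. \<exists>b. a + b = m}"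
proof -
  have "lookup ` {a. \<exists>b. a + b = m} \<subseteq> (\<Pi>\<^sub>E i\<in>UNIV. {..lookup m i})"
    by (auto simp: lookup_add)
  moreover have "finite (\<Pi>\<^sub>E i\<in>(UNIV::'n set). {..lookup m i})"
    by (intro finite_PiE) auto
  ultimately have "finite (lookup ` {a. \<exists>b. a + b = m})"
    by (rule finite_subset)
  then show ?thesis
    by (rule finite_imageD) (simp add: inj_on_def poly_mapping.lookup_inject)
qed

lemma finite_splits [simp]: "finite (splits (m :: 'n::finite mono))"
proof (rule finite_subset)
  show "splits m \<subseteq> {a. \<exists>b. a + b = m} \<times> {a. \<exists>b. a + b = m}"
    by (auto simp: splits_def) (metis add.commute)
qed (use finite_le_mono[of m] in simp)

instantiation mfps :: (finite, comm_ring_1) comm_ring_1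
begin

lift_definition zero_mfps :: "('a, 'b) mfps" is "\<lambda>_. 0" .
lift_definition one_mfps :: "('a, 'b) mfps" is "\<lambda>m. if m = 0 then 1 else 0" .
lift_definition plus_mfps :: "('a, 'b) mfps \<Rightarrow> ('a, 'b) mfps \<Rightarrow> ('a, 'b) mfps"
  is "\<lambda>f g m. f m + g m" .
lift_definition uminus_mfps :: "('a, 'b) mfps \<Rightarrow> ('a, 'b) mfps" is "\<lambda>f m. - f m" .
lift_definition minus_mfps :: "('a, 'b) mfps \<Rightarrow> ('a, 'b) mfps \<Rightarrow> ('a, 'b) mfps"
  is "\<lambda>f g m. f m - g m" .
lift_definition times_mfps :: "('a, 'b) mfps \<Rightarrow> ('a, 'b) mfps \<Rightarrow> ('a, 'b) mfps"
  is "\<lambda>f g m. \<Sum>(a, b)\<in>splits m. f a * g b" .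

instance
proof
  fix f g h :: "('a, 'b) mfps"
  show "f * g * h = f * (g * h)"
  proof (rule mfps_eqI)
    fix m :: "'a mono"
    have "mcoeff (f * g * h) m =
        (\<Sum>(a, b)\<in>splits m. \<Sum>(c, d)\<in>splits a. mcoeff f c * mcoeff g d * mcoeff h b)"
      by transfer (simp add: sum_distrib_right case_prod_unfold)
    also have "\<dots> = (\<Sum>((a, b), (c, d))\<in>(SIGMA p:splits m. splits (fst p)).
        mcoeff f c * mcoeff g d * mcoeff h b)"
      by (subst sum.Sigma[symmetric]) (auto simp: case_prod_unfold)
    also have "\<dots> = (\<Sum>((a, b), (c, d))\<in>(SIGMA p:splits m. splits (snd p)).
        mcoeff f a * mcoeff g c * mcoeff h d)"
      by (rule sum.reindex_bij_witness[where
            i = "\<lambda>((a, b), (c, d)). ((a + c, d), (a, c))" and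
            j = "\<lambda>((a, b), (c, d)). ((c, d + b), (d, b))"])
         (auto simp: splits_def add.assoc)
    also have "\<dots> = (\<Sum>(a, b)\<in>splits m. \<Sum>(c, d)\<in>splits b. mcoeff f a * mcoeff g c * mcoeff h d)"
      by (subst sum.Sigma[symmetric]) (auto simp: case_prod_unfold)
    also have "\<dots> = mcoeff (f * (g * h)) m"
      by transfer (simp add: sum_distrib_left case_prod_unfold mult.assoc)
    finally show "mcoeff (f * g * h) m = mcoeff (f * (g * h)) m" .
  qed
  show "f * g = g * f"
  proof (rule mfps_eqI)
    fix m :: "'a mono"
    have "(\<Sum>(a, b)\<in>splits m. mcoeff f a * mcoeff g b) = (\<Sum>(a, b)\<in>splits m. mcoeff g a * mcoeff f b)"
      by (rule sum.reindex_bij_witness[where i = prod.swap and j = prod.swap])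
         (auto simp: splits_def add.commute ac_simps)
    then show "mcoeff (f * g) m = mcoeff (g * f) m"
      by (simp add: times_mfps.rep_eq)
  qed
  show "1 * f = f"
  proof (rule mfps_eqI)
    fix m :: "'a mono"
    have "mcoeff (1 * f) m =
        (\<Sum>p\<in>splits m. if p = (0, m) then mcoeff f m else 0)"
      unfolding times_mfps.rep_eq one_mfps.rep_eq
      by (intro sum.cong) (auto simp: splits_def split: if_splits)
    also have "\<dots> = mcoeff f m"
      by (subst sum.delta[OF finite_splits]) (auto simp: splits_def)
    finally show "mcoeff (1 * f) m = mcoeff f m" .
  qed
  show "(f + g) * h = f * h + g * h"
    by transfer (auto simp: case_prod_unfold algebra_simps sum.distrib)
  show "(0 :: ('a, 'b) mfps) \<noteq> 1"
    by transfer (metis zero_neq_one)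
qed (transfer; auto)+

end

definition mfps_of_pol :: "('n, 'k::comm_ring_1) pol \<Rightarrow> ('n, 'k) mfps" where
  "mfps_of_pol f = Mfps (lookup f)"

definition mfps_diff :: "'n \<Rightarrow> ('n, 'k::comm_ring_1) mfps \<Rightarrow> ('n, 'k) mfps" where
  "mfps_diff i f =
     Mfps (\<lambda>m. of_nat (lookup m i + 1) * mcoeff f (m + Poly_Mapping.single i 1))"

abbreviation psr :: "('n::finite, 'k::comm_ring_1) mfps ring" where
  "psr \<equiv> ring_of_type_algebra"

definition mvar :: "'n \<Rightarrow> ('n, 'k::comm_ring_1) mfps" where
  "mvar i = mfps_of_pol (pvar i)"

primrec mpow :: "nat \<Rightarrow> ('n::finite, 'k::comm_ring_1) mfps set" where
  "mpow 0 = carrier psr"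
| "mpow (Suc s) = ideal_prod psr (genideal psr (range mvar)) (mpow s)"


section \<open>The groups \<open>G\<close>, \<open>G\<^sub>s\<close>, \<open>T\<^sub>N\<close> and the filtration of the augmentation ideal\<close>

type_synonym ('n, 'k) aut = "('n, 'k) mfps \<Rightarrow> ('n, 'k) mfps"
type_synonym ('n, 'k) tn = "('n, 'k) aut set"
type_synonym ('n, 'k) ztn = "('n, 'k) tn \<Rightarrow>\<^sub>0 int"

definition madic_continuous :: "('n::finite, 'k::comm_ring_1) aut \<Rightarrow> bool" where
  "madic_continuous g \<longleftrightarrow> (\<forall>M. \<exists>L. \<forall>f h. f - h \<in> mpow L \<longrightarrow> g f - g h \<in> mpow M)"

definition jacobian :: "('n::finite, 'k::comm_ring_1) aut \<Rightarrow> ('n, 'k) mfps" where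
  "jacobian g = det (\<chi> i j. mfps_diff j (g (mvar i)))"

definition Gvol :: "('n::finite, 'k::comm_ring_1) aut monoid" where
  "Gvol = \<lparr>carrier = {g \<in> ring_iso psr psr.
          (\<forall>c f. g (mfps_of_pol (pconst c) * f) = mfps_of_pol (pconst c) * g f) \<and>
          madic_continuous g \<and>
          (\<forall>j. g (mvar j) - mvar j \<in> mpow 2) \<and>
          jacobian g = 1},
        monoid.mult = (\<circ>), monoid.one = id\<rparr>"

definition Gs :: "nat \<Rightarrow> ('n::finite, 'k::comm_ring_1) aut set" where
  "Gs s = {g \<in> carrier Gvol. \<forall>j. g (mvar j) - mvar j \<in> mpow s}"

definition TN :: "nat \<Rightarrow> ('n::finite, 'k::comm_ring_1) tn monoid" where
  "TN N = Gvol Mod Gs N"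

definition toT :: "nat \<Rightarrow> ('n::finite, 'k::comm_ring_1) aut \<Rightarrow> ('n, 'k) tn" where
  "toT N g = Gs N #>\<^bsub>Gvol\<^esub> g"

definition ZT :: "nat \<Rightarrow> ('n::finite, 'k::comm_ring_1) ztn ring" where
  "ZT N = \<lparr>carrier = {z. keys z \<subseteq> carrier (TN N)},
           monoid.mult = (\<lambda>z w. frag_extend (\<lambda>t. frag_extend (\<lambda>u. frag_of (t \<otimes>\<^bsub>TN N\<^esub> u)) w) z),
           monoid.one = frag_of \<one>\<^bsub>TN N\<^esub>, zero = 0, add = (+)\<rparr>"

definition BN :: "nat \<Rightarrow> ('n::finite, 'k::comm_ring_1) mfps set ring" where
  "BN N = psr Quot mpow N"

definition BF :: "nat \<Rightarrow> nat \<Rightarrow> ('n::finite, 'k::comm_ring_1) mfps set set" where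
  "BF N q = {mpow N +>\<^bsub>psr\<^esub> f | f. f \<in> mpow q <+>\<^bsub>psr\<^esub> mpow N}"

text \<open>For a coset \<open>t\<close> of \<open>g\<close> and a coset \<open>b\<close> of \<open>f\<close>, the set below is the coset of \<open>g f\<close>.\<close>
definition T_act :: "('n::finite, 'k::comm_ring_1) tn \<Rightarrow> ('n, 'k) mfps set \<Rightarrow> ('n, 'k) mfps set" where
  "T_act t b = (\<Union>g\<in>t. g ` b)"

definition rhoZ :: "nat \<Rightarrow> ('n::finite, 'k::comm_ring_1) ztn \<Rightarrow> ('n, 'k) mfps set \<Rightarrow> ('n, 'k) mfps set"
  where "rhoZ N z b = (\<Oplus>\<^bsub>BN N\<^esub>t\<in>keys z. add_pow (BN N) (lookup z t) (T_act t b))"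

definition augI :: "nat \<Rightarrow> nat \<Rightarrow> ('n::finite, 'k::comm_ring_1) ztn set" where
  "augI N a = {z \<in> carrier (ZT N). (\<Sum>t\<in>keys z. lookup z t) = 0 \<and>
                 (\<forall>q. rhoZ N z ` BF N q \<subseteq> BF N (q + a))}"


section \<open>Vector spaces over \<open>k\<close>\<close>

text \<open>A \<open>k\<close>-vector space is a module record over the ring of the type \<open>'k\<close>; where only the
  vector space structure matters, the multiplicative part of the record is left unspecified.\<close>

definition kring :: "'k::field ring" where
  "kring = ring_of_type_algebra"

definition kspan :: "('k::field, 'm) module \<Rightarrow> 'm set \<Rightarrow> 'm set" where
  "kspan M S = \<Inter>{H. submodule H kring M \<and> S \<subseteq> H}"

definition quot_mod :: "('k::field, 'm) module \<Rightarrow> 'm set \<Rightarrow> ('k, 'm set) module" where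
  "quot_mod M U = \<lparr>carrier = a_rcosets\<^bsub>M\<^esub> U, monoid.mult = undefined, monoid.one = undefined,
      zero = U, add = set_add M, module.smult = (\<lambda>c u. \<Union>x\<in>u. U +>\<^bsub>M\<^esub> (c \<odot>\<^bsub>M\<^esub> x))\<rparr>"

definition lin_map :: "('k::field, 'm) module \<Rightarrow> ('k, 'l) module \<Rightarrow> ('m \<Rightarrow> 'l) \<Rightarrow> bool" where
  "lin_map M M' \<phi> \<longleftrightarrow> Module.module kring M \<and> Module.module kring M' \<and>
     \<phi> \<in> carrier M \<rightarrow> carrier M' \<and>
     (\<forall>x\<in>carrier M. \<forall>y\<in>carrier M. \<phi> (x \<oplus>\<^bsub>M\<^esub> y) = \<phi> x \<oplus>\<^bsub>M'\<^esub> \<phi> y) \<and>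
     (\<forall>c. \<forall>x\<in>carrier M. \<phi> (c \<odot>\<^bsub>M\<^esub> x) = c \<odot>\<^bsub>M'\<^esub> \<phi> x)"

definition lin_iso :: "('k::field, 'm) module \<Rightarrow> ('k, 'l) module \<Rightarrow> ('m \<Rightarrow> 'l) \<Rightarrow> bool" where
  "lin_iso M M' \<phi> \<longleftrightarrow> lin_map M M' \<phi> \<and> bij_betw \<phi> (carrier M) (carrier M')"


section \<open>The graded algebra and the Lie algebra of group symbols\<close>

type_synonym ('n, 'k) sym = "('n, 'k) ztn set"

text \<open>\<open>gr N a\<close> is \<open>\<I>\<^sub>a / \<I>\<^sub>a\<^sub>+\<^sub>1\<close>.  A scalar \<open>c\<close> of the prime field acts as any integer mapping
  to \<open>c\<close>; the choice is immaterial because \<open>p \<I>\<^sub>a \<subseteq> \<I>\<^sub>a\<^sub>+\<^sub>1\<close>.\<close>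
definition gr :: "nat \<Rightarrow> nat \<Rightarrow> ('k::field, ('n::finite, 'k) sym) module" where
  "gr N a = \<lparr>carrier = {augI N (a + 1) +>\<^bsub>ZT N\<^esub> z | z. z \<in> augI N a},
      monoid.mult = undefined, monoid.one = undefined,
      zero = augI N (a + 1), add = set_add (ZT N),
      module.smult = (\<lambda>c u. \<Union>m\<in>{m::int. of_int m = c}. \<Union>z\<in>u. augI N (a + 1) +>\<^bsub>ZT N\<^esub> frag_cmul m z)\<rparr>"

definition gr_mult :: "nat \<Rightarrow> nat \<Rightarrow> nat \<Rightarrow> ('n::finite, 'k::field) sym \<Rightarrow> ('n, 'k) sym \<Rightarrow> ('n, 'k) sym"
  where "gr_mult N a b u v = (\<Union>z\<in>u. \<Union>w\<in>v. augI N (a + b + 1) +>\<^bsub>ZT N\<^esub> (z \<otimes>\<^bsub>ZT N\<^esub> w))"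

definition gr_bracket :: "nat \<Rightarrow> nat \<Rightarrow> nat \<Rightarrow> ('n::finite, 'k::field) sym \<Rightarrow> ('n, 'k) sym \<Rightarrow> ('n, 'k) sym"
  where "gr_bracket N a b u v = gr_mult N a b u v \<ominus>\<^bsub>gr N (a + b)\<^esub> gr_mult N b a v u"

text \<open>\<open>\<Oplus>\<^sub>a\<^sub>\<ge>\<^sub>1 \<I>\<^sub>a / \<I>\<^sub>a\<^sub>+\<^sub>1\<close>; the algebra has no unit, so the field \<open>one\<close> is a dummy.\<close>
definition gr_alg :: "nat \<Rightarrow> ('k::field, nat \<Rightarrow> ('n::finite, 'k) sym) module" where
  "gr_alg N = \<lparr>carrier = {x \<in> (\<Pi>\<^sub>E a\<in>{1..}. carrier (gr N a)). finite {a\<in>{1..}. x a \<noteq> \<zero>\<^bsub>gr N a\<^esub>}},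
      monoid.mult = (\<lambda>x y. \<lambda>c\<in>{1..}. \<Oplus>\<^bsub>gr N c\<^esub>a\<in>{1..<c}. gr_mult N a (c - a) (x a) (y (c - a))),
      monoid.one = undefined,
      zero = (\<lambda>a\<in>{1..}. \<zero>\<^bsub>gr N a\<^esub>),
      add = (\<lambda>x y. \<lambda>a\<in>{1..}. x a \<oplus>\<^bsub>gr N a\<^esub> y a),
      module.smult = (\<lambda>c x. \<lambda>a\<in>{1..}. c \<odot>\<^bsub>gr N a\<^esub> x a)\<rparr>"

definition gr_incl :: "nat \<Rightarrow> nat \<Rightarrow> ('n::finite, 'k::field) sym \<Rightarrow> nat \<Rightarrow> ('n, 'k) sym" where
  "gr_incl N a u = (\<lambda>b\<in>{1..}. if b = a then u else \<zero>\<^bsub>gr N b\<^esub>)"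

definition symb :: "nat \<Rightarrow> nat \<Rightarrow> ('n::finite, 'k::field) tn \<Rightarrow> ('n, 'k) sym" where
  "symb N s t = augI N s +>\<^bsub>ZT N\<^esub> (frag_of t - frag_of \<one>\<^bsub>TN N\<^esub>)"

definition Lsym :: "nat \<Rightarrow> nat \<Rightarrow> ('n::finite, 'k::field) sym set" where
  "Lsym N s = symb N s ` toT N ` Gs s"

definition lie_mod :: "nat \<Rightarrow> nat \<Rightarrow> ('k::field, ('n::finite, 'k) sym) module" where
  "lie_mod N s = (gr N (s - 1))\<lparr>carrier := Lsym N s\<rparr>"

text \<open>\<open>[\<L>\<^sub>a, \<L>\<^sub>b]\<close>; recall that \<open>\<L>\<^sub>s\<close> sits in degree \<open>s - 1\<close>.\<close>
definition lie_bracket :: "nat \<Rightarrow> nat \<Rightarrow> nat \<Rightarrow> ('n::finite, 'k::field) sym set" where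
  "lie_bracket N a b = kspan (gr N ((a - 1) + (b - 1)))
     {gr_bracket N (a - 1) (b - 1) u v | u v. u \<in> Lsym N a \<and> v \<in> Lsym N b}"

definition lie_quot :: "nat \<Rightarrow> nat \<Rightarrow> ('k::field, ('n::finite, 'k) sym set) module" where
  "lie_quot N d = quot_mod (lie_mod N d) (lie_bracket N 2 (d - 1))"

definition lie_lt :: "nat \<Rightarrow> ('k::field, nat \<Rightarrow> ('n::finite, 'k) sym) module" where
  "lie_lt N = (gr_alg N)\<lparr>carrier := {x \<in> carrier (gr_alg N).
      \<forall>s\<ge>2. if s < N then x (s - 1) \<in> Lsym N s else x (s - 1) = \<zero>\<^bsub>gr N (s - 1)\<^esub>}\<rparr>"

definition lie_derived :: "nat \<Rightarrow> (nat \<Rightarrow> ('n::finite, 'k::field) sym) set" where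
  "lie_derived N = kspan (gr_alg N)
     {x \<otimes>\<^bsub>gr_alg N\<^esub> y \<ominus>\<^bsub>gr_alg N\<^esub> y \<otimes>\<^bsub>gr_alg N\<^esub> x | x y. x \<in> carrier (lie_lt N) \<and> y \<in> carrier (lie_lt N)}"

definition lie_abel :: "nat \<Rightarrow> ('k::field, (nat \<Rightarrow> ('n::finite, 'k) sym) set) module" where
  "lie_abel N = quot_mod (lie_lt N) (lie_derived N)"

definition lie_to_abel :: "nat \<Rightarrow> nat \<Rightarrow> ('n::finite, 'k::field) sym \<Rightarrow> (nat \<Rightarrow> ('n, 'k) sym) set" where
  "lie_to_abel N d u = lie_derived N +>\<^bsub>lie_lt N\<^esub> gr_incl N (d - 1) u"

definition lie_abel_comp :: "nat \<Rightarrow> nat \<Rightarrow> ('k::field, (nat \<Rightarrow> ('n::finite, 'k) sym) set) module" where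
  "lie_abel_comp N d = (lie_abel N)\<lparr>carrier := lie_to_abel N d ` Lsym N d\<rparr>"


section \<open>Polynomial vector fields and the leading-field identification\<close>

text \<open>\<open>D :: 'n \<Rightarrow> ('n, 'k) pol\<close> stands for \<open>\<Sum>\<^sub>i D\<^sub>i \<partial>\<^sub>i\<close>, equivalently for \<open>\<Sum>\<^sub>i D\<^sub>i \<otimes> e\<^sub>i\<close>
  in \<open>Sym(V\<^sup>*) \<otimes> V\<close>.\<close>
type_synonym ('n, 'k) vf = "'n \<Rightarrow> ('n, 'k) pol"

definition vf_mod :: "('n, 'k) vf set \<Rightarrow> ('k::field, ('n::finite, 'k) vf) module" where
  "vf_mod C = \<lparr>carrier = C, monoid.mult = undefined, monoid.one = undefined,
      zero = (\<lambda>i. 0), add = (\<lambda>D E i. D i + E i), module.smult = (\<lambda>c D i. pconst c * D i)\<rparr>"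

definition SymV :: "nat \<Rightarrow> ('n::finite, 'k::comm_ring_1) vf set" where
  "SymV s = {D. \<forall>i. D i \<in> homog s}"

definition Lvf :: "nat \<Rightarrow> ('n::finite, 'k::comm_ring_1) vf set" where
  "Lvf s = {D \<in> SymV s. (\<Sum>i\<in>UNIV. pdiff i (D i)) = 0}"

text \<open>A polynomial differential form \<open>\<omega>\<close> stands for \<open>\<Sum>\<^sub>I \<omega>\<^sub>I dx\<^sub>I\<close>, with \<open>dx\<^sub>I\<close> the wedge product
  of the \<open>dx\<^sub>i\<close>, \<open>i \<in> I\<close>, in increasing order.\<close>
type_synonym ('n, 'k) form = "'n set \<Rightarrow> ('n, 'k) pol"

definition forms :: "nat \<Rightarrow> ('n::finite, 'k::comm_ring_1) form set" where
  "forms q = {\<omega>. \<forall>I. card I \<noteq> q \<longrightarrow> \<omega> I = 0}"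

definition dform :: "('n::{finite,linorder}, 'k::comm_ring_1) form \<Rightarrow> ('n, 'k) form" where
  "dform \<omega> J = (\<Sum>j\<in>J. (- 1) ^ card {i\<in>J. i < j} * pdiff j (\<omega> (J - {j})))"

definition contract :: "('n::{finite,linorder}, 'k::comm_ring_1) vf \<Rightarrow> ('n, 'k) form \<Rightarrow> ('n, 'k) form"
  where "contract D \<omega> I = (\<Sum>j\<in>- I. (- 1) ^ card {i\<in>I. i < j} * D j * \<omega> (insert j I))"

definition vol :: "('n::finite, 'k::comm_ring_1) form" where
  "vol I = (if I = UNIV then 1 else 0)"

definition Evf :: "nat \<Rightarrow> ('n::{finite,linorder}, 'k::comm_ring_1) vf set" where
  "Evf s = {D \<in> Lvf s. \<exists>\<eta>\<in>forms (CARD('n) - 2). dform \<eta> = contract D vol}"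

definition lead :: "nat \<Rightarrow> nat \<Rightarrow> ('n::finite, 'k::field) sym \<Rightarrow> ('n, 'k) vf" where
  "lead N s u = (THE D. D \<in> SymV s \<and> (\<exists>g\<in>Gs s. u = symb N s (toT N g) \<and>
     (\<forall>i. g (mvar i) - mvar i - mfps_of_pol (D i) \<in> mpow (s + 1))))"

definition XL :: "nat \<Rightarrow> nat \<Rightarrow> ('n::{finite,linorder}, 'k::field) sym set" where
  "XL N d = {u \<in> Lsym N d. lead N d u \<in> Evf d}"


section \<open>Rational \<open>GL(V)\<close>-modules over \<open>k\<close>\<close>

text \<open>With \<open>K\<close> an algebraic closure of \<open>k\<close>, a rational module over the algebraic \<open>k\<close>-group
  \<open>GL\<^sub>n\<close> is a \<open>k\<close>-vector space \<open>M\<close> with a \<open>K\<close>-linear action of \<open>GL\<^sub>n(K)\<close> on \<open>M \<otimes> K\<close> whose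
  matrix coefficients on \<open>M\<close> lie in \<open>k[GL\<^sub>n] = k[t\<^sub>i\<^sub>j, 1/det]\<close>.  As \<open>GL\<^sub>n\<close> is smooth, this is the
  same as a comodule over \<open>k[GL\<^sub>n]\<close>.  Points in \<open>k\<close> itself would not suffice: the Frobenius
  endomorphism is the identity on them.

  An element of \<open>M \<otimes> K\<close> is represented by a finite formal sum \<open>\<Sum>\<^sub>i m\<^sub>i \<otimes> c\<^sub>i\<close>, i.e. a finitely
  supported function \<open>M \<Rightarrow> K\<close>, up to the bilinearity relations; an action is recorded by its
  values on the elements \<open>m \<otimes> 1\<close>.\<close>

type_synonym ('n, 'k) matK = "'k alg_closure ^ 'n ^ 'n"
type_synonym ('n, 'k, 'm) action = "('n, 'k) matK \<Rightarrow> 'm \<Rightarrow> ('m \<Rightarrow>\<^sub>0 'k alg_closure)"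

definition tscale :: "'c::comm_ring_1 \<Rightarrow> ('m \<Rightarrow>\<^sub>0 'c) \<Rightarrow> ('m \<Rightarrow>\<^sub>0 'c)" where
  "tscale c = Poly_Mapping.map ((*) c)"

definition tens_rels :: "('k::field, 'm) module \<Rightarrow> ('m \<Rightarrow>\<^sub>0 'k alg_closure) set" where
  "tens_rels M =
     {Poly_Mapping.single (x \<oplus>\<^bsub>M\<^esub> y) 1 - Poly_Mapping.single x 1 - Poly_Mapping.single y 1
       | x y. x \<in> carrier M \<and> y \<in> carrier M} \<union>
     {Poly_Mapping.single (c \<odot>\<^bsub>M\<^esub> x) 1 - Poly_Mapping.single x (to_ac c) | c x. x \<in> carrier M}"

definition tens_eq ::
    "('k::field, 'm) module \<Rightarrow> ('m \<Rightarrow>\<^sub>0 'k alg_closure) \<Rightarrow> ('m \<Rightarrow>\<^sub>0 'k alg_closure) \<Rightarrow> bool" where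
  "tens_eq M t u \<longleftrightarrow> t - u \<in> Modules.module.span tscale (tens_rels M)"

definition tens_map :: "('m \<Rightarrow> 'l) \<Rightarrow> ('m \<Rightarrow>\<^sub>0 'c::comm_ring_1) \<Rightarrow> ('l \<Rightarrow>\<^sub>0 'c)" where
  "tens_map \<phi> t = (\<Sum>m\<in>keys t. Poly_Mapping.single (\<phi> m) (lookup t m))"

definition tens_extend :: "('m \<Rightarrow> ('l \<Rightarrow>\<^sub>0 'c)) \<Rightarrow> ('m \<Rightarrow>\<^sub>0 'c::comm_ring_1) \<Rightarrow> ('l \<Rightarrow>\<^sub>0 'c)" where
  "tens_extend \<psi> t = (\<Sum>m\<in>keys t. tscale (lookup t m) (\<psi> m))"

text \<open>The polynomial \<open>F\<close> has one variable \<open>(i, j)\<close> for each matrix entry.\<close>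
definition regular_fun :: "(('n::finite, 'k::field) matK \<Rightarrow> 'k alg_closure) \<Rightarrow> bool" where
  "regular_fun \<phi> \<longleftrightarrow> (\<exists>(F :: ('n \<times> 'n, 'k) pol) e. \<forall>g. invertible g \<longrightarrow>
     \<phi> g = (\<Sum>m\<in>keys F. to_ac (lookup F m) * (\<Prod>(i, j)\<in>UNIV. (g $ i $ j) ^ lookup m (i, j)))
            / det g ^ e)"

definition rational_module :: "('k::field, 'm) module \<Rightarrow> ('n::finite, 'k, 'm) action \<Rightarrow> bool" where
  "rational_module M \<rho> \<longleftrightarrow>
     Module.module kring M \<and>
     (\<forall>g. invertible g \<longrightarrow>
        (\<forall>x\<in>carrier M. keys (\<rho> g x) \<subseteq> carrier M) \<and>
        (\<forall>x\<in>carrier M. \<forall>y\<in>carrier M. tens_eq M (\<rho> g (x \<oplus>\<^bsub>M\<^esub> y)) (\<rho> g x + \<rho> g y)) \<and>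
        (\<forall>c. \<forall>x\<in>carrier M. tens_eq M (\<rho> g (c \<odot>\<^bsub>M\<^esub> x)) (tscale (to_ac c) (\<rho> g x)))) \<and>
     (\<forall>x\<in>carrier M. tens_eq M (\<rho> (mat 1) x) (Poly_Mapping.single x 1)) \<and>
     (\<forall>g h. invertible g \<longrightarrow> invertible h \<longrightarrow>
        (\<forall>x\<in>carrier M. tens_eq M (\<rho> (g ** h) x) (tens_extend (\<rho> g) (\<rho> h x)))) \<and>
     (\<forall>x\<in>carrier M. \<exists>S a. finite S \<and> S \<subseteq> carrier M \<and> (\<forall>y\<in>S. regular_fun (a y)) \<and>
        (\<forall>g. invertible g \<longrightarrow> tens_eq M (\<rho> g x) (\<Sum>y\<in>S. Poly_Mapping.single y (a y g))))"

definition rational_hom :: "('k::field, 'm) module \<Rightarrow> ('n::finite, 'k, 'm) action \<Rightarrow>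
    ('k, 'l) module \<Rightarrow> ('n, 'k, 'l) action \<Rightarrow> ('m \<Rightarrow> 'l) \<Rightarrow> bool" where
  "rational_hom M \<rho> M' \<rho>' \<phi> \<longleftrightarrow>
     rational_module M \<rho> \<and> rational_module M' \<rho>' \<and> lin_map M M' \<phi> \<and>
     (\<forall>g. invertible g \<longrightarrow> (\<forall>x\<in>carrier M. tens_eq M' (\<rho>' g (\<phi> x)) (tens_map \<phi> (\<rho> g x))))"

definition rational_iso :: "('k::field, 'm) module \<Rightarrow> ('n::finite, 'k, 'm) action \<Rightarrow>
    ('k, 'l) module \<Rightarrow> ('n, 'k, 'l) action \<Rightarrow> ('m \<Rightarrow> 'l) \<Rightarrow> bool" where
  "rational_iso M \<rho> M' \<rho>' \<phi> \<longleftrightarrow> rational_hom M \<rho> M' \<rho>' \<phi> \<and> bij_betw \<phi> (carrier M) (carrier M')"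

definition transport_action :: "'m set \<Rightarrow> ('m \<Rightarrow> 'l) \<Rightarrow> ('n, 'k::field, 'l) action \<Rightarrow>
    ('n::finite, 'k, 'm) action" where
  "transport_action C \<phi> \<rho> g x = tens_map (inv_into C \<phi>) (\<rho> g (\<phi> x))"

definition frobenius_twist :: "nat \<Rightarrow> ('n::finite, 'k::field, 'm) action \<Rightarrow> ('n, 'k, 'm) action" where
  "frobenius_twist p \<rho> g = \<rho> (\<chi> i j. (g $ i $ j) ^ p)"

text \<open>\<open>(det V\<^sup>*)\<^sup>\<otimes>\<^sup>e \<otimes> M\<close>, with the one-dimensional space \<open>det V\<^sup>*\<close> identified with \<open>k\<close>; there
  \<open>g\<close> acts as \<open>det(g)\<^sup>-\<^sup>1\<close>.\<close>
definition det_dual_twist :: "nat \<Rightarrow> ('n::finite, 'k::field, 'm) action \<Rightarrow> ('n, 'k, 'm) action" where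
  "det_dual_twist e \<rho> g x = tscale (inverse (det g) ^ e) (\<rho> g x)"

text \<open>\<open>(g \<cdot> f)(v) = f(g\<^sup>-\<^sup>1 v)\<close>\<close>
definition gl_pol :: "'c::field ^ 'n ^ 'n \<Rightarrow> ('n::finite, 'c) pol \<Rightarrow> ('n, 'c) pol" where
  "gl_pol g = psubst (\<lambda>i. \<Sum>j\<in>UNIV. pconst (matrix_inv g $ i $ j) * pvar j)"

text \<open>\<open>g \<cdot> (f \<otimes> v) = (g \<cdot> f) \<otimes> g v\<close>; for the derivation \<open>D\<close> this is \<open>h \<mapsto> g \<cdot> D(g\<^sup>-\<^sup>1 \<cdot> h)\<close>.\<close>
definition gl_vf :: "'c::field ^ 'n ^ 'n \<Rightarrow> ('n::finite, 'c) vf \<Rightarrow> ('n, 'c) vf" where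
  "gl_vf g D i = (\<Sum>j\<in>UNIV. pconst (g $ i $ j) * gl_pol g (D j))"

definition vf_base_change :: "('n, 'k::field) vf \<Rightarrow> ('n, 'k alg_closure) vf" where
  "vf_base_change D i = Poly_Mapping.map to_ac (D i)"

text \<open>The natural map from \<open>C \<otimes> K\<close> to the vector fields over \<open>K\<close>, injective for a subspace \<open>C\<close>.\<close>
definition vf_realize :: "(('n, 'k::field) vf \<Rightarrow>\<^sub>0 'k alg_closure) \<Rightarrow> ('n, 'k alg_closure) vf" where
  "vf_realize t i = (\<Sum>D\<in>keys t. pconst (lookup t D) * vf_base_change D i)"

definition vf_action :: "('n, 'k) vf set \<Rightarrow> ('n::finite, 'k::field, ('n, 'k) vf) action" where
  "vf_action C g D = (SOME t. keys t \<subseteq> C \<and> vf_realize t = gl_vf g (vf_base_change D))"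

definition lie_action :: "nat \<Rightarrow> nat \<Rightarrow> ('n::finite, 'k::field, ('n, 'k) sym) action" where
  "lie_action N s = transport_action (Lsym N s) (lead N s) (vf_action (Lvf s))"

text \<open>\<open>\<delta>\<^sub>1 \<otimes> W\<^sub>r\<^sup>(\<^sup>1\<^sup>)\<close>, on the vector space \<open>W\<^sub>r = Sym\<^sup>r(V\<^sup>*) \<otimes> V\<close>.\<close>
definition W_action :: "nat \<Rightarrow> nat \<Rightarrow> ('n::finite, 'k::field, ('n, 'k) vf) action" where
  "W_action p r = det_dual_twist (p - 1) (frobenius_twist p (vf_action (SymV r)))"

end

(* The bracket of the symbols of g - 1 and
   h - 1 is the symbol of the group commutator of g and h, because (g - 1)(h - 1) - (h - 1)(g - 1) =
   (ghg^-1h^-1 - 1)hg; so leading fields turn it into the Lie bracket of vector fields.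

   Over F_p, a divergence-free homogeneous field is a combination of Hamiltonian fields
   (d_j h) d_i - (d_i h) d_j and of the "critical" monomial fields x^M d_i, with M_i divisible by p and
   M_j = -1 mod p for j <> i. The former are exact; a field is exact iff its critical coefficients vanish.
   Brackets have no critical coefficients, and conversely every monomial Hamiltonian field is an explicit
   combination of brackets with quadratic fields. Hence the quotient is read off the critical coefficients:
   the coefficient at p e + (p - 1)(1, ..., 0, ..., 1) becomes the coefficient of x^e d_i in Sym^r(V^* ) (x) V.

   For the equivariance let l_1, ..., l_n be linear forms with matrix A. The coefficient of
   (x_1 ... x_n)^(p-1) in (l_1 ... l_n)^(p-1) is det(A)^(p-1), by row operations, since p-th powers of linear
   forms do not contribute; its minors produce the factor det(g)^-(p-1) and the p-th powers of the entries
   of g. *)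
theory Submission
  imports Defs "HOL-Number_Theory.Residues"
begin


text \<open>Critical monomials and quadratic fields come from shears x_i -> x_i + w_i f with f
  constant along w, whose Jacobian matrix is a rank-one perturbation of the identity. Hamiltonian
  fields of higher degree are realized inductively by group commutators. The generation of
  Hamiltonian fields by brackets therefore serves twice: for the identification of the symbols with
  divergence-free fields, and for the bracket formula itself. The bound p >= 5 makes 2 and 3
  invertible; n >= 3 supplies a third variable in the one stubborn case, where both exponents are -2
  mod p. Estimates with group elements take place on power series: an element of the integral group
  ring becomes an operator built from representatives, well defined modulo order N. On the GL side,
  formal tensors are compared through their realizations as vector fields over the algebraic
  closure.\<close>

declare One_nat_def [simp del]

section \<open>Polynomials\<close>

abbreviation em :: "'n \<Rightarrow> 'n mono" where "em i \<equiv> Poly_Mapping.single i 1"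

lemma poly_mapping_eq_sum_single:
  fixes f :: "'a \<Rightarrow>\<^sub>0 'b::comm_monoid_add"
  shows "f = (\<Sum>m\<in>keys f. Poly_Mapping.single m (lookup f m))"
  by (rule poly_mapping_eqI) (auto simp: lookup_sum lookup_single when_def in_keys_iff)

text \<open>Zero is covered by \<open>single\<close> with the value 0, so additive and bilinear
  identities reduce to monomials without a separate base case.\<close>

lemma poly_mapping_single_induct [case_names single add]:
  fixes f :: "'a \<Rightarrow>\<^sub>0 'b::comm_monoid_add"
  assumes single: "\<And>m c. P (Poly_Mapping.single m c)"
    and add: "\<And>f g. P f \<Longrightarrow> P g \<Longrightarrow> P (f + g)"
  shows "P f"
proof -
  have "P (\<Sum>m\<in>A. Poly_Mapping.single m (lookup f m))" if "finite A" for A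
    using that
  proof (induction A)
    case empty
    show ?case using single[of undefined 0] by simp
  next
    case (insert x A)
    then show ?case by (simp add: single add)
  qed
  then show ?thesis by (subst poly_mapping_eq_sum_single) simp
qed

section \<open>Partial derivatives of polynomials\<close>

lemma mono_eq_plus_em: "lookup m i \<noteq> 0 \<Longrightarrow> m - em i + em i = (m :: 'n mono)"
  by (rule poly_mapping_eqI) (auto simp: lookup_add lookup_minus lookup_single when_def)

lemma lookup_pdiff:
  fixes f :: "('n, 'k::comm_ring_1) pol"
  shows "lookup (pdiff i f) m = of_nat (lookup m i + 1) * lookup f (m + em i)"
proof -
  have "lookup (pdiff i f) m =
    (\<Sum>m'\<in>keys f. if m' = m + em i then of_nat (lookup m i + 1) * lookup f (m + em i) else 0)"
    unfolding pdiff_def lookup_sum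
  proof (intro sum.cong refl)
    fix m' assume "m' \<in> keys f"
    show "lookup (Poly_Mapping.single (m' - em i) (of_nat (lookup m' i) * lookup f m')) m =
      (if m' = m + em i then of_nat (lookup m i + 1) * lookup f (m + em i) else 0)"
    \<comment> \<open>Subtraction of exponents truncates at 0, so \<open>m' - em i\<close>
      determines \<open>m'\<close> only if x_i divides \<open>m'\<close>; otherwise the factor
      \<open>of_nat 0\<close> removes the term.\<close>
    proof (cases "lookup m' i = 0")
      case True
      then have "m' \<noteq> m + em i" by (auto simp: lookup_add)
      with True show ?thesis by simp
    next
      case False
      then have "m' - em i = m \<longleftrightarrow> m' = m + em i"
        using mono_eq_plus_em[OF False] by auto
      then show ?thesis by (auto simp: lookup_single when_def lookup_add)
    qed
  qed
  then show ?thesis by (simp add: in_keys_iff)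
qed

lemma pdiff_0 [simp]: "pdiff i 0 = 0"
  by (rule poly_mapping_eqI) (simp add: lookup_pdiff)

lemma pdiff_add: "pdiff i (f + g) = pdiff i f + pdiff i g"
  by (rule poly_mapping_eqI) (simp add: lookup_pdiff lookup_add algebra_simps)

lemma pdiff_uminus: "pdiff i (- f) = - pdiff i f"
  by (rule poly_mapping_eqI) (simp add: lookup_pdiff)

lemma pdiff_diff: "pdiff i (f - g) = pdiff i f - pdiff i g"
  by (rule poly_mapping_eqI) (simp add: lookup_pdiff lookup_minus algebra_simps)

lemma pdiff_sum: "pdiff i (sum f A) = (\<Sum>x\<in>A. pdiff i (f x))"
  by (induction A rule: infinite_finite_induct) (auto simp: pdiff_add)

lemma pdiff_single: "pdiff i (Poly_Mapping.single m c) =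
    Poly_Mapping.single (m - em i) (of_nat (lookup m i) * c)"
  by (simp add: pdiff_def)

lemma pdiff_mult:
  fixes f g :: "('n, 'k::comm_ring_1) pol"
  shows "pdiff i (f * g) = pdiff i f * g + f * pdiff i g"
proof (induction f rule: poly_mapping_single_induct)
  case (single m c)
  show ?case
  proof (induction g rule: poly_mapping_single_induct)
    case (single m' c')
    have 1: "lookup m i \<noteq> 0 \<Longrightarrow> m + m' - em i = m - em i + m'"
      by (rule poly_mapping_eqI) (auto simp: lookup_add lookup_minus lookup_single when_def)
    have 2: "lookup m' i \<noteq> 0 \<Longrightarrow> m + m' - em i = m + (m' - em i)"
      by (rule poly_mapping_eqI) (auto simp: lookup_add lookup_minus lookup_single when_def)
    show ?case
      using 1 2 by (cases "lookup m i = 0"; cases "lookup m' i = 0")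
        (simp_all add: mult_single pdiff_single lookup_add algebra_simps flip: single_add)
  qed (simp add: pdiff_add algebra_simps)
qed (simp add: pdiff_add algebra_simps)

lemma pconst_add: "pconst (a + b) = pconst a + pconst b"
  by (simp add: pconst_def single_add)

lemma pconst_mult: "pconst (a * b) = pconst a * pconst b"
  by (simp add: pconst_def mult_single)

lemma pconst_0 [simp]: "pconst 0 = 0" and pconst_1 [simp]: "pconst 1 = 1"
  by (simp_all add: pconst_def)

lemma pconst_uminus: "pconst (- a) = - pconst a"
  by (simp add: pconst_def single_uminus)

lemma pconst_sum: "pconst (sum f A) = (\<Sum>x\<in>A. pconst (f x))"
  by (induction A rule: infinite_finite_induct) (auto simp: pconst_add)

lemma pconst_power: "pconst (a ^ n) = pconst a ^ n"
  by (induction n) (simp_all add: pconst_mult)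

lemma pconst_prod: "pconst (prod f A) = (\<Prod>x\<in>A. pconst (f x))"
  by (induction A rule: infinite_finite_induct) (auto simp: pconst_mult)

lemma pconst_times_single: "pconst a * Poly_Mapping.single m c = Poly_Mapping.single m (a * c)"
  by (simp add: pconst_def mult_single)

lemma lookup_pconst_times: "lookup (pconst a * f) m = a * lookup f m"
  by (induction f rule: poly_mapping_single_induct)
     (auto simp: pconst_times_single lookup_single when_def lookup_add algebra_simps)

lemma pdiff_pconst [simp]: "pdiff i (pconst c) = 0"
  by (simp add: pconst_def pdiff_single)

lemma pdiff_pconst_times: "pdiff i (pconst c * f) = pconst c * pdiff i f"
  by (simp add: pdiff_mult)

lemma pdiff_pvar: "pdiff i (pvar j) = (if i = j then 1 else 0)"
  by (auto simp: pvar_def pdiff_single lookup_single when_def single_diff[symmetric])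

section \<open>Total degree and induction over the polynomial ring\<close>

lemma mdeg_add [simp]: "mdeg (a + b) = mdeg a + mdeg b"
  by (simp add: mdeg_def lookup_add sum.distrib)

lemma mdeg_em [simp]: "mdeg (Poly_Mapping.single i k) = k"
  by (simp add: mdeg_def lookup_single when_def)

lemma mdeg_0 [simp]: "mdeg 0 = 0"
  by (simp add: mdeg_def)

lemma mdeg_eq_0_iff [simp]: "mdeg m = 0 \<longleftrightarrow> m = 0"
  by (auto simp: mdeg_def intro!: poly_mapping_eqI)

lemma mdeg_diff_em: "lookup m i \<noteq> 0 \<Longrightarrow> mdeg (m - em i) + 1 = mdeg m"
  by (metis mdeg_add mdeg_em mono_eq_plus_em)

lemma lookup_le_mdeg: "lookup m i \<le> mdeg m"
  unfolding mdeg_def by (rule member_le_sum) auto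

lemma finite_mdeg_le: "finite {m :: 'n::finite mono. mdeg m \<le> K}"
proof -
  have "lookup ` {m :: 'n mono. mdeg m \<le> K} \<subseteq> (\<Pi>\<^sub>E i\<in>UNIV. {..K})"
    using lookup_le_mdeg order_trans by fastforce
  then have "finite (lookup ` {m :: 'n mono. mdeg m \<le> K})"
    by (rule finite_subset) (intro finite_PiE; auto)
  then show ?thesis
    by (rule finite_imageD) (simp add: inj_on_def poly_mapping.lookup_inject)
qed

lemma single_eq_prod_pvar:
  fixes m :: "'n::finite mono"
  shows "Poly_Mapping.single m (c :: 'b::comm_ring_1) = pconst c * (\<Prod>i\<in>UNIV. pvar i ^ lookup m i)"
proof -
  have pw: "pvar i ^ k = Poly_Mapping.single (Poly_Mapping.single i k) (1 :: 'b)" for i :: 'n and k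
  proof (induction k)
    case (Suc k)
    have "pvar i ^ Suc k = (pvar i * pvar i ^ k :: ('n, 'b) pol)" by simp
    also have "\<dots> = Poly_Mapping.single (em i + Poly_Mapping.single i k) 1"
      unfolding Suc by (simp add: pvar_def mult_single)
    finally show ?case by (simp add: Suc_eq_plus1_left flip: single_add)
  qed simp
  have "(\<Prod>i\<in>A. pvar i ^ lookup m i) =
      Poly_Mapping.single (\<Sum>i\<in>A. Poly_Mapping.single i (lookup m i)) (1 :: 'b)" for A
    by (induction A rule: infinite_finite_induct) (simp_all add: pw mult_single)
  moreover have "(\<Sum>i\<in>UNIV. Poly_Mapping.single i (lookup m i)) = m"
    by (rule poly_mapping_eqI) (simp add: lookup_sum lookup_single when_def)
  ultimately show ?thesis by (simp add: pconst_def mult_single)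
qed

text \<open>Suited to maps compatible with sums and products: for homomorphisms and for the chain
  rule only the variables carry content.\<close>

lemma pol_ring_induct [case_names pconst pvar add mult]:
  fixes f :: "('n::finite, 'k::comm_ring_1) pol"
  assumes c: "\<And>c. P (pconst c)" and v: "\<And>i. P (pvar i)"
    and add: "\<And>f g. P f \<Longrightarrow> P g \<Longrightarrow> P (f + g)" and mult: "\<And>f g. P f \<Longrightarrow> P g \<Longrightarrow> P (f * g)"
  shows "P f"
proof (induction f rule: poly_mapping_single_induct)
  case (single m c)
  have pw: "P (pvar i ^ k)" for i k
    by (induction k) (use c[of 1] v mult in auto)
  have "P (\<Prod>i\<in>A. pvar i ^ lookup m i)" for A
    by (induction A rule: infinite_finite_induct) (use c[of 1] pw mult in auto)
  then show ?case unfolding single_eq_prod_pvar by (intro mult c)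
qed (rule add)

text \<open>The universal property of the polynomial ring with an arbitrary coefficient map. Its
  instances are substitution of polynomials, the linear action of GL, the substitution of p-th
  powers for the variables, and evaluation at matrix entries with coefficients moved into the
  algebraic closure.\<close>

definition evp :: "('k::comm_ring_1 \<Rightarrow> 'r) \<Rightarrow> ('n::finite \<Rightarrow> 'r) \<Rightarrow> ('n, 'k) pol \<Rightarrow> 'r::comm_ring_1" where
  "evp \<phi> v f = (\<Sum>m\<in>keys f. \<phi> (lookup f m) * (\<Prod>i\<in>UNIV. v i ^ lookup m i))"

definition coef_hom :: "('k::comm_ring_1 \<Rightarrow> 'r::comm_ring_1) \<Rightarrow> bool" where
  "coef_hom \<phi> \<longleftrightarrow> \<phi> 0 = 0 \<and> \<phi> 1 = 1 \<and> (\<forall>a b. \<phi> (a + b) = \<phi> a + \<phi> b) \<and> (\<forall>a b. \<phi> (a * b) = \<phi> a * \<phi> b)"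

lemma coef_homD:
  assumes "coef_hom \<phi>"
  shows "\<phi> 0 = 0" "\<phi> 1 = 1" "\<phi> (a + b) = \<phi> a + \<phi> b" "\<phi> (a * b) = \<phi> a * \<phi> b"
  using assms by (auto simp: coef_hom_def)

lemma coef_hom_pconst: "coef_hom (pconst :: 'k::comm_ring_1 \<Rightarrow> ('n, 'k) pol)"
  by (auto simp: coef_hom_def pconst_add pconst_mult)

lemma evp_superset:
  assumes "coef_hom \<phi>" "finite A" "keys f \<subseteq> A"
  shows "evp \<phi> v f = (\<Sum>m\<in>A. \<phi> (lookup f m) * (\<Prod>i\<in>UNIV. v i ^ lookup m i))"
  unfolding evp_def using assms
  by (intro sum.mono_neutral_left) (auto simp: coef_homD in_keys_iff)

lemma evp_single:
  "coef_hom \<phi> \<Longrightarrow> evp \<phi> v (Poly_Mapping.single m c) = \<phi> c * (\<Prod>i\<in>UNIV. v i ^ lookup m i)"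
  by (subst evp_superset[of _ "{m}"]) auto

lemma evp_0 [simp]: "evp \<phi> v 0 = 0"
  by (simp add: evp_def)

lemma evp_add:
  assumes "coef_hom \<phi>"
  shows "evp \<phi> v (f + g) = evp \<phi> v f + evp \<phi> v g"
  using evp_superset[OF assms, of "keys f \<union> keys g", of "f + g" v]
    evp_superset[OF assms, of "keys f \<union> keys g", of f v]
    evp_superset[OF assms, of "keys f \<union> keys g", of g v] keys_add[of f g]
  by (simp add: lookup_add coef_homD[OF assms] sum.distrib algebra_simps)

lemma evp_mult:
  assumes h: "coef_hom \<phi>"
  shows "evp \<phi> v (f * g) = evp \<phi> v f * evp \<phi> v g"
proof (induction f rule: poly_mapping_single_induct)
  case (single m c)
  show ?case
  proof (induction g rule: poly_mapping_single_induct)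
    case (single m' c')
    show ?case
      by (simp add: mult_single evp_single[OF h] coef_homD[OF h] lookup_add power_add prod.distrib
          algebra_simps)
  qed (simp add: evp_add[OF h] algebra_simps)
qed (simp add: evp_add[OF h] algebra_simps)

lemma evp_pconst: "coef_hom \<phi> \<Longrightarrow> evp \<phi> v (pconst c) = \<phi> c"
  by (simp add: pconst_def evp_single)

lemma evp_pvar: "coef_hom \<phi> \<Longrightarrow> evp \<phi> v (pvar i) = v i"
  by (simp add: pvar_def evp_single coef_homD lookup_single when_def power_0_left if_distrib prod.delta
      cong: if_cong)

lemma evp_sum: "coef_hom \<phi> \<Longrightarrow> evp \<phi> v (sum f A) = (\<Sum>x\<in>A. evp \<phi> v (f x))"
  by (induction A rule: infinite_finite_induct) (auto simp: evp_add)

lemma evp_1: "coef_hom \<phi> \<Longrightarrow> evp \<phi> v 1 = 1"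
  using evp_pconst[of \<phi> v 1] by (simp add: coef_homD)

lemma evp_prod: "coef_hom \<phi> \<Longrightarrow> evp \<phi> v (prod f A) = (\<Prod>x\<in>A. evp \<phi> v (f x))"
  by (induction A rule: infinite_finite_induct) (auto simp: evp_mult evp_1)

lemma evp_power: "coef_hom \<phi> \<Longrightarrow> evp \<phi> v (f ^ n) = evp \<phi> v f ^ n"
  by (induction n) (auto simp: evp_mult evp_1)

lemma psubst_evp: "psubst \<sigma> = evp pconst \<sigma>"
  by (rule ext) (simp add: psubst_def evp_def)

text \<open>Chain rule. Both sides obey the same Leibniz rule over the homomorphism
  \<open>psubst \<sigma>\<close>, so the identity is checked on constants and variables.\<close>

lemma pdiff_psubst:
  "pdiff k (psubst \<sigma> f) = (\<Sum>i\<in>UNIV. psubst \<sigma> (pdiff i f) * pdiff k (\<sigma> i))"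
proof (induction f rule: pol_ring_induct)
  case (pvar j)
  have "(\<Sum>i\<in>UNIV. evp pconst \<sigma> (pdiff i (pvar j)) * pdiff k (\<sigma> i)) =
      (\<Sum>i\<in>UNIV. if i = j then pdiff k (\<sigma> i) else 0)"
    by (intro sum.cong) (auto simp: pdiff_pvar evp_1[OF coef_hom_pconst])
  then show ?case by (simp add: psubst_evp evp_pvar coef_hom_pconst)
qed (simp_all add: psubst_evp pdiff_add evp_add evp_mult coef_hom_pconst evp_pconst pdiff_mult
     sum.distrib sum_distrib_left algebra_simps)


section \<open>Power series and the order filtration\<close>

text \<open>The power m^q of the maximal ideal, described by coefficients;
  \<open>mpow_eq_ordge\<close> proves the agreement, after which ideal products give way to order
  estimates.\<close>

definition ordge :: "nat \<Rightarrow> ('n::finite, 'k::comm_ring_1) mfps set" where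
  "ordge q = {f. \<forall>m. mdeg m < q \<longrightarrow> mcoeff f m = 0}"

abbreviation mconst :: "'k::comm_ring_1 \<Rightarrow> ('n, 'k) mfps" where
  "mconst c \<equiv> mfps_of_pol (pconst c)"

lemmas mcoeff_simps [simp] = zero_mfps.rep_eq one_mfps.rep_eq plus_mfps.rep_eq uminus_mfps.rep_eq
  minus_mfps.rep_eq

lemma mcoeff_Mfps [simp]: "mcoeff (Mfps f) = f"
  by (simp add: Mfps_inverse)

lemma mcoeff_of_pol [simp]: "mcoeff (mfps_of_pol f) = lookup f"
  by (simp add: mfps_of_pol_def)

lemma mcoeff_sum: "mcoeff (sum f A) m = (\<Sum>x\<in>A. mcoeff (f x) m)"
  by (induction A rule: infinite_finite_induct) auto

lemma ordge_0 [simp]: "ordge 0 = UNIV"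
  by (simp add: ordge_def)

lemma zero_in_ordge [simp]: "0 \<in> ordge q"
  by (simp add: ordge_def)

lemma ordge_add: "f \<in> ordge q \<Longrightarrow> g \<in> ordge q \<Longrightarrow> f + g \<in> ordge q"
  by (simp add: ordge_def)

lemma ordge_diff: "f \<in> ordge q \<Longrightarrow> g \<in> ordge q \<Longrightarrow> f - g \<in> ordge q"
  by (simp add: ordge_def)

lemma ordge_uminus: "f \<in> ordge q \<Longrightarrow> - f \<in> ordge q"
  by (simp add: ordge_def)

lemma ordge_mono: "f \<in> ordge q \<Longrightarrow> r \<le> q \<Longrightarrow> f \<in> ordge r"
  by (auto simp: ordge_def)

lemma ordge_sum: "(\<And>x. x \<in> A \<Longrightarrow> f x \<in> ordge q) \<Longrightarrow> sum f A \<in> ordge q"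
  by (induction A rule: infinite_finite_induct) (auto intro: ordge_add)

lemma ordge_mult:
  assumes "f \<in> ordge a" "g \<in> ordge b" shows "f * g \<in> ordge (a + b)"
  unfolding ordge_def
proof (safe)
  fix m :: "'a mono" assume m: "mdeg m < a + b"
  have "mcoeff f x * mcoeff g y = 0" if "(x, y) \<in> splits m" for x y
  proof -
    have "mdeg x + mdeg y < a + b" using m that by (auto simp: splits_def)
    then have "mdeg x < a \<or> mdeg y < b" by linarith
    then show ?thesis using assms by (auto simp: ordge_def)
  qed
  then show "mcoeff (f * g) m = 0"
    by (auto simp: times_mfps.rep_eq intro!: sum.neutral)
qed

lemma ordge_mult': "f \<in> ordge a \<Longrightarrow> g \<in> ordge b \<Longrightarrow> c \<le> a + b \<Longrightarrow> f * g \<in> ordge c"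
  using ordge_mono ordge_mult by blast

lemma ordge_all_imp_0: "(\<And>q. f \<in> ordge q) \<Longrightarrow> f = 0"
  by (rule mfps_eqI) (simp add: ordge_def, blast)

lemma mfps_of_pol_0 [simp]: "mfps_of_pol 0 = 0"
  by (rule mfps_eqI) simp

lemma mfps_of_pol_add: "mfps_of_pol (f + g) = mfps_of_pol f + mfps_of_pol g"
  by (rule mfps_eqI) (simp add: lookup_add)

lemma mfps_of_pol_uminus: "mfps_of_pol (- f) = - mfps_of_pol f"
  by (rule mfps_eqI) simp

lemma mfps_of_pol_diff: "mfps_of_pol (f - g) = mfps_of_pol f - mfps_of_pol g"
  by (rule mfps_eqI) (simp add: lookup_minus)

lemma mfps_of_pol_sum: "mfps_of_pol (sum f A) = (\<Sum>x\<in>A. mfps_of_pol (f x))"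
  by (induction A rule: infinite_finite_induct) (auto simp: mfps_of_pol_add)

lemma mfps_of_pol_mult:
  fixes f g :: "('n::finite, 'k::comm_ring_1) pol"
  shows "mfps_of_pol (f * g) = mfps_of_pol f * mfps_of_pol g"
proof (induction f rule: poly_mapping_single_induct)
  case (single a c)
  show ?case
  proof (induction g rule: poly_mapping_single_induct)
    case (single b d)
    show ?case
    proof (rule mfps_eqI)
      fix m
      have "mcoeff (mfps_of_pol (Poly_Mapping.single a c) * mfps_of_pol (Poly_Mapping.single b d)) m
         = (\<Sum>z\<in>splits m. if z = (a, b) then c * d else 0)"
        unfolding times_mfps.rep_eq
        by (intro sum.cong) (auto simp: lookup_single when_def split: if_splits)
      also have "\<dots> = (if (a, b) \<in> splits m then c * d else 0)"
        by simp
      finally show "mcoeff (mfps_of_pol (Poly_Mapping.single a c * Poly_Mapping.single b d)) m =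
        mcoeff (mfps_of_pol (Poly_Mapping.single a c) * mfps_of_pol (Poly_Mapping.single b d)) m"
        by (simp add: mult_single lookup_single when_def splits_def)
    qed
  qed (simp add: mfps_of_pol_add algebra_simps)
qed (simp add: mfps_of_pol_add algebra_simps)

lemma mconst_1 [simp]: "mconst 1 = 1"
  by (rule mfps_eqI) (auto simp: lookup_one when_def)

lemma mconst_add: "mconst (a + b) = mconst a + mconst b"
  by (simp add: pconst_add mfps_of_pol_add)

lemma mconst_mult: "mconst (a * b) = mconst a * mconst b"
  by (simp add: pconst_mult mfps_of_pol_mult)

lemma em_neq_0 [simp]: "em i \<noteq> (0 :: 'n mono)"
  by (metis lookup_single_eq lookup_zero one_neq_zero)

lemma em_add_diff_imp: "em i + b = m \<Longrightarrow> lookup m i \<noteq> 0"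
  by (auto simp: lookup_add)

lemma mcoeff_mvar_mult:
  fixes f :: "('n::finite, 'k::comm_ring_1) mfps"
  shows "mcoeff (mvar i * f) m = (if lookup m i = 0 then 0 else mcoeff f (m - em i))"
proof -
  have "mcoeff (mvar i * f) m =
      (\<Sum>z\<in>splits m. if z = (em i, m - em i) then mcoeff f (m - em i) else 0)"
    unfolding times_mfps.rep_eq mvar_def
    by (intro sum.cong) (auto simp: pvar_def lookup_single when_def splits_def split: if_splits)
  moreover have "(em i, m - em i) \<in> splits m \<longleftrightarrow> lookup m i \<noteq> 0"
    using mono_eq_plus_em[of m i] em_add_diff_imp[of i "m - em i" m] by (auto simp: splits_def add.commute)
  ultimately show ?thesis by simp
qed

lemma mvar_in_ordge_1 [simp]: "mvar i \<in> ordge 1"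
  by (auto simp: ordge_def mvar_def pvar_def lookup_single when_def split: if_splits)

lemma homog_in_ordge: "f \<in> homog s \<Longrightarrow> mfps_of_pol f \<in> ordge s"
  by (auto simp: ordge_def homog_def in_keys_iff)

text \<open>A form of degree s has no room below order s + 1 except in degree s itself. This is the
  source of the uniqueness of leading terms.\<close>

lemma homog_diff_in_ordge_Suc:
  assumes "f \<in> homog s" "g \<in> homog s" "mfps_of_pol f - mfps_of_pol g \<in> ordge (s + 1)"
  shows "f = g"
proof (rule poly_mapping_eqI)
  fix m
  show "lookup f m = lookup g m"
  proof (cases "mdeg m = s")
    case True
    then show ?thesis using assms(3) by (simp add: ordge_def)
  next
    case False
    then have "m \<notin> keys f" "m \<notin> keys g" using assms(1,2) by (auto simp: homog_def)
    then show ?thesis by (simp add: in_keys_iff)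
  qed
qed

text \<open>Each monomial other than 1 is charged to one variable \<open>ix m\<close> dividing it;
  h_i collects the monomials charged to i, divided by x_i. All inductions on the order rest on this
  splitting. For q = 0 the truncated q - 1 makes the bound on h_i vacuous.\<close>

lemma ordge_decompose:
  fixes f :: "('n::finite, 'k::comm_ring_1) mfps"
  assumes "f \<in> ordge q"
  obtains h where "f = mconst (mcoeff f 0) + (\<Sum>i\<in>UNIV. mvar i * h i)" "\<And>i. h i \<in> ordge (q - 1)"
proof -
  define ix where "ix m = (SOME i. lookup (m :: 'n mono) i \<noteq> 0)" for m
  have ix: "lookup m (ix m) \<noteq> 0" if "m \<noteq> 0" for m
    unfolding ix_def by (rule someI_ex) (use that in \<open>auto intro: poly_mapping_eqI\<close>)
  define h where "h i = Mfps (\<lambda>m. if ix (m + em i) = i then mcoeff f (m + em i) else 0)" for i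
  have "f = mconst (mcoeff f 0) + (\<Sum>i\<in>UNIV. mvar i * h i)"
  proof (rule mfps_eqI)
    fix m
    show "mcoeff f m = mcoeff (mconst (mcoeff f 0) + (\<Sum>i\<in>UNIV. mvar i * h i)) m"
    proof (cases "m = 0")
      case True
      then show ?thesis by (simp add: mcoeff_sum mcoeff_mvar_mult pconst_def)
    next
      case False
      have "(\<Sum>i\<in>UNIV. mcoeff (mvar i * h i) m) = (\<Sum>i\<in>UNIV. if i = ix m then mcoeff f m else 0)"
        using ix[OF False]
        by (intro sum.cong refl) (auto simp: mcoeff_mvar_mult h_def mono_eq_plus_em)
      then show ?thesis using False by (simp add: mcoeff_sum pconst_def lookup_single when_def)
    qed
  qed
  moreover have "h i \<in> ordge (q - 1)" for i
    using assms by (auto simp: h_def ordge_def)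
  ultimately show ?thesis using that by blast
qed

section \<open>The ideal powers \<open>mpow\<close> are the order filtration\<close>

lemma psr_simps [simp]:
  "carrier psr = UNIV" "x \<otimes>\<^bsub>psr\<^esub> y = x * y" "x \<oplus>\<^bsub>psr\<^esub> y = x + y" "\<zero>\<^bsub>psr\<^esub> = 0" "\<one>\<^bsub>psr\<^esub> = 1"
  by (simp_all add: ring_of_type_algebra_def)

lemma ideal_psrI:
  fixes I :: "('n::finite, 'k::comm_ring_1) mfps set"
  assumes "0 \<in> I" "\<And>a b. a \<in> I \<Longrightarrow> b \<in> I \<Longrightarrow> a + b \<in> I" "\<And>a b. a \<in> I \<Longrightarrow> b * a \<in> I"
  shows "ideal I psr"
proof (rule idealI)
  interpret cring "psr :: ('n, 'k) mfps ring" ..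
  show "ring (psr :: ('n, 'k) mfps ring)" ..
  have inv: "\<ominus>\<^bsub>psr\<^esub> x = - x" for x :: "('n, 'k) mfps"
    by (rule minus_equality) auto
  show "subgroup I (add_monoid (psr :: ('n, 'k) mfps ring))"
    using assms assms(3)[of _ "-1"]
    by (intro add.subgroupI) (auto simp: inv simp flip: a_inv_def)
qed (use assms in \<open>auto simp: mult.commute\<close>)

lemma ideal_ordge: "ideal (ordge q) (psr :: ('n::finite, 'k::comm_ring_1) mfps ring)"
  using ordge_mult[of _ 0 _ q] by (intro ideal_psrI) (auto intro: ordge_add)

lemma genideal_mvar: "genideal psr (range mvar) = (ordge 1 :: ('n::finite, 'k::comm_ring_1) mfps set)"
proof
  show "genideal psr (range mvar) \<subseteq> (ordge 1 :: ('n, 'k) mfps set)"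
    unfolding genideal_def using ideal_ordge[of 1] mvar_in_ordge_1 by blast
  show "(ordge 1 :: ('n, 'k) mfps set) \<subseteq> genideal psr (range mvar)"
    unfolding genideal_def
  proof (intro subsetI InterI, safe)
    fix f :: "('n, 'k) mfps" and I
    assume f: "f \<in> ordge 1" and I: "ideal I (psr :: ('n, 'k) mfps ring)" and v: "range mvar \<subseteq> I"
    interpret ideal I psr by fact
    from f obtain h where h: "f = mconst (mcoeff f 0) + (\<Sum>i\<in>UNIV. mvar i * h i)"
      by (rule ordge_decompose)
    have f0: "mcoeff f 0 = 0" using f by (auto simp: ordge_def)
    have a: "a + b \<in> I" if "a \<in> I" "b \<in> I" for a b using additive_subgroup.a_closed[OF ideal.axioms(1)[OF I] that] by simp
    have m: "mvar i * h i \<in> I" for i using v I_r_closed[of "mvar i" "h i"] by auto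
    have z: "0 \<in> I" using additive_subgroup.zero_closed[OF ideal.axioms(1)[OF I]] by simp
    have "(\<Sum>i\<in>A. mvar i * h i) \<in> I" for A
      by (induction A rule: infinite_finite_induct) (auto intro: a m z)
    then show "f \<in> I" using h f0 by simp
  qed
qed

text \<open>A series of order s + 1 has no constant term, so the decomposition writes it as a sum of
  products x_i h_i with h_i of order s, which is the form required by the ideal product.\<close>

lemma mpow_eq_ordge: "mpow s = (ordge s :: ('n::finite, 'k::comm_ring_1) mfps set)"
proof (induction s)
  case (Suc s)
  have "f \<in> ordge (Suc s)" if "f \<in> ideal_prod psr (ordge 1) (ordge s :: ('n, 'k) mfps set)" for f
    using that by induction (auto intro: ordge_add ordge_mult' )
  moreover have "f \<in> ideal_prod psr (ordge 1) (ordge s :: ('n, 'k) mfps set)" if f: "f \<in> ordge (Suc s)" for f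
  proof -
    from f obtain h where h: "f = mconst (mcoeff f 0) + (\<Sum>i\<in>UNIV. mvar i * h i)"
        "\<And>i. h i \<in> ordge s"
      by (rule ordge_decompose) auto
    have m: "mvar i * h i \<in> ideal_prod psr (ordge 1) (ordge s)" for i
      using ideal_prod.prod[of "mvar i" "ordge 1" "h i" "ordge s" psr] h(2) by simp
    have z: "0 \<in> ideal_prod psr (ordge 1) (ordge s :: ('n, 'k) mfps set)"
      using ideal_prod.prod[of 0 "ordge 1" 0 "ordge s :: ('n, 'k) mfps set" psr] by simp
    have a: "a + b \<in> ideal_prod psr (ordge 1) (ordge s :: ('n, 'k) mfps set)"
      if "a \<in> ideal_prod psr (ordge 1) (ordge s)" "b \<in> ideal_prod psr (ordge 1) (ordge s)" for a b
      using ideal_prod.sum[OF that] by simp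
    have "(\<Sum>i\<in>A. mvar i * h i) \<in> ideal_prod psr (ordge 1) (ordge s)" for A
      by (induction A rule: infinite_finite_induct) (auto intro: a m z)
    moreover have "mcoeff f 0 = 0" using f by (auto simp: ordge_def)
    ultimately show ?thesis using h(1) by simp
  qed
  ultimately show ?case by (auto simp: Suc genideal_mvar)
qed simp

section \<open>Formal partial derivatives of power series\<close>

lemma mcoeff_mfps_diff: "mcoeff (mfps_diff i f) m = of_nat (lookup m i + 1) * mcoeff f (m + em i)"
  by (simp add: mfps_diff_def)

lemma mfps_diff_of_pol: "mfps_diff i (mfps_of_pol f) = mfps_of_pol (pdiff i f)"
  by (rule mfps_eqI) (simp add: mcoeff_mfps_diff lookup_pdiff)

lemma mfps_diff_0 [simp]: "mfps_diff i 0 = 0"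
  by (rule mfps_eqI) (simp add: mcoeff_mfps_diff)

lemma mfps_diff_add: "mfps_diff i (f + g) = mfps_diff i f + mfps_diff i g"
  by (rule mfps_eqI) (simp add: mcoeff_mfps_diff algebra_simps)

lemma mfps_diff_diff: "mfps_diff i (f - g) = mfps_diff i f - mfps_diff i g"
  by (rule mfps_eqI) (simp add: mcoeff_mfps_diff algebra_simps)

lemma mfps_diff_ordge: "f \<in> ordge q \<Longrightarrow> mfps_diff i f \<in> ordge (q - 1)"
  by (auto simp: ordge_def mcoeff_mfps_diff)

lemma mfps_diff_mconst [simp]: "mfps_diff i (mconst c) = 0"
  by (simp add: mfps_diff_of_pol)

lemma mfps_diff_mvar: "mfps_diff i (mvar j) = (if i = j then 1 else 0)"
  using mconst_1 by (auto simp: mvar_def mfps_diff_of_pol pdiff_pvar simp flip: pconst_1)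

text \<open>In every splitting a + b = m + e_i the factor (m + e_i)_i equals a_i + b_i. This divides
  the coefficient of the product into the two Leibniz terms.\<close>

lemma mfps_diff_mult:
  fixes f g :: "('n::finite, 'k::comm_ring_1) mfps"
  shows "mfps_diff i (f * g) = mfps_diff i f * g + f * mfps_diff i g"
proof (rule mfps_eqI)
  fix m :: "'n mono"
  \<comment> \<open>Splittings with a_i = 0 carry the factor 0; on the others a -> a - e_i is a
    bijection onto the splittings of m.\<close>
  have shift: "(\<Sum>(a, b)\<in>splits (m + em i). of_nat (lookup a i) * u a * v b) =
     (\<Sum>(a, b)\<in>splits m. of_nat (lookup a i + 1) * u (a + em i) * v b)" for u v :: "'n mono \<Rightarrow> 'k"
  proof -
    have "(\<Sum>(a, b)\<in>splits (m + em i). of_nat (lookup a i) * u a * v b) =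
       (\<Sum>(a, b)\<in>{z \<in> splits (m + em i). lookup (fst z) i \<noteq> 0}. of_nat (lookup a i) * u a * v b)"
      by (rule sum.mono_neutral_right) (auto intro!: gr0I)
    also have "\<dots> = (\<Sum>(a, b)\<in>splits m. of_nat (lookup a i + 1) * u (a + em i) * v b)"
    proof (rule sum.reindex_bij_witness[where i = "\<lambda>(a, b). (a + em i, b)" and j = "\<lambda>(a, b). (a - em i, b)"])
      fix z assume z: "z \<in> {z \<in> splits (m + em i). lookup (fst z) i \<noteq> 0}"
      obtain a b where ab: "z = (a, b)" by force
      have 1: "a - em i + em i = a" using z ab by (intro mono_eq_plus_em) simp
      have "a + b = m + em i" using z ab by (simp add: splits_def)
      then have "(a - em i + em i) + b = m + em i" by (simp only: 1)
      then have "(a - em i + b) + em i = m + em i" by (simp only: ac_simps)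
      then have "a - em i + b = m" by simp
      then show "(case z of (a, b) \<Rightarrow> (a - em i, b)) \<in> splits m" using ab by (simp add: splits_def)
      show "(case case z of (a, b) \<Rightarrow> (a - em i, b) of (a, b) \<Rightarrow> (a + em i, b)) = z"
        using ab 1 by simp
      have "lookup (a - em i) i + 1 = lookup a i" using 1 by (metis lookup_add lookup_single_eq)
      from this[symmetric] show "(case case z of (a, b) \<Rightarrow> (a - em i, b) of (a, b) \<Rightarrow> of_nat (lookup a i + 1) * u (a + em i) * v b) =
        (case z of (a, b) \<Rightarrow> of_nat (lookup a i) * u a * v b)" using ab 1 by simp
    qed (auto simp: splits_def lookup_add ac_simps)
    finally show ?thesis .
  qed
  have swap: "(\<Sum>(a, b)\<in>splits x. F a b) = (\<Sum>(a, b)\<in>splits x. F b a)" for x :: "'n mono" and F :: "_ \<Rightarrow> _ \<Rightarrow> 'k"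
    by (rule sum.reindex_bij_witness[where i = prod.swap and j = prod.swap])
       (auto simp: splits_def add.commute)
  have "mcoeff (mfps_diff i (f * g)) m =
     (\<Sum>(a, b)\<in>splits (m + em i). of_nat (lookup (m + em i) i) * (mcoeff f a * mcoeff g b))"
    by (simp add: mcoeff_mfps_diff times_mfps.rep_eq sum_distrib_left case_prod_unfold lookup_add)
  also have "\<dots> = (\<Sum>(a, b)\<in>splits (m + em i). of_nat (lookup a i) * mcoeff f a * mcoeff g b)
      + (\<Sum>(a, b)\<in>splits (m + em i). of_nat (lookup b i) * mcoeff g b * mcoeff f a)"
    unfolding sum.distrib[symmetric]
  proof (intro sum.cong refl)
    fix z assume "z \<in> splits (m + em i)"
    then have "lookup (m + em i) i = lookup (fst z) i + lookup (snd z) i"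
      by (cases z) (metis (mono_tags, lifting) case_prodD fst_conv lookup_add mem_Collect_eq snd_conv splits_def)
    then show "(case z of (a, b) \<Rightarrow> of_nat (lookup (m + em i) i) * (mcoeff f a * mcoeff g b)) =
      (case z of (a, b) \<Rightarrow> of_nat (lookup a i) * mcoeff f a * mcoeff g b) +
      (case z of (a, b) \<Rightarrow> of_nat (lookup b i) * mcoeff g b * mcoeff f a)"
      by (cases z) (simp add: algebra_simps)
  qed
  also have "(\<Sum>(a, b)\<in>splits (m + em i). of_nat (lookup b i) * mcoeff g b * mcoeff f a) =
    (\<Sum>(a, b)\<in>splits (m + em i). of_nat (lookup a i) * mcoeff g a * mcoeff f b)"
    by (rule swap)
  also have "\<dots> = (\<Sum>(a, b)\<in>splits m. of_nat (lookup a i + 1) * mcoeff g (a + em i) * mcoeff f b)"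
    by (rule shift)
  also have "\<dots> = (\<Sum>(a, b)\<in>splits m. of_nat (lookup b i + 1) * mcoeff g (b + em i) * mcoeff f a)"
    by (rule swap)
  finally show "mcoeff (mfps_diff i (f * g)) m = mcoeff (mfps_diff i f * g + f * mfps_diff i g) m"
    unfolding shift mcoeff_simps times_mfps.rep_eq mcoeff_mfps_diff
    by (simp add: case_prod_unfold mult_ac)
qed


lemma mfps_of_pol_1 [simp]: "mfps_of_pol 1 = 1"
  using mconst_1 by simp

lemma em_eq_iff [simp]: "em i = em j \<longleftrightarrow> i = j"
  by (metis lookup_single_eq lookup_single_not_eq one_neq_zero)

section \<open>Endomorphisms of the power series ring\<close>

text \<open>Continuity is encoded by the condition on the images of the variables; that orders are
  respected is derived from it in \<open>alg_endo_ordge\<close>.\<close>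

definition alg_endo :: "('n::finite, 'k::comm_ring_1) aut \<Rightarrow> bool" where
  "alg_endo g \<longleftrightarrow> (\<forall>f h. g (f + h) = g f + g h) \<and> (\<forall>f h. g (f * h) = g f * g h) \<and>
     (\<forall>c. g (mconst c) = mconst c) \<and> (\<forall>i. g (mvar i) \<in> ordge 1)"

lemma alg_endoD:
  assumes "alg_endo g"
  shows "g (f + h) = g f + g h" "g (f * h) = g f * g h" "g (mconst c) = mconst c"
    "g (mvar i) \<in> ordge 1" "g 0 = 0" "g 1 = 1" "g (- f) = - g f" "g (f - h) = g f - g h"
proof -
  show 1: "g (f + h) = g f + g h" "g (f * h) = g f * g h" "g (mconst c) = mconst c"
    "g (mvar i) \<in> ordge 1" for f h c i using assms by (auto simp: alg_endo_def)
  show "g 0 = 0" "g 1 = 1" using 1(3)[of 0] 1(3)[of 1] by simp_all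
  then have *: "g (- f) = - g f" for f using 1(1)[of f "- f"] by (simp add: eq_neg_iff_add_eq_0 add.commute)
  show "g (- f) = - g f" by (rule *)
  show "g (f - h) = g f - g h" using 1(1)[of f "- h"] * by simp
qed

lemma alg_endo_sum: "alg_endo g \<Longrightarrow> g (sum f A) = (\<Sum>x\<in>A. g (f x))"
  by (induction A rule: infinite_finite_induct) (auto simp: alg_endoD)

lemma alg_endo_prod: "alg_endo g \<Longrightarrow> g (prod f A) = (\<Prod>x\<in>A. g (f x))"
  by (induction A rule: infinite_finite_induct) (auto simp: alg_endoD)

text \<open>The common induction behind all estimates below: for \<open>f = c + \<Sum>\<^sub>i x\<^sub>i f\<^sub>i\<close> the value of a map
  satisfying a Leibniz rule up to an error is controlled by its values on the \<open>f\<^sub>i\<close>, one order lower.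
  No continuity is needed, since the bound improves by one in each round.\<close>
lemma twisted_derivation_order:
  fixes \<delta> :: "('n::finite, 'k::comm_ring_1) mfps \<Rightarrow> ('n, 'k) mfps"
  assumes add: "\<And>f h. \<delta> (f + h) = \<delta> f + \<delta> h"
    and const: "\<And>c q. mconst c \<in> ordge q \<Longrightarrow> \<delta> (mconst c) \<in> ordge (e q)"
    and e: "\<And>q. e q \<le> e (q - 1) + 1"
    and u: "\<And>i. u i \<in> ordge 1"
    and mult: "\<And>q i f. f \<in> ordge (q - 1) \<Longrightarrow> \<delta> (mvar i * f) - u i * \<delta> f \<in> ordge (e q)"
    and f: "f \<in> ordge q"
  shows "\<delta> f \<in> ordge (e q)"
proof -
  have d0: "\<delta> 0 = 0" using add[of 0 0] by simp
  have dsum: "\<delta> (sum h A) = (\<Sum>i\<in>A. \<delta> (h i))" for h and A :: "'n set"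
    by (induction A rule: infinite_finite_induct) (auto simp: d0 add)
  have "\<delta> f \<in> ordge (min t (e q))" if "f \<in> ordge q" for t f q
    using that
  proof (induction t arbitrary: f q)
    case (Suc t)
    obtain h where h: "f = mconst (mcoeff f 0) + (\<Sum>i\<in>UNIV. mvar i * h i)" "\<And>i. h i \<in> ordge (q - 1)"
      by (rule ordge_decompose[OF Suc.prems]) (rule that, assumption, simp)
    have "mconst (mcoeff f 0) \<in> ordge q"
      using Suc.prems by (auto simp: ordge_def pconst_def lookup_single when_def)
    then have "\<delta> (mconst (mcoeff f 0)) \<in> ordge (min (Suc t) (e q))"
      using const ordge_mono min.cobounded2 by blast
    moreover have "\<delta> (mvar i * h i) \<in> ordge (min (Suc t) (e q))" for i
    proof -
      have "\<delta> (mvar i * h i) - u i * \<delta> (h i) \<in> ordge (min (Suc t) (e q))"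
        using mult[OF h(2)] ordge_mono min.cobounded2 by blast
      moreover have "u i * \<delta> (h i) \<in> ordge (min (Suc t) (e q))"
        by (rule ordge_mult'[OF u Suc.IH[OF h(2)]]) (use e[of q] in auto)
      ultimately show ?thesis using ordge_add by fastforce
    qed
    ultimately have "\<delta> (mconst (mcoeff f 0)) + (\<Sum>i\<in>UNIV. \<delta> (mvar i * h i)) \<in> ordge (min (Suc t) (e q))"
      by (intro ordge_add ordge_sum)
    then show ?case by (subst h(1)) (simp add: add dsum)
  qed simp
  from this[OF f, of "e q"] show ?thesis by simp
qed

lemma alg_endo_ordge:
  assumes "alg_endo g" "f \<in> ordge q"
  shows "g f \<in> ordge q"
  by (rule twisted_derivation_order[where \<delta> = g and u = "\<lambda>i. g (mvar i)" and e = "\<lambda>q. q"])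
     (use assms in \<open>auto simp: alg_endoD\<close>)

text \<open>The difference of two homomorphisms is a twisted derivation: (g - h)(x_i f) = g(x_i) (g
  - h)(f) + (g - h)(x_i) h(f). Constants are annihilated, so order 0 behaves like order 1, which is
  the reason for \<open>max q 1\<close>.\<close>

lemma alg_endo_diff_ordge:
  assumes g: "alg_endo g" and h: "alg_endo h" and s: "s \<ge> 1"
    and d: "\<And>i. g (mvar i) - h (mvar i) \<in> ordge s" and f: "f \<in> ordge q"
  shows "g f - h f \<in> ordge (max q 1 + s - 1)"
proof (rule twisted_derivation_order[where \<delta> = "\<lambda>f. g f - h f" and u = "\<lambda>i. g (mvar i)"
      and e = "\<lambda>q. max q 1 + s - 1"])
  fix q i and f :: "('a, 'b) mfps" assume f: "f \<in> ordge (q - 1)"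
  have "g (mvar i * f) - h (mvar i * f) - g (mvar i) * (g f - h f) = (g (mvar i) - h (mvar i)) * h f"
    by (simp add: alg_endoD[OF g] alg_endoD[OF h] algebra_simps)
  moreover have "\<dots> \<in> ordge (max q 1 + s - 1)"
    by (rule ordge_mult'[OF d alg_endo_ordge[OF h f]]) (use s in auto)
  ultimately show "g (mvar i * f) - h (mvar i * f) - g (mvar i) * (g f - h f) \<in> ordge (max q 1 + s - 1)"
    by simp
qed (use s f in \<open>auto simp: alg_endoD[OF g] alg_endoD[OF h]\<close>)

section \<open>Vector fields as derivations of power series, and expansion to first order\<close>

definition vfa :: "('n::finite, 'k::comm_ring_1) vf \<Rightarrow> ('n, 'k) mfps \<Rightarrow> ('n, 'k) mfps" where
  "vfa D f = (\<Sum>i\<in>UNIV. mfps_of_pol (D i) * mfps_diff i f)"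

lemma vfa_add: "vfa D (f + g) = vfa D f + vfa D g"
  by (simp add: vfa_def mfps_diff_add algebra_simps sum.distrib)

lemma vfa_diff: "vfa D (f - g) = vfa D f - vfa D g"
  by (simp add: vfa_def mfps_diff_diff algebra_simps sum_subtractf)

lemma vfa_mult: "vfa D (f * g) = vfa D f * g + f * vfa D g"
  by (simp add: vfa_def mfps_diff_mult algebra_simps sum.distrib sum_distrib_left)

lemma vfa_mconst [simp]: "vfa D (mconst c) = 0"
  by (simp add: vfa_def)

lemma vfa_mvar [simp]: "vfa D (mvar i) = mfps_of_pol (D i)"
  by (simp add: vfa_def mfps_diff_mvar if_distrib cong: if_cong)

lemma SymV_in_ordge: "D \<in> SymV s \<Longrightarrow> mfps_of_pol (D i) \<in> ordge s"
  by (simp add: SymV_def homog_in_ordge)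

text \<open>The defect of the Leibniz rule for g - 1 - D on x_i f is (g x_i - x_i - D_i) f + (g x_i
  - x_i)(g f - f). The second product is small enough because g - 1 raises orders by s - 1 >=
  1.\<close>

lemma alg_endo_first_order:
  assumes g: "alg_endo g" and s: "s \<ge> 2" and D: "D \<in> SymV s"
    and d: "\<And>i. g (mvar i) - mvar i - mfps_of_pol (D i) \<in> ordge (s + 1)" and f: "f \<in> ordge q"
  shows "g f - f - vfa D f \<in> ordge (q + s)"
proof -
  have id: "alg_endo (id :: ('a, 'b) aut)" by (simp add: alg_endo_def)
  have d1: "g (mvar i) - mvar i \<in> ordge s" for i
    using ordge_add[OF ordge_mono[OF d[of i], of s] SymV_in_ordge[OF D, of i]] by simp
  show ?thesis
  proof (rule twisted_derivation_order[where \<delta> = "\<lambda>f. g f - f - vfa D f" and u = mvar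
        and e = "\<lambda>q. q + s"])
    fix q i and f :: "('a, 'b) mfps" assume f: "f \<in> ordge (q - 1)"
    have "g (mvar i * f) - mvar i * f - vfa D (mvar i * f) - mvar i * (g f - f - vfa D f) =
      (g (mvar i) - mvar i - mfps_of_pol (D i)) * f + (g (mvar i) - mvar i) * (g f - f)"
      by (simp add: alg_endoD[OF g] vfa_mult algebra_simps)
    moreover have "(g (mvar i) - mvar i - mfps_of_pol (D i)) * f \<in> ordge (q + s)"
      by (rule ordge_mult'[OF d f]) auto
    moreover have "g f - f \<in> ordge (max (q - 1) 1 + s - 1)"
      using alg_endo_diff_ordge[OF g id, of s f "q - 1"] d1 s f by simp
    then have "(g (mvar i) - mvar i) * (g f - f) \<in> ordge (q + s)"
      by (rule ordge_mult'[OF d1]) (use s in auto)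
    ultimately show "g (mvar i * f) - mvar i * f - vfa D (mvar i * f) - mvar i * (g f - f - vfa D f)
        \<in> ordge (q + s)" by (metis ordge_add)
  qed (use f in \<open>auto simp: alg_endoD[OF g] vfa_add\<close>)
qed

text \<open>Chain rule for infinite substitutions. The difference of the two sides satisfies
  \<delta>(x_i f) = g(x_i) \<delta>(f) exactly and kills constants, hence has order at least q for
  every q.\<close>

lemma mfps_diff_alg_endo:
  assumes g: "alg_endo g"
  shows "mfps_diff j (g f) = (\<Sum>i\<in>UNIV. g (mfps_diff i f) * mfps_diff j (g (mvar i)))"
proof -
  define \<delta> where "\<delta> f = mfps_diff j (g f) - (\<Sum>i\<in>UNIV. g (mfps_diff i f) * mfps_diff j (g (mvar i)))" for f
  have "\<delta> f \<in> ordge q" for q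
  proof (rule twisted_derivation_order[where \<delta> = \<delta> and u = "\<lambda>i. g (mvar i)" and e = "\<lambda>_. q" and q = 0])
    fix i and f :: "('a, 'b) mfps"
    have "(\<Sum>l\<in>UNIV. g (mfps_diff l (mvar i * f)) * mfps_diff j (g (mvar l))) =
      (\<Sum>l\<in>UNIV. (if l = i then g f * mfps_diff j (g (mvar l)) else 0) +
         g (mvar i) * (g (mfps_diff l f) * mfps_diff j (g (mvar l))))"
      by (intro sum.cong refl)
         (auto simp: mfps_diff_mult mfps_diff_mvar alg_endoD[OF g] algebra_simps)
    then have "\<delta> (mvar i * f) = g (mvar i) * \<delta> f"
      by (simp add: \<delta>_def alg_endoD[OF g] mfps_diff_mult sum.distrib sum_distrib_left algebra_simps)
    then show "\<delta> (mvar i * f) - g (mvar i) * \<delta> f \<in> ordge q" by simp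
  qed (auto simp: \<delta>_def alg_endoD[OF g] mfps_diff_add algebra_simps sum.distrib)
  then have "\<delta> f = 0" by (rule ordge_all_imp_0)
  then show ?thesis by (simp add: \<delta>_def)
qed

text \<open>The inverse is the geometric series in 1 - g, which converges because 1 - g raises
  orders. Injectivity is the same remark: a kernel element equals its own image under 1 - g.\<close>

lemma bij_of_unipotent:
  fixes g :: "('n::finite, 'k::comm_ring_1) aut"
  assumes add: "\<And>f h. g (f - h) = g f - g h"
    and up: "\<And>q f. f \<in> ordge q \<Longrightarrow> g f - f \<in> ordge (q + 1)"
  shows "bij g"
proof (rule bijI)
  have inj0: "f = 0" if "g f = 0" for f
  proof (rule ordge_all_imp_0)
    fix q show "f \<in> ordge q"
    proof (induction q)
      case (Suc q)
      then show ?case using up[OF Suc] ordge_uminus[of "- f"] that by (auto simp: Suc_eq_plus1)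
    qed simp
  qed
  show "inj g"
  proof (rule injI)
    fix f h assume "g f = g h"
    then have "g (f - h) = 0" by (simp add: add)
    then have "f - h = 0" by (rule inj0)
    then show "f = h" by simp
  qed
  have "\<exists>h. g h = F" for F
  proof -
    define r where "r k = ((\<lambda>f. f - g f) ^^ k) F" for k
    define S where "S k = (\<Sum>i<k. r i)" for k
    have r: "r k \<in> ordge k" for k
    proof (induction k)
      case (Suc k)
      have "- (g (r k) - r k) \<in> ordge (k + 1)" by (intro ordge_uminus up Suc)
      then show ?case by (simp add: r_def) (simp only: Suc_eq_plus1)
    qed simp
    have gS: "g (S k) = F - r k" for k
    proof (induction k)
      case 0
      show ?case using add[of 0 0] by (simp add: S_def r_def)
    next
      case (Suc k)
      have "g (S k + r k) = g (S k) + g (r k)"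
        using add[of "S k" "- r k"] add[of 0 "r k"] add[of 0 0] by simp
      then show ?case using Suc by (simp add: S_def r_def)
    qed
    \<comment> \<open>The coefficient at m no longer changes from the partial sum
      \<open>S (mdeg m + 1)\<close> on, so the limit is written down coefficientwise.\<close>
    define h where "h = Mfps (\<lambda>m. mcoeff (S (mdeg m + 1)) m)"
    have SS: "S l - S k \<in> ordge k" if "k \<le> l" for k l
      using that
    proof (induction l rule: dec_induct)
      case (step l)
      have "S (Suc l) - S k = (S l - S k) + r l" by (simp add: S_def)
      moreover have "r l \<in> ordge k" using r step ordge_mono by blast
      ultimately show ?case using step.IH ordge_add by metis
    qed simp
    have hS: "h - S k \<in> ordge k" for k
      unfolding ordge_def
    proof safe
      fix m :: "'n mono" assume m: "mdeg m < k"
      have "S k - S (mdeg m + 1) \<in> ordge (mdeg m + 1)" by (rule SS) (use m in auto)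
      then show "mcoeff (h - S k) m = 0" by (simp add: ordge_def h_def)
    qed
    have pres: "g f \<in> ordge q" if "f \<in> ordge q" for f q
      using ordge_add[OF ordge_mono[OF up[OF that], of q] that] by simp
    have "g h - F \<in> ordge k" for k
    proof -
      have "g h - F = g (h - S k) - r k" by (simp add: add gS)
      then show ?thesis using pres[OF hS] r ordge_diff by metis
    qed
    then have "g h - F = 0" by (rule ordge_all_imp_0)
    then have "g h = F" by simp
    then show ?thesis by blast
  qed
  then show "surj g" by (metis surj_def)
qed

text \<open>Substitution of \<sigma>_i for x_i. The product M a of powers of the \<sigma>_i has
  order at least the degree of a, so the truncation T K to degree K determines the value modulo
  order K + 1. Identities are checked on truncations.\<close>

lemma alg_endo_exists:
  fixes \<sigma> :: "'n::finite \<Rightarrow> ('n, 'k::comm_ring_1) mfps"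
  assumes \<sigma>: "\<And>i. \<sigma> i \<in> ordge 1"
  obtains g where "alg_endo g" "\<And>i. g (mvar i) = \<sigma> i"
proof -
  define M where "M a = (\<Prod>i\<in>UNIV. \<sigma> i ^ lookup a i)" for a :: "'n mono"
  define T where "T K F = (\<Sum>a\<in>{a. mdeg a \<le> K}. mconst (mcoeff F a) * M a)" for K F
  define g where "g F = Mfps (\<lambda>m. mcoeff (T (mdeg m) F) m)" for F
  have pw: "\<sigma> i ^ k \<in> ordge k" for i k
    by (induction k) (auto intro!: ordge_mult'[OF \<sigma>])
  have "(\<Prod>i\<in>A. \<sigma> i ^ lookup a i) \<in> ordge (\<Sum>i\<in>A. lookup a i)" for a A
    by (induction A rule: infinite_finite_induct) (auto intro: ordge_mult pw)
  then have M: "M a \<in> ordge (mdeg a)" for a by (simp add: M_def mdeg_def)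
  have M_add: "M (a + b) = M a * M b" for a b
    by (simp add: M_def lookup_add power_add prod.distrib)
  have trm: "mconst c * M a \<in> ordge (mdeg a)" for c a
    using ordge_mult'[of "mconst c" 0, OF _ M] by simp
  have T: "g F - T K F \<in> ordge (K + 1)" for F K
    unfolding ordge_def
  proof safe
    fix m :: "'n mono" assume m: "mdeg m < K + 1"
    have "T K F = T (mdeg m) F + (\<Sum>a\<in>{a. mdeg a \<le> K} - {a. mdeg a \<le> mdeg m}. mconst (mcoeff F a) * M a)"
      unfolding T_def using m
      by (subst sum.subset_diff[of "{a. mdeg a \<le> mdeg m}"]) (auto simp: finite_mdeg_le add.commute)
    moreover have "mcoeff (\<Sum>a\<in>{a. mdeg a \<le> K} - {a. mdeg a \<le> mdeg m}. mconst (mcoeff F a) * M a) m = 0"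
      unfolding mcoeff_sum using trm by (intro sum.neutral) (auto simp: ordge_def)
    ultimately show "mcoeff (g F - T K F) m = 0" by (simp add: g_def)
  qed
  have eqI: "u = v" if "\<And>K. u - v \<in> ordge (K + 1)" for u v :: "('n, 'k) mfps"
  proof -
    have "u - v \<in> ordge q" for q using that[of q] by (rule ordge_mono) simp
    then show ?thesis using ordge_all_imp_0 by fastforce
  qed
  have finT: "g F = T K F" if "\<And>a. mcoeff F a \<noteq> 0 \<Longrightarrow> mdeg a \<le> K" for F K
  proof (rule eqI)
    fix L
    have "T (max K L) F = T K F"
      unfolding T_def
    proof (rule sum.mono_neutral_right)
      have "mcoeff F a = 0" if "\<not> mdeg a \<le> K" for a using \<open>\<And>a. mcoeff F a \<noteq> 0 \<Longrightarrow> mdeg a \<le> K\<close> that by blast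
      then show "\<forall>a\<in>{a. mdeg a \<le> max K L} - {a. mdeg a \<le> K}. mconst (mcoeff F a) * M a = 0" by simp
    qed (auto simp: finite_mdeg_le)
    then show "g F - T K F \<in> ordge (L + 1)"
      using T[of F "max K L"] by (auto intro: ordge_mono)
  qed
  have mult: "g (F * H) = g F * g H" for F H
  proof (rule eqI)
    fix K
    let ?S = "{a. mdeg a \<le> K} :: 'n mono set"
    have fin: "finite ?S" by (rule finite_mdeg_le)
    have mF: "mconst (mcoeff (F * H) m) * M m =
      (\<Sum>z\<in>splits m. mconst (mcoeff F (fst z) * mcoeff H (snd z)) * M (fst z + snd z))" for m
    proof -
      have "mcoeff (F * H) m = (\<Sum>z\<in>splits m. mcoeff F (fst z) * mcoeff H (snd z))"
        by (simp add: times_mfps.rep_eq case_prod_unfold)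
      then have "mconst (mcoeff (F * H) m) * M m =
          (\<Sum>z\<in>splits m. mconst (mcoeff F (fst z) * mcoeff H (snd z)) * M m)"
        by (simp only: pconst_sum mfps_of_pol_sum sum_distrib_right)
      also have "\<dots> = (\<Sum>z\<in>splits m. mconst (mcoeff F (fst z) * mcoeff H (snd z)) * M (fst z + snd z))"
        by (intro sum.cong) (auto simp: splits_def)
      finally show ?thesis .
    qed
    have "T K (F * H) = (\<Sum>(m, z)\<in>Sigma ?S splits. mconst (mcoeff F (fst z) * mcoeff H (snd z)) * M (fst z + snd z))"
      unfolding T_def mF by (rule sum.Sigma) (use fin in auto)
    also have "\<dots> = (\<Sum>z\<in>{z \<in> ?S \<times> ?S. mdeg (fst z + snd z) \<le> K}. mconst (mcoeff F (fst z) * mcoeff H (snd z)) * M (fst z + snd z))"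
      by (rule sum.reindex_bij_witness[where i = "\<lambda>z. (fst z + snd z, z)" and j = snd])
         (auto simp: splits_def)
    finally have 1: "T K (F * H) = \<dots>" .
    have 2: "T K F * T K H = (\<Sum>z\<in>?S \<times> ?S. mconst (mcoeff F (fst z) * mcoeff H (snd z)) * M (fst z + snd z))"
      unfolding T_def sum_product sum.cartesian_product
      by (intro sum.cong) (auto simp: mconst_mult M_add)
    \<comment> \<open>The product of the truncations contains, beyond the truncated product, only
      pairs of monomials of total degree above K.\<close>
    have "T K F * T K H - T K (F * H) = (\<Sum>z\<in>?S \<times> ?S - {z \<in> ?S \<times> ?S. mdeg (fst z + snd z) \<le> K}.
        mconst (mcoeff F (fst z) * mcoeff H (snd z)) * M (fst z + snd z))"
      unfolding 1 2 using fin by (subst sum_diff) auto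
    moreover have "\<dots> \<in> ordge (K + 1)"
    proof (intro ordge_sum)
      fix z assume "z \<in> ?S \<times> ?S - {z \<in> ?S \<times> ?S. mdeg (fst z + snd z) \<le> K}"
      then have "K + 1 \<le> mdeg (fst z + snd z)" by auto
      then show "mconst (mcoeff F (fst z) * mcoeff H (snd z)) * M (fst z + snd z) \<in> ordge (K + 1)"
        using trm ordge_mono by blast
    qed
    ultimately have 3: "T K F * T K H - T K (F * H) \<in> ordge (K + 1)" by simp
    have "g (F * H) - g F * g H = (g (F * H) - T K (F * H)) - (T K F * T K H - T K (F * H))
       - (g F - T K F) * g H - T K F * (g H - T K H)" by (simp add: algebra_simps)
    moreover have "(g F - T K F) * g H \<in> ordge (K + 1)"
      using ordge_mult'[OF T, of "g H" 0] by simp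
    moreover have "T K F * (g H - T K H) \<in> ordge (K + 1)"
      using ordge_mult'[OF _ T, of "T K F" 0] by simp
    ultimately show "g (F * H) - g F * g H \<in> ordge (K + 1)"
      using T 3 ordge_diff by metis
  qed
  have add: "g (F + H) = g F + g H" for F H
    by (rule mfps_eqI) (simp add: g_def T_def mconst_add algebra_simps sum.distrib)
  have T1: "T 1 F = mconst (mcoeff F 0) + (\<Sum>i\<in>UNIV. mconst (mcoeff F (em i)) * \<sigma> i)" for F
  proof -
    have set: "{a. mdeg a \<le> 1} = insert 0 (range (em :: 'n \<Rightarrow> 'n mono))"
    proof -
      have False if a: "mdeg a \<le> 1" "a \<noteq> 0" "a \<notin> range em" for a :: "'n mono"
      proof -
      from a obtain i where i: "lookup a i \<noteq> 0" by (metis lookup_zero poly_mapping_eqI)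
      have "mdeg (a - em i) = 0" using mdeg_diff_em[OF i] a(1) by linarith
      then have "a - em i = 0" by (simp only: mdeg_eq_0_iff)
      then have "a = em i" using mono_eq_plus_em[OF i] by (metis add_0)
      then show False using a(3) by blast
      qed
      moreover have "mdeg (0 :: 'n mono) \<le> 1" "\<And>i. mdeg (em i :: 'n mono) \<le> 1" by simp_all
      ultimately show ?thesis by blast
    qed
    have inj: "inj (em :: 'n \<Rightarrow> 'n mono)"
      by (rule injI) simp
    have M1: "M (em i) = \<sigma> i" for i
    proof -
      have "M (em i) = (\<Prod>j\<in>UNIV. if j = i then \<sigma> i else 1)"
        unfolding M_def by (intro prod.cong) (auto simp: lookup_single when_def)
      then show ?thesis by simp
    qed
    have "0 \<notin> range (em :: 'n \<Rightarrow> 'n mono)" using em_neq_0 by (metis rangeE)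
    then show ?thesis unfolding T_def set
      by (simp add: sum.reindex[OF inj] M1) (simp add: M_def)
  qed
  have "alg_endo g"
    unfolding alg_endo_def
  proof safe
    fix c
    have "g (mconst c) = T 1 (mconst c)"
      by (rule finT) (auto simp: pconst_def lookup_single when_def split: if_splits)
    then show "g (mconst c) = mconst c"
      by (simp add: T1 pconst_def lookup_single when_def)
  next
    fix i
    have "g (mvar i) - T 0 (mvar i) \<in> ordge 1" using T[of "mvar i" 0] by simp
    moreover have "T 0 (mvar i) = 0"
      by (simp add: T_def mvar_def pvar_def lookup_single when_def M_def)
    ultimately show "g (mvar i) \<in> ordge 1" by simp
  qed (rule add mult)+
  moreover have "g (mvar i) = \<sigma> i" for i
  proof -
    have "g (mvar i) = T 1 (mvar i)"
      by (rule finT) (auto simp: mvar_def pvar_def lookup_single when_def split: if_splits)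
    also have "\<dots> = (\<Sum>j\<in>UNIV. if j = i then \<sigma> i else 0)"
    proof -
      have 0: "mcoeff (mvar i) 0 = (0 :: 'k)" and "mcoeff (mvar i) (em j) = (if j = i then 1 else (0 :: 'k))" for j
        by (auto simp: mvar_def pvar_def lookup_single when_def)
      then have "mconst (mcoeff (mvar i) (em j)) * \<sigma> j = (if j = i then \<sigma> i else 0)" for j
        by simp
      with 0 show ?thesis unfolding T1 by simp
    qed
    finally show ?thesis by simp
  qed
  ultimately show ?thesis using that by blast
qed


section \<open>Polynomial vector fields\<close>

lemma homog_0 [simp]: "0 \<in> homog s"
  by (simp add: homog_def)

lemma homog_add: "f \<in> homog s \<Longrightarrow> g \<in> homog s \<Longrightarrow> f + g \<in> homog s"
  using keys_add[of f g] by (auto simp: homog_def)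

lemma homog_uminus: "f \<in> homog s \<Longrightarrow> - f \<in> homog s"
  by (auto simp: homog_def in_keys_iff)

lemma homog_diff: "f \<in> homog s \<Longrightarrow> g \<in> homog s \<Longrightarrow> f - g \<in> homog s"
  using homog_add[of f s "- g"] homog_uminus[of g s] by simp

lemma homog_sum: "(\<And>x. x \<in> A \<Longrightarrow> f x \<in> homog s) \<Longrightarrow> sum f A \<in> homog s"
  by (induction A rule: infinite_finite_induct) (auto intro: homog_add)

lemma homog_pconst_mult: "f \<in> homog s \<Longrightarrow> pconst c * f \<in> homog s"
  by (auto simp: homog_def in_keys_iff lookup_pconst_times)

lemma homog_mult: "f \<in> homog a \<Longrightarrow> g \<in> homog b \<Longrightarrow> f * g \<in> homog (a + b)"
  using keys_mult[of f g] by (fastforce simp: homog_def)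

lemma homog_single: "c = 0 \<or> mdeg m = s \<Longrightarrow> Poly_Mapping.single m c \<in> homog s"
  by (auto simp: homog_def)

lemma homog_pdiff: "f \<in> homog s \<Longrightarrow> pdiff i f \<in> homog (s - 1)"
proof -
  assume f: "f \<in> homog s"
  have "mdeg m = s - 1" if "m \<in> keys (pdiff i f)" for m
  proof -
    have "m + em i \<in> keys f" using that by (auto simp: in_keys_iff lookup_pdiff)
    then have "mdeg (m + em i) = s" using f unfolding homog_def by blast
    then show ?thesis by simp
  qed
  then show ?thesis by (simp add: homog_def)
qed

section \<open>Hamiltonian fields, critical monomials and their span\<close>

lemma pdiff_commute: "pdiff i (pdiff j f) = pdiff j (pdiff i f)"
proof (rule poly_mapping_eqI)
  fix m
  have "m + em i + em j = m + em j + em i" by (simp add: ac_simps)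
  then show "lookup (pdiff i (pdiff j f)) m = lookup (pdiff j (pdiff i f)) m"
    by (cases "i = j") (simp_all add: lookup_pdiff lookup_add lookup_single_not_eq mult.left_commute)
qed

definition vbr :: "('n::finite, 'k::comm_ring_1) vf \<Rightarrow> ('n, 'k) vf \<Rightarrow> ('n, 'k) vf" where
  "vbr D E j = (\<Sum>i\<in>UNIV. D i * pdiff i (E j) - E i * pdiff i (D j))"

definition mf :: "'k::comm_ring_1 \<Rightarrow> 'n mono \<Rightarrow> 'n \<Rightarrow> ('n, 'k) vf" where
  "mf c M i = (\<lambda>j. if j = i then Poly_Mapping.single M c else 0)"

definition ham :: "('n, 'k::comm_ring_1) pol \<Rightarrow> 'n \<Rightarrow> 'n \<Rightarrow> ('n, 'k) vf" where
  "ham h i j = (\<lambda>l. if l = i then pdiff j h else if l = j then - pdiff i h else 0)"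

text \<open>The monomial fields \<open>x\<^sup>M \<partial>\<^sub>i\<close> not detected by exactness: exponents \<open>p e\<^sub>i\<close> in \<open>x\<^sub>i\<close> and
  \<open>p e\<^sub>j + p - 1\<close> in the other variables.\<close>
definition crit :: "nat \<Rightarrow> 'n \<Rightarrow> 'n mono \<Rightarrow> bool" where
  "crit p i M \<longleftrightarrow> p dvd lookup M i \<and> (\<forall>j. j \<noteq> i \<longrightarrow> p dvd lookup M j + 1)"

definition noncrit :: "nat \<Rightarrow> ('n, 'k::zero) vf \<Rightarrow> bool" where
  "noncrit p D \<longleftrightarrow> (\<forall>i M. crit p i M \<longrightarrow> lookup (D i) M = 0)"

lemma SymV_0: "(\<lambda>i. 0) \<in> SymV d"
  by (simp add: SymV_def)

lemma SymV_add: "D \<in> SymV d \<Longrightarrow> E \<in> SymV d \<Longrightarrow> (\<lambda>i. D i + E i) \<in> SymV d"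
  by (simp add: SymV_def homog_add)

lemma SymV_scale: "D \<in> SymV d \<Longrightarrow> (\<lambda>i. pconst c * D i) \<in> SymV d"
  by (simp add: SymV_def homog_pconst_mult)

lemma Lvf_0: "(\<lambda>i. 0) \<in> Lvf d"
  by (simp add: Lvf_def SymV_0)

lemma Lvf_add: "D \<in> Lvf d \<Longrightarrow> E \<in> Lvf d \<Longrightarrow> (\<lambda>i. D i + E i) \<in> Lvf d"
  by (simp add: Lvf_def SymV_add pdiff_add sum.distrib)

lemma Lvf_scale: "D \<in> Lvf d \<Longrightarrow> (\<lambda>i. pconst c * D i) \<in> Lvf d"
  by (simp add: Lvf_def SymV_scale pdiff_pconst_times flip: sum_distrib_left)

lemma Lvf_uminus: "D \<in> Lvf d \<Longrightarrow> (\<lambda>i. - D i) \<in> Lvf d"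
  using Lvf_scale[of D d "- 1"] by (simp add: pconst_uminus)

lemma Lvf_diff: "D \<in> Lvf d \<Longrightarrow> E \<in> Lvf d \<Longrightarrow> (\<lambda>i. D i - E i) \<in> Lvf d"
  using Lvf_add[of D d "\<lambda>i. - E i"] Lvf_uminus[of E d] by simp

lemma Lvf_mf:
  assumes "mdeg M = d" "of_nat (lookup M i) * c = 0"
  shows "mf c M i \<in> Lvf d"
proof -
  have "(\<Sum>l\<in>UNIV. pdiff l (mf c M i l)) =
      (\<Sum>l\<in>UNIV. if l = i then pdiff i (Poly_Mapping.single M c) else 0)"
    by (intro sum.cong) (auto simp: mf_def)
  also have "\<dots> = 0" using assms(2) by (simp add: pdiff_single)
  finally show ?thesis using assms(1) by (simp add: Lvf_def SymV_def mf_def homog_single)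
qed

lemma Lvf_ham:
  assumes h: "h \<in> homog (d + 1)" and ij: "i \<noteq> j"
  shows "ham h i j \<in> Lvf d"
proof -
  have "(\<Sum>l\<in>UNIV. pdiff l (ham h i j l)) =
      (\<Sum>l\<in>UNIV. (if l = i then pdiff i (pdiff j h) else 0) + (if l = j then - pdiff j (pdiff i h) else 0))"
    by (intro sum.cong) (use ij in \<open>auto simp: ham_def pdiff_uminus\<close>)
  also have "\<dots> = 0" by (simp add: sum.distrib pdiff_commute[of j i])
  finally show ?thesis
    using homog_pdiff[OF h] by (auto simp: Lvf_def SymV_def ham_def homog_uminus)
qed

lemma ham_swap: "i \<noteq> j \<Longrightarrow> ham h i j = ham (- h) j i"
  by (auto simp: ham_def pdiff_uminus)

lemma ham_single:
  assumes "i \<noteq> j"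
  shows "ham (Poly_Mapping.single H c) i j =
    (\<lambda>l. mf (of_nat (lookup H j) * c) (H - em j) i l + mf (- of_nat (lookup H i) * c) (H - em i) j l)"
  using assms by (auto simp: ham_def mf_def pdiff_single simp flip: single_uminus)

text \<open>At an exponent critical for the component l, every M_m + 1 with m \<noteq> l is
  divisible by p, so a derivative \<partial>_m has no coefficient there; and the component l of a
  Hamiltonian field is a derivative in a direction other than l.\<close>

lemma noncrit_ham:
  fixes h :: "('n::finite, 'k::field) pol"
  assumes p: "CHAR('k) = p" and ij: "i \<noteq> j"
  shows "noncrit p (ham h i j)"
  unfolding noncrit_def
proof safe
  fix l :: 'n and M assume c: "crit p l M"
  have "p dvd lookup M m + 1" if "m \<noteq> l" for m
    using c that unfolding crit_def by blast
  then have "(of_nat (lookup M m + 1) :: 'k) = 0" if "m \<noteq> l" for m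
    using that p by (simp only: of_nat_eq_0_iff_char_dvd)
  then have "lookup (pdiff m g) M = 0" if "m \<noteq> l" for m and g :: "('n, 'k) pol"
    using that by (subst lookup_pdiff) (metis mult_zero_left)
  then show "lookup (ham h i j l) M = 0" using ij by (auto simp: ham_def)
qed

text \<open>Elimination on the number of pairs (component, monomial) in the support. A noncritical
  term a x^M \<partial>_i is removed by a Hamiltonian field whose second monomial either has
  coefficient 0 or already belongs to the support, so the support shrinks strictly.\<close>

lemma Lvf_induct_aux:
  fixes D :: "('n::finite, 'k::field) vf"
  assumes p: "CHAR('k) = p"
    and zero: "P (\<lambda>_. 0)"
    and add: "\<And>D E. P D \<Longrightarrow> P E \<Longrightarrow> P (\<lambda>i. D i + E i)"
    and ham: "\<And>i j M c. i \<noteq> j \<Longrightarrow> mdeg M = d + 1 \<Longrightarrow> P (ham (Poly_Mapping.single M c) i j)"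
  shows "D \<in> Lvf d \<Longrightarrow> (\<And>i M c. crit p i M \<Longrightarrow> M \<in> keys (D i) \<Longrightarrow> P (mf c M i)) \<Longrightarrow> P D"
proof (induction "card (Sigma UNIV (\<lambda>i. keys (D i)))" arbitrary: D rule: less_induct)
  case less
  note crit = less.prems(2)
  define S where "S E = Sigma UNIV (\<lambda>i. keys (E i))" for E :: "('n, 'k) vf"
  have step: "P D" if E: "E \<in> Lvf d" "P E"
    and sub: "S (\<lambda>i. D i - E i) \<subset> S D" for E
  proof -
    have "finite (S D)" by (simp add: S_def)
    then have "card (S (\<lambda>i. D i - E i)) < card (S D)" using sub by (rule psubset_card_mono)
    moreover have "P (mf c M i)" if "crit p i M" "M \<in> keys (D i - E i)" for i M c
    proof -
      have "(i, M) \<in> S (\<lambda>i. D i - E i)" using that by (simp add: S_def)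
      then have "(i, M) \<in> S D" using sub by blast
      then show ?thesis using crit that by (simp add: S_def)
    qed
    ultimately have "P (\<lambda>i. D i - E i)"
      using less.hyps[OF _ Lvf_diff[OF less.prems(1) E(1)]] unfolding S_def by blast
    from add[OF this E(2)] show ?thesis by simp
  qed
  show ?case
  proof (cases "\<forall>i. D i = 0")
    case True
    then have "D = (\<lambda>_. 0)" by auto
    then show ?thesis using zero by simp
  next
    case False
    then obtain i M where M: "M \<in> keys (D i)" by (metis all_not_in_conv keys_eq_empty)
    define a where "a = lookup (D i) M"
    have a: "a \<noteq> 0" using M by (simp add: a_def in_keys_iff)
    have D: "D \<in> SymV d" "(\<Sum>i\<in>UNIV. pdiff i (D i)) = 0" using less.prems(1) by (auto simp: Lvf_def)
    have dM: "mdeg M = d" using D(1) M by (auto simp: SymV_def homog_def)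
    show ?thesis
    proof (cases "crit p i M")
      case True
      have "of_nat (lookup M i) = (0 :: 'k)" using True p by (simp add: crit_def of_nat_eq_0_iff_char_dvd)
      then have "mf a M i \<in> Lvf d" using dM by (intro Lvf_mf) auto
      moreover have "S (\<lambda>l. D l - mf a M i l) \<subset> S D"
      proof -
        have "S (\<lambda>l. D l - mf a M i l) \<subseteq> S D - {(i, M)}"
          by (auto simp: S_def mf_def in_keys_iff lookup_minus lookup_single when_def a_def split: if_splits)
        then show ?thesis using M by (auto simp: S_def)
      qed
      ultimately show ?thesis using step crit[OF True M] by blast
    next
      case False
      \<comment> \<open>The index j must make M_j + 1 invertible, so that the Hamiltonian field can
        reach x^M \<partial>_i, and must not let its partner term enlarge the support.\<close>
      have "\<exists>j. j \<noteq> i \<and> of_nat (lookup M j + 1) \<noteq> (0 :: 'k) \<and>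
         (of_nat (lookup M i) = (0 :: 'k) \<or> M + em j - em i \<in> keys (D j))"
      proof (cases "of_nat (lookup M i) = (0 :: 'k)")
        case True
        then have "p dvd lookup M i" using p by (simp add: of_nat_eq_0_iff_char_dvd)
        then obtain j where "j \<noteq> i" "\<not> p dvd lookup M j + 1" using False by (auto simp: crit_def)
        moreover have "of_nat (lookup M j + 1) \<noteq> (0 :: 'k)"
          using \<open>\<not> p dvd lookup M j + 1\<close> p of_nat_eq_0_iff_char_dvd by blast
        ultimately show ?thesis using True by blast
      next
        case nz: False
        then have Mi: "lookup M i \<noteq> 0" by (metis of_nat_0)
        \<comment> \<open>The term x^M \<partial>_i contributes a nonzero coefficient to the
          divergence at \<nu>. Since the total is 0, some other component j contributes there too,
          and its monomial \<nu> + e_j is the partner term.\<close>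
        define \<nu> where "\<nu> = M - em i"
        have \<nu>: "M = \<nu> + em i" using mono_eq_plus_em[OF Mi] by (simp add: \<nu>_def)
        have "(\<Sum>l\<in>UNIV. lookup (pdiff l (D l)) \<nu>) = 0"
          using arg_cong[OF D(2), of "\<lambda>f. lookup f \<nu>"] by (simp add: lookup_sum)
        moreover have "lookup (pdiff i (D i)) \<nu> \<noteq> 0"
          using nz a by (simp add: lookup_pdiff \<nu> a_def lookup_add)
        moreover have "(\<Sum>l\<in>UNIV. lookup (pdiff l (D l)) \<nu>) = lookup (pdiff i (D i)) \<nu>"
          if "\<And>j. j \<noteq> i \<Longrightarrow> lookup (pdiff j (D j)) \<nu> = 0"
          by (subst sum.mono_neutral_right[of UNIV "{i}"]) (use that in auto)
        ultimately obtain j where j: "j \<noteq> i" "lookup (pdiff j (D j)) \<nu> \<noteq> 0" by metis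
        have "lookup M j = lookup \<nu> j" using j(1) by (simp add: \<nu> lookup_add lookup_single_not_eq)
        then have "of_nat (lookup M j + 1) \<noteq> (0 :: 'k)" "lookup (D j) (\<nu> + em j) \<noteq> 0"
          using j(2) by (auto simp: lookup_pdiff)
        moreover have "M + em j - em i = \<nu> + em j"
          unfolding \<nu> by (rule poly_mapping_eqI) (simp add: lookup_add lookup_minus)
        ultimately show ?thesis using j(1) by (auto simp: in_keys_iff)
      qed
      then obtain j where j: "j \<noteq> i" "of_nat (lookup M j + 1) \<noteq> (0 :: 'k)"
        "of_nat (lookup M i) = (0 :: 'k) \<or> M + em j - em i \<in> keys (D j)" by blast
      \<comment> \<open>Normalized so that the \<partial>_i component of the Hamiltonian field of b
        x^(M + e_j) is exactly a x^M.\<close>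
      define b where "b = a / of_nat (lookup M j + 1)"
      define E where "E = ham (Poly_Mapping.single (M + em j) b) i j"
      have E_eq: "E = (\<lambda>l. mf a M i l + mf (- of_nat (lookup M i) * b) (M + em j - em i) j l)"
        unfolding E_def ham_single[OF j(1)[symmetric]]
        using j(1,2) by (simp add: lookup_add lookup_single_not_eq b_def)
      have "E \<in> Lvf d" unfolding E_def using j(1) dM by (intro Lvf_ham homog_single) auto
      moreover have "P E" unfolding E_def using j(1) dM by (intro ham) auto
      moreover have "S (\<lambda>l. D l - E l) \<subset> S D"
      proof -
        have "S (\<lambda>l. D l - E l) \<subseteq> S D - {(i, M)}"
          using j(1,3)
          by (auto simp: E_eq S_def mf_def in_keys_iff lookup_minus lookup_add lookup_single when_def a_def split: if_splits)
        then show ?thesis using M by (auto simp: S_def)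
      qed
      ultimately show ?thesis by (rule step)
    qed
  qed
qed

lemma Lvf_induct [consumes 2, case_names zero add ham crit]:
  fixes D :: "('n::finite, 'k::field) vf"
  assumes "D \<in> Lvf d" "CHAR('k) = p"
    and "P (\<lambda>_. 0)" "\<And>D E. P D \<Longrightarrow> P E \<Longrightarrow> P (\<lambda>i. D i + E i)"
    and "\<And>i j M c. i \<noteq> j \<Longrightarrow> mdeg M = d + 1 \<Longrightarrow> P (ham (Poly_Mapping.single M c) i j)"
    and "\<And>i M c. crit p i M \<Longrightarrow> mdeg M = d \<Longrightarrow> P (mf c M i)"
  shows "P D"
proof (rule Lvf_induct_aux[where p = p and d = d])
  show "P (mf c M i)" if "crit p i M" "M \<in> keys (D i)" for i M c
    using that assms(1) by (intro assms(6)) (auto simp: Lvf_def SymV_def homog_def)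
qed (use assms in auto)

text \<open>The elimination only ever meets critical monomials of the given field; if it has none,
  Hamiltonian fields alone span.\<close>

lemma noncrit_Lvf_induct [consumes 3, case_names zero add ham]:
  fixes D :: "('n::finite, 'k::field) vf"
  assumes "D \<in> Lvf d" "noncrit p D" "CHAR('k) = p"
    and "P (\<lambda>_. 0)" "\<And>D E. P D \<Longrightarrow> P E \<Longrightarrow> P (\<lambda>i. D i + E i)"
    and "\<And>i j M c. i \<noteq> j \<Longrightarrow> mdeg M = d + 1 \<Longrightarrow> P (ham (Poly_Mapping.single M c) i j)"
  shows "P D"
proof (rule Lvf_induct_aux[where p = p and d = d])
  show "P (mf c M i)" if "crit p i M" "M \<in> keys (D i)" for i M c
    using that assms(2) by (auto simp: noncrit_def in_keys_iff)
qed (use assms in auto)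

section \<open>The Lie bracket of divergence-free fields\<close>

lemma vbr_add_left: "vbr (\<lambda>i. D i + E i) F = (\<lambda>j. vbr D F j + vbr E F j)"
  by (rule ext) (simp add: vbr_def pdiff_add algebra_simps sum.distrib sum_subtractf)

lemma vbr_add_right: "vbr F (\<lambda>i. D i + E i) = (\<lambda>j. vbr F D j + vbr F E j)"
  by (rule ext) (simp add: vbr_def pdiff_add algebra_simps sum.distrib sum_subtractf)

text \<open>For divergence-free D and E the bracket is the divergence of the bivector D \<and> E,
  because the Leibniz terms with div D and div E drop out. Both that brackets are divergence-free
  and that they have no critical coefficients is read off from this form.\<close>

lemma vbr_eq_antisym_div:
  assumes "D \<in> Lvf a" "E \<in> Lvf b"
  shows "vbr D E j = (\<Sum>i\<in>UNIV. pdiff i (D i * E j - E i * D j))"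
proof -
  have "(\<Sum>i\<in>UNIV. pdiff i (D i * E j - E i * D j)) =
     (\<Sum>i\<in>UNIV. pdiff i (D i)) * E j - (\<Sum>i\<in>UNIV. pdiff i (E i)) * D j + vbr D E j"
    by (simp add: vbr_def pdiff_diff pdiff_mult sum_distrib_left sum_distrib_right sum_subtractf sum.distrib algebra_simps)
  then show ?thesis using assms by (simp add: Lvf_def)
qed

lemma homog_antisym: "D \<in> SymV a \<Longrightarrow> E \<in> SymV b \<Longrightarrow> D i * E j - E i * D j \<in> homog (a + b)"
  using homog_mult[of "D i" a "E j" b] homog_mult[of "E i" b "D j" a]
  by (intro homog_diff) (auto simp: SymV_def add.commute)

text \<open>The divergence of the bracket is a double divergence of an antisymmetric tensor, hence 0
  since partial derivatives commute.\<close>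

lemma vbr_in_Lvf:
  fixes D E :: "('n::finite, 'k::comm_ring_1) vf"
  assumes "D \<in> Lvf a" "E \<in> Lvf b"
  shows "vbr D E \<in> Lvf (a + b - 1)"
proof -
  define A where "A i j = D i * E j - E i * D j" for i j
  have br: "vbr D E j = (\<Sum>i\<in>UNIV. pdiff i (A i j))" for j
    unfolding A_def by (rule vbr_eq_antisym_div[OF assms])
  have "vbr D E j \<in> homog (a + b - 1)" for j
    unfolding br A_def by (intro homog_sum homog_pdiff homog_antisym) (use assms in \<open>auto simp: Lvf_def\<close>)
  then have "vbr D E \<in> SymV (a + b - 1)" by (simp add: SymV_def)
  moreover have "(\<Sum>j\<in>UNIV. pdiff j (vbr D E j)) = 0"
  proof -
    let ?T = "\<lambda>u v. \<Sum>j\<in>UNIV. \<Sum>i\<in>UNIV. pdiff j (pdiff i (u i * v j)) :: ('n, 'k) pol"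
    have sw: "?T D E = ?T E D"
      by (subst sum.swap) (intro sum.cong refl; subst pdiff_commute; simp add: mult.commute)
    have "(\<Sum>j\<in>UNIV. pdiff j (vbr D E j)) = ?T D E - ?T E D"
      by (simp add: br A_def pdiff_sum pdiff_diff sum_subtractf)
    then show ?thesis using sw by simp
  qed
  ultimately show ?thesis by (simp add: Lvf_def)
qed

text \<open>In the component l the summand i = l vanishes by antisymmetry, and the summands
  \<partial>_i with i \<noteq> l have no coefficient at an exponent with M_i = -1 mod p.\<close>

lemma noncrit_vbr:
  fixes D E :: "('n::finite, 'k::field) vf"
  assumes p: "CHAR('k) = p" and "D \<in> Lvf a" "E \<in> Lvf b"
  shows "noncrit p (vbr D E)"
  unfolding noncrit_def
proof safe
  fix l :: 'n and M assume c: "crit p l M"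
  have "lookup (pdiff i (D i * E l - E i * D l)) M = 0" for i
  proof (cases "i = l")
    case False
    then have "p dvd lookup M i + 1" using c unfolding crit_def by blast
    then have "(of_nat (lookup M i + 1) :: 'k) = 0"
      using p by (simp only: of_nat_eq_0_iff_char_dvd)
    then show ?thesis by (simp only: lookup_pdiff mult_zero_left)
  qed (simp add: mult.commute)
  then show "lookup (vbr D E l) M = 0"
    by (simp add: vbr_eq_antisym_div[OF assms(2,3)] lookup_sum)
qed


section \<open>Brackets with quadratic fields\<close>

text \<open>The span of the brackets of quadratic fields with fields of degree d - 1. Sums suffice,
  since a scalar can be absorbed into one factor of a bracket.\<close>

inductive_set brs :: "nat \<Rightarrow> ('n::finite, 'k::comm_ring_1) vf set" for d where
  zero: "(\<lambda>_. 0) \<in> brs d"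
| add: "D \<in> brs d \<Longrightarrow> E \<in> brs d \<Longrightarrow> (\<lambda>i. D i + E i) \<in> brs d"
| br: "D \<in> Lvf 2 \<Longrightarrow> E \<in> Lvf (d - 1) \<Longrightarrow> vbr D E \<in> brs d"

lemma mf_0 [simp]: "mf 0 M i = (\<lambda>_. 0)"
  by (auto simp: mf_def)

lemma mf_add_mf: "mf a M i l + mf b M i l = mf (a + b) M i l"
  by (simp add: mf_def single_add)

lemma mf_uminus: "mf (- a) M i l = - mf a M i l"
  and mf_diff: "mf (a - b) M i l = mf a M i l - mf b M i l"
  by (simp_all add: mf_def single_uminus single_diff)

text \<open>The result exponents A + B - e_i and A + B - e_j enter as \<open>C\<close> and
  \<open>C'\<close>, characterized by addition and left arbitrary when the coefficient is 0. This
  avoids truncated subtraction in the applications.\<close>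

lemma vbr_mf:
  fixes i j :: "'n::finite" and a b :: "'k::comm_ring_1"
  assumes "A + B = C + em i \<or> lookup B i = 0" "A + B = C' + em j \<or> lookup A j = 0"
  shows "vbr (mf a A i) (mf b B j) =
    (\<lambda>l. mf (a * b * of_nat (lookup B i)) C j l + mf (- (a * b * of_nat (lookup A j))) C' i l)"
proof
  fix l
  have *: "vbr (mf a A i) (mf b B j) l =
      Poly_Mapping.single A a * pdiff i (mf b B j l) - Poly_Mapping.single B b * pdiff j (mf a A i l)"
  proof -
    have "(\<Sum>m\<in>UNIV. mf c M m' m * pdiff m f) = Poly_Mapping.single M c * pdiff m' f"
      for c :: 'k and M and m' :: 'n and f
    proof -
      have "(\<Sum>m\<in>UNIV. mf c M m' m * pdiff m f) =
          (\<Sum>m\<in>UNIV. if m = m' then Poly_Mapping.single M c * pdiff m' f else 0)"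
        by (intro sum.cong) (auto simp: mf_def)
      then show ?thesis by simp
    qed
    then show ?thesis by (simp add: vbr_def sum_subtractf)
  qed
  have 1: "Poly_Mapping.single A a * pdiff i (Poly_Mapping.single B b) =
      Poly_Mapping.single C (a * b * of_nat (lookup B i))"
  proof (cases "lookup B i = 0")
    case False
    have "A + (B - em i) + em i = A + B"
      using mono_eq_plus_em[OF False] by (simp add: add.assoc)
    then have "A + (B - em i) = C" using assms(1) False by auto
    then show ?thesis by (simp add: pdiff_single mult_single mult_ac)
  qed (simp add: pdiff_single)
  have 2: "Poly_Mapping.single B b * pdiff j (Poly_Mapping.single A a) =
      Poly_Mapping.single C' (a * b * of_nat (lookup A j))"
  proof (cases "lookup A j = 0")
    case False
    have "B + (A - em j) + em j = A + B"
      by (simp only: add.assoc mono_eq_plus_em[OF False] add.commute[of B A])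
    then have "B + (A - em j) = C'" using assms(2) False by auto
    then show ?thesis by (simp add: pdiff_single mult_single mult_ac)
  qed (simp add: pdiff_single)
  have "pdiff i (mf b B j l) = (if l = j then pdiff i (Poly_Mapping.single B b) else 0)"
    "pdiff j (mf a A i l) = (if l = i then pdiff j (Poly_Mapping.single A a) else 0)"
    by (simp_all add: mf_def)
  then show "vbr (mf a A i) (mf b B j) l =
    mf (a * b * of_nat (lookup B i)) C j l + mf (- (a * b * of_nat (lookup A j))) C' i l"
    unfolding * using 1 2 by (auto simp: mf_def single_uminus)
qed

text \<open>Both summands contribute to the divergence at the same monomial \<nu>, so a single
  scalar equation decides.\<close>

lemma Lvf_two:
  assumes "i \<noteq> j" "of_nat (lookup \<nu> i + 1) * a + of_nat (lookup \<nu> j + 1) * b = 0"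
    "d = mdeg \<nu> + 1"
  shows "(\<lambda>l. mf a (\<nu> + em i) i l + mf b (\<nu> + em j) j l) \<in> Lvf d"
proof -
  have "(\<Sum>l\<in>UNIV. pdiff l (mf a (\<nu> + em i) i l + mf b (\<nu> + em j) j l)) =
      (\<Sum>l\<in>UNIV. (if l = i then Poly_Mapping.single \<nu> (of_nat (lookup \<nu> i + 1) * a) else 0) +
         (if l = j then Poly_Mapping.single \<nu> (of_nat (lookup \<nu> j + 1) * b) else 0))"
    using assms(1) by (intro sum.cong refl) (auto simp: mf_def pdiff_single lookup_add)
  also have "\<dots> = Poly_Mapping.single \<nu> (of_nat (lookup \<nu> i + 1) * a + of_nat (lookup \<nu> j + 1) * b)"
    by (simp add: sum.distrib flip: single_add)
  also have "\<dots> = 0" using assms(2) by simp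
  finally show ?thesis
    using assms(3) by (auto simp: Lvf_def SymV_def mf_def intro!: homog_add homog_single)
qed

lemma mono_obtain_em:
  assumes "lookup M i \<noteq> 0" obtains R where "M = R + em i"
  using mono_eq_plus_em[OF assms] by metis

text \<open>If x_j divides x^M, put B = M - e_j. The bracket of x_j^2 \<partial>_j - 2 x_i x_j
  \<partial>_i with x^B \<partial>_i is (B_j + 2) x^M \<partial>_i, and B_j + 2 = M_j + 1 is
  invertible.\<close>

lemma mf_in_brs:
  fixes c :: "'k::field"
  assumes ij: "i \<noteq> j" and M: "lookup M i = 0" "of_nat (lookup M j + 1) \<noteq> (0 :: 'k)"
    and d: "mdeg M = d" "d \<ge> 3"
  shows "mf c M (i :: 'n::finite) \<in> brs d"
proof (cases "lookup M j = 0")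
  case False
  then obtain B where B: "M = B + em j" by (rule mono_obtain_em)
  have Bi: "lookup B i = 0" and Bj: "lookup M j = lookup B j + 1"
    using M(1) by (auto simp: B lookup_add)
  define b where "b = c / of_nat (lookup M j + 1)"
  have "(\<lambda>l. mf 1 (em j + em j) j l + mf (- 2) (em j + em i) i l) \<in> (Lvf 2 :: ('n, 'k) vf set)"
    using ij by (intro Lvf_two) (auto simp: lookup_single_not_eq)
  moreover have "mf b B i \<in> Lvf (d - 1)"
    using d Bi by (intro Lvf_mf) (auto simp: B)
  ultimately have "vbr (\<lambda>l. mf 1 (em j + em j) j l + mf (- 2) (em j + em i) i l) (mf b B i) \<in> brs d"
    by (rule brs.br)
  also have "vbr (\<lambda>l. mf 1 (em j + em j) j l + mf (- 2) (em j + em i) i l) (mf b B i) = mf c M i"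
  proof -
    have 1: "vbr (mf 1 (em j + em j) j) (mf b B i) =
       (\<lambda>l. mf (1 * b * of_nat (lookup B j)) M i l + mf (- (1 * b * of_nat (lookup (em j + em j) i))) 0 j l)"
      using ij by (intro vbr_mf) (auto simp: B lookup_add lookup_single_not_eq ac_simps)
    have 2: "vbr (mf (- 2) (em j + em i) i) (mf b B i) =
       (\<lambda>l. mf (- 2 * b * of_nat (lookup B i)) M i l + mf (- (- 2 * b * of_nat (lookup (em j + em i) i))) M i l)"
      using ij Bi by (intro vbr_mf) (auto simp: B ac_simps)
    have "b * of_nat (lookup B j) + 2 * b = c"
    proof -
      have "of_nat (lookup M j + 1) = of_nat (lookup B j) + (2 :: 'k)" by (simp add: Bj)
      then have "b * (of_nat (lookup B j) + 2) = c" using M(2) unfolding b_def by (metis nonzero_eq_divide_eq)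
      then show ?thesis by (simp add: algebra_simps)
    qed
    then show ?thesis
      using ij Bi unfolding vbr_add_left 1 2 by (simp add: lookup_add lookup_single_not_eq mf_add_mf mult.commute)
  qed
  finally show ?thesis .
next
  case True
  \<comment> \<open>Neither x_i nor x_j divides x^M here, but the degree allows two other variables
    x_k, x_m, possibly equal, to be split off. The bracket of x_k x_m \<partial>_j with x^R x_j
    \<partial>_i, where R = M - e_k - e_m, returns x^M \<partial>_i.\<close>
  have "M \<noteq> 0" using d by auto
  then obtain k where k: "lookup M k \<noteq> 0" by (metis lookup_zero poly_mapping_eqI)
  then obtain R' where R': "M = R' + em k" by (rule mono_obtain_em)
  have "R' \<noteq> 0" using d R' by auto
  then obtain m where m: "lookup R' m \<noteq> 0" by (metis lookup_zero poly_mapping_eqI)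
  then obtain R where R: "R' = R + em m" by (rule mono_obtain_em)
  have z: "k \<noteq> i" "k \<noteq> j" "m \<noteq> i" "m \<noteq> j" "lookup R i = 0" "lookup R j = 0"
    using True M(1) k m R R' by (auto simp: lookup_add)
  have "mf 1 (em k + em m) j \<in> (Lvf 2 :: ('n, 'k) vf set)"
    using z by (intro Lvf_mf) (auto simp: lookup_add lookup_single_not_eq)
  moreover have "mf c (R + em j) i \<in> Lvf (d - 1)"
    using d z ij by (intro Lvf_mf) (auto simp: R R' lookup_add lookup_single_not_eq)
  ultimately have "vbr (mf 1 (em k + em m) j) (mf c (R + em j) i) \<in> brs d"
    by (rule brs.br)
  also have "vbr (mf 1 (em k + em m) j) (mf c (R + em j) i) =
     (\<lambda>l. mf (1 * c * of_nat (lookup (R + em j) j)) M i l + mf (- (1 * c * of_nat (lookup (em k + em m) i))) 0 j l)"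
    using z by (intro vbr_mf) (auto simp: R R' lookup_add lookup_single_not_eq ac_simps)
  also have "\<dots> = mf c M i"
    using z by (simp add: lookup_add lookup_single_not_eq)
  finally show ?thesis .
qed

text \<open>The Hamiltonian field of c x^\<mu> x_i x_j, that is c x^\<mu> times the torus field
  (\<mu>_j + 1) x_i \<partial>_i - (\<mu>_i + 1) x_j \<partial>_j; see \<open>ham_eq_tor\<close>.
  This is the hard case of the generation result.\<close>

definition tor :: "'n mono \<Rightarrow> 'n \<Rightarrow> 'n \<Rightarrow> 'k::comm_ring_1 \<Rightarrow> ('n, 'k) vf" where
  "tor \<mu> i j c = (\<lambda>l. mf (c * of_nat (lookup \<mu> j + 1)) (\<mu> + em i) i l +
     mf (- c * of_nat (lookup \<mu> i + 1)) (\<mu> + em j) j l)"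

lemma tor_swap: "tor \<mu> i j c = tor \<mu> j i (- c)"
  by (simp add: tor_def add.commute)

lemma ham_eq_tor: "i \<noteq> j \<Longrightarrow> ham (Poly_Mapping.single (\<mu> + em i + em j) c) i j = tor \<mu> i j c"
proof -
  assume ij: "i \<noteq> j"
  have "\<mu> + em i + em j - em i = \<mu> + em j" "\<mu> + em i + em j - em j = \<mu> + em i"
    by (rule poly_mapping_eqI, simp add: lookup_add lookup_minus)+
  then show ?thesis
    unfolding ham_single[OF ij] tor_def using ij
    by (simp add: lookup_add lookup_single_not_eq algebra_simps)
qed

text \<open>Bracket of c x_i^2 \<partial>_j with x^\<rho> x_j (x_i \<partial>_i + \<beta> x_j
  \<partial>_j), where \<rho> = \<mu> - 2 e_i.\<close>

lemma tor_in_brs_1: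
  fixes c :: "'k::field"
  assumes ij: "i \<noteq> (j :: 'n::finite)" and \<mu>: "lookup \<mu> i \<ge> 2" "of_nat (lookup \<mu> j + 2) \<noteq> (0 :: 'k)"
    and d: "mdeg \<mu> + 1 = d"
  shows "tor \<mu> i j c \<in> brs d"
proof -
  have "lookup \<mu> i \<noteq> 0" using \<mu>(1) by simp
  then obtain \<rho>' where r': "\<mu> = \<rho>' + em i" by (rule mono_obtain_em)
  have "lookup \<rho>' i \<noteq> 0" using \<mu>(1) by (simp add: r' lookup_add)
  then obtain \<rho> where r: "\<rho>' = \<rho> + em i" by (rule mono_obtain_em)
  have li: "lookup \<mu> i = lookup \<rho> i + 2" and lj: "lookup \<mu> j = lookup \<rho> j"
    using ij by (simp_all add: r r' lookup_add lookup_single_not_eq)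
  \<comment> \<open>Forced by the vanishing of the divergence of the second factor: \<beta>
    (\<rho>_j + 2) = -(\<rho>_i + 1). Solving for it is what requires \<mu>_j + 2 to be
    invertible.\<close>
  define \<beta> where "\<beta> = (1 - of_nat (lookup \<mu> i)) / (of_nat (lookup \<mu> j + 2) :: 'k)"
  have \<beta>: "\<beta> * (of_nat (lookup \<rho> j) + 2) = - 1 - of_nat (lookup \<rho> i)"
  proof -
    have "of_nat (lookup \<mu> j + 2) = of_nat (lookup \<rho> j) + (2 :: 'k)"
      by (simp only: of_nat_add of_nat_numeral lj)
    then show ?thesis using \<mu>(2) unfolding \<beta>_def by (simp only: nonzero_eq_divide_eq) (simp add: li)
  qed
  let ?Y = "\<lambda>l. mf 1 (\<rho> + em j + em i) i l + mf \<beta> (\<rho> + em j + em j) j l"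
  have "mf c (em i + em i) j \<in> Lvf 2"
    using ij by (intro Lvf_mf) (auto simp: lookup_add lookup_single_not_eq)
  moreover have "?Y \<in> Lvf (d - 1)"
  proof (intro Lvf_two ij)
    show "of_nat (lookup (\<rho> + em j) i + 1) * 1 + of_nat (lookup (\<rho> + em j) j + 1) * \<beta> = 0"
      using \<beta> ij by (simp add: lookup_add lookup_single_not_eq algebra_simps)
    show "d - 1 = mdeg (\<rho> + em j) + 1" using d by (simp add: r r')
  qed
  ultimately have "vbr (mf c (em i + em i) j) ?Y \<in> brs d" by (rule brs.br)
  also have "vbr (mf c (em i + em i) j) ?Y = tor \<mu> i j c"
  proof -
    have 1: "vbr (mf c (em i + em i) j) (mf 1 (\<rho> + em j + em i) i) =
      (\<lambda>l. mf (c * 1 * of_nat (lookup (\<rho> + em j + em i) j)) (\<mu> + em i) i l +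
           mf (- (c * 1 * of_nat (lookup (em i + em i) i))) (\<mu> + em j) j l)"
      by (intro vbr_mf disjI1) (simp_all add: r r' ac_simps)
    have 2: "vbr (mf c (em i + em i) j) (mf \<beta> (\<rho> + em j + em j) j) =
      (\<lambda>l. mf (c * \<beta> * of_nat (lookup (\<rho> + em j + em j) j)) (\<mu> + em j) j l +
           mf (- (c * \<beta> * of_nat (lookup (em i + em i) j))) 0 j l)"
      using ij by (intro vbr_mf) (auto simp: r r' ac_simps lookup_add lookup_single_not_eq)
    have "c * \<beta> * (of_nat (lookup \<rho> j) + 2) - 2 * c = - c * of_nat (lookup \<mu> i + 1)"
      unfolding mult.assoc \<beta> li by (simp add: algebra_simps)
    then have k: "- (2 * c) + c * \<beta> * (of_nat (lookup \<rho> j) + 2) = - c * of_nat (lookup \<mu> i + 1)" by simp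
    have "vbr (mf c (em i + em i) j) ?Y l = mf (c * (of_nat (lookup \<rho> j) + 1)) (\<mu> + em i) i l +
        mf (- (2 * c) + c * \<beta> * (of_nat (lookup \<rho> j) + 2)) (\<mu> + em j) j l" for l
      unfolding vbr_add_right 1 2 using ij
      by (simp add: lookup_add lookup_single_not_eq ac_simps mf_uminus mf_diff flip: mf_add_mf)
    then show ?thesis unfolding k tor_def lj by (intro ext) simp
  qed
  finally show ?thesis .
qed

text \<open>Bracket of -c x_j^2 \<partial>_i with x^\<rho> x_i \<partial>_j for \<rho> = \<mu> -
  e_j. The second factor is divergence-free because x_j does not divide x^\<rho>, and the 2 from
  differentiating x_j^2 is \<mu>_j + 1.\<close>

lemma tor_in_brs_2:
  fixes c :: "'k::field"
  assumes ij: "i \<noteq> (j :: 'n::finite)" and \<mu>: "lookup \<mu> j = 1" and d: "mdeg \<mu> + 1 = d"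
  shows "tor \<mu> i j c \<in> brs d"
proof -
  obtain \<rho> where r: "\<mu> = \<rho> + em j" using \<mu> by (metis mono_obtain_em one_neq_zero)
  have l: "lookup \<rho> j = 0" "lookup \<mu> i = lookup \<rho> i"
    using \<mu> ij by (auto simp: r lookup_add lookup_single_not_eq)
  have "mf (- c) (em j + em j) i \<in> Lvf 2"
    using ij by (intro Lvf_mf) (auto simp: lookup_add lookup_single_not_eq)
  moreover have "mf 1 (\<rho> + em i) j \<in> (Lvf (d - 1) :: ('n, 'k) vf set)"
    using ij l d by (intro Lvf_mf) (auto simp: r lookup_add lookup_single_not_eq)
  ultimately have "vbr (mf (- c) (em j + em j) i) (mf 1 (\<rho> + em i) j) \<in> brs d" by (rule brs.br)
  also have "vbr (mf (- c) (em j + em j) i) (mf 1 (\<rho> + em i) j) =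
      (\<lambda>l. mf (- c * 1 * of_nat (lookup (\<rho> + em i) i)) (\<mu> + em j) j l +
           mf (- (- c * 1 * of_nat (lookup (em j + em j) j))) (\<mu> + em i) i l)"
    by (intro vbr_mf disjI1) (simp_all add: r ac_simps)
  also have "\<dots> = tor \<mu> i j c"
    using ij l by (intro ext) (simp add: tor_def \<mu> lookup_add add.commute)
  finally show ?thesis .
qed

text \<open>As for exponent 1 in x_j, with x_j^2 replaced by x_j x_k for a third variable x_k
  dividing x^\<mu>; now differentiating x_j x_k gives the factor 1 = \<mu>_j + 1.\<close>

lemma tor_in_brs_3:
  fixes c :: "'k::field"
  assumes ij: "i \<noteq> (j :: 'n::finite)" and \<mu>: "lookup \<mu> i = 0" "lookup \<mu> j = 0" "lookup \<mu> k \<noteq> 0"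
    and d: "mdeg \<mu> + 1 = d"
  shows "tor \<mu> i j c \<in> brs d"
proof -
  obtain \<rho> where r: "\<mu> = \<rho> + em k" using \<mu>(3) by (rule mono_obtain_em)
  have l: "lookup \<rho> j = 0" "lookup \<rho> i = 0" "k \<noteq> i" "k \<noteq> j"
    using \<mu> by (auto simp: r lookup_add)
  have "mf (- c) (em j + em k) i \<in> Lvf 2"
    using ij l by (intro Lvf_mf) (auto simp: lookup_add lookup_single_not_eq)
  moreover have "mf 1 (\<rho> + em i) j \<in> (Lvf (d - 1) :: ('n, 'k) vf set)"
    using ij l d by (intro Lvf_mf) (auto simp: r lookup_add lookup_single_not_eq)
  ultimately have "vbr (mf (- c) (em j + em k) i) (mf 1 (\<rho> + em i) j) \<in> brs d" by (rule brs.br)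
  also have "vbr (mf (- c) (em j + em k) i) (mf 1 (\<rho> + em i) j) =
      (\<lambda>l. mf (- c * 1 * of_nat (lookup (\<rho> + em i) i)) (\<mu> + em j) j l +
           mf (- (- c * 1 * of_nat (lookup (em j + em k) j))) (\<mu> + em i) i l)"
    by (intro vbr_mf disjI1) (simp_all add: r ac_simps)
  also have "\<dots> = tor \<mu> i j c"
    using ij l by (intro ext) (simp add: tor_def \<mu> lookup_add lookup_single_not_eq add.commute)
  finally show ?thesis .
qed

text \<open>With \<rho> = \<mu> - e_m, the bracket of x_m^2 \<partial>_m - 2 x_m x_i \<partial>_i
  with b x^\<rho> (x_j \<partial>_j - x_i \<partial>_i). The second factor is divergence-free since
  \<mu>_i and \<mu>_j agree mod p. The common coefficient is b (\<rho>_m + 4) = b (\<mu>_m + 3),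
  whence the value of b.\<close>

lemma tor_in_brs_4:
  fixes c :: "'k::field"
  assumes ij: "i \<noteq> (j :: 'n::finite)" "m \<noteq> i" "m \<noteq> j"
    and \<mu>: "of_nat (lookup \<mu> i + 2) = (0 :: 'k)" "of_nat (lookup \<mu> j + 2) = (0 :: 'k)" "lookup \<mu> m \<noteq> 0"
      "of_nat (lookup \<mu> m + 3) \<noteq> (0 :: 'k)"
    and d: "mdeg \<mu> + 1 = d"
  shows "tor \<mu> i j c \<in> brs d"
proof -
  obtain \<rho> where r: "\<mu> = \<rho> + em m" using \<mu>(3) by (rule mono_obtain_em)
  have l: "lookup \<rho> j = lookup \<mu> j" "lookup \<rho> i = lookup \<mu> i" "lookup \<mu> m = lookup \<rho> m + 1"
    using ij by (auto simp: r lookup_add lookup_single_not_eq)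
  have oi: "of_nat (lookup \<mu> i) = (- 2 :: 'k)" and oj: "of_nat (lookup \<mu> j) = (- 2 :: 'k)"
    using \<mu>(1,2) by (simp_all only: eq_neg_iff_add_eq_0 of_nat_add of_nat_numeral)
  define b where "b = c / of_nat (lookup \<mu> m + 3)"
  have b: "b * (of_nat (lookup \<rho> m) + 4) = c"
    using \<mu>(4) by (simp add: b_def l field_simps)
  let ?X = "\<lambda>l. mf 1 (em m + em m) m l + mf (- 2) (em m + em i) i l"
  let ?Y = "\<lambda>l. mf (- b) (\<rho> + em i) i l + mf b (\<rho> + em j) j l"
  have "?X \<in> (Lvf 2 :: ('n, 'k) vf set)"
    using ij by (intro Lvf_two) (auto simp: lookup_single_not_eq)
  moreover have "?Y \<in> Lvf (d - 1)"
  proof (intro Lvf_two ij)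
    show "of_nat (lookup \<rho> i + 1) * - b + of_nat (lookup \<rho> j + 1) * b = 0"
      by (simp add: l oi oj)
    show "d - 1 = mdeg \<rho> + 1" using d by (simp add: r)
  qed
  ultimately have "vbr ?X ?Y \<in> brs d" by (rule brs.br)
  also have "vbr ?X ?Y = tor \<mu> i j c"
  proof -
    have 1: "vbr (mf 1 (em m + em m) m) (mf (- b) (\<rho> + em i) i) =
       (\<lambda>l. mf (1 * - b * of_nat (lookup (\<rho> + em i) m)) (\<mu> + em i) i l +
         mf (- (1 * - b * of_nat (lookup (em m + em m) i))) 0 m l)"
      using ij by (intro vbr_mf) (auto simp: r lookup_add lookup_single_not_eq ac_simps)
    have 2: "vbr (mf 1 (em m + em m) m) (mf b (\<rho> + em j) j) =
       (\<lambda>l. mf (1 * b * of_nat (lookup (\<rho> + em j) m)) (\<mu> + em j) j l +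
         mf (- (1 * b * of_nat (lookup (em m + em m) j))) 0 m l)"
      using ij by (intro vbr_mf) (auto simp: r lookup_add lookup_single_not_eq ac_simps)
    have 3: "vbr (mf (- 2) (em m + em i) i) (mf (- b) (\<rho> + em i) i) =
       (\<lambda>l. mf (- 2 * - b * of_nat (lookup (\<rho> + em i) i)) (\<mu> + em i) i l +
         mf (- (- 2 * - b * of_nat (lookup (em m + em i) i))) (\<mu> + em i) i l)"
      by (intro vbr_mf disjI1) (auto simp: r ac_simps)
    have 4: "vbr (mf (- 2) (em m + em i) i) (mf b (\<rho> + em j) j) =
       (\<lambda>l. mf (- 2 * b * of_nat (lookup (\<rho> + em j) i)) (\<mu> + em j) j l +
         mf (- (- 2 * b * of_nat (lookup (em m + em i) j))) 0 i l)"
      using ij by (intro vbr_mf) (auto simp: r lookup_add lookup_single_not_eq ac_simps)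
    have R1: "mf x M i l + (mf y M i l + mf z M i l) = mf (x + y + z) M i l" for x y z :: 'k and M l
      by (simp add: mf_add_mf add.assoc)
    have e1: "- (b * of_nat (lookup \<rho> m)) + (2 * b * (of_nat (lookup \<rho> i) + 1) + - (2 * b)) = c * of_nat (lookup \<mu> j + 1)"
      using b by (simp add: l oi oj algebra_simps)
    have e2: "b * of_nat (lookup \<rho> m) + - (2 * b * of_nat (lookup \<rho> i)) = - c * of_nat (lookup \<mu> i + 1)"
      using b by (simp add: l oi oj algebra_simps)
    have "vbr ?X ?Y l = mf (- (b * of_nat (lookup \<rho> m)) + (2 * b * (of_nat (lookup \<rho> i) + 1) + - (2 * b))) (\<mu> + em i) i l
       + mf (b * of_nat (lookup \<rho> m) + - (2 * b * of_nat (lookup \<rho> i))) (\<mu> + em j) j l" for l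
      unfolding vbr_add_right vbr_add_left 1 2 3 4 using ij
      by (simp add: lookup_add lookup_single_not_eq algebra_simps mf_uminus mf_diff flip: mf_add_mf)
    then show ?thesis unfolding e1 e2 tor_def by (intro ext)
  qed
  finally show ?thesis .
qed

text \<open>If no small exponent occurs and the first construction fails in both orders of i and j,
  then both exponents are -2 mod p. Only then is a third variable x_m used, with a case distinction
  on its exponent mod p.\<close>

lemma tor_in_brs:
  fixes c :: "'k::field"
  assumes ij: "i \<noteq> (j :: 'n::finite)" and d: "mdeg \<mu> + 1 = d" "d \<ge> 3"
    and n: "CARD('n) \<ge> 3" and p: "CHAR('k) \<ge> 5"
  shows "tor \<mu> i j c \<in> brs d"
proof -
  have nz: "of_nat a \<noteq> (0 :: 'k)" if "0 < a" "a < 5" for a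
    using p that by (metis CHAR_pos_iff dvd_imp_le less_le_trans not_le of_nat_eq_0_iff_char_dvd)
  \<comment> \<open>Here p >= 5 enters: exponents 0 and 1 would give the values 2 and 3, both
    nonzero in k.\<close>
  have ge2: "lookup \<mu> l \<ge> 2" if "of_nat (lookup \<mu> l + 2) = (0 :: 'k)" for l
  proof (rule ccontr)
    assume "\<not> 2 \<le> lookup \<mu> l"
    then show False using nz[of "lookup \<mu> l + 2"] that by simp
  qed
  consider "lookup \<mu> i \<ge> 2" "of_nat (lookup \<mu> j + 2) \<noteq> (0 :: 'k)"
    | "lookup \<mu> j \<ge> 2" "of_nat (lookup \<mu> i + 2) \<noteq> (0 :: 'k)"
    | "lookup \<mu> j = 1" | "lookup \<mu> i = 1" | "lookup \<mu> i = 0" "lookup \<mu> j = 0"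
    | "of_nat (lookup \<mu> i + 2) = (0 :: 'k)" "of_nat (lookup \<mu> j + 2) = (0 :: 'k)"
    using ge2[of i] ge2[of j] by linarith
  then show ?thesis
  proof cases
    case 1 then show ?thesis using ij d by (intro tor_in_brs_1)
  next
    case 2 then show ?thesis unfolding tor_swap[of \<mu> i] using ij d by (intro tor_in_brs_1) auto
  next
    case 3 then show ?thesis using ij d by (intro tor_in_brs_2)
  next
    case 4 then show ?thesis unfolding tor_swap[of \<mu> i] using ij d by (intro tor_in_brs_2) auto
  next
    case 5
    have "\<mu> \<noteq> 0" using d by auto
    then obtain k where "lookup \<mu> k \<noteq> 0" by (metis lookup_zero poly_mapping_eqI)
    then show ?thesis using 5 ij d by (intro tor_in_brs_3)
  next
    case 6
    \<comment> \<open>Here n >= 3 enters. For x = \<mu>_m equal to -1 or -2 the number x + 3 is 2 or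
      1, so the construction with x_m applies directly.\<close>
    have "\<exists>m. m \<noteq> i \<and> m \<noteq> j"
    proof (rule ccontr)
      assume "\<nexists>m. m \<noteq> i \<and> m \<noteq> j"
      then have "(UNIV :: 'n set) \<subseteq> {i, j}" by auto
      then have "CARD('n) \<le> card {i, j}" by (rule card_mono[rotated]) simp
      then show False using n ij by simp
    qed
    then obtain m where m: "m \<noteq> i" "m \<noteq> j" by blast
    define x where "x = (of_nat (lookup \<mu> m) :: 'k)"
    have two: "(2 :: 'k) \<noteq> 0" using nz[of 2] by simp
    consider "x + 1 = 0" | "x + 2 = 0" | "x + 1 \<noteq> 0" "x + 2 \<noteq> 0" by blast
    then show ?thesis
    proof cases
      case 1
      then have x: "x = - 1" by (simp only: eq_neg_iff_add_eq_0)
      have "x + 3 \<noteq> 0" using two by (simp add: x)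
      moreover have "lookup \<mu> m \<noteq> 0" using x unfolding x_def by (intro notI) simp
      ultimately show ?thesis using 6 m ij d by (intro tor_in_brs_4[of i j m]) (auto simp: x_def)
    next
      case 2
      then have x: "x = - 2" by (simp only: eq_neg_iff_add_eq_0)
      have "x + 3 \<noteq> 0" by (simp add: x)
      moreover have "lookup \<mu> m \<noteq> 0" using x two unfolding x_def by (intro notI) simp
      ultimately show ?thesis using 6 m ij d by (intro tor_in_brs_4[of i j m]) (auto simp: x_def)
    next
      case 3
      \<comment> \<open>The weights s and t give \<open>tor \<mu> i m s\<close> and
        \<open>tor \<mu> j m t\<close> the right \<partial>_i and \<partial>_j parts; their
        \<partial>_m parts then cancel, since s (\<mu>_i + 1) + t (\<mu>_j + 1) = 0.\<close>
      define s where "s = c * of_nat (lookup \<mu> j + 1) / (x + 1)"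
      define t where "t = - c * of_nat (lookup \<mu> i + 1) / (x + 1)"
      have mm: "of_nat (lookup \<mu> m + 2) \<noteq> (0 :: 'k)"
        using 3(2) by (simp only: x_def of_nat_add of_nat_numeral not_False_eq_True)
      have "tor \<mu> i m s \<in> brs d" "tor \<mu> j m t \<in> brs d"
        by (rule tor_in_brs_1[OF _ ge2[OF 6(1)] mm d(1)], use m in blast)
           (rule tor_in_brs_1[OF _ ge2[OF 6(2)] mm d(1)], use m in blast)
      from brs.add[OF this] have "(\<lambda>l. tor \<mu> i m s l + tor \<mu> j m t l) \<in> brs d" .
      also have "(\<lambda>l. tor \<mu> i m s l + tor \<mu> j m t l) = tor \<mu> i j c"
      proof
        fix l
        have s1: "s * of_nat (lookup \<mu> m + 1) = c * of_nat (lookup \<mu> j + 1)"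
          and t1: "t * of_nat (lookup \<mu> m + 1) = - c * of_nat (lookup \<mu> i + 1)"
          using 3(1) by (simp_all add: s_def t_def x_def)
        have st: "- s * of_nat (lookup \<mu> i + 1) + - t * of_nat (lookup \<mu> j + 1) = 0"
          using 3(1) by (simp add: s_def t_def field_simps)
        have "mf (- s * of_nat (lookup \<mu> i + 1)) (\<mu> + em m) m l + mf (- t * of_nat (lookup \<mu> j + 1)) (\<mu> + em m) m l = 0"
          unfolding mf_add_mf st by simp
        then show "tor \<mu> i m s l + tor \<mu> j m t l = tor \<mu> i j c l"
          unfolding tor_def s1 t1 by (simp add: algebra_simps)
      qed
      finally show ?thesis .
    qed
  qed
qed

text \<open>If x_i or x_j does not divide the Hamiltonian, the field is at most a single monomial
  field. If both do, it is a \<open>tor\<close>.\<close>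

lemma ham_in_brs:
  fixes c :: "'k::field"
  assumes ij: "i \<noteq> (j :: 'n::finite)" and d: "mdeg H = d + 1" "d \<ge> 3"
    and n: "CARD('n) \<ge> 3" and p: "CHAR('k) \<ge> 5"
  shows "ham (Poly_Mapping.single H c) i j \<in> brs d"
proof -
  have one: "ham (Poly_Mapping.single H c) i j \<in> brs d"
    if ij: "i \<noteq> j" and z: "lookup H i = 0" for i j :: 'n and c :: 'k
  proof (cases "of_nat (lookup H j) = (0 :: 'k)")
    case True
    then show ?thesis unfolding ham_single[OF ij] using z brs.zero by simp
  next
    case False
    then have "lookup H j \<noteq> 0" by (metis of_nat_0)
    then obtain M where M: "H = M + em j" by (rule mono_obtain_em)
    have "mf (of_nat (lookup H j) * c) M i \<in> brs d"
    proof (rule mf_in_brs[OF ij])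
      show "lookup M i = 0" using z by (simp add: M lookup_add)
      show "of_nat (lookup M j + 1) \<noteq> (0 :: 'k)" using False by (simp add: M lookup_add)
    qed (use d M in auto)
    then show ?thesis unfolding ham_single[OF ij] using z by (simp add: M)
  qed
  consider "lookup H i = 0" | "lookup H j = 0" | "lookup H i \<noteq> 0" "lookup H j \<noteq> 0" by blast
  then show ?thesis
  proof cases
    case 1 then show ?thesis using one ij by blast
  next
    case 2
    have "ham (Poly_Mapping.single H c) i j = ham (Poly_Mapping.single H (- c)) j i"
      using ham_swap[OF ij] by (simp add: single_uminus)
    then show ?thesis using one[of j i] 2 ij by simp
  next
    case 3
    obtain M where M: "H = M + em j" using 3(2) by (rule mono_obtain_em)
    have "lookup M i \<noteq> 0" using 3(1) ij by (simp add: M lookup_add lookup_single_not_eq)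
    then obtain \<mu> where \<mu>: "M = \<mu> + em i" by (rule mono_obtain_em)
    have "tor \<mu> i j c \<in> brs d" by (rule tor_in_brs) (use assms M \<mu> in auto)
    then show ?thesis using ham_eq_tor[OF ij, of \<mu> c] by (simp add: M \<mu>)
  qed
qed

lemma noncrit_in_brs:
  fixes D :: "('n::finite, 'k::field) vf"
  assumes "D \<in> Lvf d" "noncrit CHAR('k) D" "d \<ge> 3" "CARD('n) \<ge> 3" "CHAR('k) \<ge> 5"
  shows "D \<in> brs d"
  using assms(1,2) refl
  by (induction rule: noncrit_Lvf_induct) (auto intro: brs.intros ham_in_brs assms)


section \<open>Exact vector fields\<close>

lemma contract_vol_compl:
  "contract D vol (UNIV - {j}) = (- 1) ^ card {i. i \<noteq> j \<and> i < j} * D j"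
proof -
  have "- (UNIV - {j}) = {j}" "insert j (UNIV - {j}) = UNIV" by auto
  then show ?thesis by (simp add: contract_def vol_def)
qed

lemma contract_vol_other:
  assumes "\<nexists>j. I = UNIV - {j}"
  shows "contract D vol I = 0"
proof -
  have "insert j I \<noteq> UNIV" if "j \<in> - I" for j using assms that by auto
  then show ?thesis by (simp add: contract_def vol_def)
qed

lemma exact_add:
  assumes "\<eta> \<in> forms q" "\<zeta> \<in> forms q" "dform \<eta> = contract D vol" "dform \<zeta> = contract E vol"
  shows "\<exists>\<xi>\<in>forms q. dform \<xi> = contract (\<lambda>i. D i + E i) vol"
proof (rule bexI)
  show "dform (\<lambda>I. \<eta> I + \<zeta> I) = contract (\<lambda>i. D i + E i) vol"
  proof
    fix J
    have "dform (\<lambda>I. \<eta> I + \<zeta> I) J = dform \<eta> J + dform \<zeta> J"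
      by (simp add: dform_def pdiff_add algebra_simps sum.distrib)
    also have "\<dots> = contract (\<lambda>i. D i + E i) vol J"
      by (simp add: assms contract_def algebra_simps sum.distrib)
    finally show "dform (\<lambda>I. \<eta> I + \<zeta> I) J = contract (\<lambda>i. D i + E i) vol J" .
  qed
qed (use assms in \<open>auto simp: forms_def\<close>)

text \<open>The potential is h times the product of all dx_l with l different from i and j. Its
  differential has only the components omitting i and omitting j; a and b are the positions at which
  i and j are reinserted. The ordering i < j produces the extra 1 in position b + 1 and thereby the
  minus sign of \<open>ham\<close>.\<close>

lemma exact_ham_less:
  fixes h :: "('n::{finite,linorder}, 'k::comm_ring_1) pol"
  assumes ij: "i < j"
  shows "\<exists>\<eta>\<in>forms (CARD('n) - 2). dform \<eta> = contract (ham h i j) vol"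
proof -
  define a where "a = card {x. x < i}"
  define b where "b = card {x. x < j \<and> x \<noteq> i}"
  define \<eta> where "\<eta> I = (if I = UNIV - {i, j} then (- 1) ^ (a + b) * h else 0)" for I :: "'n set"
  have sgn_a: "(- 1) ^ (a + a) = (1 :: ('n, 'k) pol)" and sgn_b: "(- 1) ^ (b + b) = (1 :: ('n, 'k) pol)"
    by (simp_all flip: mult_2)
  have pe: "pdiff l (\<eta> (J - {l})) = (if J - {l} = UNIV - {i, j} then (- 1) ^ (a + b) * pdiff l h else 0)" for l J
    using pdiff_pconst_times[of l "(- 1) ^ (a + b)" h] by (simp add: \<eta>_def pconst_power pconst_uminus)
  have Ji: "card {x. x \<noteq> i \<and> x < i} = a" "card {x. x \<noteq> i \<and> x < j} = b"
    by (auto simp: a_def b_def intro!: arg_cong[where f = card])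
  have Jj: "card {x. x \<noteq> j \<and> x < j} = b + 1" "card {x. x \<noteq> j \<and> x < i} = a"
  proof -
    have "{x. x \<noteq> j \<and> x < j} = insert i {x. x < j \<and> x \<noteq> i}" using ij by auto
    then show "card {x. x \<noteq> j \<and> x < j} = b + 1" by (simp add: b_def)
    have "{x. x \<noteq> j \<and> x < i} = {x. x < i}" using ij by auto
    then show "card {x. x \<noteq> j \<and> x < i} = a" by (simp add: a_def)
  qed
  have "dform \<eta> J = contract (ham h i j) vol J" for J
  proof (cases "\<exists>m. J = UNIV - {m}")
    case False
    have "J - {l} \<noteq> UNIV - {i, j}" if "l \<in> J" for l
    proof
      assume eq: "J - {l} = UNIV - {i, j}"
      then have "l = i \<or> l = j" using that by auto
      then have "J = UNIV - {i} \<or> J = UNIV - {j} \<or> J = UNIV"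
        using eq that by blast
      moreover have "J \<noteq> UNIV" using eq ij by auto
      ultimately show False using False by blast
    qed
    then show ?thesis by (simp add: contract_vol_other[OF False] dform_def pe)
  next
    case True
    then obtain m where m: "J = UNIV - {m}" by blast
    have s1: "{x \<in> J. x < l} = {x. x \<noteq> m \<and> x < l}" for l using m by auto
    consider "m = i" | "m = j" | "m \<noteq> i" "m \<noteq> j" by blast
    then show ?thesis
    proof cases
      case 1
      have c: "l \<in> J \<Longrightarrow> J - {l} = UNIV - {i, j} \<longleftrightarrow> l = j" for l using m 1 ij by auto
      have "dform \<eta> J = (\<Sum>l\<in>J. if l = j then (- 1) ^ b * ((- 1) ^ (a + b) * pdiff j h) else 0)"
        unfolding dform_def by (intro sum.cong) (auto simp: s1 pe c 1 Ji)
      also have "\<dots> = (- 1) ^ a * (- 1) ^ (b + b) * pdiff j h"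
        using m 1 ij by (simp add: power_add mult_ac)
      finally show ?thesis
        using ij sgn_b unfolding m 1 contract_vol_compl by (simp add: Ji ham_def)
    next
      case 2
      have c: "l \<in> J \<Longrightarrow> J - {l} = UNIV - {i, j} \<longleftrightarrow> l = i" for l using m 2 ij by auto
      have "dform \<eta> J = (\<Sum>l\<in>J. if l = i then (- 1) ^ a * ((- 1) ^ (a + b) * pdiff i h) else 0)"
        unfolding dform_def by (intro sum.cong) (auto simp: s1 pe c 2 Jj)
      also have "\<dots> = (- 1) ^ b * (- 1) ^ (a + a) * pdiff i h"
        using m 2 ij by (simp add: power_add mult_ac)
      finally show ?thesis
        using ij sgn_a unfolding m 2 contract_vol_compl by (auto simp: Jj ham_def power_add)
    next
      case 3
      have "J - {l} \<noteq> UNIV - {i, j}" for l using m 3 by auto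
      then have "dform \<eta> J = 0" by (simp add: dform_def pe)
      then show ?thesis using 3 unfolding m contract_vol_compl by (simp add: ham_def)
    qed
  qed
  moreover have "card (UNIV - {i, j}) = CARD('n) - 2" using ij by (simp add: card_Diff_subset)
  then have "\<eta> \<in> forms (CARD('n) - 2)" by (auto simp: forms_def \<eta>_def)
  ultimately show ?thesis by blast
qed

lemma exact_ham:
  fixes h :: "('n::{finite,linorder}, 'k::comm_ring_1) pol"
  assumes ij: "i \<noteq> j"
  shows "\<exists>\<eta>\<in>forms (CARD('n) - 2). dform \<eta> = contract (ham h i j) vol"
  using exact_ham_less[of i j h] exact_ham_less[of j i "- h"] ham_swap[OF ij, of h] ij
  by (cases i j rule: linorder_cases) simp_all

text \<open>The component omitting dx_j of a differential involves only derivatives \<partial>_l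
  with l \<noteq> j, and these have no coefficient at an exponent with M_l = -1 mod p. The converse
  is the spanning by Hamiltonian fields.\<close>

lemma Evf_eq_noncrit:
  assumes p: "CHAR('k::field) = p" and n: "CARD('n::{finite,linorder}) \<ge> 2"
  shows "(Evf d :: ('n, 'k) vf set) = {D \<in> Lvf d. noncrit p D}"
proof (intro subset_antisym subsetI)
  fix D :: "('n, 'k) vf" assume D: "D \<in> Evf d"
  then obtain \<eta> where \<eta>: "\<eta> \<in> forms (CARD('n) - 2)" "dform \<eta> = contract D vol"
    by (auto simp: Evf_def)
  have "noncrit p D"
    unfolding noncrit_def
  proof safe
    fix j :: 'n and M assume c: "crit p j M"
    define S where "S = (- 1 :: 'k) ^ card {i. i \<noteq> j \<and> i < j}"
    have "lookup (dform \<eta> (UNIV - {j})) M = 0"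
      unfolding dform_def lookup_sum
    proof (intro sum.neutral ballI)
      fix l assume "l \<in> UNIV - {j}"
      then have "p dvd lookup M l + 1" using c unfolding crit_def by blast
      then have z: "(of_nat (lookup M l + 1) :: 'k) = 0" using p by (simp only: of_nat_eq_0_iff_char_dvd)
      have "lookup (pdiff l f) M = 0" for f :: "('n, 'k) pol" unfolding lookup_pdiff z by simp
      then have "lookup (pconst ((- 1) ^ card {i \<in> UNIV - {j}. i < l}) * pdiff l (\<eta> (UNIV - {j} - {l}))) M = 0"
        unfolding lookup_pconst_times by simp
      then show "lookup ((- 1) ^ card {i \<in> UNIV - {j}. i < l} * pdiff l (\<eta> (UNIV - {j} - {l}))) M = 0"
        by (simp add: pconst_power pconst_uminus)
    qed
    then have "lookup (pconst S * D j) M = 0"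
      unfolding \<eta>(2) contract_vol_compl S_def by (simp add: pconst_power pconst_uminus)
    moreover have "S \<noteq> 0" by (simp add: S_def)
    ultimately show "lookup (D j) M = 0" by (simp add: lookup_pconst_times)
  qed
  then show "D \<in> {D \<in> Lvf d. noncrit p D}" using D by (simp add: Evf_def)
next
  fix D :: "('n, 'k) vf" assume D: "D \<in> {D \<in> Lvf d. noncrit p D}"
  then have "D \<in> Lvf d" "noncrit p D" by auto
  then have "\<exists>\<eta>\<in>forms (CARD('n) - 2). dform \<eta> = contract D vol"
    using p
  proof (induction rule: noncrit_Lvf_induct)
    case zero
    have "dform (\<lambda>_. 0) = contract (\<lambda>_. 0 :: ('n, 'k) pol) vol"
      by (intro ext) (simp add: dform_def contract_def)
    then show ?case by (intro bexI[of _ "\<lambda>_. 0"]) (auto simp: forms_def)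
  next
    case (add D E)
    then show ?case using exact_add by blast
  next
    case (ham i j M c)
    then show ?case by (intro exact_ham)
  qed
  then show "D \<in> Evf d" using D by (simp add: Evf_def)
qed

section \<open>Determinants\<close>

lemma det_fun_upd_add:
  fixes R :: "'n::finite \<Rightarrow> 'a::comm_ring_1 ^ 'n"
  shows "det (\<chi> i. (R(k := x + y)) i) = det (\<chi> i. (R(k := x)) i) + det (\<chi> i. (R(k := y)) i)"
  using det_row_add[of k "\<lambda>_. x" "\<lambda>_. y" R] by (simp add: fun_upd_def)

lemma det_fun_upd_mul:
  fixes R :: "'n::finite \<Rightarrow> 'a::comm_ring_1 ^ 'n"
  shows "det (\<chi> i. (R(k := c *s x)) i) = c * det (\<chi> i. (R(k := x)) i)"
  using det_row_mul[of k c "\<lambda>_. x" R] by (simp add: fun_upd_def)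

lemma det_fun_upd_add_row:
  fixes R :: "'n::finite \<Rightarrow> 'a::comm_ring_1 ^ 'n"
  assumes "k \<noteq> l"
  shows "det (\<chi> i. (R(k := x + c *s R l)) i) = det (\<chi> i. (R(k := x)) i)"
proof -
  have "det (\<chi> i. (R(k := R l)) i) = 0"
    by (rule det_identical_rows[OF assms]) (use assms in \<open>simp add: row_def\<close>)
  then show ?thesis by (simp add: det_fun_upd_add det_fun_upd_mul del: fun_upd_apply)
qed

lemma det_axis_upd:
  fixes v :: "'a::comm_ring_1 ^ 'n::finite"
  shows "det (\<chi> i. ((\<lambda>a. axis a 1)(k := v)) i) = v $ k"
proof -
  let ?E = "\<lambda>a. axis a 1 :: 'a ^ 'n"
  have "det (\<chi> i. (?E(k := v $ k *s axis k 1 + (\<Sum>l\<in>L. v $ l *s axis l 1))) i) = v $ k"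
    if "k \<notin> L" for L
    using finite[of L] that
  proof (induction L)
    case empty
    have "(\<chi> i. (?E(k := v $ k *s axis k 1)) i) $ i $ j = 0" if "i \<noteq> j" for i j
      using that by (auto simp: axis_def)
    then have "det (\<chi> i. (?E(k := v $ k *s axis k 1)) i) =
        (\<Prod>i\<in>UNIV. (\<chi> i. (?E(k := v $ k *s axis k 1)) i) $ i $ i)"
      by (rule det_diagonal)
    also have "\<dots> = (\<Prod>i\<in>UNIV. if i = k then v $ k else 1)"
      by (intro prod.cong) (auto simp: axis_def)
    finally show ?case by simp
  next
    case (insert l L)
    then have "k \<noteq> l" by auto
    from det_fun_upd_add_row[OF this, of ?E "v $ k *s axis k 1 + (\<Sum>l\<in>L. v $ l *s axis l 1)" "v $ l"]
    show ?case using insert by (simp add: add_ac)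
  qed
  from this[of "UNIV - {k}"] have "det (\<chi> i. (?E(k := v $ k *s axis k 1 + (\<Sum>l\<in>UNIV - {k}. v $ l *s axis l 1))) i) = v $ k"
    by simp
  moreover have "v $ k *s axis k 1 + (\<Sum>l\<in>UNIV - {k}. v $ l *s axis l 1) = v"
    using basis_expansion[of v] by (simp add: sum.remove[of UNIV k])
  ultimately show ?thesis by simp
qed

text \<open>The determinant of 1 + u v^T is 1 plus the pairing of u with v. The rows receive their
  multiples of v one at a time, over a ring without division. It computes the Jacobian of a
  shear.\<close>

lemma det_rank_one:
  fixes u :: "'n::finite \<Rightarrow> 'a::comm_ring_1" and v :: "'n \<Rightarrow> 'a"
  shows "det (\<chi> a b. (if a = b then 1 else 0) + u a * v b) = 1 + (\<Sum>a\<in>UNIV. u a * v a)"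
proof -
  define V where "V = (\<chi> b. v b)"
  define R where "R S a = axis a 1 + (if a \<in> S then u a *s V else 0)" for S a
  \<comment> \<open>Once row k is v itself, the multiples of v in the rows of T are removable by row
    operations.\<close>
  have 1: "det (\<chi> i. ((R T)(k := V)) i) = v k" if "k \<notin> T" for T k
    using finite[of T] that
  proof (induction T)
    case empty
    then show ?case using det_axis_upd[of k V] by (simp add: R_def V_def)
  next
    case (insert a T)
    then have ak: "a \<noteq> k" by auto
    have "(R (insert a T))(k := V) = ((R T)(k := V))(a := axis a 1 + u a *s ((R T)(k := V)) k)"
      using ak by (auto simp: R_def)
    moreover have "((R T)(k := V))(a := axis a 1) = (R T)(k := V)"
      using ak insert by (auto simp: R_def)
    ultimately show ?case
      using det_fun_upd_add_row[OF ak, of "(R T)(k := V)" "axis a 1" "u a"] insert by simp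
  qed
  have "det (\<chi> i. R S i) = 1 + (\<Sum>a\<in>S. u a * v a)" for S
    using finite[of S]
  proof (induction S)
    case empty
    have "(\<chi> i. R {} i) = mat 1" by (simp add: R_def mat_def vec_eq_iff axis_def)
    then show ?case by simp
  next
    case (insert k S)
    have "R (insert k S) = (R S)(k := axis k 1 + u k *s V)" by (auto simp: R_def)
    moreover have "(R S)(k := axis k 1) = R S" using insert by (auto simp: R_def)
    ultimately show ?case
      using insert 1[OF insert(2)] by (simp add: det_fun_upd_add det_fun_upd_mul del: fun_upd_apply)
  qed
  moreover have "(\<chi> i. R UNIV i) = (\<chi> a b. (if a = b then 1 else 0) + u a * v b)"
    by (simp add: R_def V_def vec_eq_iff axis_def)
  ultimately show ?thesis by metis
qed

text \<open>A permutation other than the identity moves at least two indices and so contributes two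
  small off-diagonal factors; the identity contributes the product of the 1 + A_ii.\<close>

lemma det_first_order:
  fixes A :: "'n::finite \<Rightarrow> 'n \<Rightarrow> ('m::finite, 'k::comm_ring_1) mfps"
  assumes A: "\<And>i j. A i j \<in> ordge t"
  shows "det (\<chi> i j. (if i = j then 1 else 0) + A i j) - 1 - (\<Sum>i\<in>UNIV. A i i) \<in> ordge (2 * t)"
proof -
  define F where "F p = of_int (sign p) * (\<Prod>i\<in>UNIV. (if i = p i then 1 else 0) + A i (p i))" for p
  have "det (\<chi> i j. (if i = j then 1 else 0) + A i j) = (\<Sum>p\<in>{p. p permutes UNIV}. F p)"
    by (simp add: det_def F_def)
  also have "\<dots> = F id + (\<Sum>p\<in>{p. p permutes UNIV} - {id}. F p)"
    by (rule sum.remove) (auto simp: permutes_id finite_permutations)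
  finally have det: "det (\<chi> i j. (if i = j then 1 else 0) + A i j) = \<dots>" .
  have nonid: "F p \<in> ordge (2 * t)" if p: "p \<in> {p. p permutes UNIV} - {id}" for p
  proof -
    obtain i where i: "p i \<noteq> i" using p by (metis DiffD2 eq_id_iff insertI1)
    have inj: "inj p" using p by (auto intro: permutes_inj)
    define j where "j = p i"
    have j: "p j \<noteq> j" "j \<noteq> i" using i inj by (auto simp: j_def inj_eq)
    let ?f = "\<lambda>i. (if i = p i then 1 else 0) + A i (p i)"
    have "(\<Prod>i\<in>UNIV. ?f i) = ?f i * (?f j * prod ?f (UNIV - {i} - {j}))"
      using j by (subst prod.remove[of UNIV i], simp, simp, subst prod.remove[of _ j], auto)
    also have "\<dots> \<in> ordge (2 * t)"
    proof (rule ordge_mult')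
      show "?f i \<in> ordge t" using A i by simp
      show "?f j * prod ?f (UNIV - {i} - {j}) \<in> ordge t"
        by (rule ordge_mult'[of _ t _ 0]) (use A j in auto)
    qed simp
    finally show ?thesis unfolding F_def by (intro ordge_mult'[of _ 0 _ "2 * t"]) auto
  qed
  have S: "(\<Sum>i\<in>S. A i i) \<in> ordge t" for S by (intro ordge_sum A)
  have "(\<Prod>i\<in>S. 1 + A i i) - 1 - (\<Sum>i\<in>S. A i i) \<in> ordge (2 * t)" for S
    using finite[of S]
  proof (induction S)
    case (insert k S)
    let ?R = "(\<Prod>i\<in>S. 1 + A i i) - 1 - (\<Sum>i\<in>S. A i i)"
    have eq: "(\<Prod>i\<in>insert k S. 1 + A i i) - 1 - (\<Sum>i\<in>insert k S. A i i) =
        ?R + A k k * (\<Sum>i\<in>S. A i i) + A k k * ?R"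
      using insert by (simp add: algebra_simps)
    have "A k k * (\<Sum>i\<in>S. A i i) \<in> ordge (2 * t)" by (rule ordge_mult'[OF A S]) simp
    moreover have "A k k * ?R \<in> ordge (2 * t)" by (rule ordge_mult'[OF A insert.IH]) simp
    ultimately show ?case unfolding eq by (intro ordge_add insert.IH)
  qed simp
  from this[of UNIV] have "F id - 1 - (\<Sum>i\<in>UNIV. A i i) \<in> ordge (2 * t)"
    by (simp add: F_def)
  from ordge_add[OF this ordge_sum[of "{p. p permutes UNIV} - {id}" F "2 * t"]] nonid
  show ?thesis unfolding det by (simp add: algebra_simps)
qed


section \<open>The group of volume preserving automorphisms\<close>

lemma alg_endo_of_int: "alg_endo g \<Longrightarrow> g (of_int (sign q)) = of_int (sign q)"
  by (cases q rule: sign_cases) (simp_all add: alg_endoD)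

lemma alg_endo_det:
  assumes g: "alg_endo g"
  shows "g (det A) = det (\<chi> i j. g (A $ i $ j))"
  by (simp add: det_def alg_endo_sum[OF g] alg_endoD[OF g] alg_endo_prod[OF g] alg_endo_of_int[OF g])

text \<open>The chain rule makes the Jacobian matrix of the composite a product, in which the
  entries of the matrix of h are moved by g.\<close>

lemma jacobian_comp:
  assumes g: "alg_endo g"
  shows "jacobian (g \<circ> h) = g (jacobian h) * jacobian g"
proof -
  have "(\<chi> i j. mfps_diff j ((g \<circ> h) (mvar i))) =
      (\<chi> i l. g (mfps_diff l (h (mvar i)))) ** (\<chi> l j. mfps_diff j (g (mvar l)))"
    by (simp add: matrix_matrix_mult_def mfps_diff_alg_endo[OF g, of _ "h _"])
  then show ?thesis by (simp add: jacobian_def det_mul alg_endo_det[OF g])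
qed

lemma jacobian_id: "jacobian (id :: ('n::finite, 'k::comm_ring_1) aut) = 1"
proof -
  have "(\<chi> i j. mfps_diff j (id (mvar i))) = (mat 1 :: ('n, 'k) mfps ^ 'n ^ 'n)"
    by (auto simp: mat_def vec_eq_iff mfps_diff_mvar)
  then show ?thesis unfolding jacobian_def by (simp only: det_I)
qed

lemma alg_endo_unipotent:
  assumes g: "alg_endo g" and "\<And>i. g (mvar i) - mvar i \<in> ordge s" "s \<ge> 1" "f \<in> ordge q"
  shows "g f - f \<in> ordge (max q 1 + s - 1)"
proof -
  have "alg_endo id" by (simp add: alg_endo_def)
  from alg_endo_diff_ordge[OF g this assms(3), of f q] assms(2,4) show ?thesis by simp
qed

lemma alg_endo_up:
  assumes "alg_endo g" "\<And>i. g (mvar i) - mvar i \<in> ordge 2" "f \<in> ordge q"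
  shows "g f - f \<in> ordge (q + 1)"
  using alg_endo_unipotent[of g 2 f q] assms by (auto intro: ordge_mono)

text \<open>Bijectivity comes from the geometric series of \<open>bij_of_unipotent\<close>,
  continuity from the fact that orders are respected.\<close>

lemma Gvol_iff:
  fixes g :: "('n::finite, 'k::comm_ring_1) aut"
  shows "g \<in> carrier Gvol \<longleftrightarrow>
    alg_endo g \<and> (\<forall>j. g (mvar j) - mvar j \<in> ordge 2) \<and> jacobian g = 1"
proof safe
  assume g: "g \<in> carrier Gvol"
  then have h: "g \<in> ring_hom psr psr" and c: "g (mconst c * f) = mconst c * g f"
    and x: "g (mvar j) - mvar j \<in> ordge 2" and j: "jacobian g = 1" for c f j
    by (auto simp: Gvol_def ring_iso_def mpow_eq_ordge)
  from h have h': "g (u * v) = g u * g v" "g (u + v) = g u + g v" "g 1 = 1" for u v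
    by (auto simp: ring_hom_def)
  have "g (mvar i) \<in> ordge 1" for i
    using ordge_add[OF ordge_mono[OF x[of i], of 1] mvar_in_ordge_1[of i]] by simp
  then show "alg_endo g" using h' c[of _ 1] by (simp add: alg_endo_def)
  show "g (mvar j) - mvar j \<in> ordge 2" "jacobian g = 1" for j by (rule x j)+
next
  assume g: "alg_endo g" "\<forall>j. g (mvar j) - mvar j \<in> ordge 2" "jacobian g = 1"
  have "bij g"
    by (rule bij_of_unipotent) (use alg_endoD[OF g(1)] alg_endo_up[OF g(1)] g(2) in auto)
  moreover have "g \<in> ring_hom psr psr"
    using alg_endoD[OF g(1)] by (auto simp: ring_hom_def)
  moreover have "madic_continuous g"
    unfolding madic_continuous_def mpow_eq_ordge
    using alg_endo_ordge[OF g(1)] alg_endoD(8)[OF g(1)] by metis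
  ultimately show "g \<in> carrier Gvol"
    using g alg_endoD[OF g(1)] by (auto simp: Gvol_def ring_iso_def mpow_eq_ordge)
qed

lemma GvolD:
  assumes "g \<in> carrier Gvol"
  shows "alg_endo g" "g (mvar j) - mvar j \<in> ordge 2" "jacobian g = 1" "bij g"
proof -
  show "bij g" using assms by (simp add: Gvol_def ring_iso_def)
qed (use assms in \<open>auto simp: Gvol_iff\<close>)

lemma Gvol_up: "g \<in> carrier Gvol \<Longrightarrow> f \<in> ordge q \<Longrightarrow> g f - f \<in> ordge (q + 1)"
  using alg_endo_up GvolD by blast

text \<open>In f = g f - (g f - f) the second term has order one more than is already known for f,
  so the bound climbs until it reaches that of g f.\<close>

lemma Gvol_reflects_ordge:
  assumes g: "g \<in> carrier Gvol" and f: "g f \<in> ordge q"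
  shows "f \<in> ordge q"
proof -
  have "f \<in> ordge (min t q)" for t
  proof (induction t)
    case (Suc t)
    have "g f - f \<in> ordge (min (Suc t) q)"
      using Gvol_up[OF g Suc] by (rule ordge_mono) auto
    moreover have "g f \<in> ordge (min (Suc t) q)" using f by (rule ordge_mono) simp
    ultimately have "g f - (g f - f) \<in> ordge (min (Suc t) q)" by (rule ordge_diff[rotated])
    then show ?case by simp
  qed simp
  from this[of q] show ?thesis by simp
qed

lemma mult_Gvol [simp]: "g \<otimes>\<^bsub>Gvol\<^esub> h = g \<circ> h" and one_Gvol [simp]: "\<one>\<^bsub>Gvol\<^esub> = id"
  by (simp_all add: Gvol_def)

lemma Gvol_comp: "g \<in> carrier Gvol \<Longrightarrow> h \<in> carrier Gvol \<Longrightarrow> g \<circ> h \<in> carrier Gvol"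
proof -
  assume g: "g \<in> carrier Gvol" and h: "h \<in> carrier Gvol"
  note G = alg_endoD[OF GvolD(1)[OF g]] and H = alg_endoD[OF GvolD(1)[OF h]]
  have x: "(g \<circ> h) (mvar j) - mvar j \<in> ordge 2" for j
  proof -
    have "g (h (mvar j) - mvar j) + (g (mvar j) - mvar j) \<in> ordge 2"
      using alg_endo_ordge[OF GvolD(1)[OF g] GvolD(2)[OF h]] GvolD(2)[OF g] by (rule ordge_add)
    then show ?thesis by (simp add: G)
  qed
  moreover have "jacobian (g \<circ> h) = 1"
    using GvolD(3)[OF g] GvolD(3)[OF h] by (simp add: jacobian_comp[OF GvolD(1)[OF g]] G)
  moreover have "alg_endo (g \<circ> h)"
    unfolding alg_endo_def using alg_endo_ordge[OF GvolD(1)[OF g] H(4)] by (simp add: G H)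
  ultimately show ?thesis by (simp add: Gvol_iff)
qed

lemma Gvol_id: "id \<in> carrier Gvol"
  by (simp add: Gvol_iff alg_endo_def jacobian_id)

lemma Gvol_inv: 
  assumes g: "g \<in> carrier Gvol" shows "inv_into UNIV g \<in> carrier Gvol"
proof -
  note G = alg_endoD[OF GvolD(1)[OF g]]
  have gi: "g (inv_into UNIV g f) = f" and ig: "inv_into UNIV g (g f) = f" for f
    using GvolD(4)[OF g] by (simp_all add: bij_is_surj bij_is_inj surj_f_inv_f)
  have eqI: "inv_into UNIV g f = h" if "g h = f" for f h using that ig by auto
  have "alg_endo (inv_into UNIV g)"
    unfolding alg_endo_def
  proof safe
    show "inv_into UNIV g (mvar i) \<in> ordge 1" for i
      by (rule Gvol_reflects_ordge[OF g]) (simp add: gi)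
  qed (auto intro!: eqI simp: G gi)
  moreover have "inv_into UNIV g (mvar j) - mvar j \<in> ordge 2" for j
  proof (rule Gvol_reflects_ordge[OF g])
    show "g (inv_into UNIV g (mvar j) - mvar j) \<in> ordge 2"
      using ordge_uminus[OF GvolD(2)[OF g, of j]] by (simp add: G gi)
  qed
  moreover have "jacobian (inv_into UNIV g) = 1"
  proof -
    have "g (jacobian (inv_into UNIV g)) * jacobian g = jacobian (g \<circ> inv_into UNIV g)"
      by (rule jacobian_comp[OF GvolD(1)[OF g], symmetric])
    also have "g \<circ> inv_into UNIV g = id" using gi by (auto simp: fun_eq_iff)
    also have "jacobian id = 1" by (rule jacobian_id)
    finally have "g (jacobian (inv_into UNIV g)) = 1" using GvolD(3)[OF g] by simp
    then show ?thesis using ig[of "jacobian (inv_into UNIV g)"] ig[of 1] G(6) by metis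
  qed
  ultimately show ?thesis by (simp add: Gvol_iff)
qed

lemma Gvol_inv_apply:
  assumes "g \<in> carrier Gvol" shows "g (inv_into UNIV g f) = f" "inv_into UNIV g (g f) = f"
  using GvolD(4)[OF assms] by (simp_all add: bij_is_surj bij_is_inj surj_f_inv_f)

lemma group_Gvol: "group Gvol"
proof (rule groupI)
  show "\<exists>y\<in>carrier Gvol. y \<otimes>\<^bsub>Gvol\<^esub> x = \<one>\<^bsub>Gvol\<^esub>" if "x \<in> carrier Gvol" for x :: "('a, 'b) aut"
    using Gvol_inv[OF that] Gvol_inv_apply[OF that] by (intro bexI[of _ "inv_into UNIV x"]) auto
qed (auto simp: Gvol_comp Gvol_id comp_assoc)

lemma inv_Gvol: "g \<in> carrier Gvol \<Longrightarrow> inv\<^bsub>Gvol\<^esub> g = inv_into UNIV g"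
  by (intro group.inv_equality[OF group_Gvol]) (auto simp: Gvol_inv fun_eq_iff Gvol_inv_apply)

lemma Gs_iff: "g \<in> Gs s \<longleftrightarrow> g \<in> carrier Gvol \<and> (\<forall>j. g (mvar j) - mvar j \<in> ordge s)"
  by (simp add: Gs_def mpow_eq_ordge)

lemma Gs_unipotent: "g \<in> Gs s \<Longrightarrow> s \<ge> 1 \<Longrightarrow> f \<in> ordge q \<Longrightarrow> g f - f \<in> ordge (max q 1 + s - 1)"
  using alg_endo_unipotent[of g s f q] GvolD(1) by (auto simp: Gs_iff)

lemma Gs_mono: "g \<in> Gs s \<Longrightarrow> r \<le> s \<Longrightarrow> g \<in> Gs r"
  by (auto simp: Gs_iff intro: ordge_mono)

lemma Gs_comp:
  assumes "g \<in> Gs s" "h \<in> Gs s" shows "g \<circ> h \<in> Gs s"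
proof -
  have g: "g \<in> carrier Gvol" and h: "h \<in> carrier Gvol" using assms by (auto simp: Gs_iff)
  have "g (h (mvar j) - mvar j) + (g (mvar j) - mvar j) \<in> ordge s" for j
    by (intro ordge_add alg_endo_ordge[OF GvolD(1)[OF g]]) (use assms in \<open>auto simp: Gs_iff\<close>)
  then show ?thesis using Gvol_comp[OF g h] by (simp add: Gs_iff alg_endoD[OF GvolD(1)[OF g]])
qed

text \<open>The conjugate moves x_j by g applied to (h - 1)(g^-1 x_j), and g^-1 x_j still has order
  1.\<close>

lemma Gs_conj:
  assumes g: "g \<in> carrier Gvol" and h: "h \<in> Gs s" and s: "s \<ge> 1"
  shows "g \<circ> h \<circ> inv_into UNIV g \<in> Gs s"
proof -
  have hG: "h \<in> carrier Gvol" using h by (simp add: Gs_iff)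
  have "(g \<circ> h \<circ> inv_into UNIV g) (mvar j) - mvar j \<in> ordge s" for j
  proof -
    have "inv_into UNIV g (mvar j) \<in> ordge 1"
      using alg_endoD(4)[OF GvolD(1)[OF Gvol_inv[OF g]]] .
    from Gs_unipotent[OF h s this] have "h (inv_into UNIV g (mvar j)) - inv_into UNIV g (mvar j) \<in> ordge s" by simp
    from alg_endo_ordge[OF GvolD(1)[OF g] this] show ?thesis
      by (simp add: alg_endoD[OF GvolD(1)[OF g]] Gvol_inv_apply[OF g])
  qed
  moreover have "g \<circ> h \<circ> inv_into UNIV g \<in> carrier Gvol" by (intro Gvol_comp Gvol_inv g hG)
  ultimately show ?thesis by (simp add: Gs_iff)
qed

lemma Gs_inv:
  assumes g: "g \<in> Gs s" shows "inv_into UNIV g \<in> Gs s"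
proof -
  have gG: "g \<in> carrier Gvol" using g by (simp add: Gs_iff)
  have "inv_into UNIV g (mvar j) - mvar j \<in> ordge s" for j
  proof (rule Gvol_reflects_ordge[OF gG])
    show "g (inv_into UNIV g (mvar j) - mvar j) \<in> ordge s"
      using ordge_uminus[of "g (mvar j) - mvar j" s] g
      by (simp add: alg_endoD[OF GvolD(1)[OF gG]] Gvol_inv_apply[OF gG] Gs_iff)
  qed
  then show ?thesis using Gvol_inv[OF gG] by (simp add: Gs_iff)
qed

lemma normal_Gs: "s \<ge> 1 \<Longrightarrow> normal (Gs s) Gvol"
proof -
  assume s: "s \<ge> 1"
  interpret group Gvol by (rule group_Gvol)
  have "subgroup (Gs s) Gvol"
  proof (rule subgroupI)
    have "id \<in> Gs s" using Gvol_id by (simp add: Gs_iff)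
    then show "Gs s \<noteq> {}" by blast
    show sub: "Gs s \<subseteq> carrier Gvol" by (auto simp: Gs_iff)
    show "inv\<^bsub>Gvol\<^esub> g \<in> Gs s" if "g \<in> Gs s" for g
      using Gs_inv[OF that] inv_Gvol[of g] sub that by auto
  qed (simp add: Gs_comp)
  moreover have "x \<otimes>\<^bsub>Gvol\<^esub> h \<otimes>\<^bsub>Gvol\<^esub> inv\<^bsub>Gvol\<^esub> x \<in> Gs s" if "x \<in> carrier Gvol" "h \<in> Gs s" for x h
    using Gs_conj[OF that s] by (simp add: inv_Gvol that)
  ultimately show ?thesis by (simp only: normal_inv_iff) blast
qed

section \<open>Leading fields\<close>

text \<open>A relation between automorphisms and fields, kept apart from \<open>lead\<close>, so
  that products and commutators can be computed before any symbol is formed.\<close>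

definition has_lead :: "nat \<Rightarrow> ('n::finite, 'k::comm_ring_1) aut \<Rightarrow> ('n, 'k) vf \<Rightarrow> bool" where
  "has_lead s g D \<longleftrightarrow> g \<in> Gs s \<and> D \<in> SymV s \<and>
     (\<forall>i. g (mvar i) - mvar i - mfps_of_pol (D i) \<in> ordge (s + 1))"

lemma has_leadI:
  assumes g: "g \<in> carrier Gvol" and D: "D \<in> SymV s"
    and d: "\<And>i. g (mvar i) - mvar i - mfps_of_pol (D i) \<in> ordge (s + 1)"
  shows "has_lead s g D"
proof -
  have "g (mvar i) - mvar i \<in> ordge s" for i
    using ordge_add[OF ordge_mono[OF d[of i], of s] SymV_in_ordge[OF D, of i]] by simp
  then show ?thesis using assms by (simp add: has_lead_def Gs_iff)
qed

lemma has_leadD: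
  assumes "has_lead s g D"
  shows "g \<in> Gs s" "D \<in> SymV s" "g (mvar i) - mvar i - mfps_of_pol (D i) \<in> ordge (s + 1)"
    "g \<in> carrier Gvol" "g (mvar i) - mvar i \<in> ordge s"
  using assms by (auto simp: has_lead_def Gs_iff)

lemma has_lead_exists:
  assumes g: "g \<in> Gs s" obtains D where "has_lead s g D"
proof -
  define D where "D i = (\<Sum>m\<in>{m. mdeg m = s}. Poly_Mapping.single m (mcoeff (g (mvar i) - mvar i) m))" for i
  have fin: "finite {m :: 'a mono. mdeg m = s}" by (rule finite_subset[OF _ finite_mdeg_le[of s]]) auto
  have l: "lookup (D i) m = (if mdeg m = s then mcoeff (g (mvar i) - mvar i) m else 0)" for i m
    using fin by (simp add: D_def lookup_sum lookup_single when_def)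
  have "D \<in> SymV s" by (auto simp: SymV_def homog_def in_keys_iff l split: if_splits)
  moreover have "g (mvar i) - mvar i - mfps_of_pol (D i) \<in> ordge (s + 1)" for i
  proof -
    have "mcoeff (g (mvar i) - mvar i) m = 0" if "mdeg m < s" for m
      using g that by (auto simp: Gs_iff ordge_def)
    then show ?thesis by (auto simp: ordge_def l)
  qed
  ultimately have "has_lead s g D" using g by (simp add: has_lead_def)
  then show ?thesis by (rule that)
qed

lemma has_lead_cong:
  assumes "has_lead s g D" "has_lead s h E" "\<And>i. g (mvar i) - h (mvar i) \<in> ordge (s + 1)"
  shows "D = E"
proof
  fix i
  have "(h (mvar i) - mvar i - mfps_of_pol (E i)) - (g (mvar i) - mvar i - mfps_of_pol (D i)) +
      (g (mvar i) - h (mvar i)) \<in> ordge (s + 1)"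
    by (rule ordge_add[OF ordge_diff[OF has_leadD(3)[OF assms(2)] has_leadD(3)[OF assms(1)]] assms(3)])
  then have "mfps_of_pol (D i) - mfps_of_pol (E i) \<in> ordge (s + 1)" by (simp add: algebra_simps)
  then show "D i = E i"
    using has_leadD(2)[OF assms(1)] has_leadD(2)[OF assms(2)]
    by (intro homog_diff_in_ordge_Suc) (auto simp: SymV_def)
qed

lemma has_lead_diff:
  assumes "has_lead s g D" "has_lead s h D"
  shows "g (mvar i) - h (mvar i) \<in> ordge (s + 1)"
  using ordge_diff[OF has_leadD(3)[OF assms(1), of i] has_leadD(3)[OF assms(2), of i]] by simp

text \<open>Expanding Jacobian 1 to first order leaves div D = 0 modulo order s, as the quadratic
  error has order 2 (s - 1) >= s. Since div D is homogeneous of degree s - 1, it vanishes.\<close>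

lemma has_lead_Lvf:
  assumes g: "has_lead s g D" and s: "s \<ge> 2"
  shows "D \<in> Lvf s"
proof -
  define A where "A i j = mfps_diff j (g (mvar i) - mvar i)" for i j
  have A: "A i j \<in> ordge (s - 1)" for i j
    unfolding A_def by (rule mfps_diff_ordge[OF has_leadD(5)[OF g]])
  have "jacobian g = det (\<chi> i j. (if i = j then 1 else 0) + A i j)"
    unfolding jacobian_def
    by (rule arg_cong[where f = det]) (auto simp: vec_eq_iff A_def mfps_diff_diff mfps_diff_mvar)
  then have "1 - 1 - (\<Sum>i\<in>UNIV. A i i) \<in> ordge (2 * (s - 1))"
    using det_first_order[of A "s - 1"] A GvolD(3)[OF has_leadD(4)[OF g]] by simp
  then have "1 - 1 - (\<Sum>i\<in>UNIV. A i i) \<in> ordge s" by (rule ordge_mono) (use s in auto)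
  moreover have "(\<Sum>i\<in>UNIV. mfps_diff i (g (mvar i) - mvar i - mfps_of_pol (D i))) \<in> ordge s"
    using mfps_diff_ordge[OF has_leadD(3)[OF g]] by (intro ordge_sum) simp
  ultimately have "(1 - 1 - (\<Sum>i\<in>UNIV. A i i)) + (\<Sum>i\<in>UNIV. mfps_diff i (g (mvar i) - mvar i - mfps_of_pol (D i))) \<in> ordge s"
    by (rule ordge_add)
  also have "(1 - 1 - (\<Sum>i\<in>UNIV. A i i)) + (\<Sum>i\<in>UNIV. mfps_diff i (g (mvar i) - mvar i - mfps_of_pol (D i))) =
      - (mfps_of_pol (\<Sum>i\<in>UNIV. pdiff i (D i)) - mfps_of_pol 0)"
    by (simp add: A_def mfps_diff_diff mfps_diff_of_pol mfps_of_pol_sum sum_subtractf)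
  finally have "mfps_of_pol (\<Sum>i\<in>UNIV. pdiff i (D i)) - mfps_of_pol 0 \<in> ordge (s - 1 + 1)"
    using s ordge_uminus by fastforce
  moreover have "(\<Sum>i\<in>UNIV. pdiff i (D i)) \<in> homog (s - 1)"
    using has_leadD(2)[OF g] by (intro homog_sum homog_pdiff) (auto simp: SymV_def)
  ultimately have "(\<Sum>i\<in>UNIV. pdiff i (D i)) = 0" by (intro homog_diff_in_ordge_Suc) auto
  then show ?thesis using has_leadD(2)[OF g] by (simp add: Lvf_def)
qed

lemma has_lead_id: "has_lead s id (\<lambda>_. 0)"
  by (rule has_leadI) (auto simp: Gvol_id SymV_0)

text \<open>The displacement of h is altered by g only one order higher, so leading fields
  add.\<close>

lemma has_lead_comp:
  assumes g: "has_lead s g D" and h: "has_lead s h E" and s: "s \<ge> 1"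
  shows "has_lead s (g \<circ> h) (\<lambda>i. D i + E i)"
proof (rule has_leadI)
  show "g \<circ> h \<in> carrier Gvol" using has_leadD(4) g h by (intro Gvol_comp)
  show "(\<lambda>i. D i + E i) \<in> SymV s" using has_leadD(2) g h by (intro SymV_add)
  fix i
  define u where "u = h (mvar i) - mvar i"
  have "g u - u \<in> ordge (s + 1)"
    using Gvol_up[OF has_leadD(4)[OF g], of u s] has_leadD(5)[OF h] by (simp add: u_def)
  then have "(g (mvar i) - mvar i - mfps_of_pol (D i)) + (h (mvar i) - mvar i - mfps_of_pol (E i)) + (g u - u) \<in> ordge (s + 1)"
    using has_leadD(3) g h by (intro ordge_add)
  then show "(g \<circ> h) (mvar i) - mvar i - mfps_of_pol (D i + E i) \<in> ordge (s + 1)"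
    by (simp add: u_def alg_endoD[OF GvolD(1)[OF has_leadD(4)[OF g]]] mfps_of_pol_add algebra_simps)
qed

lemma vfa_ordge: "D \<in> SymV a \<Longrightarrow> f \<in> ordge q \<Longrightarrow> vfa D f \<in> ordge (a + q - 1)"
  unfolding vfa_def
  by (intro ordge_sum ordge_mult'[OF SymV_in_ordge mfps_diff_ordge]) auto

lemma vfa_of_pol: "vfa D (mfps_of_pol f) = mfps_of_pol (\<Sum>i\<in>UNIV. D i * pdiff i f)"
  by (simp add: vfa_def mfps_diff_of_pol mfps_of_pol_sum mfps_of_pol_mult)

section \<open>Group commutators and the bracket of leading fields\<close>

definition gcomm :: "('n, 'k) aut \<Rightarrow> ('n, 'k) aut \<Rightarrow> ('n, 'k) aut" where
  "gcomm g h = (g \<circ> h) \<circ> inv_into UNIV (h \<circ> g)"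

lemma gcomm_in_Gvol: "g \<in> carrier Gvol \<Longrightarrow> h \<in> carrier Gvol \<Longrightarrow> gcomm g h \<in> carrier Gvol"
  unfolding gcomm_def by (intro Gvol_comp Gvol_inv)

lemma gcomm_comp: "g \<in> carrier Gvol \<Longrightarrow> h \<in> carrier Gvol \<Longrightarrow> gcomm g h \<circ> (h \<circ> g) = g \<circ> h"
  using Gvol_inv_apply(2)[OF Gvol_comp[of h g]] by (auto simp: gcomm_def fun_eq_iff)

text \<open>Write the commutator as (g h)(h g)^-1 and let (h g)^-1 send x_i to x_i + v with v of
  order 2. Its displacement of x_i is (g h - h g)(x_i + v), where g h - h g = (g - 1)(h - 1) - (h -
  1)(g - 1). On x_i this gives the bracket to leading order, on v something of order a + b.\<close>

lemma has_lead_gcomm: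
  assumes g: "has_lead a g D" and h: "has_lead b h E" and ab: "a \<ge> 2" "b \<ge> 2"
  shows "has_lead (a + b - 1) (gcomm g h) (vbr D E)"
proof (rule has_leadI)
  note gG = has_leadD(4)[OF g] and hG = has_leadD(4)[OF h]
  note eg = GvolD(1)[OF gG] and eh = GvolD(1)[OF hG]
  show "gcomm g h \<in> carrier Gvol" by (rule gcomm_in_Gvol[OF gG hG])
  have "D \<in> Lvf a" "E \<in> Lvf b" using has_lead_Lvf g h ab by blast+
  from vbr_in_Lvf[OF this] show "vbr D E \<in> SymV (a + b - 1)" by (simp add: Lvf_def)
  \<comment> \<open>To leading order k - 1 acts on u as the derivation F on the leading part f of u;
    the difference u - f already has one order more.\<close>
  have first: "alg_endo k \<Longrightarrow> has_lead c k F \<Longrightarrow> c \<ge> 2 \<Longrightarrow>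
      u - mfps_of_pol f \<in> ordge (e + 1) \<Longrightarrow> mfps_of_pol f \<in> ordge e \<Longrightarrow>
      k u - u - mfps_of_pol (\<Sum>j\<in>UNIV. F j * pdiff j f) \<in> ordge (c + e)"
    for k :: "('a, 'b) aut" and u c F f e
  proof -
    assume k: "alg_endo k" "has_lead c k F" "c \<ge> 2" and u: "u - mfps_of_pol f \<in> ordge (e + 1)" "mfps_of_pol f \<in> ordge e"
    have "u \<in> ordge e" using ordge_add[OF ordge_mono[OF u(1), of e] u(2)] by simp
    then have "k u - u - vfa F u \<in> ordge (e + c)"
      using alg_endo_first_order[OF k(1,3) has_leadD(2)[OF k(2)] has_leadD(3)[OF k(2)]] by blast
    moreover have "vfa F (u - mfps_of_pol f) \<in> ordge (e + c)"
      using vfa_ordge[OF has_leadD(2)[OF k(2)] u(1)] by (simp add: add.commute)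
    ultimately have "(k u - u - vfa F u) + vfa F (u - mfps_of_pol f) \<in> ordge (e + c)" by (rule ordge_add)
    moreover have "(k u - u - vfa F u) + vfa F (u - mfps_of_pol f) =
        k u - u - mfps_of_pol (\<Sum>j\<in>UNIV. F j * pdiff j f)"
      by (simp add: vfa_diff vfa_of_pol)
    ultimately show ?thesis by (simp only: add.commute[of e c])
  qed
  fix i
  let ?x = "mvar i :: ('a, 'b) mfps"
  define k where "k = inv_into UNIV (h \<circ> g)"
  have kG: "k \<in> carrier Gvol" unfolding k_def by (intro Gvol_inv Gvol_comp gG hG)
  have hgk: "h (g (k f)) = f" for f
    using Gvol_inv_apply(1)[OF Gvol_comp[OF hG gG]] by (simp add: k_def)
  define ug where "ug = g ?x - ?x"
  define uh where "uh = h ?x - ?x"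
  define v where "v = k ?x - ?x"
  have v: "v \<in> ordge 2" unfolding v_def by (rule GvolD(2)[OF kG])
  have 1: "g uh - uh - mfps_of_pol (\<Sum>j\<in>UNIV. D j * pdiff j (E i)) \<in> ordge (a + b)"
    by (rule first[OF eg g ab(1)])
       (use has_leadD(3)[OF h] SymV_in_ordge[OF has_leadD(2)[OF h]] in \<open>auto simp: uh_def\<close>)
  have 2: "h ug - ug - mfps_of_pol (\<Sum>j\<in>UNIV. E j * pdiff j (D i)) \<in> ordge (b + a)"
    by (rule first[OF eh h ab(2)])
       (use has_leadD(3)[OF g] SymV_in_ordge[OF has_leadD(2)[OF g]] in \<open>auto simp: ug_def\<close>)
  have up: "r f - f \<in> ordge (q + c - 1)" if "has_lead c r F" "c \<ge> 2" "f \<in> ordge q" "q \<ge> 1" for r c F f q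
    using Gs_unipotent[OF has_leadD(1)[OF that(1)], of f q] that by (simp add: max_def)
  \<comment> \<open>Order 2 of v, plus b - 1 from h - 1, plus a - 1 from g - 1, is exactly a +
    b.\<close>
  have 3: "g (h v - v) - (h v - v) \<in> ordge (a + b)"
  proof (rule ordge_mono)
    show "g (h v - v) - (h v - v) \<in> ordge (2 + b - 1 + a - 1)"
      by (rule up[OF g ab(1) up[OF h ab(2) v]]) (use ab in auto)
  qed (use ab in auto)
  have 4: "h (g v - v) - (g v - v) \<in> ordge (a + b)"
  proof (rule ordge_mono)
    show "h (g v - v) - (g v - v) \<in> ordge (2 + a - 1 + b - 1)"
      by (rule up[OF h ab(2) up[OF g ab(1) v]]) (use ab in auto)
  qed (use ab in auto)
  have "gcomm g h ?x - ?x = g (h (k ?x)) - h (g (k ?x))"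
    unfolding gcomm_def k_def[symmetric] hgk by simp
  also have "k ?x = ?x + v" by (simp add: v_def)
  also have "g (h (?x + v)) - h (g (?x + v)) =
     (g uh - uh) - (h ug - ug) + (g (h v - v) - (h v - v)) - (h (g v - v) - (g v - v))"
    by (simp add: ug_def uh_def alg_endoD[OF eg] alg_endoD[OF eh] algebra_simps)
  finally have "gcomm g h ?x - ?x - mfps_of_pol (vbr D E i) =
     (g uh - uh - mfps_of_pol (\<Sum>j\<in>UNIV. D j * pdiff j (E i)))
     - (h ug - ug - mfps_of_pol (\<Sum>j\<in>UNIV. E j * pdiff j (D i)))
     + (g (h v - v) - (h v - v)) - (h (g v - v) - (g v - v))"
    by (simp add: vbr_def sum_subtractf mfps_of_pol_diff)
  moreover have "\<dots> \<in> ordge (a + b)"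
    by (rule ordge_diff[OF ordge_add[OF ordge_diff[OF 1 2[unfolded add.commute[of b a]]] 3] 4])
  ultimately show "gcomm g h ?x - ?x - mfps_of_pol (vbr D E i) \<in> ordge (a + b - 1 + 1)"
    using ab by simp
qed

section \<open>Realization of divergence-free fields as leading fields\<close>

lemma shear_has_lead:
  fixes f :: "('n::finite, 'k::comm_ring_1) pol"
  assumes f: "f \<in> homog s" and s: "s \<ge> 2" and w: "(\<Sum>i\<in>UNIV. pconst (w i) * pdiff i f) = 0"
  shows "\<exists>g. has_lead s g (\<lambda>i. pconst (w i) * f)"
proof -
  define D where "D i = pconst (w i) * f" for i
  have D: "D \<in> SymV s" using f by (simp add: D_def SymV_def homog_pconst_mult)
  have "mvar i + mfps_of_pol (D i) \<in> ordge 1" for i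
    using ordge_mono[OF SymV_in_ordge[OF D, of i], of 1] s by (intro ordge_add) auto
  then obtain g where g: "alg_endo g" "\<And>i. g (mvar i) = mvar i + mfps_of_pol (D i)"
    using alg_endo_exists[of "\<lambda>i. mvar i + mfps_of_pol (D i)"] by blast
  \<comment> \<open>The Jacobian matrix is the identity plus w times the gradient of f, so its
    determinant is 1 plus the derivative of f along w, and that derivative is 0.\<close>
  have "jacobian g = det (\<chi> i j. (if i = j then 1 else 0) + mconst (w i) * mfps_of_pol (pdiff j f))"
    unfolding jacobian_def g(2) mfps_diff_add mfps_diff_of_pol
    by (rule arg_cong[where f = det])
       (auto simp: vec_eq_iff mfps_diff_mvar D_def pdiff_pconst_times mfps_of_pol_mult)
  also have "\<dots> = 1 + mfps_of_pol (\<Sum>i\<in>UNIV. pconst (w i) * pdiff i f)"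
    by (simp add: det_rank_one mfps_of_pol_sum mfps_of_pol_mult)
  finally have "jacobian g = 1" using w by simp
  moreover have "g (mvar j) - mvar j \<in> ordge 2" for j
    using ordge_mono[OF SymV_in_ordge[OF D, of j], of 2] s by (simp add: g(2))
  ultimately have "g \<in> carrier Gvol" using g(1) by (simp add: Gvol_iff)
  then have "has_lead s g D" using D by (intro has_leadI) (simp_all add: g(2))
  then show ?thesis unfolding D_def by blast
qed

lemma mf_has_lead:
  assumes "mdeg M = s" "s \<ge> 2" "of_nat (lookup M i) * c = 0"
  shows "\<exists>g. has_lead s g (mf c M i)"
proof -
  have "(\<Sum>l\<in>UNIV. pconst (if l = i then 1 else 0) * pdiff l (Poly_Mapping.single M c)) =
     (\<Sum>l\<in>UNIV. if l = i then pdiff i (Poly_Mapping.single M c) else 0)"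
    by (intro sum.cong) auto
  also have "\<dots> = 0" using assms(3) by (simp add: pdiff_single)
  finally have "\<exists>g. has_lead s g (\<lambda>l. pconst (if l = i then 1 else 0) * Poly_Mapping.single M c)"
    using assms by (intro shear_has_lead homog_single) auto
  moreover have "(\<lambda>l. pconst (if l = i then 1 else 0) * Poly_Mapping.single M c) = mf c M i"
    by (auto simp: mf_def)
  ultimately show ?thesis by simp
qed

lemma shear2_has_lead:
  fixes f :: "('n::finite, 'k::comm_ring_1) pol"
  assumes ij: "i \<noteq> j" and f: "f \<in> homog s" "s \<ge> 2" "pconst \<alpha> * pdiff i f + pdiff j f = 0"
  shows "\<exists>g. has_lead s g (\<lambda>l. if l = i then pconst \<alpha> * f else if l = j then f else 0)"
proof -
  let ?w = "\<lambda>l. if l = i then \<alpha> else if l = j then 1 else 0"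
  have "(\<Sum>l\<in>UNIV. pconst (?w l) * pdiff l f) =
     (\<Sum>l\<in>UNIV. (if l = i then pconst \<alpha> * pdiff i f else 0) + (if l = j then pdiff j f else 0))"
    using ij by (intro sum.cong) auto
  also have "\<dots> = 0" using f(3) by (simp add: sum.distrib)
  finally have "\<exists>g. has_lead s g (\<lambda>l. pconst (?w l) * f)" using f by (intro shear_has_lead)
  moreover have "(\<lambda>l. pconst (?w l) * f) = (\<lambda>l. if l = i then pconst \<alpha> * f else if l = j then f else 0)"
    by auto
  ultimately show ?thesis by simp
qed

lemma lookup_2_times: "lookup (2 * f) m = lookup f m * (2 :: 'k::comm_ring_1)"
  by (simp only: mult_2 mult_2_right lookup_add)

text \<open>The field is not itself a shear. It is a sum of shears in diagonal directions such as
  \<partial>_i + \<partial>_j, corrected by monomial fields.\<close>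

lemma tor_has_lead_2:
  fixes c :: "'k::field"
  assumes ij: "i \<noteq> (j :: 'n::finite)" and two: "(2 :: 'k) \<noteq> 0"
  shows "\<exists>g. has_lead 2 g (tor (em k) i j c)"
proof -
  let ?L = "\<lambda>D. \<exists>g. has_lead 2 g (D :: ('n, 'k) vf)"
  have add: "?L (\<lambda>i. D i + E i)" if "?L D" "?L E" for D E
    using that has_lead_comp[of 2] by fastforce
  have k1: "?L (tor (em k) i j c)" if "k \<noteq> i" "k \<noteq> j"
  proof -
    \<comment> \<open>f = c x_k (x_i - x_j) is constant along \<partial>_i + \<partial>_j. The mixed
      terms of f (\<partial>_i + \<partial>_j) are removed by monomial fields, and x_k (x_i
      \<partial>_i - x_j \<partial>_j) remains.\<close>
    let ?f = "Poly_Mapping.single (em i + em k) c + Poly_Mapping.single (em j + em k) (- c) :: ('n, 'k) pol"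
    have "em i + em k - em i = em k" "em j + em k - em j = em k" by simp_all
    then have "pconst 1 * pdiff i ?f + pdiff j ?f = 0"
      using ij that by (simp add: pdiff_add pdiff_single lookup_add lookup_single_not_eq flip: single_add)
    then have "?L (\<lambda>l. if l = i then pconst 1 * ?f else if l = j then ?f else 0)"
      using ij by (intro shear2_has_lead homog_add homog_single) auto
    moreover have "?L (mf c (em j + em k) i)" "?L (mf (- c) (em i + em k) j)"
      using ij that by (auto intro!: mf_has_lead simp: lookup_add lookup_single_not_eq)
    ultimately have "?L (\<lambda>l. (if l = i then pconst 1 * ?f else if l = j then ?f else 0) +
        (mf c (em j + em k) i l + mf (- c) (em i + em k) j l))"
      by (intro add)
    also have "(\<lambda>l. (if l = i then pconst 1 * ?f else if l = j then ?f else 0) +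
        (mf c (em j + em k) i l + mf (- c) (em i + em k) j l)) = tor (em k) i j c"
      using ij that
      by (intro ext) (simp add: tor_def mf_def lookup_single_not_eq single_uminus add.commute)
    finally show ?thesis .
  qed
  have k2: "?L (tor (em i) i j c)" if ij: "i \<noteq> j" for i j :: 'n and c :: 'k
  proof -
    \<comment> \<open>The target c x_i^2 \<partial>_i - 2 c x_i x_j \<partial>_j is b (x_i - x_j)^2
      (\<partial>_i + \<partial>_j) + b (x_i + x_j)^2 (\<partial>_i - \<partial>_j) - c x_j^2
      \<partial>_i, by the parallelogram and polarization identities for squares.\<close>
    define b where "b = c / 2"
    have b: "b + b = c" using two by (simp add: b_def field_simps)
    let ?q = "\<lambda>u v w. Poly_Mapping.single (em i + em i) u + Poly_Mapping.single (em i + em j) v +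
       Poly_Mapping.single (em j + em j) w :: ('n, 'k) pol"
    have cancel: "em i + em j - em i = em j" "em i + em j - em j = em i" "em i + em i - em i = em i"
      "em j + em j - em j = em j" by simp_all
    have dq: "pdiff i (?q u v w) = Poly_Mapping.single (em i) (2 * u) + Poly_Mapping.single (em j) v"
      "pdiff j (?q u v w) = Poly_Mapping.single (em i) v + Poly_Mapping.single (em j) (2 * w)" for u v w
      using ij by (simp_all add: pdiff_add pdiff_single lookup_add lookup_single_not_eq cancel)
    have bb: "2 * b = c" using b by simp
    have "pconst 1 * pdiff i (?q b (- c) b) + pdiff j (?q b (- c) b) = 0"
      unfolding dq bb by (simp add: single_uminus)
    then have "?L (\<lambda>l. if l = i then pconst 1 * ?q b (- c) b else if l = j then ?q b (- c) b else 0)"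
      using ij by (intro shear2_has_lead homog_add homog_single) auto
    moreover have "pconst (- 1) * pdiff i (?q (- b) (- c) (- b)) + pdiff j (?q (- b) (- c) (- b)) = 0"
      unfolding dq mult_minus_right bb by (simp add: pconst_uminus single_uminus)
    then have "?L (\<lambda>l. if l = i then pconst (- 1) * ?q (- b) (- c) (- b) else if l = j then ?q (- b) (- c) (- b) else 0)"
      using ij by (intro shear2_has_lead homog_add homog_single) auto
    moreover have "?L (mf (- c) (em j + em j) i)"
      using ij by (auto intro!: mf_has_lead simp: lookup_add lookup_single_not_eq)
    ultimately have "?L (\<lambda>l. (if l = i then pconst 1 * ?q b (- c) b else if l = j then ?q b (- c) b else 0)
       + ((if l = i then pconst (- 1) * ?q (- b) (- c) (- b) else if l = j then ?q (- b) (- c) (- b) else 0)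
       + mf (- c) (em j + em j) i l))"
      by (intro add)
    also have "(\<lambda>l. (if l = i then pconst 1 * ?q b (- c) b else if l = j then ?q b (- c) b else 0)
       + ((if l = i then pconst (- 1) * ?q (- b) (- c) (- b) else if l = j then ?q (- b) (- c) (- b) else 0)
       + mf (- c) (em j + em j) i l)) = tor (em i) i j c"
    proof
      fix l
      show "(if l = i then pconst 1 * ?q b (- c) b else if l = j then ?q b (- c) b else 0)
       + ((if l = i then pconst (- 1) * ?q (- b) (- c) (- b) else if l = j then ?q (- b) (- c) (- b) else 0)
       + mf (- c) (em j + em j) i l) = tor (em i) i j c l"
      proof (rule poly_mapping_eqI)
        fix m
        consider "l = i" | "l = j" | "l \<noteq> i" "l \<noteq> j" by blast
        then show "lookup ((if l = i then pconst 1 * ?q b (- c) b else if l = j then ?q b (- c) b else 0)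
          + ((if l = i then pconst (- 1) * ?q (- b) (- c) (- b) else if l = j then ?q (- b) (- c) (- b) else 0)
          + mf (- c) (em j + em j) i l)) m = lookup (tor (em i) i j c l) m"
        proof cases
          case 1
          then show ?thesis
            using ij by (simp add: tor_def mf_def lookup_single_not_eq lookup_pconst_times lookup_add lookup_single when_def flip: b)
        next
          case 2
          then show ?thesis
            using ij by (simp add: tor_def mf_def lookup_pconst_times lookup_add lookup_single when_def
                lookup_2_times)
        qed (simp add: tor_def mf_def)
      qed
    qed
    finally show ?thesis .
  qed
  show ?thesis
  proof -
    consider "k = i" | "k = j" | "k \<noteq> i" "k \<noteq> j" by blast
    then show ?thesis
    proof cases
      case 1
      show ?thesis unfolding 1 by (rule k2[OF ij])
    next
      case 2
      show ?thesis unfolding 2 tor_swap[of "em j" i j c] by (rule k2[OF ij[symmetric]])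
    qed (rule k1)
  qed
qed

text \<open>Critical monomials are shears in every degree. Hamiltonian fields are explicit for d =
  2; for d >= 3 they are sums of brackets of fields of degrees 2 and d - 1, both smaller than d,
  which are realized by induction and combined by group commutators.\<close>

lemma Lvf_has_lead:
  fixes D :: "('n::finite, 'k::field) vf"
  assumes n: "CARD('n) \<ge> 3" and p: "CHAR('k) \<ge> 5"
  shows "d \<ge> 2 \<Longrightarrow> D \<in> Lvf d \<Longrightarrow> \<exists>g. has_lead d g D"
proof (induction d arbitrary: D rule: less_induct)
  case (less d)
  have two: "(2 :: 'k) \<noteq> 0"
    using p of_nat_eq_0_iff_char_dvd[where ?'a = 'k, of 2] by (auto dest: dvd_imp_le)
  have lead_add: "\<exists>g. has_lead d g (\<lambda>i. D i + E i)"
    if DE: "\<exists>g. has_lead d g D" "\<exists>g. has_lead d g E" for D E :: "('n, 'k) vf"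
  proof -
    obtain g h where "has_lead d g D" "has_lead d h E" using DE by blast
    from has_lead_comp[OF this] less.prems(1) show ?thesis by auto
  qed
  show ?case
    using less.prems(2) refl
  proof (induction rule: Lvf_induct)
    case zero
    show ?case using has_lead_id by blast
  next
    case (add D E)
    then show ?case by (intro lead_add)
  next
    case (crit i M c)
    have "of_nat (lookup M i) = (0 :: 'k)" using crit by (simp add: crit_def of_nat_eq_0_iff_char_dvd)
    then show ?case using crit less.prems(1) by (intro mf_has_lead) auto
  next
    case (ham i j M c)
    note ij = \<open>i \<noteq> j\<close>
    show ?case
    proof (cases "d = 2")
      case True
      have one: "\<exists>g. has_lead d g (ham (Poly_Mapping.single M c) i j)"
        if ij: "i \<noteq> j" and z: "lookup M i = 0" for i j and c :: 'k
      proof (cases "lookup M j = 0")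
        case True
        then show ?thesis unfolding ham_single[OF ij] using z has_lead_id by auto
      next
        case False
        then obtain R where R: "M = R + em j" by (rule mono_obtain_em)
        have "lookup R i = 0" using z by (simp add: R lookup_add)
        then have "\<exists>g. has_lead d g (mf (of_nat (lookup M j) * c) R i)"
          using ham(2) less.prems(1) by (intro mf_has_lead) (auto simp: R)
        then show ?thesis unfolding ham_single[OF ij] using z by (simp add: R)
      qed
      consider "lookup M i = 0" | "lookup M j = 0" | "lookup M i \<noteq> 0" "lookup M j \<noteq> 0" by blast
      then show ?thesis
      proof cases
        case 1 then show ?thesis using one ij by blast
      next
        case 2
        have "ham (Poly_Mapping.single M c) i j = ham (Poly_Mapping.single M (- c)) j i"
          using ham_swap[OF ij] by (simp add: single_uminus)
        then show ?thesis using one[of j i] 2 ij by simp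
      next
        case 3
        obtain R where R: "M = R + em j" using 3(2) by (rule mono_obtain_em)
        have "lookup R i \<noteq> 0" using 3(1) ij by (simp add: R lookup_add lookup_single_not_eq)
        then obtain \<mu> where \<mu>: "R = \<mu> + em i" by (rule mono_obtain_em)
        have "\<mu> \<noteq> 0" using ham(2) True R \<mu> by auto
        then obtain k where "lookup \<mu> k \<noteq> 0" by (metis lookup_zero poly_mapping_eqI)
        then obtain \<nu> where \<nu>: "\<mu> = \<nu> + em k" by (rule mono_obtain_em)
        \<comment> \<open>The Hamiltonian has degree 3 and is divisible by x_i x_j, so exactly one
          variable x_k is left.\<close>
        have "mdeg \<nu> = 0" using ham(2) True by (simp add: R \<mu> \<nu>)
        then have "\<mu> = em k" using \<nu> by simp
        then show ?thesis
          using tor_has_lead_2[OF ij two, of k c] ham_eq_tor[OF ij, of \<mu> c] True by (simp add: R \<mu>)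
      qed
    next
      case False
      then have d: "d \<ge> 3" using less.prems(1) by simp
      have "ham (Poly_Mapping.single M c) i j \<in> brs d" using ham d n p by (intro ham_in_brs) auto
      then show ?thesis
      proof (induction rule: brs.induct)
        case zero
        show ?case using has_lead_id by blast
      next
        case (add D E)
        then show ?case by (intro lead_add)
      next
        case (br D E)
        have "\<exists>g. has_lead 2 g D" by (rule less.IH) (use br d in auto)
        moreover have "\<exists>h. has_lead (d - 1) h E" by (rule less.IH) (use br d in auto)
        ultimately obtain g h where "has_lead 2 g D" "has_lead (d - 1) h E" by blast
        moreover have "2 \<le> d - 1" "2 + (d - 1) - 1 = d" using d by auto
        ultimately show ?case using has_lead_gcomm[of 2 g D "d - 1" h E] by auto
      qed
    qed
  qed
qed


section \<open>Cosets and the action of the integral group ring\<close>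

text \<open>Cosets in a type with addition. The coset operations of the records for power series and
  for the group ring both reduce to this one, so that ordinary arithmetic applies.\<close>

definition acs :: "'a::ab_group_add set \<Rightarrow> 'a \<Rightarrow> 'a set" where
  "acs U z = (\<lambda>u. u + z) ` U"

definition asub :: "'a::ab_group_add set \<Rightarrow> bool" where
  "asub U \<longleftrightarrow> 0 \<in> U \<and> (\<forall>x\<in>U. \<forall>y\<in>U. x - y \<in> U)"

lemma asub_add: "asub U \<Longrightarrow> x \<in> U \<Longrightarrow> y \<in> U \<Longrightarrow> x + y \<in> U"
  unfolding asub_def by (metis diff_0 diff_minus_eq_add)

lemma asub_uminus: "asub U \<Longrightarrow> x \<in> U \<Longrightarrow> - x \<in> U"
  unfolding asub_def by (metis diff_0)

lemma a_r_coset_eq_acs: "ring.add R = (+) \<Longrightarrow> U +>\<^bsub>R\<^esub> z = acs U z"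
  by (auto simp: a_r_coset_def' acs_def)

lemma mem_acs: "asub U \<Longrightarrow> x \<in> acs U z \<longleftrightarrow> x - z \<in> U"
  by (auto simp: acs_def image_iff) (metis add_diff_cancel_right' diff_add_cancel)

lemma acs_eq_iff: "asub U \<Longrightarrow> acs U x = acs U y \<longleftrightarrow> x - y \<in> U"
proof
  assume U: "asub U" and "acs U x = acs U y"
  then have "x \<in> acs U y" using mem_acs[OF U, of x x] by (simp add: asub_def)
  then show "x - y \<in> U" using mem_acs[OF U] by blast
next
  assume U: "asub U" and d: "x - y \<in> U"
  have "z - x \<in> U \<longleftrightarrow> z - y \<in> U" for z
    using asub_add[OF U _ d, of "z - x"] asub_add[OF U _ asub_uminus[OF U d], of "z - y"] by auto
  then show "acs U x = acs U y" using mem_acs[OF U] by blast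
qed

lemma acs_0: "acs U 0 = U"
  by (simp add: acs_def)

lemma set_add_acs:
  assumes "ring.add R = (+)" "asub U"
  shows "acs U x <+>\<^bsub>R\<^esub> acs U y = acs U (x + y)"
proof -
  have "acs U x <+>\<^bsub>R\<^esub> acs U y = {h + k |h k. h \<in> acs U x \<and> k \<in> acs U y}"
    using assms(1) by (auto simp: set_add_def')
  also have "\<dots> = acs U (x + y)"
  proof safe
    fix h k assume "h \<in> acs U x" "k \<in> acs U y"
    then have "(h - x) + (k - y) \<in> U" using assms(2) by (auto simp: mem_acs intro: asub_add)
    then show "h + k \<in> acs U (x + y)" using assms(2) by (simp add: mem_acs algebra_simps)
  next
    fix z assume "z \<in> acs U (x + y)"
    then have "z - y \<in> acs U x" "y \<in> acs U y" using assms(2) by (simp_all add: mem_acs asub_def algebra_simps)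
    then show "\<exists>h k. z = h + k \<and> h \<in> acs U x \<and> k \<in> acs U y"
      by (intro exI[of _ "z - y"] exI[of _ y]) simp
  qed
  finally show ?thesis .
qed

lemma asub_ordge: "asub (ordge q)"
  by (simp add: asub_def ordge_diff)

lemma add_psr: "ring.add psr = (+)"
  by (simp add: ring_of_type_algebra_def)

section \<open>The truncated group and its representatives\<close>

lemma toT_eq: "toT N g = (\<lambda>h. h \<circ> g) ` Gs N"
  by (auto simp: toT_def r_coset_def)

lemma group_TN: "N \<ge> 1 \<Longrightarrow> group (TN N)"
  unfolding TN_def by (intro normal.factorgroup_is_group normal_Gs)

lemma carrier_TN: "carrier (TN N) = toT N ` carrier Gvol"
  by (simp add: TN_def carrier_FactGroup toT_def)

lemma toT_comp:
  assumes "N \<ge> 1" "g \<in> carrier Gvol" "h \<in> carrier Gvol"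
  shows "toT N g \<otimes>\<^bsub>TN N\<^esub> toT N h = toT N (g \<circ> h)"
  using normal.rcos_sum[OF normal_Gs[OF assms(1)] assms(2,3)] by (simp add: TN_def toT_def)

lemma toT_one:
  assumes N: "N \<ge> 1" and g: "g \<in> Gs N"
  shows "toT N g = \<one>\<^bsub>TN N\<^esub>"
proof -
  interpret normal "Gs N" Gvol using normal_Gs[OF N] .
  have "Gs N #>\<^bsub>Gvol\<^esub> g = Gs N" using rcos_const[OF is_group g] .
  then show ?thesis by (simp add: TN_def toT_def)
qed

lemma toT_eqI:
  assumes N: "N \<ge> 1" and g: "g \<in> carrier Gvol" and h: "h \<in> toT N g"
  shows "toT N h = toT N g"
proof -
  interpret normal "Gs N" Gvol using normal_Gs[OF N] .
  show ?thesis
    using repr_independence[OF h[unfolded toT_def] g subgroup_axioms] by (simp add: toT_def)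
qed

text \<open>An arbitrary automorphism in the coset; by \<open>rep_toT\<close> the choice affects
  values only in order N.\<close>

definition rep :: "('n, 'k) tn \<Rightarrow> ('n, 'k) aut" where
  "rep t = (SOME g. g \<in> t)"

lemma mem_toT:
  assumes N: "N \<ge> 1" and g: "g \<in> carrier Gvol" and h: "h \<in> toT N g"
  shows "h \<in> carrier Gvol" "h f - g f \<in> ordge N"
proof -
  obtain l where l: "l \<in> Gs N" "h = l \<circ> g" using h by (auto simp: toT_eq)
  then show "h \<in> carrier Gvol" using g by (auto simp: Gs_iff intro: Gvol_comp)
  show "h f - g f \<in> ordge N"
    using Gs_unipotent[OF l(1) N, of "g f" 0] by (simp add: l(2) max_def)
qed

lemma rep_toT:
  fixes g :: "('n::finite, 'k::comm_ring_1) aut"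
  assumes N: "N \<ge> 1" and g: "g \<in> carrier Gvol"
  shows "rep (toT N g) \<in> toT N g" "rep (toT N g) \<in> carrier Gvol" "rep (toT N g) f - g f \<in> ordge N"
proof -
  have "id \<in> (Gs N :: ('n, 'k) aut set)" using Gvol_id by (simp add: Gs_iff)
  then have "id \<circ> g \<in> toT N g" unfolding toT_eq by (rule imageI)
  then have "g \<in> toT N g" by simp
  then show r: "rep (toT N g) \<in> toT N g" unfolding rep_def using someI[of "\<lambda>x. x \<in> toT N g" g] by simp
  show "rep (toT N g) \<in> carrier Gvol" "rep (toT N g) f - g f \<in> ordge N"
    by (rule mem_toT[OF N g r])+
qed

lemma rep_TN:
  assumes N: "N \<ge> 1" and t: "t \<in> carrier (TN N)"
  shows "rep t \<in> carrier Gvol" "toT N (rep t) = t"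
proof -
  obtain g where g: "g \<in> carrier Gvol" "t = toT N g" using t by (auto simp: carrier_TN)
  show "rep t \<in> carrier Gvol" unfolding g(2) by (rule rep_toT(2)[OF N g(1)])
  show "toT N (rep t) = t" unfolding g(2) by (rule toT_eqI[OF N g(1) rep_toT(1)[OF N g(1)]])
qed

text \<open>A lift of \<open>rhoZ\<close> to power series. It depends on the chosen representatives,
  but only modulo order N, which is invisible on B_N.\<close>

definition opz :: "('n::finite, 'k::comm_ring_1) ztn \<Rightarrow> ('n, 'k) mfps \<Rightarrow> ('n, 'k) mfps" where
  "opz z f = (\<Sum>t\<in>keys z. of_int (lookup z t) * rep t f)"

definition csum :: "('a \<Rightarrow>\<^sub>0 int) \<Rightarrow> int" where
  "csum z = (\<Sum>t\<in>keys z. lookup z t)"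

lemma sum_keys_superset:
  fixes F :: "'a \<Rightarrow> 'b::comm_ring_1"
  assumes "finite A" "keys z \<subseteq> A"
  shows "(\<Sum>t\<in>keys z. of_int (lookup z t) * F t) = (\<Sum>t\<in>A. of_int (lookup z t) * F t)"
  using assms by (intro sum.mono_neutral_left) (auto simp: in_keys_iff)

lemma sum_keys_add:
  fixes F :: "'a \<Rightarrow> 'b::comm_ring_1"
  shows "(\<Sum>t\<in>keys (z + w). of_int (lookup (z + w) t) * F t) =
    (\<Sum>t\<in>keys z. of_int (lookup z t) * F t) + (\<Sum>t\<in>keys w. of_int (lookup w t) * F t)"
  using sum_keys_superset[of "keys z \<union> keys w" z F] sum_keys_superset[of "keys z \<union> keys w" w F]
    sum_keys_superset[of "keys z \<union> keys w" "z + w" F] keys_add[of z w]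
  by (simp add: lookup_add distrib_right sum.distrib)

lemma sum_keys_cmul:
  fixes F :: "'a \<Rightarrow> 'b::comm_ring_1"
  shows "(\<Sum>t\<in>keys (frag_cmul m z). of_int (lookup (frag_cmul m z) t) * F t) =
    of_int m * (\<Sum>t\<in>keys z. of_int (lookup z t) * F t)"
  using sum_keys_superset[of "keys z" "frag_cmul m z" F] keys_cmul[of m z]
  by (simp add: sum_distrib_left mult.assoc)

lemma opz_add: "opz (z + w) f = opz z f + opz w f"
  unfolding opz_def by (rule sum_keys_add)

lemma opz_cmul: "opz (frag_cmul m z) f = of_int m * opz z f"
  unfolding opz_def by (rule sum_keys_cmul)

lemma opz_0 [simp]: "opz 0 f = 0"
  by (simp add: opz_def)

lemma opz_uminus: "opz (- z) f = - opz z f"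
  using opz_cmul[of "- 1" z f] by simp

lemma opz_diff: "opz (z - w) f = opz z f - opz w f"
  using opz_add[of z "- w" f] by (simp add: opz_uminus)

lemma opz_of: "opz (frag_of t) f = rep t f"
  by (simp add: opz_def)

lemma csum_eq: "csum z = (\<Sum>t\<in>keys z. of_int (lookup z t) * 1)"
  by (simp add: csum_def)

lemma csum_add: "csum (z + w) = csum z + csum w"
  unfolding csum_eq by (rule sum_keys_add)

lemma csum_cmul: "csum (frag_cmul m z) = m * csum z"
  unfolding csum_eq using sum_keys_cmul[where F = "\<lambda>_. 1 :: int"] by simp

lemma csum_uminus: "csum (- z) = - csum z"
  using csum_cmul[of "- 1" z] by simp

lemma csum_of: "csum (frag_of t) = 1"
  by (simp add: csum_def)

lemma csum_0 [simp]: "csum 0 = 0"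
  by (simp add: csum_def)

lemma opz_sum: "opz (sum z A) f = (\<Sum>i\<in>A. opz (z i) f)"
  by (induction A rule: infinite_finite_induct) (auto simp: opz_add)

lemma csum_sum: "csum (sum z A) = (\<Sum>i\<in>A. csum (z i))"
  by (induction A rule: infinite_finite_induct) (auto simp: csum_add)

lemma opz_frag_extend: "opz (frag_extend b x) f = (\<Sum>i\<in>keys x. of_int (lookup x i) * opz (b i) f)"
  by (simp add: frag_extend_def opz_sum opz_cmul)

lemma csum_frag_extend: "csum (frag_extend b x) = (\<Sum>i\<in>keys x. lookup x i * csum (b i))"
  by (simp add: frag_extend_def csum_sum csum_cmul)

lemma opz_linear:
  assumes N: "N \<ge> 1" and z: "keys z \<subseteq> carrier (TN N)"
  shows "opz z (f - h) = opz z f - opz z h" "opz z (sum \<phi> A) = (\<Sum>i\<in>A. opz z (\<phi> i))"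
    "opz z (of_int m * f) = of_int m * opz z f" "f \<in> ordge q \<Longrightarrow> opz z f \<in> ordge q"
proof -
  have e: "alg_endo (rep t)" if "t \<in> keys z" for t
    using GvolD(1)[OF rep_TN(1)[OF N]] z that by blast
  have int: "g (of_int m) = of_int m" if "alg_endo g" for g :: "('a, 'b) aut" and m
  proof -
    have "g (of_nat n) = of_nat n" for n
      by (induction n) (simp_all add: alg_endoD[OF that])
    then show ?thesis by (cases m rule: int_cases2) (simp_all add: alg_endoD[OF that])
  qed
  show "opz z (f - h) = opz z f - opz z h"
    by (simp add: opz_def alg_endoD[OF e] algebra_simps flip: sum_subtractf)
  show "opz z (of_int m * f) = of_int m * opz z f"
    by (simp add: opz_def alg_endoD[OF e] int[OF e] sum_distrib_left mult.left_commute)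
  show "opz z (sum \<phi> A) = (\<Sum>i\<in>A. opz z (\<phi> i))"
    unfolding opz_def by (subst sum.swap) (simp add: alg_endo_sum[OF e] sum_distrib_left)
  show "opz z f \<in> ordge q" if "f \<in> ordge q"
    unfolding opz_def using alg_endo_ordge[OF e that] by (intro ordge_sum ordge_mult'[of _ 0 _ q q]) auto
qed

lemma ZT_simps [simp]:
  "ring.add (ZT N) = (+)" "carrier (ZT N) = {z. keys z \<subseteq> carrier (TN N)}" "\<zero>\<^bsub>ZT N\<^esub> = 0"
  "z \<otimes>\<^bsub>ZT N\<^esub> w = frag_extend (\<lambda>t. frag_extend (\<lambda>u. frag_of (t \<otimes>\<^bsub>TN N\<^esub> u)) w) z"
  by (simp_all add: ZT_def)

lemma ZT_mult_closed:
  assumes N: "N \<ge> 1" and "keys z \<subseteq> carrier (TN N)" "keys w \<subseteq> carrier (TN N)"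
  shows "keys (z \<otimes>\<^bsub>ZT N\<^esub> w) \<subseteq> carrier (TN N)"
proof
  fix s assume "s \<in> keys (z \<otimes>\<^bsub>ZT N\<^esub> w)"
  then obtain t where t: "t \<in> keys z" "s \<in> keys (frag_extend (\<lambda>u. frag_of (t \<otimes>\<^bsub>TN N\<^esub> u)) w)"
    using keys_frag_extend by fastforce
  then obtain u where "u \<in> keys w" "s = t \<otimes>\<^bsub>TN N\<^esub> u"
    using keys_frag_extend[of "\<lambda>u. frag_of (t \<otimes>\<^bsub>TN N\<^esub> u)" w] by (fastforce simp: keys_frag_of)
  moreover from this have "u \<in> carrier (TN N)" "t \<in> carrier (TN N)" using t assms(2,3) by auto
  ultimately show "s \<in> carrier (TN N)"
    using monoid.m_closed[OF group.is_monoid[OF group_TN[OF N]]] by simp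
qed

lemma csum_mult: "csum (z \<otimes>\<^bsub>ZT N\<^esub> w) = csum z * csum w"
proof -
  have "csum (frag_extend (\<lambda>u. frag_of (t \<otimes>\<^bsub>TN N\<^esub> u)) w) = csum w" for t
    by (simp add: csum_frag_extend csum_of) (simp add: csum_def)
  then show ?thesis by (simp add: csum_frag_extend) (simp add: csum_def[of z] sum_distrib_right)
qed

text \<open>The representative of a product of cosets and the product of the representatives lie in
  the same coset, hence agree only up to order N.\<close>

lemma opz_mult:
  assumes N: "N \<ge> 1" and z: "keys z \<subseteq> carrier (TN N)" and w: "keys w \<subseteq> carrier (TN N)"
  shows "opz (z \<otimes>\<^bsub>ZT N\<^esub> w) f - opz z (opz w f) \<in> ordge N"
proof -
  have "opz (z \<otimes>\<^bsub>ZT N\<^esub> w) f = (\<Sum>t\<in>keys z. \<Sum>u\<in>keys w.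
      of_int (lookup z t) * (of_int (lookup w u) * rep (t \<otimes>\<^bsub>TN N\<^esub> u) f))"
    by (simp add: opz_frag_extend opz_of sum_distrib_left)
  moreover have "opz z (opz w f) = (\<Sum>t\<in>keys z. \<Sum>u\<in>keys w.
      of_int (lookup z t) * (of_int (lookup w u) * rep t (rep u f)))"
  proof -
    have "opz z (opz w f) = (\<Sum>u\<in>keys w. of_int (lookup w u) * opz z (rep u f))"
      using z unfolding opz_def[of w] by (simp add: opz_linear[OF N])
    also have "\<dots> = (\<Sum>u\<in>keys w. \<Sum>t\<in>keys z. of_int (lookup z t) * (of_int (lookup w u) * rep t (rep u f)))"
      by (simp add: opz_def[of z] sum_distrib_left mult.left_commute)
    finally show ?thesis by (subst sum.swap)
  qed
  moreover have "rep (t \<otimes>\<^bsub>TN N\<^esub> u) f - rep t (rep u f) \<in> ordge N" if "t \<in> keys z" "u \<in> keys w" for t u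
  proof -
    have t: "t \<in> carrier (TN N)" and u: "u \<in> carrier (TN N)" using that z w by auto
    have "t \<otimes>\<^bsub>TN N\<^esub> u = toT N (rep t \<circ> rep u)"
      using toT_comp[OF N rep_TN(1)[OF N t] rep_TN(1)[OF N u]] rep_TN(2)[OF N t] rep_TN(2)[OF N u] by simp
    then show ?thesis
      using rep_toT(3)[OF N Gvol_comp[OF rep_TN(1)[OF N t] rep_TN(1)[OF N u]], of f] by simp
  qed
  then have "of_int (lookup z t) * (of_int (lookup w u) * (rep (t \<otimes>\<^bsub>TN N\<^esub> u) f - rep t (rep u f))) \<in> ordge N"
    if "t \<in> keys z" "u \<in> keys w" for t u
    using that by (intro ordge_mult'[of _ 0 _ N]) auto
  then have "(\<Sum>t\<in>keys z. \<Sum>u\<in>keys w. of_int (lookup z t) *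
      (of_int (lookup w u) * (rep (t \<otimes>\<^bsub>TN N\<^esub> u) f - rep t (rep u f)))) \<in> ordge N"
    by (intro ordge_sum) auto
  ultimately show ?thesis by (simp add: right_diff_distrib sum_subtractf)
qed

section \<open>The action on B_N as order estimates on power series\<close>

lemma BN_ring: "ring (BN N :: ('n::finite, 'k::comm_ring_1) mfps set ring)"
  unfolding BN_def mpow_eq_ordge by (rule ideal.quotient_is_ring[OF ideal_ordge])

lemma BN_simps:
  "carrier (BN N) = range (acs (ordge N))" "\<zero>\<^bsub>BN N\<^esub> = ordge N"
  "acs (ordge N) f \<oplus>\<^bsub>BN N\<^esub> acs (ordge N) h = acs (ordge N) (f + h)"
  by (auto simp: BN_def mpow_eq_ordge FactRing_def A_RCOSETS_def' a_r_coset_eq_acs[OF add_psr]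
      set_add_acs[OF add_psr asub_ordge])

lemma add_pow_BN:
  fixes f :: "('n::finite, 'k::comm_ring_1) mfps"
  shows "add_pow (BN N) (m :: int) (acs (ordge N) f) = acs (ordge N) (of_int m * f)"
proof -
  interpret ring "BN N :: ('n, 'k) mfps set ring" by (rule BN_ring)
  have nat: "add_pow (BN N) (k :: nat) (acs (ordge N) f) = acs (ordge N) (of_nat k * f)" for k
  proof (induction k)
    case 0
    then show ?case by (simp add: add_pow_def BN_simps acs_0)
  next
    case (Suc k)
    have "add_pow (BN N) (Suc k) (acs (ordge N) f) = add_pow (BN N) k (acs (ordge N) f) \<oplus>\<^bsub>BN N\<^esub> acs (ordge N) f"
      by (simp add: add_pow_def)
    then show ?case by (simp add: Suc BN_simps algebra_simps)
  qed
  have neg: "\<ominus>\<^bsub>BN N\<^esub> acs (ordge N) h = acs (ordge N) (- h)" for h :: "('n, 'k) mfps"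
    by (rule minus_equality) (auto simp: BN_simps acs_0)
  show ?thesis
  proof (cases "m \<ge> 0")
    case True
    then show ?thesis by (simp add: add_pow_int_ge nat)
  next
    case False
    then have "(of_nat (nat (- m)) :: ('n, 'k) mfps) = of_int (- m)"
      by (simp add: of_nat_nat)
    then show ?thesis using False by (simp add: add_pow_int_lt nat neg)
  qed
qed

lemma T_act_toT:
  assumes N: "N \<ge> 1" and t: "t \<in> carrier (TN N)"
  shows "T_act t (acs (ordge N) f) = acs (ordge N) (rep t f)"
proof -
  note g = rep_TN[OF N t]
  have "h ` acs (ordge N) f = acs (ordge N) (rep t f)" if "h \<in> t" for h
  proof -
    have h: "h \<in> carrier Gvol" "h f - rep t f \<in> ordge N"
      using mem_toT[OF N g(1)] that g(2) by auto
    have "h ` acs (ordge N) f = acs (ordge N) (h f)"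
    proof safe
      fix x assume "x \<in> acs (ordge N) f"
      then have "h (x - f) \<in> ordge N"
        using alg_endo_ordge[OF GvolD(1)[OF h(1)]] by (simp add: mem_acs[OF asub_ordge])
      then show "h x \<in> acs (ordge N) (h f)"
        by (simp add: mem_acs[OF asub_ordge] alg_endoD[OF GvolD(1)[OF h(1)]])
    next
      fix y assume "y \<in> acs (ordge N) (h f)"
      then have "h (inv_into UNIV h y - f) \<in> ordge N"
        by (simp add: mem_acs[OF asub_ordge] alg_endoD[OF GvolD(1)[OF h(1)]] Gvol_inv_apply[OF h(1)])
      then have "inv_into UNIV h y \<in> acs (ordge N) f"
        using Gvol_reflects_ordge[OF h(1)] by (simp add: mem_acs[OF asub_ordge])
      then show "y \<in> h ` acs (ordge N) f" by (rule image_eqI[rotated]) (simp add: Gvol_inv_apply[OF h(1)])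
    qed
    also have "\<dots> = acs (ordge N) (rep t f)" using h(2) by (simp add: acs_eq_iff[OF asub_ordge])
    finally show ?thesis .
  qed
  moreover have "t \<noteq> {}" using rep_toT(1)[OF N g(1)] g(2) by auto
  ultimately show ?thesis unfolding T_act_def by blast
qed

lemma rhoZ_eq_opz:
  fixes z :: "('n::finite, 'k::comm_ring_1) ztn"
  assumes N: "N \<ge> 1" and z: "keys z \<subseteq> carrier (TN N)"
  shows "rhoZ N z (acs (ordge N) f) = acs (ordge N) (opz z f)"
proof -
  interpret ring "BN N :: ('n, 'k) mfps set ring" by (rule BN_ring)
  have "(\<Oplus>\<^bsub>BN N\<^esub>t\<in>A. acs (ordge N) (\<phi> t)) = acs (ordge N) (\<Sum>t\<in>A. \<phi> t)" if "finite A"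
    for A and \<phi> :: "('n, 'k) tn \<Rightarrow> ('n, 'k) mfps"
    using that
  proof (induction A)
    case (insert t A)
    then show ?case by (subst finsum_insert) (auto simp: BN_simps)
  qed (simp add: BN_simps acs_0)
  moreover have "(\<Oplus>\<^bsub>BN N\<^esub>t\<in>keys z. add_pow (BN N) (lookup z t) (T_act t (acs (ordge N) f))) =
      (\<Oplus>\<^bsub>BN N\<^esub>t\<in>keys z. acs (ordge N) (of_int (lookup z t) * rep t f))"
    using z by (intro finsum_cong') (auto simp: T_act_toT[OF N] add_pow_BN BN_simps)
  ultimately show ?thesis by (simp add: rhoZ_def opz_def)
qed

lemma BF_eq: "BF N q = acs (ordge N) ` (ordge (min q N) :: ('n::finite, 'k::comm_ring_1) mfps set)"
proof -
  have "mpow q <+>\<^bsub>psr\<^esub> mpow N = (ordge (min q N) :: ('n, 'k) mfps set)"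
  proof -
    have "mpow q <+>\<^bsub>psr\<^esub> mpow N = {h + k |h k. h \<in> ordge q \<and> k \<in> (ordge N :: ('n, 'k) mfps set)}"
      by (auto simp: set_add_def' add_psr mpow_eq_ordge)
    also have "\<dots> = ordge (min q N)"
    proof (cases "q \<le> N")
      case True
      then have "h + k \<in> ordge q" if "h \<in> ordge q" "k \<in> ordge N" for h k :: "('n, 'k) mfps"
        using ordge_add[OF that(1) ordge_mono[OF that(2), of q]] by simp
      moreover have "\<exists>h k. f = h + k \<and> h \<in> ordge q \<and> k \<in> ordge N" if "f \<in> ordge q" for f :: "('n, 'k) mfps"
        using that by (intro exI[of _ f] exI[of _ 0]) simp
      ultimately show ?thesis using True by (auto simp: min_def)
    next
      case False
      then have "h + k \<in> ordge N" if "h \<in> ordge q" "k \<in> ordge N" for h k :: "('n, 'k) mfps"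
        using ordge_add[OF ordge_mono[OF that(1), of N] that(2)] by simp
      moreover have "\<exists>h k. f = h + k \<and> h \<in> ordge q \<and> k \<in> ordge N" if "f \<in> ordge N" for f :: "('n, 'k) mfps"
        using that by (intro exI[of _ 0] exI[of _ f]) simp
      ultimately show ?thesis using False by (auto simp: min_def)
    qed
    finally show ?thesis .
  qed
  then show ?thesis by (auto simp: BF_def a_r_coset_eq_acs[OF add_psr] mpow_eq_ordge)
qed

text \<open>Turns the filtration condition on cosets into an estimate on power series, capped at N
  because everything of order N is 0 in B_N.\<close>

lemma augI_iff:
  fixes z :: "('n::finite, 'k::comm_ring_1) ztn"
  assumes N: "N \<ge> 1"
  shows "z \<in> augI N a \<longleftrightarrow> keys z \<subseteq> carrier (TN N) \<and> csum z = 0 \<and>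
    (\<forall>q. \<forall>f\<in>ordge q. opz z f \<in> ordge (min (q + a) N))"
proof (cases "keys z \<subseteq> carrier (TN N)")
  case True
  have BFmem: "acs (ordge N) h \<in> BF N q \<longleftrightarrow> h \<in> ordge (min q N)" for h :: "('n, 'k) mfps" and q
  proof
    assume "acs (ordge N) h \<in> BF N q"
    then obtain k where k: "k \<in> ordge (min q N)" "acs (ordge N) h = acs (ordge N) k"
      unfolding BF_eq by blast
    then have k2: "h - k \<in> ordge N" by (simp add: acs_eq_iff[OF asub_ordge])
    have "(h - k) + k \<in> ordge (min q N)" by (rule ordge_add[OF ordge_mono[OF k2] k(1)]) simp
    then show "h \<in> ordge (min q N)" by simp
  qed (auto simp: BF_eq)
  have A: "rhoZ N z ` BF N q \<subseteq> BF N (q + a) \<longleftrightarrow> (\<forall>f\<in>ordge (min q N). opz z f \<in> ordge (min (q + a) N))" for q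
  proof -
    have "rhoZ N z ` BF N q = (\<lambda>f. acs (ordge N) (opz z f)) ` ordge (min q N)"
      by (simp add: BF_eq image_image rhoZ_eq_opz[OF N True])
    then show ?thesis using BFmem by (simp add: image_subset_iff)
  qed
  \<comment> \<open>The filtration of B_N is stationary from q = N on, and min (min q N + a) N is
    still at least min (q + a) N.\<close>
  have B: "(\<forall>q. \<forall>f\<in>ordge (min q N). opz z f \<in> ordge (min (q + a) N)) \<longleftrightarrow>
      (\<forall>q. \<forall>f\<in>ordge q. opz z f \<in> ordge (min (q + a) N))"
  proof (intro iffI allI ballI)
    fix q and f :: "('n, 'k) mfps" assume H: "\<forall>q. \<forall>f\<in>ordge (min q N). opz z f \<in> ordge (min (q + a) N)" and f: "f \<in> ordge q"
    have "f \<in> ordge (min q N)" using f by (rule ordge_mono) simp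
    then show "opz z f \<in> ordge (min (q + a) N)" using H by blast
  next
    fix q and f :: "('n, 'k) mfps" assume H: "\<forall>q. \<forall>f\<in>ordge q. opz z f \<in> ordge (min (q + a) N)" and f: "f \<in> ordge (min q N)"
    then have "opz z f \<in> ordge (min (min q N + a) N)" by blast
    then show "opz z f \<in> ordge (min (q + a) N)" by (rule ordge_mono) auto
  qed
  have "z \<in> augI N a \<longleftrightarrow> csum z = 0 \<and> (\<forall>q. rhoZ N z ` BF N q \<subseteq> BF N (q + a))"
    using True unfolding augI_def csum_def ZT_simps(2) by blast
  then show ?thesis unfolding A B using True by blast
qed (simp add: augI_def)


section \<open>Vector spaces as module records\<close>

lemma kring_simps [simp]:
  "carrier kring = UNIV" "x \<otimes>\<^bsub>kring\<^esub> y = x * y" "x \<oplus>\<^bsub>kring\<^esub> y = x + y" "\<zero>\<^bsub>kring\<^esub> = 0" "\<one>\<^bsub>kring\<^esub> = 1"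
  by (simp_all add: kring_def ring_of_type_algebra_def)

lemma cring_kring: "cring (kring :: 'k::field ring)"
  unfolding kring_def by (rule cring_from_type_algebra)

lemma kring_uminus [simp]: "\<ominus>\<^bsub>kring\<^esub> x = - (x :: 'k::field)"
  by (rule abelian_group.minus_equality[OF ring.is_abelian_group[OF cring.axioms(1)[OF cring_kring]]]) auto

lemma submodule_kringI:
  assumes M: "Module.module (kring :: 'k::field ring) M" and H: "H \<subseteq> carrier M" "\<zero>\<^bsub>M\<^esub> \<in> H"
    "\<And>x y. x \<in> H \<Longrightarrow> y \<in> H \<Longrightarrow> x \<oplus>\<^bsub>M\<^esub> y \<in> H" "\<And>(c :: 'k) x. x \<in> H \<Longrightarrow> c \<odot>\<^bsub>M\<^esub> x \<in> H"
  shows "submodule H kring M"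
proof -
  interpret Module.module "kring :: 'k ring" M by (rule M)
  show ?thesis
  proof (rule submoduleI)
    show "\<ominus>\<^bsub>M\<^esub> a \<in> H" if "a \<in> H" for a
    proof -
      have a: "a \<in> carrier M" using that H(1) by blast
      have "(- 1 :: 'k) \<odot>\<^bsub>M\<^esub> a = \<ominus>\<^bsub>M\<^esub> a"
        using smult_l_minus[of 1 a] a smult_one[OF a] by simp
      then show ?thesis using H(4)[OF that, of "- 1"] by simp
    qed
  qed (use H in auto)
qed

lemma submodule_kringD:
  assumes "submodule H (kring :: 'k::field ring) M"
  shows "H \<subseteq> carrier M" "\<zero>\<^bsub>M\<^esub> \<in> H" "x \<in> H \<Longrightarrow> y \<in> H \<Longrightarrow> x \<oplus>\<^bsub>M\<^esub> y \<in> H"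
    "x \<in> H \<Longrightarrow> (c :: 'k) \<odot>\<^bsub>M\<^esub> x \<in> H"
proof -
  interpret submodule H "kring :: 'k ring" M by (rule assms)
  show "H \<subseteq> carrier M" "\<zero>\<^bsub>M\<^esub> \<in> H" "x \<in> H \<Longrightarrow> y \<in> H \<Longrightarrow> x \<oplus>\<^bsub>M\<^esub> y \<in> H"
    "x \<in> H \<Longrightarrow> (c :: 'k) \<odot>\<^bsub>M\<^esub> x \<in> H"
    using subset one_closed m_closed smult_closed by auto
qed

lemma kspan_subset: "submodule H kring M \<Longrightarrow> S \<subseteq> H \<Longrightarrow> kspan M S \<subseteq> H"
  unfolding kspan_def by blast

lemma kspan_superset: "S \<subseteq> kspan M S"
  unfolding kspan_def by blast

lemma kspan_submodule:
  assumes M: "Module.module (kring :: 'k::field ring) M" and S: "S \<subseteq> carrier M"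
  shows "submodule (kspan M S) (kring :: 'k ring) M"
proof (rule submodule_kringI[OF M])
  have "submodule (carrier M) (kring :: 'k ring) M"
    using M by (rule Module.module.carrier_is_submodule)
  then show "kspan M S \<subseteq> carrier M" using S by (rule kspan_subset)
qed (auto simp: kspan_def intro: submodule_kringD)

lemma module_vf_mod:
  fixes C :: "('n::finite, 'k::field) vf set"
  assumes "(\<lambda>i. 0) \<in> C" "\<And>D E. D \<in> C \<Longrightarrow> E \<in> C \<Longrightarrow> (\<lambda>i. D i + E i) \<in> C"
    "\<And>c D. D \<in> C \<Longrightarrow> (\<lambda>i. pconst c * D i) \<in> C"
  shows "Module.module kring (vf_mod C)"
proof (intro moduleI abelian_groupI cring_kring)
  fix x assume "x \<in> carrier (vf_mod C)"
  then show "\<exists>y\<in>carrier (vf_mod C). y \<oplus>\<^bsub>vf_mod C\<^esub> x = \<zero>\<^bsub>vf_mod C\<^esub>"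
    using assms(3)[of x "- 1"] by (auto simp: vf_mod_def pconst_uminus intro!: bexI[of _ "\<lambda>i. - x i"])
qed (use assms in \<open>auto simp: vf_mod_def algebra_simps pconst_add pconst_mult\<close>)

lemma module_Lvf: "Module.module kring (vf_mod (Lvf d))"
  by (rule module_vf_mod) (auto intro: Lvf_0 Lvf_add Lvf_scale)

lemma module_SymV: "Module.module kring (vf_mod (SymV d))"
  by (rule module_vf_mod) (auto intro: SymV_0 SymV_add SymV_scale)

lemma abelian_subgroup_submodule:
  assumes M: "Module.module (kring :: 'k::field ring) M" and U: "submodule U (kring :: 'k ring) M"
  shows "abelian_subgroup U M"
proof -
  interpret Module.module "kring :: 'k ring" M by (rule M)
  interpret submodule U "kring :: 'k ring" M by (rule U)
  show ?thesis
    by (rule abelian_subgroupI3) (auto simp: additive_subgroup_def subgroup_axioms intro: M.abelian_group_axioms)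
qed

lemma quot_coset_eq_iff:
  assumes M: "Module.module (kring :: 'k::field ring) M" and U: "submodule U (kring :: 'k ring) M"
    and xy: "x \<in> carrier M" "y \<in> carrier M"
  shows "U +>\<^bsub>M\<^esub> x = U +>\<^bsub>M\<^esub> y \<longleftrightarrow> x \<ominus>\<^bsub>M\<^esub> y \<in> U"
proof -
  interpret abelian_subgroup U M by (rule abelian_subgroup_submodule[OF M U])
  have "x \<ominus>\<^bsub>M\<^esub> y \<in> U \<longleftrightarrow> x \<in> U +>\<^bsub>M\<^esub> y" using a_rcos_module[OF xy(2,1)] by (simp add: a_minus_def)
  then show ?thesis
    using a_repr_independence[OF _ xy(2) a_subgroup, of x] a_rcos_self[OF xy(1)] by auto
qed

text \<open>The union defining \<open>smult\<close> collapses to one coset because U is closed under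
  scalars.\<close>

lemma quot_mod_simps:
  assumes M: "Module.module (kring :: 'k::field ring) M" and U: "submodule U (kring :: 'k ring) M"
  shows "carrier (quot_mod M U) = (\<lambda>x. U +>\<^bsub>M\<^esub> x) ` carrier M" "\<zero>\<^bsub>quot_mod M U\<^esub> = U"
    "x \<in> carrier M \<Longrightarrow> y \<in> carrier M \<Longrightarrow>
      (U +>\<^bsub>M\<^esub> x) \<oplus>\<^bsub>quot_mod M U\<^esub> (U +>\<^bsub>M\<^esub> y) = U +>\<^bsub>M\<^esub> (x \<oplus>\<^bsub>M\<^esub> y)"
    "x \<in> carrier M \<Longrightarrow> (c :: 'k) \<odot>\<^bsub>quot_mod M U\<^esub> (U +>\<^bsub>M\<^esub> x) = U +>\<^bsub>M\<^esub> (c \<odot>\<^bsub>M\<^esub> x)"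
proof -
  interpret Module.module "kring :: 'k ring" M by (rule M)
  interpret AS: abelian_subgroup U M by (rule abelian_subgroup_submodule[OF M U])
  show "carrier (quot_mod M U) = (\<lambda>x. U +>\<^bsub>M\<^esub> x) ` carrier M" "\<zero>\<^bsub>quot_mod M U\<^esub> = U"
    by (auto simp: quot_mod_def A_RCOSETS_def')
  show "x \<in> carrier M \<Longrightarrow> y \<in> carrier M \<Longrightarrow>
      (U +>\<^bsub>M\<^esub> x) \<oplus>\<^bsub>quot_mod M U\<^esub> (U +>\<^bsub>M\<^esub> y) = U +>\<^bsub>M\<^esub> (x \<oplus>\<^bsub>M\<^esub> y)"
    by (simp add: quot_mod_def AS.a_rcos_sum)
  assume x: "x \<in> carrier M"
  have "U +>\<^bsub>M\<^esub> (c \<odot>\<^bsub>M\<^esub> x') = U +>\<^bsub>M\<^esub> (c \<odot>\<^bsub>M\<^esub> x)" if "x' \<in> U +>\<^bsub>M\<^esub> x" for x'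
  proof -
    have x': "x' \<in> carrier M" using that x submodule_kringD(1)[OF U] by (auto simp: a_r_coset_def')
    have "x' \<ominus>\<^bsub>M\<^esub> x \<in> U" using AS.a_rcos_module[OF x x'] that by (simp add: a_minus_def)
    then have "c \<odot>\<^bsub>M\<^esub> (x' \<ominus>\<^bsub>M\<^esub> x) \<in> U" by (rule submodule_kringD(4)[OF U])
    then have "c \<odot>\<^bsub>M\<^esub> x' \<ominus>\<^bsub>M\<^esub> c \<odot>\<^bsub>M\<^esub> x \<in> U"
      using x x' by (simp add: a_minus_def smult_r_distr smult_r_minus)
    then show ?thesis using quot_coset_eq_iff[OF M U] x x' by simp
  qed
  moreover have "x \<in> U +>\<^bsub>M\<^esub> x" using AS.a_rcos_self[OF x] .
  ultimately have "(\<Union>x'\<in>U +>\<^bsub>M\<^esub> x. U +>\<^bsub>M\<^esub> (c \<odot>\<^bsub>M\<^esub> x')) = U +>\<^bsub>M\<^esub> (c \<odot>\<^bsub>M\<^esub> x)" by blast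
  then show "c \<odot>\<^bsub>quot_mod M U\<^esub> (U +>\<^bsub>M\<^esub> x) = U +>\<^bsub>M\<^esub> (c \<odot>\<^bsub>M\<^esub> x)" by (simp add: quot_mod_def)
qed

lemma quot_mod_module:
  assumes M: "Module.module (kring :: 'k::field ring) M" and U: "submodule U (kring :: 'k ring) M"
  shows "Module.module (kring :: 'k ring) (quot_mod M U)"
proof -
  interpret Module.module "kring :: 'k ring" M by (rule M)
  interpret AS: abelian_subgroup U M by (rule abelian_subgroup_submodule[OF M U])
  note S = quot_mod_simps[OF M U]
  have z: "U = U +>\<^bsub>M\<^esub> \<zero>\<^bsub>M\<^esub>" using a_coset_add_zero submodule_kringD(1)[OF U] by simp
  show ?thesis
  proof (intro moduleI abelian_groupI cring_kring)
    fix x assume "x \<in> carrier (quot_mod M U)"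
    then obtain a where a: "a \<in> carrier M" "x = U +>\<^bsub>M\<^esub> a" by (auto simp: S(1))
    then show "\<exists>y\<in>carrier (quot_mod M U). y \<oplus>\<^bsub>quot_mod M U\<^esub> x = \<zero>\<^bsub>quot_mod M U\<^esub>"
      by (intro bexI[of _ "U +>\<^bsub>M\<^esub> (\<ominus>\<^bsub>M\<^esub> a)"]) (auto simp: S l_neg simp flip: z)
    show "\<zero>\<^bsub>quot_mod M U\<^esub> \<oplus>\<^bsub>quot_mod M U\<^esub> x = x"
      using a unfolding S(2) by (subst z) (simp add: S)
  next
    show "\<zero>\<^bsub>quot_mod M U\<^esub> \<in> carrier (quot_mod M U)"
      unfolding S(1,2) by (subst z) (rule imageI, simp)
  next
    fix x y assume "x \<in> carrier (quot_mod M U)" "y \<in> carrier (quot_mod M U)"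
    then obtain a b where "a \<in> carrier M" "x = U +>\<^bsub>M\<^esub> a" "b \<in> carrier M" "y = U +>\<^bsub>M\<^esub> b" by (auto simp: S(1))
    then show "x \<oplus>\<^bsub>quot_mod M U\<^esub> y \<in> carrier (quot_mod M U)"
      "x \<oplus>\<^bsub>quot_mod M U\<^esub> y = y \<oplus>\<^bsub>quot_mod M U\<^esub> x" by (auto simp: S M.a_comm)
  qed (auto simp: S M.a_assoc smult_l_distr[simplified] smult_r_distr[simplified] smult_assoc1[simplified]
      smult_one[simplified] smult_closed[simplified])
qed

lemma lin_mapD:
  assumes "lin_map M M' f"
  shows "Module.module kring M" "Module.module kring M'" "x \<in> carrier M \<Longrightarrow> f x \<in> carrier M'"
    "x \<in> carrier M \<Longrightarrow> y \<in> carrier M \<Longrightarrow> f (x \<oplus>\<^bsub>M\<^esub> y) = f x \<oplus>\<^bsub>M'\<^esub> f y"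
    "x \<in> carrier M \<Longrightarrow> f (c \<odot>\<^bsub>M\<^esub> x) = c \<odot>\<^bsub>M'\<^esub> f x"
  using assms by (auto simp: lin_map_def)

lemma lin_map_zero_minus:
  assumes f: "lin_map (M :: ('k::field, 'm) module) (M' :: ('k, 'l) module) f"
  shows "f \<zero>\<^bsub>M\<^esub> = \<zero>\<^bsub>M'\<^esub>" "x \<in> carrier M \<Longrightarrow> y \<in> carrier M \<Longrightarrow> f (x \<ominus>\<^bsub>M\<^esub> y) = f x \<ominus>\<^bsub>M'\<^esub> f y"
proof -
  interpret M: Module.module "kring :: 'k ring" M by (rule lin_mapD(1)[OF f])
  interpret M': Module.module "kring :: 'k ring" M' by (rule lin_mapD(2)[OF f])
  have z: "f \<zero>\<^bsub>M\<^esub> \<in> carrier M'" by (rule lin_mapD(3)[OF f]) simp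
  have "f \<zero>\<^bsub>M\<^esub> \<oplus>\<^bsub>M'\<^esub> f \<zero>\<^bsub>M\<^esub> = f \<zero>\<^bsub>M\<^esub>" using lin_mapD(4)[OF f, of "\<zero>\<^bsub>M\<^esub>" "\<zero>\<^bsub>M\<^esub>"] by simp
  then show f0: "f \<zero>\<^bsub>M\<^esub> = \<zero>\<^bsub>M'\<^esub>" using z M'.add.l_cancel_one by auto
  assume x: "x \<in> carrier M" and y: "y \<in> carrier M"
  have "f (x \<ominus>\<^bsub>M\<^esub> y) \<oplus>\<^bsub>M'\<^esub> f y = f ((x \<ominus>\<^bsub>M\<^esub> y) \<oplus>\<^bsub>M\<^esub> y)"
    using x y by (intro lin_mapD(4)[OF f, symmetric]) auto
  also have "(x \<ominus>\<^bsub>M\<^esub> y) \<oplus>\<^bsub>M\<^esub> y = x" using x y by (simp add: a_minus_def M.a_assoc M.l_neg)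
  finally have "f (x \<ominus>\<^bsub>M\<^esub> y) \<oplus>\<^bsub>M'\<^esub> f y \<ominus>\<^bsub>M'\<^esub> f y = f x \<ominus>\<^bsub>M'\<^esub> f y" by simp
  moreover have "f (x \<ominus>\<^bsub>M\<^esub> y) \<in> carrier M'" "f y \<in> carrier M'" using x y lin_mapD(3)[OF f] by auto
  ultimately show "f (x \<ominus>\<^bsub>M\<^esub> y) = f x \<ominus>\<^bsub>M'\<^esub> f y"
    by (simp add: a_minus_def M'.a_assoc M'.r_neg)
qed

lemma kernel_submodule:
  assumes f: "lin_map (M :: ('k::field, 'm) module) (M' :: ('k, 'l) module) f"
  shows "submodule {x \<in> carrier M. f x = \<zero>\<^bsub>M'\<^esub>} kring M"
proof -
  interpret M: Module.module "kring :: 'k ring" M by (rule lin_mapD(1)[OF f])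
  interpret M': Module.module "kring :: 'k ring" M' by (rule lin_mapD(2)[OF f])
  show ?thesis
  proof (rule submodule_kringI[OF lin_mapD(1)[OF f]])
    show "\<zero>\<^bsub>M\<^esub> \<in> {x \<in> carrier M. f x = \<zero>\<^bsub>M'\<^esub>}" by (simp add: lin_map_zero_minus(1)[OF f])
    show "c \<odot>\<^bsub>M\<^esub> x \<in> {x \<in> carrier M. f x = \<zero>\<^bsub>M'\<^esub>}" if "x \<in> {x \<in> carrier M. f x = \<zero>\<^bsub>M'\<^esub>}" for c x
      using that lin_mapD(5)[OF f, of x c] M.smult_closed[of c x] M'.smult_r_null[of c] by simp
    show "x \<oplus>\<^bsub>M\<^esub> y \<in> {x \<in> carrier M. f x = \<zero>\<^bsub>M'\<^esub>}"
      if "x \<in> {x \<in> carrier M. f x = \<zero>\<^bsub>M'\<^esub>}" "y \<in> {x \<in> carrier M. f x = \<zero>\<^bsub>M'\<^esub>}" for x y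
      using that lin_mapD(4)[OF f, of x y] by simp
  qed auto
qed

text \<open>The formula on cosets is part of the conclusion because the isomorphisms of the quotient
  must be compatible with the same projection from the symbols.\<close>

lemma first_isomorphism:
  assumes f: "lin_map (M :: ('k::field, 'm) module) (M' :: ('k, 'l) module) f"
    and surj: "f ` carrier M = carrier M'" and ker: "{x \<in> carrier M. f x = \<zero>\<^bsub>M'\<^esub>} = U"
  shows "\<exists>\<psi>. lin_iso (quot_mod M U) M' \<psi> \<and> (\<forall>x\<in>carrier M. \<psi> (U +>\<^bsub>M\<^esub> x) = f x)"
proof -
  note M = lin_mapD(1)[OF f]
  interpret M: Module.module "kring :: 'k ring" M by (rule M)
  interpret M': Module.module "kring :: 'k ring" M' by (rule lin_mapD(2)[OF f])
  have U: "submodule U (kring :: 'k ring) M" using kernel_submodule[OF f] unfolding ker .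
  interpret AS: abelian_subgroup U M by (rule abelian_subgroup_submodule[OF M U])
  note S = quot_mod_simps[OF M U]
  have eq: "U +>\<^bsub>M\<^esub> x = U +>\<^bsub>M\<^esub> y \<longleftrightarrow> f x = f y" if xy: "x \<in> carrier M" "y \<in> carrier M" for x y
  proof -
    have "U +>\<^bsub>M\<^esub> x = U +>\<^bsub>M\<^esub> y \<longleftrightarrow> f x \<ominus>\<^bsub>M'\<^esub> f y = \<zero>\<^bsub>M'\<^esub>"
    proof -
      have "x \<ominus>\<^bsub>M\<^esub> y \<in> carrier M" using xy by (rule M.minus_closed)
      moreover have "w \<in> U \<longleftrightarrow> w \<in> carrier M \<and> f w = \<zero>\<^bsub>M'\<^esub>" for w unfolding ker[symmetric] by blast
      ultimately show ?thesis
        unfolding quot_coset_eq_iff[OF M U xy] lin_map_zero_minus(2)[OF f xy, symmetric] by blast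
    qed
    moreover have "a \<ominus>\<^bsub>M'\<^esub> b = \<zero>\<^bsub>M'\<^esub> \<longleftrightarrow> a = b" if ab: "a \<in> carrier M'" "b \<in> carrier M'" for a b
    proof
      assume "a \<ominus>\<^bsub>M'\<^esub> b = \<zero>\<^bsub>M'\<^esub>"
      then have "a \<ominus>\<^bsub>M'\<^esub> b \<oplus>\<^bsub>M'\<^esub> b = b" using ab by simp
      then show "a = b" using ab by (simp add: a_minus_def M'.a_assoc M'.l_neg)
    qed (use ab in \<open>simp add: a_minus_def M'.r_neg\<close>)
    ultimately show ?thesis using lin_mapD(3)[OF f] xy by simp
  qed
  define \<psi> where "\<psi> A = f (SOME x. x \<in> carrier M \<and> A = U +>\<^bsub>M\<^esub> x)" for A
  have \<psi>: "\<psi> (U +>\<^bsub>M\<^esub> x) = f x" if x: "x \<in> carrier M" for x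
  proof -
    have "\<exists>y. y \<in> carrier M \<and> U +>\<^bsub>M\<^esub> x = U +>\<^bsub>M\<^esub> y" using x by blast
    from someI_ex[OF this] show ?thesis unfolding \<psi>_def using eq[OF x] by auto
  qed
  have "bij_betw \<psi> (carrier (quot_mod M U)) (carrier M')"
    unfolding bij_betw_def
  proof
    show "inj_on \<psi> (carrier (quot_mod M U))"
    proof (rule inj_onI)
      fix A B assume AB: "A \<in> carrier (quot_mod M U)" "B \<in> carrier (quot_mod M U)" "\<psi> A = \<psi> B"
      then obtain x y where "x \<in> carrier M" "A = U +>\<^bsub>M\<^esub> x" "y \<in> carrier M" "B = U +>\<^bsub>M\<^esub> y"
        unfolding S(1) by blast
      then show "A = B" using AB(3) eq by (simp add: \<psi>)
    qed
    show "\<psi> ` carrier (quot_mod M U) = carrier M'"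
      using surj by (auto simp: S(1) \<psi> image_image)
  qed
  moreover have "lin_map (quot_mod M U) M' \<psi>"
    unfolding lin_map_def
    using quot_mod_module[OF M U] lin_mapD(2)[OF f]
    by (auto simp: S \<psi> lin_mapD[OF f] M.smult_closed[simplified])
  ultimately show ?thesis using \<psi> unfolding lin_iso_def by blast
qed

lemma acs_self: "asub U \<Longrightarrow> z \<in> acs U z"
  by (simp add: mem_acs) (simp add: asub_def)

section \<open>The graded pieces of the augmentation ideal\<close>

lemma asub_augI:
  assumes N: "N \<ge> 1"
  shows "asub (augI N a :: ('n::finite, 'k::comm_ring_1) ztn set)"
proof -
  have "x - y \<in> augI N a" if "x \<in> augI N a" "y \<in> augI N a" for x y :: "('n, 'k) ztn"
  proof -
    have "keys (x - y) \<subseteq> keys x \<union> keys y" by (rule keys_diff)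
    moreover have "csum (x - y) = csum x - csum y" using csum_add[of x "- y"] by (simp add: csum_uminus)
    ultimately show ?thesis
      using that unfolding augI_iff[OF N] by (auto simp: opz_diff intro!: ordge_diff)
  qed
  moreover have "0 \<in> (augI N a :: ('n, 'k) ztn set)" by (simp add: augI_iff[OF N])
  ultimately show ?thesis by (simp add: asub_def)
qed

lemma augI_mono: "N \<ge> 1 \<Longrightarrow> a \<le> b \<Longrightarrow> z \<in> augI N b \<Longrightarrow> z \<in> augI N a"
proof -
  assume N: "N \<ge> 1" and ab: "a \<le> b" and z: "z \<in> augI N b"
  have "opz z f \<in> ordge (min (q + a) N)" if "f \<in> ordge q" for f q
    by (rule ordge_mono[of _ "min (q + b) N"]) (use z that ab in \<open>auto simp: augI_iff[OF N]\<close>)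
  then show ?thesis using z by (auto simp: augI_iff[OF N])
qed

lemma augI_cmul:
  fixes z :: "('a::finite, 'b::comm_ring_1) ztn"
  assumes N: "N \<ge> 1" and z: "z \<in> augI N a" shows "frag_cmul m z \<in> augI N a"
proof -
  have "of_int m * h \<in> ordge r" if "h \<in> ordge r" for h :: "('a, 'b) mfps" and r
    using ordge_mult'[of "of_int m" 0 h r r] that by simp
  then show ?thesis
    using z keys_cmul[of m z] unfolding augI_iff[OF N] by (auto simp: opz_cmul csum_cmul)
qed

lemma of_int_mfps: "(of_int m :: ('n::finite, 'k::comm_ring_1) mfps) = mconst (of_int m)"
proof -
  have "(of_nat n :: ('n, 'k) mfps) = mconst (of_nat n)" for n
    by (induction n) (simp_all add: mconst_add pconst_add mfps_of_pol_add)
  then show ?thesis by (cases m rule: int_cases2) (simp_all add: pconst_uminus mfps_of_pol_uminus)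
qed

text \<open>An integer that is 0 in k acts as 0 on power series over k, so the multiple acts as the
  zero operator and lies in every step of the filtration.\<close>

lemma augI_char:
  fixes z :: "('n::finite, 'k::comm_ring_1) ztn"
  assumes N: "N \<ge> 1" and z: "z \<in> augI N a" and m: "(of_int m :: 'k) = 0"
  shows "frag_cmul m z \<in> augI N b"
proof -
  have "(of_int m :: ('n, 'k) mfps) = 0" by (simp add: of_int_mfps m)
  then show ?thesis using z keys_cmul[of m z]
    unfolding augI_iff[OF N] by (auto simp: opz_cmul csum_cmul)
qed

lemma augI_mult:
  fixes z w :: "('a::finite, 'b::comm_ring_1) ztn"
  assumes N: "N \<ge> 1" and z: "z \<in> augI N a" and w: "w \<in> augI N b"
  shows "z \<otimes>\<^bsub>ZT N\<^esub> w \<in> augI N (a + b)"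
  unfolding augI_iff[OF N]
proof (intro conjI allI ballI)
  have k: "keys z \<subseteq> carrier (TN N)" "keys w \<subseteq> carrier (TN N)" using z w by (auto simp: augI_iff[OF N])
  show "keys (z \<otimes>\<^bsub>ZT N\<^esub> w) \<subseteq> carrier (TN N)" by (rule ZT_mult_closed[OF N k])
  show "csum (z \<otimes>\<^bsub>ZT N\<^esub> w) = 0" using z by (simp add: csum_mult augI_iff[OF N] del: ZT_simps)
  fix q and f :: "('a, 'b) mfps" assume f: "f \<in> ordge q"
  have "opz w f \<in> ordge (min (q + b) N)" using w f by (simp add: augI_iff[OF N])
  then have "opz z (opz w f) \<in> ordge (min (min (q + b) N + a) N)" using z by (simp add: augI_iff[OF N])
  then have "opz z (opz w f) \<in> ordge (min (q + (a + b)) N)" by (rule ordge_mono) auto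
  moreover have "opz (z \<otimes>\<^bsub>ZT N\<^esub> w) f - opz z (opz w f) \<in> ordge (min (q + (a + b)) N)"
    by (rule ordge_mono[OF opz_mult[OF N k]]) simp
  ultimately have "(opz (z \<otimes>\<^bsub>ZT N\<^esub> w) f - opz z (opz w f)) + opz z (opz w f) \<in> ordge (min (q + (a + b)) N)"
    by (rule ordge_add[rotated])
  then show "opz (z \<otimes>\<^bsub>ZT N\<^esub> w) f \<in> ordge (min (q + (a + b)) N)" by simp
qed

lemma gr_carrier: "carrier (gr N a) = acs (augI N (a + 1)) ` augI N a"
  by (auto simp: gr_def a_r_coset_eq_acs[OF ZT_simps(1)])

lemma gr_zero: "\<zero>\<^bsub>gr N a\<^esub> = acs (augI N (a + 1)) 0"
  by (simp add: gr_def acs_0)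

lemma gr_add:
  "N \<ge> 1 \<Longrightarrow> acs (augI N (a + 1)) z \<oplus>\<^bsub>gr N a\<^esub> acs (augI N (a + 1)) w = acs (augI N (a + 1)) (z + w)"
  by (simp add: gr_def set_add_acs[OF ZT_simps(1) asub_augI])

text \<open>Another integer lift of c changes the result by a multiple that is 0 in k, hence by an
  element of every \<open>augI\<close>; another representative z changes it within
  \<open>augI N (a + 1)\<close>. The double union is therefore one coset.\<close>

lemma gr_smult:
  fixes z :: "('n::finite, 'k::field) ztn"
  assumes N: "N \<ge> 1" and z: "z \<in> augI N a" and m: "of_int m = c"
  shows "c \<odot>\<^bsub>gr N a\<^esub> acs (augI N (a + 1)) z = acs (augI N (a + 1)) (frag_cmul m z)"
proof -
  note U = asub_augI[OF N, of "a + 1"]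
  have "acs (augI N (a + 1)) (frag_cmul m' w) = acs (augI N (a + 1)) (frag_cmul m z)"
    if "of_int m' = c" "w \<in> acs (augI N (a + 1)) z" for m' w
  proof -
    have "w - z \<in> augI N (a + 1)" using that(2) by (simp add: mem_acs[OF U])
    then have "frag_cmul m' (w - z) \<in> augI N (a + 1)" by (rule augI_cmul[OF N])
    moreover have "frag_cmul (m' - m) z \<in> augI N (a + 1)"
      by (rule augI_char[OF N z]) (simp add: that(1) m)
    ultimately have "frag_cmul m' (w - z) + frag_cmul (m' - m) z \<in> augI N (a + 1)" by (rule asub_add[OF U])
    also have "frag_cmul m' (w - z) + frag_cmul (m' - m) z = frag_cmul m' w - frag_cmul m z"
      by (rule poly_mapping_eqI) (simp add: lookup_add lookup_minus algebra_simps)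
    finally show ?thesis by (simp add: acs_eq_iff[OF U])
  qed
  then have "(\<Union>w\<in>acs (augI N (a + 1)) z. acs (augI N (a + 1)) (frag_cmul m' w)) = acs (augI N (a + 1)) (frag_cmul m z)"
    if "of_int m' = c" for m'
    using that acs_self[OF U, of z] by blast
  then have "(\<Union>m'\<in>{m'. of_int m' = c}. \<Union>w\<in>acs (augI N (a + 1)) z. acs (augI N (a + 1)) (frag_cmul m' w)) =
      acs (augI N (a + 1)) (frag_cmul m z)"
    using m by auto
  then show ?thesis by (simp add: gr_def a_r_coset_eq_acs[OF ZT_simps(1)])
qed

text \<open>The hypothesis \<open>sur\<close> says that the integers map onto k. It supplies the
  lift without which the union defining \<open>smult\<close> would be empty.\<close>

lemma module_gr:
  assumes N: "N \<ge> 1" and sur: "\<And>c :: 'k. \<exists>m :: int. of_int m = c"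
  shows "Module.module kring (gr N a :: ('k::field, ('n::finite, 'k) sym) module)"
proof (intro moduleI abelian_groupI cring_kring)
  let ?C = "acs (augI N (a + 1) :: ('n, 'k) ztn set)"
  note U = asub_augI[OF N, of "a + 1"] and A = asub_augI[OF N, of a]
  note S = gr_carrier gr_zero gr_add[OF N]
  fix x assume x: "x \<in> carrier (gr N a :: ('k, ('n, 'k) sym) module)"
  then obtain u where u: "u \<in> augI N a" "x = ?C u" by (auto simp: gr_carrier)
  show "\<exists>y\<in>carrier (gr N a). y \<oplus>\<^bsub>gr N a\<^esub> x = \<zero>\<^bsub>gr N a\<^esub>"
    using asub_uminus[OF A u(1)] by (intro bexI[of _ "?C (- u)"]) (auto simp: S u)
  show "\<zero>\<^bsub>gr N a\<^esub> \<oplus>\<^bsub>gr N a\<^esub> x = x" by (simp add: S u)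
  show "\<one>\<^bsub>kring\<^esub> \<odot>\<^bsub>gr N a\<^esub> x = x"
    using gr_smult[OF N u(1), of 1 1] by (simp add: u)
  {
    fix y assume "y \<in> carrier (gr N a :: ('k, ('n, 'k) sym) module)"
    then obtain v where v: "v \<in> augI N a" "y = ?C v" by (auto simp: gr_carrier)
    show "x \<oplus>\<^bsub>gr N a\<^esub> y \<in> carrier (gr N a)" using asub_add[OF A u(1) v(1)] by (auto simp: S u v)
    show "x \<oplus>\<^bsub>gr N a\<^esub> y = y \<oplus>\<^bsub>gr N a\<^esub> x" by (simp add: S u v add.commute[of u v])
    fix c :: 'k
    obtain m where m: "of_int m = c" using sur by blast
    show "c \<odot>\<^bsub>gr N a\<^esub> (x \<oplus>\<^bsub>gr N a\<^esub> y) = c \<odot>\<^bsub>gr N a\<^esub> x \<oplus>\<^bsub>gr N a\<^esub> c \<odot>\<^bsub>gr N a\<^esub> y"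
      by (simp add: S u v gr_smult[OF N _ m] asub_add[OF A] frag_cmul_distrib2)
    fix z assume "z \<in> carrier (gr N a :: ('k, ('n, 'k) sym) module)"
    then obtain w where w: "w \<in> augI N a" "z = ?C w" by (auto simp: gr_carrier)
    show "x \<oplus>\<^bsub>gr N a\<^esub> y \<oplus>\<^bsub>gr N a\<^esub> z = x \<oplus>\<^bsub>gr N a\<^esub> (y \<oplus>\<^bsub>gr N a\<^esub> z)" by (simp add: S u v w add.assoc[of u v w])
  }
  fix c d :: 'k
  obtain m l where m: "of_int m = c" and l: "of_int l = d" using sur by metis
  have ml: "of_int (m + l) = c + d" "of_int (m * l) = c * d" using m l by simp_all
  show "c \<odot>\<^bsub>gr N a\<^esub> x \<in> carrier (gr N a)"
    using augI_cmul[OF N u(1)] by (auto simp: gr_smult[OF N u(1) m] u(2) gr_carrier)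
  show "(c \<oplus>\<^bsub>kring\<^esub> d) \<odot>\<^bsub>gr N a\<^esub> x = c \<odot>\<^bsub>gr N a\<^esub> x \<oplus>\<^bsub>gr N a\<^esub> d \<odot>\<^bsub>gr N a\<^esub> x"
    by (simp add: u(2) gr_smult[OF N u(1) m] gr_smult[OF N u(1) l] gr_smult[OF N u(1) ml(1)] S frag_cmul_distrib)
  show "(c \<otimes>\<^bsub>kring\<^esub> d) \<odot>\<^bsub>gr N a\<^esub> x = c \<odot>\<^bsub>gr N a\<^esub> (d \<odot>\<^bsub>gr N a\<^esub> x)"
    by (simp add: u(2) gr_smult[OF N u(1) l] gr_smult[OF N u(1) ml(2)] gr_smult[OF N augI_cmul[OF N u(1)] m])
next
  show "\<zero>\<^bsub>gr N a\<^esub> \<in> carrier (gr N a :: ('k, ('n, 'k) sym) module)"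
    using asub_augI[OF N, of a] by (auto simp: gr_carrier gr_zero asub_def)
qed

lemma gr_minus:
  assumes N: "N \<ge> 1" and sur: "\<And>c :: 'k. \<exists>m :: int. of_int m = c"
    and z: "z \<in> augI N a" and w: "(w :: ('n::finite, 'k::field) ztn) \<in> augI N a"
  shows "acs (augI N (a + 1)) z \<ominus>\<^bsub>gr N a :: ('k, ('n, 'k) sym) module\<^esub> acs (augI N (a + 1)) w = acs (augI N (a + 1)) (z - w)"
proof -
  interpret Module.module "kring :: 'k ring" "gr N a :: ('k, ('n, 'k) sym) module"
    by (rule module_gr[OF N sur])
  have "\<ominus>\<^bsub>gr N a\<^esub> acs (augI N (a + 1)) w = acs (augI N (a + 1)) (- w)"
    using w asub_uminus[OF asub_augI[OF N] w]
    by (intro minus_equality) (auto simp: gr_carrier gr_zero gr_add[OF N])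
  then show ?thesis by (simp add: a_minus_def gr_add[OF N])
qed

text \<open>z' w' - z w = (z' - z) w' + z (w' - w) shows independence of the
  representatives.\<close>

lemma gr_mult_acs:
  assumes N: "N \<ge> 1" and z: "z \<in> augI N a" and w: "w \<in> augI N b"
  shows "gr_mult N a b (acs (augI N (a + 1)) z) (acs (augI N (b + 1)) w) =
    acs (augI N (a + b + 1)) (z \<otimes>\<^bsub>ZT N\<^esub> w)"
proof -
  note U = asub_augI[OF N]
  have "acs (augI N (a + b + 1)) (z' \<otimes>\<^bsub>ZT N\<^esub> w') = acs (augI N (a + b + 1)) (z \<otimes>\<^bsub>ZT N\<^esub> w)"
    if z': "z' \<in> acs (augI N (a + 1)) z" and w': "w' \<in> acs (augI N (b + 1)) w" for z' w'
  proof -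
    have dz: "z' - z \<in> augI N (a + 1)" and dw: "w' - w \<in> augI N (b + 1)"
      using z' w' by (simp_all add: mem_acs[OF U])
    have w'b: "w' \<in> augI N b"
      using asub_add[OF U augI_mono[OF N _ dw, of b] w] by simp
    have d1: "(z' - z) \<otimes>\<^bsub>ZT N\<^esub> w' \<in> augI N (a + b + 1)" and d2: "z \<otimes>\<^bsub>ZT N\<^esub> (w' - w) \<in> augI N (a + b + 1)"
      using augI_mult[OF N dz w'b] augI_mult[OF N z dw] by (simp_all add: ac_simps)
    have "z' \<otimes>\<^bsub>ZT N\<^esub> w' - z \<otimes>\<^bsub>ZT N\<^esub> w = (z' - z) \<otimes>\<^bsub>ZT N\<^esub> w' + z \<otimes>\<^bsub>ZT N\<^esub> (w' - w)"
    proof -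
      have "z \<otimes>\<^bsub>ZT N\<^esub> (w' - w) = z \<otimes>\<^bsub>ZT N\<^esub> w' - z \<otimes>\<^bsub>ZT N\<^esub> w"
      proof -
        have "frag_extend (\<lambda>t. F t - G t) z = frag_extend F z - frag_extend G z" for F G :: "_ \<Rightarrow> ('a, 'b) ztn"
          by (simp add: frag_extend_def frag_cmul_diff_distrib sum_subtractf[symmetric])
             (rule sum.cong, simp, rule poly_mapping_eqI, simp add: lookup_minus right_diff_distrib)
        then show ?thesis by (simp add: frag_extend_diff)
      qed
      then show ?thesis by (simp add: frag_extend_diff)
    qed
    then show ?thesis using asub_add[OF U d1 d2] by (simp add: acs_eq_iff[OF U] del: ZT_simps)
  qed
  moreover have "z \<in> acs (augI N (a + 1)) z" "w \<in> acs (augI N (b + 1)) w"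
    by (rule acs_self[OF U])+
  ultimately have "(\<Union>z'\<in>acs (augI N (a + 1)) z. \<Union>w'\<in>acs (augI N (b + 1)) w. acs (augI N (a + b + 1)) (z' \<otimes>\<^bsub>ZT N\<^esub> w'))
      = acs (augI N (a + b + 1)) (z \<otimes>\<^bsub>ZT N\<^esub> w)"
    by blast
  then show ?thesis by (simp add: gr_mult_def a_r_coset_eq_acs[OF ZT_simps(1)] del: ZT_simps(4))
qed


section \<open>Group symbols\<close>

definition dz :: "nat \<Rightarrow> ('n::finite, 'k::comm_ring_1) aut \<Rightarrow> ('n, 'k) ztn" where
  "dz N g = frag_of (toT N g) - frag_of \<one>\<^bsub>TN N\<^esub>"

lemma symb_eq: "symb N s (toT N g) = acs (augI N s) (dz N g)"
  by (simp add: symb_def a_r_coset_eq_acs[OF ZT_simps(1)] dz_def)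

lemma TN_one_eq: "N \<ge> 1 \<Longrightarrow> \<one>\<^bsub>TN N\<^esub> = toT N (id :: ('n::finite, 'k::comm_ring_1) aut)"
  using toT_one[of N "id :: ('n, 'k) aut"] Gvol_id[where 'a = 'n and 'b = 'k] by (simp add: Gs_iff)

lemma dz_keys:
  assumes N: "N \<ge> 1" and g: "g \<in> carrier Gvol"
  shows "keys (dz N g) \<subseteq> carrier (TN N)" "csum (dz N g) = 0"
proof -
  have "keys (dz N g) \<subseteq> {toT N id, toT N g}"
    using keys_diff[of "frag_of (toT N g)" "frag_of (toT N id)"] by (simp add: dz_def TN_one_eq[OF N])
  then show "keys (dz N g) \<subseteq> carrier (TN N)" using g Gvol_id by (auto simp: carrier_TN)
  show "csum (dz N g) = 0"
    using csum_add[of "frag_of (toT N g)" "- frag_of \<one>\<^bsub>TN N\<^esub>"] by (simp add: dz_def csum_of csum_uminus)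
qed

lemma opz_dz:
  assumes N: "N \<ge> 1" and g: "g \<in> carrier Gvol"
  shows "opz (dz N g) f - (g f - f) \<in> ordge N"
proof -
  have "rep (toT N g) f - g f \<in> ordge N" by (rule rep_toT(3)[OF N g])
  moreover have "rep (toT N id) f - id f \<in> ordge N" by (rule rep_toT(3)[OF N Gvol_id])
  ultimately have "(rep (toT N g) f - g f) - (rep (toT N id) f - id f) \<in> ordge N" by (rule ordge_diff)
  then show ?thesis by (simp add: dz_def TN_one_eq[OF N] opz_diff opz_of algebra_simps)
qed

text \<open>Lets the operator of z be replaced by an explicit expression h in automorphisms that
  agrees with it modulo order N; all memberships of group symbols are shown this way.\<close>

lemma augI_approxI:
  fixes z :: "('n::finite, 'k::comm_ring_1) ztn"
  assumes N: "N \<ge> 1" and z: "keys z \<subseteq> carrier (TN N)" "csum z = 0"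
    and h: "\<And>q f. f \<in> ordge q \<Longrightarrow> opz z f - h f \<in> ordge N \<and> h f \<in> ordge (q + a)"
  shows "z \<in> augI N a"
  unfolding augI_iff[OF N]
proof (intro conjI allI ballI z)
  fix q and f :: "('n, 'k) mfps" assume "f \<in> ordge q"
  from h[OF this] have "opz z f - h f \<in> ordge N" "h f \<in> ordge (q + a)" by auto
  then have "opz z f - h f \<in> ordge (min (q + a) N)" "h f \<in> ordge (min (q + a) N)"
    by (auto elim!: ordge_mono)
  from ordge_add[OF this] show "opz z f \<in> ordge (min (q + a) N)" by simp
qed

lemma dz_in_augI:
  assumes N: "N \<ge> 1" and g: "g \<in> Gs s" and s: "s \<ge> 1"
  shows "dz N g \<in> augI N (s - 1)"
proof (rule augI_approxI[where h = "\<lambda>f. g f - f"])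
  have gG: "g \<in> carrier Gvol" using g by (simp add: Gs_iff)
  show "keys (dz N g) \<subseteq> carrier (TN N)" "csum (dz N g) = 0" by (rule dz_keys[OF N gG])+
  fix q and f :: "('a, 'b) mfps" assume f: "f \<in> ordge q"
  have "g f - f \<in> ordge (q + (s - 1))"
    by (rule ordge_mono[OF Gs_unipotent[OF g s f]]) (use s in auto)
  then show "opz (dz N g) f - (g f - f) \<in> ordge N \<and> g f - f \<in> ordge (q + (s - 1))"
    using opz_dz[OF N gG] by blast
qed (rule N)

lemma keys_csum_diff:
  assumes "keys z \<subseteq> C" "csum z = 0" "keys w \<subseteq> C" "csum w = 0"
  shows "keys (z - w) \<subseteq> C" "csum (z - w) = 0"
  using assms keys_diff[of z w] csum_add[of z "- w"] by (auto simp: csum_uminus)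

text \<open>g h - 1 exceeds (g - 1) + (h - 1) by (g - 1)(h - 1), where h - 1 raises orders by s - 1
  and g - 1 by at least one more. Symbols are therefore additive.\<close>

lemma dz_comp:
  assumes N: "N \<ge> 1" and g: "g \<in> Gs s" and h: "h \<in> Gs s" and s: "s \<ge> 1"
  shows "dz N (g \<circ> h) - (dz N g + dz N h) \<in> augI N s"
proof -
  have gG: "g \<in> carrier Gvol" and hG: "h \<in> carrier Gvol" using g h by (simp_all add: Gs_iff)
  note ghG = Gvol_comp[OF gG hG]
  have "dz N (g \<circ> h) - dz N g - dz N h \<in> augI N s"
  proof (rule augI_approxI[where h = "\<lambda>f. g (h f - f) - (h f - f)"])
    show "keys (dz N (g \<circ> h) - dz N g - dz N h) \<subseteq> carrier (TN N)" "csum (dz N (g \<circ> h) - dz N g - dz N h) = 0"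
      using keys_csum_diff[OF keys_csum_diff[OF dz_keys[OF N ghG] dz_keys[OF N gG]] dz_keys[OF N hG]] by auto
    fix q and f :: "('a, 'b) mfps" assume f: "f \<in> ordge q"
    have "h f - f \<in> ordge (max q 1 + s - 1)" by (rule Gs_unipotent[OF h s f])
    from Gvol_up[OF gG this] have "g (h f - f) - (h f - f) \<in> ordge (q + s)"
      by (rule ordge_mono) (use s in auto)
    moreover have "(opz (dz N (g \<circ> h)) f - ((g \<circ> h) f - f)) - (opz (dz N g) f - (g f - f)) - (opz (dz N h) f - (h f - f)) \<in> ordge N"
      by (rule ordge_diff[OF ordge_diff[OF opz_dz[OF N ghG] opz_dz[OF N gG]] opz_dz[OF N hG]])
    then have "opz (dz N (g \<circ> h) - dz N g - dz N h) f - (g (h f - f) - (h f - f)) \<in> ordge N"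
      by (simp add: opz_diff opz_add alg_endoD[OF GvolD(1)[OF gG]] algebra_simps)
    ultimately show "opz (dz N (g \<circ> h) - dz N g - dz N h) f - (g (h f - f) - (h f - f)) \<in> ordge N \<and>
       g (h f - f) - (h f - f) \<in> ordge (q + s)" by blast
  qed (rule N)
  then show ?thesis by (simp add: algebra_simps)
qed

text \<open>The order of g - h on all series is controlled by its order on the variables. The
  assumption s < N keeps degree s visible below the truncation.\<close>

lemma dz_diff_iff:
  assumes N: "s < N" and g: "g \<in> carrier Gvol" and h: "h \<in> carrier Gvol"
  shows "dz N g - dz N h \<in> augI N s \<longleftrightarrow> (\<forall>i. g (mvar i) - h (mvar i) \<in> ordge (s + 1))"
proof
  have N1: "N \<ge> 1" using N by simp
  {
    fix i
    assume "dz N g - dz N h \<in> augI N s"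
    then have "opz (dz N g - dz N h) (mvar i) \<in> ordge (min (1 + s) N)"
      using mvar_in_ordge_1 unfolding augI_iff[OF N1] by blast
    then have "opz (dz N g) (mvar i) - opz (dz N h) (mvar i) \<in> ordge (s + 1)"
      using N by (simp add: opz_diff min_def add.commute split: if_splits)
    moreover have "opz (dz N g) (mvar i) - (g (mvar i) - mvar i) \<in> ordge (s + 1)"
      "opz (dz N h) (mvar i) - (h (mvar i) - mvar i) \<in> ordge (s + 1)"
      using N ordge_mono[OF opz_dz[OF N1 g], of "s + 1" "mvar i"] ordge_mono[OF opz_dz[OF N1 h], of "s + 1" "mvar i"]
      by auto
    ultimately have "(opz (dz N g) (mvar i) - opz (dz N h) (mvar i)) - (opz (dz N g) (mvar i) - (g (mvar i) - mvar i))
      + (opz (dz N h) (mvar i) - (h (mvar i) - mvar i)) \<in> ordge (s + 1)"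
      by (intro ordge_add[OF ordge_diff])
    then have "g (mvar i) - h (mvar i) \<in> ordge (s + 1)" by (simp add: algebra_simps)
  }
  then show "dz N g - dz N h \<in> augI N s \<Longrightarrow> \<forall>i. g (mvar i) - h (mvar i) \<in> ordge (s + 1)" by blast
  assume d: "\<forall>i. g (mvar i) - h (mvar i) \<in> ordge (s + 1)"
  show "dz N g - dz N h \<in> augI N s"
  proof (rule augI_approxI[where h = "\<lambda>f. g f - h f"])
    show "keys (dz N g - dz N h) \<subseteq> carrier (TN N)" "csum (dz N g - dz N h) = 0"
      using keys_csum_diff[OF dz_keys[OF N1 g] dz_keys[OF N1 h]] by auto
    fix q and f :: "('a, 'b) mfps" assume f: "f \<in> ordge q"
    have "g f - h f \<in> ordge (max q 1 + (s + 1) - 1)"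
      by (rule alg_endo_diff_ordge[OF GvolD(1)[OF g] GvolD(1)[OF h] _ _ f]) (use d in auto)
    then have "g f - h f \<in> ordge (q + s)" by (rule ordge_mono) auto
    moreover have "(opz (dz N g) f - (g f - f)) - (opz (dz N h) f - (h f - f)) \<in> ordge N"
      using opz_dz[OF N1 g, of f] opz_dz[OF N1 h, of f] by (rule ordge_diff)
    ultimately show "opz (dz N g - dz N h) f - (g f - h f) \<in> ordge N \<and> g f - h f \<in> ordge (q + s)"
      by (simp add: opz_diff algebra_simps)
  qed (rule N1)
qed

lemma opz_dz_mult:
  assumes N: "N \<ge> 1" and g: "g \<in> carrier Gvol" and h: "h \<in> carrier Gvol"
  shows "opz (dz N g \<otimes>\<^bsub>ZT N\<^esub> dz N h) f - (g (h f - f) - (h f - f)) \<in> ordge N"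
proof -
  define w where "w = opz (dz N h) f"
  note G = alg_endoD[OF GvolD(1)[OF g]]
  have w: "w - (h f - f) \<in> ordge N" unfolding w_def by (rule opz_dz[OF N h])
  have 1: "opz (dz N g \<otimes>\<^bsub>ZT N\<^esub> dz N h) f - opz (dz N g) w \<in> ordge N"
    unfolding w_def by (rule opz_mult[OF N dz_keys(1)[OF N g] dz_keys(1)[OF N h]])
  have 2: "opz (dz N g) w - (g w - w) \<in> ordge N" by (rule opz_dz[OF N g])
  have 3: "g (w - (h f - f)) - (w - (h f - f)) \<in> ordge N"
    using ordge_diff[OF alg_endo_ordge[OF GvolD(1)[OF g] w] w] .
  have "opz (dz N g \<otimes>\<^bsub>ZT N\<^esub> dz N h) f - (g (h f - f) - (h f - f)) =
     (opz (dz N g \<otimes>\<^bsub>ZT N\<^esub> dz N h) f - opz (dz N g) w) + (opz (dz N g) w - (g w - w)) +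
     (g (w - (h f - f)) - (w - (h f - f)))"
    by (simp add: G del: ZT_simps)
  also have "\<dots> \<in> ordge N" by (rule ordge_add[OF ordge_add[OF 1 2] 3])
  finally show ?thesis .
qed

text \<open>With c = \<open>gcomm g h\<close> one has g h = c h g, so g h - h g - (c - 1) = (c -
  1)(h g - 1). The second factor raises orders by 1 and the first by s - 1.\<close>

lemma dz_gcomm:
  assumes N: "N \<ge> 1" and g: "g \<in> carrier Gvol" and h: "h \<in> carrier Gvol"
    and c: "gcomm g h \<in> Gs s" and s: "s \<ge> 1"
  shows "dz N g \<otimes>\<^bsub>ZT N\<^esub> dz N h - dz N h \<otimes>\<^bsub>ZT N\<^esub> dz N g - dz N (gcomm g h) \<in> augI N s"
proof (rule augI_approxI[where h = "\<lambda>f. gcomm g h (h (g f) - f) - (h (g f) - f)"])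
  let ?c = "gcomm g h"
  have cG: "?c \<in> carrier Gvol" by (rule gcomm_in_Gvol[OF g h])
  note G = alg_endoD[OF GvolD(1)[OF g]] and H = alg_endoD[OF GvolD(1)[OF h]] and C = alg_endoD[OF GvolD(1)[OF cG]]
  have k: "keys (dz N g \<otimes>\<^bsub>ZT N\<^esub> dz N h) \<subseteq> carrier (TN N)" "csum (dz N g \<otimes>\<^bsub>ZT N\<^esub> dz N h) = 0"
    if "g \<in> carrier Gvol" "h \<in> carrier Gvol" for g h :: "('a, 'b) aut"
    using ZT_mult_closed[OF N dz_keys(1)[OF N that(1)] dz_keys(1)[OF N that(2)]] dz_keys(2)[OF N that(1)]
    by (simp_all only: csum_mult)
  show "keys (dz N g \<otimes>\<^bsub>ZT N\<^esub> dz N h - dz N h \<otimes>\<^bsub>ZT N\<^esub> dz N g - dz N ?c) \<subseteq> carrier (TN N)"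
    "csum (dz N g \<otimes>\<^bsub>ZT N\<^esub> dz N h - dz N h \<otimes>\<^bsub>ZT N\<^esub> dz N g - dz N ?c) = 0"
    using keys_csum_diff[OF keys_csum_diff[OF k[OF g h] k[OF h g]] dz_keys[OF N cG]] by (auto simp del: ZT_simps)
  fix q and f :: "('a, 'b) mfps" assume f: "f \<in> ordge q"
  have "(h \<circ> g) f - f \<in> ordge (q + 1)" by (rule Gvol_up[OF Gvol_comp[OF h g] f])
  then have "h (g f) - f \<in> ordge (q + 1)" by simp
  from Gs_unipotent[OF c s this]
  have "?c (h (g f) - f) - (h (g f) - f) \<in> ordge (q + s)" by (rule ordge_mono) (use s in auto)
  moreover have "opz (dz N g \<otimes>\<^bsub>ZT N\<^esub> dz N h - dz N h \<otimes>\<^bsub>ZT N\<^esub> dz N g - dz N ?c) f - (?c (h (g f) - f) - (h (g f) - f)) \<in> ordge N"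
  proof -
    have chg: "?c (h (g f)) = g (h f)" using fun_cong[OF gcomm_comp[OF g h], of f] by simp
    have mem: "(opz (dz N g \<otimes>\<^bsub>ZT N\<^esub> dz N h) f - (g (h f - f) - (h f - f)))
      - (opz (dz N h \<otimes>\<^bsub>ZT N\<^esub> dz N g) f - (h (g f - f) - (g f - f))) - (opz (dz N ?c) f - (?c f - f)) \<in> ordge N"
      by (rule ordge_diff[OF ordge_diff[OF opz_dz_mult[OF N g h] opz_dz_mult[OF N h g]] opz_dz[OF N cG]])
    have eq: "(opz (dz N g \<otimes>\<^bsub>ZT N\<^esub> dz N h) f - (g (h f - f) - (h f - f)))
      - (opz (dz N h \<otimes>\<^bsub>ZT N\<^esub> dz N g) f - (h (g f - f) - (g f - f))) - (opz (dz N ?c) f - (?c f - f)) =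
      opz (dz N g \<otimes>\<^bsub>ZT N\<^esub> dz N h - dz N h \<otimes>\<^bsub>ZT N\<^esub> dz N g - dz N ?c) f - (?c (h (g f) - f) - (h (g f) - f))"
      by (simp add: opz_diff G H C chg del: ZT_simps)
    show ?thesis using mem unfolding eq .
  qed
  ultimately show "opz (dz N g \<otimes>\<^bsub>ZT N\<^esub> dz N h - dz N h \<otimes>\<^bsub>ZT N\<^esub> dz N g - dz N ?c) f - (?c (h (g f) - f) - (h (g f) - f)) \<in> ordge N
     \<and> ?c (h (g f) - f) - (h (g f) - f) \<in> ordge (q + s)" by blast
qed (rule N)

section \<open>Group symbols and their leading fields\<close>

abbreviation sy :: "nat \<Rightarrow> nat \<Rightarrow> ('n::finite, 'k::comm_ring_1) aut \<Rightarrow> ('n, 'k) sym" where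
  "sy N s g \<equiv> acs (augI N s) (dz N g)"

lemma Lsym_eq: "Lsym N s = sy N s ` Gs s"
  by (simp add: Lsym_def symb_eq image_image)

lemma Lsym_obtain:
  assumes "u \<in> Lsym N s"
  obtains g D where "has_lead s g D" "u = sy N s g"
  using assms has_lead_exists unfolding Lsym_eq by blast

lemma has_lead_sy_in_Lsym: "has_lead s g D \<Longrightarrow> sy N s g \<in> Lsym N s"
  using has_leadD(1) by (auto simp: Lsym_eq)

text \<open>Well-definedness and injectivity of the leading-field identification at once: both sides
  say that g and h agree on the variables modulo order s + 1.\<close>

lemma sy_eq_iff:
  assumes N: "s < N" and g: "has_lead s g D" and h: "has_lead s h E"
  shows "sy N s g = sy N s h \<longleftrightarrow> D = E"
proof -
  have "sy N s g = sy N s h \<longleftrightarrow> (\<forall>i. g (mvar i) - h (mvar i) \<in> ordge (s + 1))"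
    using N by (simp add: acs_eq_iff asub_augI dz_diff_iff has_leadD(4)[OF g] has_leadD(4)[OF h])
  also have "\<dots> \<longleftrightarrow> D = E"
    using has_lead_cong[OF g h] has_lead_diff[of s g D h] g h by blast
  finally show ?thesis .
qed

lemma lead_sy:
  assumes N: "s < N" and g: "has_lead s g D"
  shows "lead N s (sy N s g) = D"
proof -
  have eq: "(D' \<in> SymV s \<and> (\<exists>h\<in>Gs s. sy N s g = symb N s (toT N h) \<and>
      (\<forall>i. h (mvar i) - mvar i - mfps_of_pol (D' i) \<in> mpow (s + 1)))) \<longleftrightarrow>
      (\<exists>h. has_lead s h D' \<and> sy N s g = sy N s h)" for D'
    unfolding has_lead_def symb_eq mpow_eq_ordge by blast
  show ?thesis
    unfolding lead_def eq
    by (rule the_equality) (use g sy_eq_iff[OF N g] in blast)+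
qed

text \<open>The parameter \<open>ty\<close> only ties the type variables to the locale. The
  assumption \<open>sur\<close> expresses that k is a prime field.\<close>

locale lie_setting =
  fixes N :: nat and ty :: "('n::{finite,linorder} \<times> 'k::field) itself"
  assumes N: "N \<ge> 3" and sur: "\<And>c :: 'k. \<exists>m :: nat. of_nat m = c"
    and n: "CARD('n) \<ge> 3" and p: "CHAR('k) \<ge> 5"
begin

lemma N1: "N \<ge> 1"
  using N by simp

lemma sur_int: "\<exists>m :: int. of_int m = (c :: 'k)"
  using sur[of c] by (metis of_int_of_nat_eq)

lemmas module_grN = module_gr[OF N1 sur_int, where 'n = 'n]

lemma sy_in_gr: "g \<in> Gs s \<Longrightarrow> s \<ge> 1 \<Longrightarrow> sy N s g \<in> carrier (gr N (s - 1) :: ('k, ('n, 'k) sym) module)"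
  using dz_in_augI[OF N1, of g s] by (auto simp: gr_carrier)

lemma sy_comp:
  fixes g h :: "('n, 'k) aut"
  assumes g: "g \<in> Gs s" and h: "h \<in> Gs s" and s: "s \<ge> 1"
  shows "sy N s (g \<circ> h) = sy N s g \<oplus>\<^bsub>gr N (s - 1) :: ('k, ('n, 'k) sym) module\<^esub> sy N s h"
  using gr_add[OF N1, of "s - 1" "dz N g" "dz N h"] dz_comp[OF N1 g h s] s
  by (simp add: acs_eq_iff[OF asub_augI[OF N1]])

lemma sy_id: "sy N s (id :: ('n, 'k) aut) = acs (augI N s) 0"
  by (simp add: dz_def TN_one_eq[OF N1])

text \<open>A scalar of the prime field is a natural number m, and the m-th power of g has leading
  field m D and symbol m times that of g.\<close>

lemma sy_smult:
  fixes c :: 'k and g :: "('n, 'k) aut"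
  assumes g: "has_lead s g D" and s: "s \<ge> 2"
  shows "\<exists>h. has_lead s h (\<lambda>i. pconst c * D i) \<and>
     c \<odot>\<^bsub>gr N (s - 1) :: ('k, ('n, 'k) sym) module\<^esub> sy N s g = sy N s h"
proof -
  obtain m where m: "of_nat m = c" using sur by blast
  have "\<exists>h. has_lead s h (\<lambda>i. pconst (of_nat m) * D i) \<and> dz N h - frag_cmul (int m) (dz N g) \<in> augI N s" for m
  proof (induction m)
    case 0
    have "asub (augI N s :: ('n, 'k) ztn set)" by (rule asub_augI[OF N1])
    moreover have "dz N (id :: ('n, 'k) aut) = 0" by (simp add: dz_def TN_one_eq[OF N1])
    ultimately have "dz N (id :: ('n, 'k) aut) - frag_cmul (int 0) (dz N g) \<in> augI N s"
      by (simp only: asub_def of_nat_0 frag_cmul_zero diff_zero)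
    moreover have "has_lead s (id :: ('n, 'k) aut) (\<lambda>i. pconst (of_nat 0) * D i)"
      using has_lead_id by (simp only: of_nat_0 pconst_0 mult_zero_left)
    ultimately show ?case by blast
  next
    case (Suc m)
    then obtain h where h: "has_lead s h (\<lambda>i. pconst (of_nat m) * D i)"
      "dz N h - frag_cmul (int m) (dz N g) \<in> augI N s" by blast
    have "has_lead s (g \<circ> h) (\<lambda>i. D i + pconst (of_nat m) * D i)"
      by (rule has_lead_comp[OF g h(1)]) (use s in simp)
    moreover have "(dz N (g \<circ> h) - (dz N g + dz N h)) + (dz N h - frag_cmul (int m) (dz N g)) \<in> augI N s"
      by (rule asub_add[OF asub_augI[OF N1] dz_comp[OF N1 has_leadD(1)[OF g] has_leadD(1)[OF h(1)]] h(2)]) (use s in simp)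
    moreover have "(dz N (g \<circ> h) - (dz N g + dz N h)) + (dz N h - frag_cmul (int m) (dz N g)) =
        dz N (g \<circ> h) - frag_cmul (int (Suc m)) (dz N g)"
    proof -
      have "frag_cmul (int (Suc m)) (dz N g) = dz N g + frag_cmul (int m) (dz N g)"
        by (simp add: frag_cmul_distrib)
      moreover have "(a - (b + c)) + (c - d) = a - (b + d)" for a b c d :: "('n, 'k) ztn"
        by (simp add: algebra_simps)
      ultimately show ?thesis by (simp only:)
    qed
    moreover have "(\<lambda>i. D i + pconst (of_nat m) * D i) = (\<lambda>i. pconst (of_nat (Suc m)) * D i)"
      by (simp add: pconst_add algebra_simps)
    ultimately show ?case by (metis (no_types, lifting))
  qed
  from this[of m] obtain h where h: "has_lead s h (\<lambda>i. pconst c * D i)"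
      "dz N h - frag_cmul (int m) (dz N g) \<in> augI N s" unfolding m by blast
  have "c \<odot>\<^bsub>gr N (s - 1) :: ('k, ('n, 'k) sym) module\<^esub> sy N s g = acs (augI N s) (frag_cmul (int m) (dz N g))"
    using gr_smult[OF N1 dz_in_augI[OF N1 has_leadD(1)[OF g]], of "int m" c] m s by simp
  also have "\<dots> = sy N s h"
    using h(2) asub_uminus[OF asub_augI[OF N1] h(2)] by (simp add: acs_eq_iff[OF asub_augI[OF N1]])
  finally show ?thesis using h(1) by blast
qed

lemma Lsym_submodule:
  assumes s: "s \<ge> 2"
  shows "submodule (Lsym N s) kring (gr N (s - 1) :: ('k, ('n, 'k) sym) module)"
proof (rule submodule_kringI[OF module_grN])
  show "Lsym N s \<subseteq> carrier (gr N (s - 1) :: ('k, ('n, 'k) sym) module)"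
    using sy_in_gr s by (auto simp: Lsym_eq)
  have "sy N s id \<in> (Lsym N s :: ('n, 'k) sym set)" by (rule has_lead_sy_in_Lsym[OF has_lead_id])
  then show "\<zero>\<^bsub>gr N (s - 1)\<^esub> \<in> (Lsym N s :: ('n, 'k) sym set)" using s by (simp add: sy_id gr_zero)
  show "x \<oplus>\<^bsub>gr N (s - 1)\<^esub> y \<in> Lsym N s" if xy: "x \<in> Lsym N s" "y \<in> Lsym N s" for x y :: "('n, 'k) sym"
  proof -
    obtain g h where gh: "g \<in> Gs s" "x = sy N s g" "h \<in> Gs s" "y = sy N s h" using xy unfolding Lsym_eq by blast
    have "sy N s (g \<circ> h) = x \<oplus>\<^bsub>gr N (s - 1)\<^esub> y" unfolding gh(2,4) by (rule sy_comp) (use gh s in auto)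
    then show ?thesis using Gs_comp[OF gh(1,3)] unfolding Lsym_eq by (metis imageI)
  qed
  show "c \<odot>\<^bsub>gr N (s - 1)\<^esub> x \<in> Lsym N s" if x: "x \<in> Lsym N s" for c :: 'k and x :: "('n, 'k) sym"
  proof -
    obtain g D where "has_lead s g D" "x = sy N s g" using x by (rule Lsym_obtain)
    then show ?thesis using sy_smult[OF _ s, of g D c] has_lead_sy_in_Lsym by fastforce
  qed
qed

lemma lie_mod_simps:
  "carrier (lie_mod N s) = Lsym N s" "x \<oplus>\<^bsub>lie_mod N s\<^esub> y = x \<oplus>\<^bsub>gr N (s - 1)\<^esub> y"
  "c \<odot>\<^bsub>lie_mod N s\<^esub> x = c \<odot>\<^bsub>gr N (s - 1)\<^esub> x" "\<zero>\<^bsub>lie_mod N s\<^esub> = \<zero>\<^bsub>gr N (s - 1)\<^esub>"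
  by (simp_all add: lie_mod_def)

lemma module_lie_mod:
  assumes "s \<ge> 2"
  shows "Module.module kring (lie_mod N s :: ('k, ('n, 'k) sym) module)"
  unfolding lie_mod_def by (rule submodule.submodule_is_module[OF Lsym_submodule[OF assms] module_grN])

lemma lead_has_lead:
  assumes "2 \<le> s" "s < N" "u \<in> Lsym N s"
  obtains g where "has_lead s g (lead N s u)" "u = sy N s g" "lead N s u \<in> Lvf s"
proof -
  obtain g D where g: "has_lead s g D" "u = sy N s g" using assms(3) by (rule Lsym_obtain)
  then show ?thesis using that[of g] lead_sy[OF assms(2) g(1)] has_lead_Lvf[OF g(1) assms(1)] by simp
qed

lemma vf_mod_simps:
  "carrier (vf_mod C) = C" "D \<oplus>\<^bsub>vf_mod C\<^esub> E = (\<lambda>i. D i + E i)" "\<zero>\<^bsub>vf_mod C\<^esub> = (\<lambda>i. 0)"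
  "c \<odot>\<^bsub>vf_mod C\<^esub> D = (\<lambda>i. pconst c * D i)"
  by (simp_all add: vf_mod_def)

lemma lead_lin_map:
  assumes s: "2 \<le> s" "s < N"
  shows "lin_map (lie_mod N s :: ('k, ('n, 'k) sym) module) (vf_mod (Lvf s)) (lead N s)"
  unfolding lin_map_def
proof (intro conjI ballI allI funcsetI)
  show "Module.module kring (lie_mod N s :: ('k, ('n, 'k) sym) module)" by (rule module_lie_mod[OF s(1)])
  show "Module.module kring (vf_mod (Lvf s) :: ('k, ('n, 'k) vf) module)" by (rule module_Lvf)
  fix x assume "x \<in> carrier (lie_mod N s :: ('k, ('n, 'k) sym) module)"
  then have x: "x \<in> Lsym N s" by (simp add: lie_mod_simps)
  then obtain g where g: "has_lead s g (lead N s x)" "x = sy N s g" "lead N s x \<in> Lvf s"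
    by (rule lead_has_lead[OF s])
  show "lead N s x \<in> carrier (vf_mod (Lvf s))" using g by (simp add: vf_mod_simps)
  show "lead N s (c \<odot>\<^bsub>lie_mod N s\<^esub> x) = c \<odot>\<^bsub>vf_mod (Lvf s)\<^esub> lead N s x" for c
  proof -
    obtain h where "has_lead s h (\<lambda>i. pconst c * lead N s x i)" "c \<odot>\<^bsub>gr N (s - 1)\<^esub> sy N s g = sy N s h"
      using sy_smult[OF g(1) s(1)] by blast
    then show ?thesis using lead_sy[OF s(2)] g(2) by (simp add: lie_mod_simps vf_mod_simps)
  qed
  fix y assume "y \<in> carrier (lie_mod N s :: ('k, ('n, 'k) sym) module)"
  then have y: "y \<in> Lsym N s" by (simp add: lie_mod_simps)
  then obtain h where h: "has_lead s h (lead N s y)" "y = sy N s h" "lead N s y \<in> Lvf s"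
    by (rule lead_has_lead[OF s])
  have "has_lead s (g \<circ> h) (\<lambda>i. lead N s x i + lead N s y i)" by (rule has_lead_comp[OF g(1) h(1)]) (use s in simp)
  from lead_sy[OF s(2) this] show "lead N s (x \<oplus>\<^bsub>lie_mod N s\<^esub> y) = lead N s x \<oplus>\<^bsub>vf_mod (Lvf s)\<^esub> lead N s y"
    using sy_comp[OF has_leadD(1)[OF g(1)] has_leadD(1)[OF h(1)]] s g(2) h(2) by (simp add: lie_mod_simps vf_mod_simps)
qed

lemma lead_inj:
  assumes s: "2 \<le> s" "s < N" and "u \<in> Lsym N s" "v \<in> Lsym N s" "lead N s u = (lead N s v :: ('n, 'k) vf)"
  shows "u = v"
proof -
  obtain g where g: "has_lead s g (lead N s u)" "u = sy N s g" using lead_has_lead[OF s assms(3)] by metis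
  obtain h where h: "has_lead s h (lead N s v)" "v = sy N s h" using lead_has_lead[OF s assms(4)] by metis
  show ?thesis using sy_eq_iff[OF s(2) g(1) h(1)] g(2) h(2) assms(5) by simp
qed

lemma lead_surj:
  assumes s: "2 \<le> s" "s < N" and D: "(D :: ('n, 'k) vf) \<in> Lvf s"
  obtains g where "has_lead s g D" "sy N s g \<in> Lsym N s" "lead N s (sy N s g) = D"
proof -
  obtain g where "has_lead s g D" using Lvf_has_lead[OF n p s(1) D] by blast
  then show ?thesis using that has_lead_sy_in_Lsym lead_sy[OF s(2)] by blast
qed

lemma lead_bij:
  assumes s: "2 \<le> s" "s < N"
  shows "bij_betw (lead N s) (Lsym N s) (Lvf s :: ('n, 'k) vf set)"
  unfolding bij_betw_def
proof
  show "inj_on (lead N s) (Lsym N s :: ('n, 'k) sym set)" using lead_inj[OF s] by (auto intro: inj_onI)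
  show "lead N s ` Lsym N s = (Lvf s :: ('n, 'k) vf set)"
  proof (intro subset_antisym subsetI)
    fix D :: "('n, 'k) vf" assume "D \<in> lead N s ` Lsym N s"
    then show "D \<in> Lvf s" using lead_has_lead[OF s] by (metis imageE)
  next
    fix D :: "('n, 'k) vf" assume "D \<in> Lvf s"
    then obtain g where "sy N s g \<in> Lsym N s" "lead N s (sy N s g) = D" by (rule lead_surj[OF s])
    then show "D \<in> lead N s ` Lsym N s" by force
  qed
qed

lemma gr_bracket_sy:
  fixes g h :: "('n, 'k) aut"
  assumes g: "g \<in> Gs a" and h: "h \<in> Gs b" and c: "gcomm g h \<in> Gs (a + b - 1)" and ab: "a \<ge> 2" "b \<ge> 2"
  shows "gr_bracket N (a - 1) (b - 1) (sy N a g) (sy N b h) = sy N (a + b - 1) (gcomm g h)"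
proof -
  have gG: "g \<in> carrier Gvol" and hG: "h \<in> carrier Gvol" using g h by (simp_all add: Gs_iff)
  have dg: "dz N g \<in> augI N (a - 1)" and dh: "dz N h \<in> augI N (b - 1)"
    using dz_in_augI[OF N1 g] dz_in_augI[OF N1 h] ab by simp_all
  have s: "a - 1 + (b - 1) + 1 = a + b - 1" "b - 1 + (a - 1) = a - 1 + (b - 1)" using ab by simp_all
  have "gr_mult N (a - 1) (b - 1) (sy N a g) (sy N b h) = acs (augI N (a - 1 + (b - 1) + 1)) (dz N g \<otimes>\<^bsub>ZT N\<^esub> dz N h)"
    using gr_mult_acs[OF N1 dg dh] ab by simp
  moreover have "gr_mult N (b - 1) (a - 1) (sy N b h) (sy N a g) = acs (augI N (a - 1 + (b - 1) + 1)) (dz N h \<otimes>\<^bsub>ZT N\<^esub> dz N g)"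
    using gr_mult_acs[OF N1 dh dg] ab unfolding s(2) by simp
  moreover have "dz N g \<otimes>\<^bsub>ZT N\<^esub> dz N h \<in> augI N (a - 1 + (b - 1))" "dz N h \<otimes>\<^bsub>ZT N\<^esub> dz N g \<in> augI N (a - 1 + (b - 1))"
    using augI_mult[OF N1 dg dh] augI_mult[OF N1 dh dg] by (simp_all only: s(2))
  ultimately have "gr_bracket N (a - 1) (b - 1) (sy N a g) (sy N b h) =
      acs (augI N (a + b - 1)) (dz N g \<otimes>\<^bsub>ZT N\<^esub> dz N h - dz N h \<otimes>\<^bsub>ZT N\<^esub> dz N g)"
    unfolding gr_bracket_def by (simp only: gr_minus[OF N1 sur_int]) (simp only: s(1))
  also have "\<dots> = sy N (a + b - 1) (gcomm g h)"
    using dz_gcomm[OF N1 gG hG c] ab by (simp add: acs_eq_iff[OF asub_augI[OF N1]] del: ZT_simps)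
  finally show ?thesis .
qed

lemma Evf_eq: "(Evf d :: ('n, 'k) vf set) = {D \<in> Lvf d. noncrit CHAR('k) D}"
  using n by (intro Evf_eq_noncrit refl) simp

text \<open>The bracket of two symbols is the symbol of a group commutator, whose leading field is a
  Lie bracket and hence exact. When a + b - 1 >= N the commutator lies in G_N and is trivial in
  T_N.\<close>

lemma bracket_in_XL:
  assumes u: "(u :: ('n, 'k) sym) \<in> Lsym N a" and v: "v \<in> Lsym N b" and ab: "a \<ge> 2" "b \<ge> 2"
  shows "if a + b - 1 < N then gr_bracket N (a - 1) (b - 1) u v \<in> XL N (a + b - 1)
    else gr_bracket N (a - 1) (b - 1) u v = acs (augI N (a + b - 1)) 0"
proof -
  obtain g D where g: "has_lead a g D" "u = sy N a g" using u by (rule Lsym_obtain)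
  obtain h E where h: "has_lead b h E" "v = sy N b h" using v by (rule Lsym_obtain)
  note c = has_lead_gcomm[OF g(1) h(1) ab]
  have br: "gr_bracket N (a - 1) (b - 1) u v = sy N (a + b - 1) (gcomm g h)"
    unfolding g(2) h(2) by (rule gr_bracket_sy[OF has_leadD(1)[OF g(1)] has_leadD(1)[OF h(1)] has_leadD(1)[OF c] ab])
  show ?thesis
  proof (cases "a + b - 1 < N")
    case True
    have "D \<in> Lvf a" "E \<in> Lvf b" using has_lead_Lvf g(1) h(1) ab by blast+
    then have "vbr D E \<in> Evf (a + b - 1)"
      using vbr_in_Lvf[of D a E b] noncrit_vbr[OF refl, of D a E b] by (simp add: Evf_eq)
    then show ?thesis using True lead_sy[OF True c] has_lead_sy_in_Lsym[OF c] by (simp add: br XL_def)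
  next
    case False
    then have "gcomm g h \<in> Gs N" using Gs_mono[OF has_leadD(1)[OF c]] by simp
    then have "dz N (gcomm g h) = 0" by (simp add: dz_def toT_one[OF N1])
    then show ?thesis using False by (simp add: br)
  qed
qed

lemma XL_eq: "(XL N d :: ('n, 'k) sym set) = {u \<in> Lsym N d. lead N d u \<in> Evf d}"
  by (simp add: XL_def)

lemma Evf_submodule: "submodule (Evf d) kring (vf_mod (Lvf d) :: ('k, ('n, 'k) vf) module)"
  by (rule submodule_kringI[OF module_Lvf])
     (auto simp: vf_mod_simps Evf_eq noncrit_def Lvf_0 Lvf_add Lvf_scale lookup_add lookup_pconst_times)

lemma XL_submodule:
  assumes d: "2 \<le> d" "d < N"
  shows "submodule (XL N d) kring (gr N (d - 1) :: ('k, ('n, 'k) sym) module)"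
proof (rule submodule_kringI[OF module_grN])
  note L = submodule_kringD[OF Lsym_submodule[OF d(1)]] and E = submodule_kringD[OF Evf_submodule[of d], unfolded vf_mod_simps]
  note lead = lin_mapD[OF lead_lin_map[OF d], unfolded lie_mod_simps vf_mod_simps]
  have z: "lead N d \<zero>\<^bsub>gr N (d - 1)\<^esub> = (\<lambda>i. 0 :: ('n, 'k) pol)"
    using lin_map_zero_minus(1)[OF lead_lin_map[OF d]] by (simp add: lie_mod_simps vf_mod_simps)
  show "XL N d \<subseteq> carrier (gr N (d - 1) :: ('k, ('n, 'k) sym) module)" using L(1) by (auto simp: XL_eq)
  show "\<zero>\<^bsub>gr N (d - 1)\<^esub> \<in> (XL N d :: ('n, 'k) sym set)" using L(2) E(2) z by (simp add: XL_eq)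
  show "x \<oplus>\<^bsub>gr N (d - 1)\<^esub> y \<in> XL N d" if "x \<in> XL N d" "y \<in> XL N d" for x y :: "('n, 'k) sym"
    using that L(3) E(3) lead(4) by (simp add: XL_eq)
  show "c \<odot>\<^bsub>gr N (d - 1)\<^esub> x \<in> XL N d" if "x \<in> XL N d" for c :: 'k and x :: "('n, 'k) sym"
    using that L(4) E(4) lead(5) by (simp add: XL_eq)
qed

text \<open>An exact leading field is a sum of brackets of fields; each factor lifts to an
  automorphism, so the span contains a symbol with the same leading field, and injectivity of
  \<open>lead\<close> finishes.\<close>

lemma lie_bracket_eq_XL:
  assumes d: "3 \<le> d" "d < N"
  shows "(lie_bracket N 2 (d - 1) :: ('n, 'k) sym set) = XL N d"
proof -
  define S where "S = {gr_bracket N 1 (d - 2) u v |u v. (u :: ('n, 'k) sym) \<in> Lsym N 2 \<and> v \<in> Lsym N (d - 1)}"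
  have d2: "2 \<le> d" "2 \<le> d - 1" "2 + (d - 1) - 1 = d" "d - 1 - 1 = d - 2" "2 - 1 = (1 :: nat)" "1 + (d - 2) = d - 1"
    using d by auto
  have lb: "(lie_bracket N 2 (d - 1) :: ('n, 'k) sym set) = kspan (gr N (d - 1) :: ('k, ('n, 'k) sym) module) S"
    unfolding lie_bracket_def S_def d2(4,5,6) ..
  have S: "S \<subseteq> XL N d"
  proof
    fix x assume "x \<in> S"
    then obtain u v where uv: "(u :: ('n, 'k) sym) \<in> Lsym N 2" "v \<in> Lsym N (d - 1)" "x = gr_bracket N 1 (d - 2) u v"
      unfolding S_def by blast
    then show "x \<in> XL N d" using bracket_in_XL[OF uv(1,2) _ d2(2)] d(2) unfolding d2 by simp
  qed
  have sub: "submodule (kspan (gr N (d - 1)) S) kring (gr N (d - 1) :: ('k, ('n, 'k) sym) module)"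
    by (rule kspan_submodule[OF module_grN]) (use S submodule_kringD(1)[OF XL_submodule[OF d2(1) d(2)]] in blast)
  have span: "\<exists>u \<in> kspan (gr N (d - 1) :: ('k, ('n, 'k) sym) module) S. u \<in> Lsym N d \<and> lead N d u = D"
    if "D \<in> brs d" for D :: "('n, 'k) vf"
    using that
  proof induction
    case zero
    have "lead N d \<zero>\<^bsub>gr N (d - 1)\<^esub> = (\<lambda>i. 0 :: ('n, 'k) pol)"
      using lin_map_zero_minus(1)[OF lead_lin_map[OF d2(1) d(2)]] by (simp add: lie_mod_simps vf_mod_simps)
    then show ?case using submodule_kringD(2)[OF sub] submodule_kringD(2)[OF Lsym_submodule[OF d2(1)]] by blast
  next
    case (add D E)
    then obtain u v where uv: "u \<in> kspan (gr N (d - 1) :: ('k, ('n, 'k) sym) module) S" "u \<in> Lsym N d" "lead N d u = D"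
      "v \<in> kspan (gr N (d - 1) :: ('k, ('n, 'k) sym) module) S" "v \<in> Lsym N d" "lead N d v = E" by blast
    show ?case
    proof (intro bexI conjI)
      show "u \<oplus>\<^bsub>gr N (d - 1) :: ('k, ('n, 'k) sym) module\<^esub> v \<in> kspan (gr N (d - 1)) S"
        using submodule_kringD(3)[OF sub] uv by blast
      show "u \<oplus>\<^bsub>gr N (d - 1) :: ('k, ('n, 'k) sym) module\<^esub> v \<in> Lsym N d"
        using submodule_kringD(3)[OF Lsym_submodule[OF d2(1)]] uv by blast
      show "lead N d (u \<oplus>\<^bsub>gr N (d - 1) :: ('k, ('n, 'k) sym) module\<^esub> v) = (\<lambda>i. D i + E i)"
        using lin_mapD(4)[OF lead_lin_map[OF d2(1) d(2)], of u v] uv by (simp add: lie_mod_simps vf_mod_simps)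
    qed
  next
    case (br D E)
    obtain g where g: "has_lead 2 g D" using Lvf_has_lead[OF n p _ br(1)] by auto
    obtain h where h: "has_lead (d - 1) h E" using Lvf_has_lead[OF n p d2(2) br(2)] by auto
    note c = has_lead_gcomm[OF g h order_refl d2(2), unfolded d2(3)]
    have "gr_bracket N 1 (d - 2) (sy N 2 g) (sy N (d - 1) h) = sy N d (gcomm g h)"
      using gr_bracket_sy[OF has_leadD(1)[OF g] has_leadD(1)[OF h] _ order_refl d2(2)] has_leadD(1)[OF c]
      unfolding d2 by simp
    then have "sy N d (gcomm g h) = gr_bracket N 1 (d - 2) (sy N 2 g) (sy N (d - 1) h)" by (rule sym)
    then have "sy N d (gcomm g h) \<in> S"
      unfolding S_def using has_lead_sy_in_Lsym[OF g] has_lead_sy_in_Lsym[OF h] by blast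
    then have "sy N d (gcomm g h) \<in> kspan (gr N (d - 1) :: ('k, ('n, 'k) sym) module) S"
      using kspan_superset by (rule subsetD[rotated])
    then show ?case using lead_sy[OF d(2) c] has_lead_sy_in_Lsym[OF c] by (intro bexI[of _ "sy N d (gcomm g h)"] conjI)
  qed
  show ?thesis unfolding lb
  proof
    show "kspan (gr N (d - 1) :: ('k, ('n, 'k) sym) module) S \<subseteq> XL N d" by (rule kspan_subset[OF XL_submodule[OF d2(1) d(2)] S])
    show "XL N d \<subseteq> kspan (gr N (d - 1) :: ('k, ('n, 'k) sym) module) S"
    proof
      fix u :: "('n, 'k) sym" assume "u \<in> XL N d"
      then have u: "u \<in> Lsym N d" "lead N d u \<in> Evf d" by (auto simp: XL_eq)
      then have "lead N d u \<in> brs d" using noncrit_in_brs[OF _ _ d(1) n p] by (simp add: Evf_eq)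
      from span[OF this] show "u \<in> kspan (gr N (d - 1) :: ('k, ('n, 'k) sym) module) S"
        using lead_inj[OF d2(1) d(2) _ u(1)] by blast
    qed
  qed
qed

end


section \<open>The abelianization\<close>

context lie_setting
begin

lemma gr_finsum:
  fixes F :: "'i \<Rightarrow> ('n, 'k) ztn"
  assumes "finite A" "\<And>a. a \<in> A \<Longrightarrow> F a \<in> augI N c"
  shows "(\<Oplus>\<^bsub>gr N c :: ('k, ('n, 'k) sym) module\<^esub>a\<in>A. acs (augI N (c + 1)) (F a)) = acs (augI N (c + 1)) (sum F A)"
proof -
  interpret M: Module.module "kring :: 'k ring" "gr N c :: ('k, ('n, 'k) sym) module" by (rule module_grN)
  show ?thesis using assms
  proof (induction A)
    case (insert a A)
    then show ?case by (subst M.finsum_insert) (auto simp: gr_carrier gr_add[OF N1])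
  qed (simp add: gr_zero)
qed

lemma gr_alg_simps:
  "carrier (gr_alg N) = {x \<in> (\<Pi>\<^sub>E a\<in>{1..}. carrier (gr N a)). finite {a\<in>{1..}. x a \<noteq> \<zero>\<^bsub>gr N a\<^esub>}}"
  "x \<otimes>\<^bsub>gr_alg N\<^esub> y = (\<lambda>c\<in>{1..}. \<Oplus>\<^bsub>gr N c\<^esub>a\<in>{1..<c}. gr_mult N a (c - a) (x a) (y (c - a)))"
  "\<zero>\<^bsub>gr_alg N\<^esub> = (\<lambda>a\<in>{1..}. \<zero>\<^bsub>gr N a\<^esub>)"
  "x \<oplus>\<^bsub>gr_alg N\<^esub> y = (\<lambda>a\<in>{1..}. x a \<oplus>\<^bsub>gr N a\<^esub> y a)"
  "c \<odot>\<^bsub>gr_alg N\<^esub> x = (\<lambda>a\<in>{1..}. c \<odot>\<^bsub>gr N a\<^esub> x a)"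
  by (simp_all add: gr_alg_def)

lemma augI_closed:
  "0 \<in> (augI N a :: ('n, 'k) ztn set)"
  "z \<in> augI N a \<Longrightarrow> w \<in> augI N a \<Longrightarrow> z + w \<in> (augI N a :: ('n, 'k) ztn set)"
  "z \<in> augI N a \<Longrightarrow> w \<in> augI N a \<Longrightarrow> z - w \<in> (augI N a :: ('n, 'k) ztn set)"
proof -
  have A: "asub (augI N a :: ('n, 'k) ztn set)" by (rule asub_augI[OF N1])
  show "0 \<in> (augI N a :: ('n, 'k) ztn set)" using A by (simp add: asub_def)
  show "z \<in> augI N a \<Longrightarrow> w \<in> augI N a \<Longrightarrow> z + w \<in> (augI N a :: ('n, 'k) ztn set)" by (rule asub_add[OF A])
  show "z \<in> augI N a \<Longrightarrow> w \<in> augI N a \<Longrightarrow> z - w \<in> (augI N a :: ('n, 'k) ztn set)" using A unfolding asub_def by blast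
qed

lemma gr_alg_carrierI:
  fixes x :: "nat \<Rightarrow> ('n, 'k) sym"
  assumes "x \<in> extensional {1..}" "\<And>a. a \<ge> 1 \<Longrightarrow> x a \<in> carrier (gr N a :: ('k, ('n, 'k) sym) module)"
    "finite F" "\<And>a. a \<ge> 1 \<Longrightarrow> a \<notin> F \<Longrightarrow> x a = \<zero>\<^bsub>gr N a :: ('k, ('n, 'k) sym) module\<^esub>"
  shows "x \<in> carrier (gr_alg N :: ('k, _) module)"
proof -
  have "{a \<in> {1..}. x a \<noteq> \<zero>\<^bsub>gr N a :: ('k, ('n, 'k) sym) module\<^esub>} \<subseteq> F" using assms(4) by auto
  then have "finite {a \<in> {1..}. x a \<noteq> \<zero>\<^bsub>gr N a :: ('k, ('n, 'k) sym) module\<^esub>}" using assms(3) by (rule finite_subset)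
  then show ?thesis using assms(1,2) by (simp add: gr_alg_simps PiE_def)
qed

lemma gr_alg_carrierD:
  fixes x :: "nat \<Rightarrow> ('n, 'k) sym"
  assumes "x \<in> carrier (gr_alg N :: ('k, _) module)"
  shows "x \<in> extensional {1..}" "a \<ge> 1 \<Longrightarrow> x a \<in> carrier (gr N a :: ('k, ('n, 'k) sym) module)"
    "finite {a \<in> {1..}. x a \<noteq> \<zero>\<^bsub>gr N a :: ('k, ('n, 'k) sym) module\<^esub>}"
  using assms by (auto simp: gr_alg_simps PiE_def)

lemma gr_alg_eqI:
  assumes "x \<in> extensional {1..}" "y \<in> extensional {1..}" "\<And>a. a \<ge> 1 \<Longrightarrow> x a = y a"
  shows "x = y"
  using assms by (intro extensionalityI) auto

lemma module_gr_alg: "Module.module kring (gr_alg N :: ('k, nat \<Rightarrow> ('n, 'k) sym) module)"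
proof -
  let ?G = "\<lambda>a. gr N a :: ('k, ('n, 'k) sym) module"
  have M: "Module.module kring (?G a)" for a by (rule module_grN)
  have A: "abelian_group (?G a)" for a using M by (rule Module.module.axioms(2))
  note B = abelian_group.axioms(1)[OF A]
  note D = gr_alg_carrierD
  have mz: "\<ominus>\<^bsub>?G a\<^esub> \<zero>\<^bsub>?G a\<^esub> = \<zero>\<^bsub>?G a\<^esub>" for a
    using abelian_group.r_neg[OF A[of a] abelian_monoid.zero_closed[OF B]]
      abelian_monoid.l_zero[OF B abelian_group.a_inv_closed[OF A[of a] abelian_monoid.zero_closed[OF B]]] by simp
  show ?thesis
  proof (intro moduleI abelian_groupI cring_kring)
    fix x :: "nat \<Rightarrow> ('n, 'k) sym" assume x: "x \<in> carrier (gr_alg N :: ('k, _) module)"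
    show "\<exists>y\<in>carrier (gr_alg N). y \<oplus>\<^bsub>gr_alg N :: ('k, _) module\<^esub> x = \<zero>\<^bsub>gr_alg N\<^esub>"
    proof (rule bexI)
      show "(\<lambda>a\<in>{1..}. \<ominus>\<^bsub>?G a\<^esub> x a) \<oplus>\<^bsub>gr_alg N :: ('k, _) module\<^esub> x = \<zero>\<^bsub>gr_alg N\<^esub>"
        by (rule gr_alg_eqI) (auto simp: gr_alg_simps abelian_group.l_neg[OF A] D(2)[OF x])
      show "(\<lambda>a\<in>{1..}. \<ominus>\<^bsub>?G a\<^esub> x a) \<in> carrier (gr_alg N :: ('k, _) module)"
        by (rule gr_alg_carrierI[OF _ _ D(3)[OF x]])
           (auto simp: abelian_group.a_inv_closed[OF A] D(2)[OF x] mz)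
    qed
    show "\<zero>\<^bsub>gr_alg N\<^esub> \<oplus>\<^bsub>gr_alg N :: ('k, _) module\<^esub> x = x"
      by (rule gr_alg_eqI) (auto simp: gr_alg_simps abelian_monoid.l_zero[OF B] D[OF x])
    show "\<one>\<^bsub>kring\<^esub> \<odot>\<^bsub>gr_alg N :: ('k, _) module\<^esub> x = x"
      using Module.module.smult_one[OF M D(2)[OF x]]
      by (intro gr_alg_eqI) (auto simp: gr_alg_simps D[OF x])
    fix c d :: 'k
    have sc: "c \<odot>\<^bsub>?G a\<^esub> x a \<in> carrier (?G a)" if "a \<ge> 1" for a c
      using Module.module.smult_closed[OF M _ D(2)[OF x that], of c] by simp
    show "c \<odot>\<^bsub>gr_alg N :: ('k, _) module\<^esub> x \<in> carrier (gr_alg N :: ('k, _) module)"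
      using Module.module.smult_r_null[OF M, of c]
      by (intro gr_alg_carrierI[OF _ _ D(3)[OF x]]) (auto simp: gr_alg_simps sc)
    show "(c \<oplus>\<^bsub>kring\<^esub> d) \<odot>\<^bsub>gr_alg N :: ('k, _) module\<^esub> x = c \<odot>\<^bsub>gr_alg N :: ('k, _) module\<^esub> x \<oplus>\<^bsub>gr_alg N :: ('k, _) module\<^esub> d \<odot>\<^bsub>gr_alg N :: ('k, _) module\<^esub> x"
      using Module.module.smult_l_distr[OF M _ _ D(2)[OF x], of c d]
      by (intro gr_alg_eqI) (auto simp: gr_alg_simps)
    show "(c \<otimes>\<^bsub>kring\<^esub> d) \<odot>\<^bsub>gr_alg N :: ('k, _) module\<^esub> x = c \<odot>\<^bsub>gr_alg N :: ('k, _) module\<^esub> (d \<odot>\<^bsub>gr_alg N :: ('k, _) module\<^esub> x)"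
      using Module.module.smult_assoc1[OF M _ _ D(2)[OF x], of c d]
      by (intro gr_alg_eqI) (auto simp: gr_alg_simps)
    fix y :: "nat \<Rightarrow> ('n, 'k) sym" assume y: "y \<in> carrier (gr_alg N :: ('k, _) module)"
    show "x \<oplus>\<^bsub>gr_alg N :: ('k, _) module\<^esub> y \<in> carrier (gr_alg N :: ('k, _) module)"
      by (rule gr_alg_carrierI[OF _ _ finite_UnI[OF D(3)[OF x] D(3)[OF y]]])
         (auto simp: gr_alg_simps abelian_monoid.a_closed[OF B] D(2)[OF x] D(2)[OF y] abelian_monoid.l_zero[OF B] abelian_monoid.zero_closed[OF B])
    show "x \<oplus>\<^bsub>gr_alg N :: ('k, _) module\<^esub> y = y \<oplus>\<^bsub>gr_alg N :: ('k, _) module\<^esub> x"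
      using abelian_monoid.a_comm[OF B D(2)[OF x] D(2)[OF y]] by (intro gr_alg_eqI) (auto simp: gr_alg_simps)
    show "c \<odot>\<^bsub>gr_alg N :: ('k, _) module\<^esub> (x \<oplus>\<^bsub>gr_alg N :: ('k, _) module\<^esub> y) =
       c \<odot>\<^bsub>gr_alg N :: ('k, _) module\<^esub> x \<oplus>\<^bsub>gr_alg N :: ('k, _) module\<^esub> c \<odot>\<^bsub>gr_alg N :: ('k, _) module\<^esub> y"
      using Module.module.smult_r_distr[OF M _ D(2)[OF x] D(2)[OF y], of c]
      by (intro gr_alg_eqI) (auto simp: gr_alg_simps)
    fix z :: "nat \<Rightarrow> ('n, 'k) sym" assume z: "z \<in> carrier (gr_alg N :: ('k, _) module)"
    show "x \<oplus>\<^bsub>gr_alg N :: ('k, _) module\<^esub> y \<oplus>\<^bsub>gr_alg N :: ('k, _) module\<^esub> z =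
       x \<oplus>\<^bsub>gr_alg N :: ('k, _) module\<^esub> (y \<oplus>\<^bsub>gr_alg N :: ('k, _) module\<^esub> z)"
      using abelian_monoid.a_assoc[OF B D(2)[OF x] D(2)[OF y] D(2)[OF z]] by (intro gr_alg_eqI) (auto simp: gr_alg_simps)
  next
    show "\<zero>\<^bsub>gr_alg N :: ('k, _) module\<^esub> \<in> carrier (gr_alg N :: ('k, nat \<Rightarrow> ('n, 'k) sym) module)"
      by (rule gr_alg_carrierI[of _ "{}"]) (auto simp: gr_alg_simps abelian_monoid.zero_closed[OF B])
  qed
qed

text \<open>Subtraction in the record is only known through negatives, so it is recovered
  componentwise by adding y back.\<close>

lemma gr_alg_minus:
  fixes x y :: "nat \<Rightarrow> ('n, 'k) sym"
  assumes x: "x \<in> carrier (gr_alg N :: ('k, _) module)" and y: "y \<in> carrier (gr_alg N :: ('k, _) module)" and a: "a \<ge> 1"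
  shows "(x \<ominus>\<^bsub>gr_alg N :: ('k, _) module\<^esub> y) a = x a \<ominus>\<^bsub>gr N a :: ('k, ('n, 'k) sym) module\<^esub> y a"
proof -
  interpret M: Module.module "kring :: 'k ring" "gr_alg N :: ('k, nat \<Rightarrow> ('n, 'k) sym) module" by (rule module_gr_alg)
  interpret G: Module.module "kring :: 'k ring" "gr N a :: ('k, ('n, 'k) sym) module" by (rule module_grN)
  have "x \<ominus>\<^bsub>gr_alg N :: ('k, _) module\<^esub> y \<oplus>\<^bsub>gr_alg N :: ('k, _) module\<^esub> y = x"
    using x y by (simp add: a_minus_def M.a_assoc M.l_neg)
  from fun_cong[OF this, of a] have "(x \<ominus>\<^bsub>gr_alg N :: ('k, _) module\<^esub> y) a \<oplus>\<^bsub>gr N a :: ('k, ('n, 'k) sym) module\<^esub> y a = x a"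
    using a by (simp add: gr_alg_simps(4))
  moreover have "(x \<ominus>\<^bsub>gr_alg N :: ('k, _) module\<^esub> y) a \<in> carrier (gr N a :: ('k, ('n, 'k) sym) module)" "y a \<in> carrier (gr N a :: ('k, ('n, 'k) sym) module)"
    using gr_alg_carrierD(2)[OF M.minus_closed[OF x y] a] gr_alg_carrierD(2)[OF y a] by auto
  ultimately show ?thesis by (metis G.a_assoc G.r_neg G.r_zero G.a_inv_closed a_minus_def)
qed

lemma lie_lt_iff:
  fixes x :: "nat \<Rightarrow> ('n, 'k) sym"
  shows "x \<in> carrier (lie_lt N :: ('k, _) module) \<longleftrightarrow> x \<in> carrier (gr_alg N :: ('k, _) module) \<and>
    (\<forall>c\<ge>1. if c + 1 < N then x c \<in> Lsym N (c + 1) else x c = acs (augI N (c + 1)) 0)"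
proof -
  have "(\<forall>s\<ge>2. P s (s - 1)) \<longleftrightarrow> (\<forall>c\<ge>1. P (c + 1) c)" for P :: "nat \<Rightarrow> nat \<Rightarrow> bool"
  proof safe
    fix s :: nat assume "\<forall>c\<ge>1. P (c + 1) c" "s \<ge> 2"
    then show "P s (s - 1)" using spec[of "\<lambda>c. c \<ge> 1 \<longrightarrow> P (c + 1) c" "s - 1"] by simp
  next
    fix c :: nat assume "\<forall>s\<ge>2. P s (s - 1)" "c \<ge> 1"
    then show "P (c + 1) c" using spec[of "\<lambda>s. s \<ge> 2 \<longrightarrow> P s (s - 1)" "c + 1"] by simp
  qed
  note E = this[of "\<lambda>s c. if s < N then x c \<in> Lsym N s else x c = acs (augI N s) 0"]
  have "x \<in> carrier (lie_lt N :: ('k, _) module) \<longleftrightarrow> x \<in> carrier (gr_alg N :: ('k, _) module) \<and>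
    (\<forall>s\<ge>2. if s < N then x (s - 1) \<in> Lsym N s else x (s - 1) = acs (augI N s) 0)"
    by (simp add: lie_lt_def gr_zero)
  then show ?thesis unfolding E .
qed

lemma zero_in_Lsym: "acs (augI N s) 0 \<in> (Lsym N s :: ('n, 'k) sym set)"
proof -
  have "sy N s id \<in> (Lsym N s :: ('n, 'k) sym set)" by (rule has_lead_sy_in_Lsym[OF has_lead_id])
  then show ?thesis by (simp only: sy_id)
qed

lemma lie_lt_Lsym:
  fixes x :: "nat \<Rightarrow> ('n, 'k) sym"
  shows "x \<in> carrier (lie_lt N :: ('k, _) module) \<Longrightarrow> c \<ge> 1 \<Longrightarrow> x c \<in> Lsym N (c + 1)"
  using zero_in_Lsym[of "c + 1"] unfolding lie_lt_iff by metis

lemma lie_lt_submodule: "submodule (carrier (lie_lt N)) kring (gr_alg N :: ('k, nat \<Rightarrow> ('n, 'k) sym) module)"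
proof (rule submodule_kringI[OF module_gr_alg])
  interpret M: Module.module "kring :: 'k ring" "gr_alg N :: ('k, nat \<Rightarrow> ('n, 'k) sym) module" by (rule module_gr_alg)
  note L = submodule_kringD[OF Lsym_submodule, of "_ + 1", simplified]
  have cl: "c + 1 \<ge> 2" if "c \<ge> 1" for c :: nat using that by simp
  show "carrier (lie_lt N) \<subseteq> carrier (gr_alg N :: ('k, nat \<Rightarrow> ('n, 'k) sym) module)" by (auto simp: lie_lt_iff)
  show "\<zero>\<^bsub>gr_alg N :: ('k, _) module\<^esub> \<in> (carrier (lie_lt N :: ('k, _) module) :: (nat \<Rightarrow> ('n, 'k) sym) set)"
    using M.zero_closed zero_in_Lsym unfolding lie_lt_iff by (auto simp: gr_alg_simps(3) gr_zero)
  fix x :: "nat \<Rightarrow> ('n, 'k) sym" assume x: "x \<in> carrier (lie_lt N :: ('k, _) module)"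
  then have xg: "x \<in> carrier (gr_alg N :: ('k, _) module)" by (simp add: lie_lt_iff)
  show "c \<odot>\<^bsub>gr_alg N :: ('k, _) module\<^esub> x \<in> carrier (lie_lt N :: ('k, _) module)" for c :: 'k
    unfolding lie_lt_iff
  proof (intro conjI allI impI)
    show "c \<odot>\<^bsub>gr_alg N :: ('k, _) module\<^esub> x \<in> carrier (gr_alg N :: ('k, _) module)"
      using M.smult_closed[of c x] xg by simp
    fix a :: nat assume a: "a \<ge> 1"
    show "if a + 1 < N then (c \<odot>\<^bsub>gr_alg N :: ('k, _) module\<^esub> x) a \<in> Lsym N (a + 1)
      else (c \<odot>\<^bsub>gr_alg N :: ('k, _) module\<^esub> x) a = acs (augI N (a + 1)) 0"
      using x a submodule_kringD(4)[OF Lsym_submodule[OF cl[OF a]], of "x a" c]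
        Module.module.smult_r_null[OF module_grN, of c a]
      by (auto simp: lie_lt_iff gr_alg_simps(5) gr_zero)
  qed
  fix y :: "nat \<Rightarrow> ('n, 'k) sym" assume y: "y \<in> carrier (lie_lt N :: ('k, _) module)"
  then have yg: "y \<in> carrier (gr_alg N :: ('k, _) module)" by (simp add: lie_lt_iff)
  show "x \<oplus>\<^bsub>gr_alg N :: ('k, _) module\<^esub> y \<in> carrier (lie_lt N :: ('k, _) module)"
    unfolding lie_lt_iff
  proof (intro conjI allI impI)
    show "x \<oplus>\<^bsub>gr_alg N :: ('k, _) module\<^esub> y \<in> carrier (gr_alg N :: ('k, _) module)" using xg yg by simp
    fix a :: nat assume a: "a \<ge> 1"
    show "if a + 1 < N then (x \<oplus>\<^bsub>gr_alg N :: ('k, _) module\<^esub> y) a \<in> Lsym N (a + 1)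
      else (x \<oplus>\<^bsub>gr_alg N :: ('k, _) module\<^esub> y) a = acs (augI N (a + 1)) 0"
      using x y a submodule_kringD(3)[OF Lsym_submodule[OF cl[OF a]], of "x a" "y a"]
      by (auto simp: lie_lt_iff gr_alg_simps(4) gr_add[OF N1])
  qed
qed

text \<open>A graded upper bound for the derived algebra: exact components below the truncation,
  zero components from degree N - 1 on.\<close>

definition lie_ex :: "(nat \<Rightarrow> ('n, 'k) sym) set" where
  "lie_ex = {z \<in> carrier (gr_alg N :: ('k, _) module).
     \<forall>c\<ge>1. z c \<in> (if c + 1 < N then XL N (c + 1) else {acs (augI N (c + 1)) 0})}"

lemma lie_ex_component_submodule:
  assumes c: "c \<ge> 1"
  shows "submodule (if c + 1 < N then XL N (c + 1) else {acs (augI N (c + 1)) 0}) kring (gr N c :: ('k, ('n, 'k) sym) module)"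
proof (cases "c + 1 < N")
  case True
  then show ?thesis using XL_submodule[of "c + 1"] c by simp
next
  case False
  have "0 \<in> (augI N c :: ('n, 'k) ztn set)" by (rule augI_closed)
  then have "submodule {acs (augI N (c + 1)) 0} kring (gr N c :: ('k, ('n, 'k) sym) module)"
    using Module.module.smult_r_null[OF module_grN, of _ c]
    by (intro submodule_kringI[OF module_grN]) (auto simp: gr_carrier gr_zero gr_add[OF N1])
  then show ?thesis using False by simp
qed

lemma lie_ex_submodule: "submodule lie_ex kring (gr_alg N :: ('k, nat \<Rightarrow> ('n, 'k) sym) module)"
proof (rule submodule_kringI[OF module_gr_alg])
  interpret M: Module.module "kring :: 'k ring" "gr_alg N :: ('k, nat \<Rightarrow> ('n, 'k) sym) module" by (rule module_gr_alg)
  note C = submodule_kringD[OF lie_ex_component_submodule]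
  show "lie_ex \<subseteq> carrier (gr_alg N :: ('k, _) module)" by (auto simp: lie_ex_def)
  show "\<zero>\<^bsub>gr_alg N :: ('k, _) module\<^esub> \<in> lie_ex"
    using M.zero_closed C(2) by (simp add: lie_ex_def gr_alg_simps(3) del: if_split)
  show "x \<oplus>\<^bsub>gr_alg N :: ('k, _) module\<^esub> y \<in> lie_ex" if "x \<in> lie_ex" "y \<in> lie_ex" for x y
  proof -
    note xy = that[unfolded lie_ex_def mem_Collect_eq]
    show ?thesis unfolding lie_ex_def mem_Collect_eq
    proof (intro conjI allI impI)
      show "x \<oplus>\<^bsub>gr_alg N :: ('k, _) module\<^esub> y \<in> carrier (gr_alg N :: ('k, _) module)" using xy by blast
      fix c :: nat assume c: "c \<ge> 1"
      have "(x \<oplus>\<^bsub>gr_alg N :: ('k, _) module\<^esub> y) c = x c \<oplus>\<^bsub>gr N c :: ('k, ('n, 'k) sym) module\<^esub> y c"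
        using c by (simp add: gr_alg_simps(4))
      then show "(x \<oplus>\<^bsub>gr_alg N :: ('k, _) module\<^esub> y) c \<in> (if c + 1 < N then XL N (c + 1) else {acs (augI N (c + 1)) 0})"
        using C(3)[OF c xy(1)[THEN conjunct2, rule_format, OF c] xy(2)[THEN conjunct2, rule_format, OF c]] by (simp only:)
    qed
  qed
  show "c \<odot>\<^bsub>gr_alg N :: ('k, _) module\<^esub> x \<in> lie_ex" if "x \<in> lie_ex" for c :: 'k and x
  proof -
    note x = that[unfolded lie_ex_def mem_Collect_eq]
    show ?thesis unfolding lie_ex_def mem_Collect_eq
    proof (intro conjI allI impI)
      show "c \<odot>\<^bsub>gr_alg N :: ('k, _) module\<^esub> x \<in> carrier (gr_alg N :: ('k, _) module)" using x M.smult_closed[of c x] by simp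
      fix a :: nat assume a: "a \<ge> 1"
      have "(c \<odot>\<^bsub>gr_alg N :: ('k, _) module\<^esub> x) a = c \<odot>\<^bsub>gr N a :: ('k, ('n, 'k) sym) module\<^esub> x a"
        using a by (simp add: gr_alg_simps(5))
      then show "(c \<odot>\<^bsub>gr_alg N :: ('k, _) module\<^esub> x) a \<in> (if a + 1 < N then XL N (a + 1) else {acs (augI N (a + 1)) 0})"
        using C(4)[OF a x[THEN conjunct2, rule_format, OF a], of c] by (simp only:)
    qed
  qed
qed

lemma lie_ex_subset: "lie_ex \<subseteq> carrier (lie_lt N :: ('k, _) module)"
  by (auto simp: lie_ex_def lie_lt_iff XL_eq split: if_splits)

text \<open>The representatives are chosen to be 0 in degrees >= N, which makes the finite support
  of products visible.\<close>

lemma lie_lt_reps: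
  fixes x :: "nat \<Rightarrow> ('n, 'k) sym"
  assumes x: "x \<in> carrier (lie_lt N :: ('k, _) module)"
  obtains \<xi> where "\<And>a. a \<ge> 1 \<Longrightarrow> \<xi> a \<in> augI N a" "\<And>a. a \<ge> 1 \<Longrightarrow> x a = acs (augI N (a + 1)) (\<xi> a)"
    "\<And>a. a \<ge> N \<Longrightarrow> \<xi> a = 0"
proof -
  have "\<exists>z. z \<in> augI N a \<and> x a = acs (augI N (a + 1)) z \<and> (a \<ge> N \<longrightarrow> z = 0)" if a: "a \<ge> 1" for a
  proof (cases "a \<ge> N")
    case True
    have "0 \<in> (augI N a :: ('n, 'k) ztn set)" by (rule augI_closed)
    then show ?thesis using x a True by (auto simp: lie_lt_iff)
  next
    case False
    then show ?thesis using x a gr_alg_carrierD(2)[of x a] by (auto simp: lie_lt_iff gr_carrier)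
  qed
  then obtain \<xi> where "\<And>a. a \<ge> 1 \<Longrightarrow> \<xi> a \<in> augI N a \<and> x a = acs (augI N (a + 1)) (\<xi> a) \<and> (a \<ge> N \<longrightarrow> \<xi> a = 0)"
    by metis
  then show ?thesis using that[of \<xi>] N1 by force
qed

lemma lie_lt_mult:
  fixes x y :: "nat \<Rightarrow> ('n, 'k) sym"
  assumes \<xi>': "\<forall>a\<ge>1. \<xi> a \<in> augI N a" "\<forall>a\<ge>1. x a = acs (augI N (a + 1)) (\<xi> a)" "\<forall>a\<ge>N. \<xi> a = 0"
    and \<eta>': "\<forall>a\<ge>1. \<eta> a \<in> augI N a" "\<forall>a\<ge>1. y a = acs (augI N (a + 1)) (\<eta> a)" "\<forall>a\<ge>N. \<eta> a = 0"
  shows "x \<otimes>\<^bsub>gr_alg N :: ('k, _) module\<^esub> y \<in> carrier (gr_alg N :: ('k, _) module)"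
    "c \<ge> 1 \<Longrightarrow> (x \<otimes>\<^bsub>gr_alg N :: ('k, _) module\<^esub> y) c = acs (augI N (c + 1)) (\<Sum>a\<in>{1..<c}. \<xi> a \<otimes>\<^bsub>ZT N\<^esub> \<eta> (c - a))"
    "a \<in> {1..<c} \<Longrightarrow> \<xi> a \<otimes>\<^bsub>ZT N\<^esub> \<eta> (c - a) \<in> augI N c"
proof -
  note \<xi> = \<xi>'[rule_format] and \<eta> = \<eta>'[rule_format]
  have m: "\<xi> a \<otimes>\<^bsub>ZT N\<^esub> \<eta> (c - a) \<in> augI N c" if "a \<in> {1..<c}" for a c
  proof -
    have "a \<ge> 1" "c - a \<ge> 1" "a + (c - a) = c" using that by auto
    then show ?thesis using augI_mult[OF N1 \<xi>(1)[of a] \<eta>(1)[of "c - a"]] by (simp only:)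
  qed
  show "a \<in> {1..<c} \<Longrightarrow> \<xi> a \<otimes>\<^bsub>ZT N\<^esub> \<eta> (c - a) \<in> augI N c" by (rule m)
  have gm: "gr_mult N a (c - a) (x a) (y (c - a)) = acs (augI N (c + 1)) (\<xi> a \<otimes>\<^bsub>ZT N\<^esub> \<eta> (c - a))" if "a \<in> {1..<c}" for a c
  proof -
    have "a \<ge> 1" "c - a \<ge> 1" "a + (c - a) = c" using that by auto
    then show ?thesis using gr_mult_acs[OF N1 \<xi>(1)[of a] \<eta>(1)[of "c - a"]] \<xi>(2)[of a] \<eta>(2)[of "c - a"] by (simp only:)
  qed
  have v: "(x \<otimes>\<^bsub>gr_alg N :: ('k, _) module\<^esub> y) c = acs (augI N (c + 1)) (\<Sum>a\<in>{1..<c}. \<xi> a \<otimes>\<^bsub>ZT N\<^esub> \<eta> (c - a))" if c: "c \<ge> 1" for c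
  proof -
    interpret M: Module.module "kring :: 'k ring" "gr N c :: ('k, ('n, 'k) sym) module" by (rule module_grN)
    have "(x \<otimes>\<^bsub>gr_alg N :: ('k, _) module\<^esub> y) c = (\<Oplus>\<^bsub>gr N c :: ('k, ('n, 'k) sym) module\<^esub>a\<in>{1..<c}. gr_mult N a (c - a) (x a) (y (c - a)))"
      using c by (simp add: gr_alg_simps(2))
    also have "\<dots> = (\<Oplus>\<^bsub>gr N c :: ('k, ('n, 'k) sym) module\<^esub>a\<in>{1..<c}. acs (augI N (c + 1)) (\<xi> a \<otimes>\<^bsub>ZT N\<^esub> \<eta> (c - a)))"
      using gm m by (intro M.finsum_cong') (auto simp: gr_carrier simp del: ZT_simps)
    also have "\<dots> = acs (augI N (c + 1)) (\<Sum>a\<in>{1..<c}. \<xi> a \<otimes>\<^bsub>ZT N\<^esub> \<eta> (c - a))"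
      using m by (intro gr_finsum) auto
    finally show ?thesis .
  qed
  then show "c \<ge> 1 \<Longrightarrow> (x \<otimes>\<^bsub>gr_alg N :: ('k, _) module\<^esub> y) c = acs (augI N (c + 1)) (\<Sum>a\<in>{1..<c}. \<xi> a \<otimes>\<^bsub>ZT N\<^esub> \<eta> (c - a))" .
  show "x \<otimes>\<^bsub>gr_alg N :: ('k, _) module\<^esub> y \<in> carrier (gr_alg N :: ('k, _) module)"
  \<comment> \<open>In degree c >= 2 N one of the two degrees a and c - a is at least N, so every
    product vanishes.\<close>
  proof (rule gr_alg_carrierI[of _ "{..<2 * N}"])
    show "x \<otimes>\<^bsub>gr_alg N :: ('k, _) module\<^esub> y \<in> extensional {1..}" by (simp add: gr_alg_simps(2))
    fix c :: nat assume c: "c \<ge> 1"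
    have "(\<Sum>a\<in>{1..<c}. \<xi> a \<otimes>\<^bsub>ZT N\<^esub> \<eta> (c - a)) \<in> augI N c"
    proof -
      have "(\<Sum>a\<in>A. \<xi> a \<otimes>\<^bsub>ZT N\<^esub> \<eta> (c - a)) \<in> augI N c" if "finite A" "A \<subseteq> {1..<c}" for A
        using that
      proof (induction A)
        case empty
        show ?case by (simp add: augI_closed)
      next
        case (insert a A)
        then show ?case using m by (simp add: augI_closed del: ZT_simps)
      qed
      then show ?thesis by blast
    qed
    then show "(x \<otimes>\<^bsub>gr_alg N :: ('k, _) module\<^esub> y) c \<in> carrier (gr N c :: ('k, ('n, 'k) sym) module)"
      unfolding v[OF c] gr_carrier by (rule imageI)
    assume "c \<notin> {..<2 * N}"
    then have "\<xi> a \<otimes>\<^bsub>ZT N\<^esub> \<eta> (c - a) = 0" for a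
    proof -
      have "a \<ge> N \<or> c - a \<ge> N" using \<open>c \<notin> {..<2 * N}\<close> by auto
      moreover have "frag_extend (\<lambda>t. 0) z = 0" for z :: "('n, 'k) ztn" by (simp add: frag_extend_def)
      ultimately show ?thesis using \<xi>(3)[of a] \<eta>(3)[of "c - a"] by auto
    qed
    then show "(x \<otimes>\<^bsub>gr_alg N :: ('k, _) module\<^esub> y) c = \<zero>\<^bsub>gr N c :: ('k, ('n, 'k) sym) module\<^esub>"
      unfolding v[OF c] gr_zero by simp
  qed simp
qed

lemma lie_lt_bracket:
  fixes x y :: "nat \<Rightarrow> ('n, 'k) sym"
  assumes x: "x \<in> carrier (lie_lt N :: ('k, _) module)" and y: "y \<in> carrier (lie_lt N :: ('k, _) module)"
  shows "x \<otimes>\<^bsub>gr_alg N :: ('k, _) module\<^esub> y \<ominus>\<^bsub>gr_alg N :: ('k, _) module\<^esub> y \<otimes>\<^bsub>gr_alg N :: ('k, _) module\<^esub> x \<in> carrier (gr_alg N :: ('k, _) module)"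
    "c \<ge> 1 \<Longrightarrow> \<exists>\<beta>. (x \<otimes>\<^bsub>gr_alg N :: ('k, _) module\<^esub> y \<ominus>\<^bsub>gr_alg N :: ('k, _) module\<^esub> y \<otimes>\<^bsub>gr_alg N :: ('k, _) module\<^esub> x) c =
        acs (augI N (c + 1)) (\<Sum>a\<in>{1..<c}. \<beta> a) \<and>
      (\<forall>a\<in>{1..<c}. \<beta> a \<in> augI N c \<and> acs (augI N (c + 1)) (\<beta> a) = gr_bracket N a (c - a) (x a) (y (c - a)))"
proof -
  interpret M: Module.module "kring :: 'k ring" "gr_alg N :: ('k, nat \<Rightarrow> ('n, 'k) sym) module" by (rule module_gr_alg)
  obtain \<xi> where \<xi>: "\<And>a. a \<ge> 1 \<Longrightarrow> \<xi> a \<in> augI N a" "\<And>a. a \<ge> 1 \<Longrightarrow> x a = acs (augI N (a + 1)) (\<xi> a)" "\<And>a. a \<ge> N \<Longrightarrow> \<xi> a = 0"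
    using lie_lt_reps[OF x] by blast
  obtain \<eta> where \<eta>: "\<And>a. a \<ge> 1 \<Longrightarrow> \<eta> a \<in> augI N a" "\<And>a. a \<ge> 1 \<Longrightarrow> y a = acs (augI N (a + 1)) (\<eta> a)" "\<And>a. a \<ge> N \<Longrightarrow> \<eta> a = 0"
    using lie_lt_reps[OF y] by blast
  have \<xi>': "\<forall>a\<ge>1. \<xi> a \<in> augI N a" "\<forall>a\<ge>1. x a = acs (augI N (a + 1)) (\<xi> a)" "\<forall>a\<ge>N. \<xi> a = 0"
    and \<eta>': "\<forall>a\<ge>1. \<eta> a \<in> augI N a" "\<forall>a\<ge>1. y a = acs (augI N (a + 1)) (\<eta> a)" "\<forall>a\<ge>N. \<eta> a = 0"
    using \<xi> \<eta> by blast+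
  note xy = lie_lt_mult[OF \<xi>' \<eta>'] and yx = lie_lt_mult[OF \<eta>' \<xi>']
  show "x \<otimes>\<^bsub>gr_alg N :: ('k, _) module\<^esub> y \<ominus>\<^bsub>gr_alg N :: ('k, _) module\<^esub> y \<otimes>\<^bsub>gr_alg N :: ('k, _) module\<^esub> x \<in> carrier (gr_alg N :: ('k, _) module)"
    by (rule M.minus_closed[OF xy(1) yx(1)])
  assume c: "c \<ge> 1"
  define \<beta> where "\<beta> a = \<xi> a \<otimes>\<^bsub>ZT N\<^esub> \<eta> (c - a) - \<eta> (c - a) \<otimes>\<^bsub>ZT N\<^esub> \<xi> a" for a
  have yx3: "\<eta> (c - a) \<otimes>\<^bsub>ZT N\<^esub> \<xi> a \<in> augI N c" if "a \<in> {1..<c}" for a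
  proof -
    have "c - a \<in> {1..<c}" "c - (c - a) = a" using that by auto
    then show ?thesis using yx(3)[of "c - a" c] by (simp only:)
  qed
  have sum_in: "(\<Sum>a\<in>A. F a) \<in> augI N c" if "\<And>a. a \<in> A \<Longrightarrow> F a \<in> augI N c" for A and F :: "nat \<Rightarrow> ('n, 'k) ztn"
    using that
  proof (induction A rule: infinite_finite_induct)
    case (insert a A)
    then show ?case by (simp add: augI_closed)
  qed (simp_all add: augI_closed)
  \<comment> \<open>The second product is summed in reverse, so that equal a refers to the same pair
    of components in both products and the difference becomes a sum of homogeneous brackets.\<close>
  have rev: "(\<Sum>a\<in>{1..<c}. \<eta> a \<otimes>\<^bsub>ZT N\<^esub> \<xi> (c - a)) = (\<Sum>a\<in>{1..<c}. \<eta> (c - a) \<otimes>\<^bsub>ZT N\<^esub> \<xi> a)"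
    by (rule sum.reindex_bij_witness[where i = "\<lambda>a. c - a" and j = "\<lambda>a. c - a"]) auto
  have "(x \<otimes>\<^bsub>gr_alg N :: ('k, _) module\<^esub> y \<ominus>\<^bsub>gr_alg N :: ('k, _) module\<^esub> y \<otimes>\<^bsub>gr_alg N :: ('k, _) module\<^esub> x) c =
     acs (augI N (c + 1)) ((\<Sum>a\<in>{1..<c}. \<xi> a \<otimes>\<^bsub>ZT N\<^esub> \<eta> (c - a)) - (\<Sum>a\<in>{1..<c}. \<eta> (c - a) \<otimes>\<^bsub>ZT N\<^esub> \<xi> a))"
    unfolding gr_alg_minus[OF xy(1) yx(1) c] xy(2)[OF c] yx(2)[OF c] rev
    by (rule gr_minus[OF N1 sur_int sum_in sum_in]) (use xy(3) yx3 in auto)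
  also have "(\<Sum>a\<in>{1..<c}. \<xi> a \<otimes>\<^bsub>ZT N\<^esub> \<eta> (c - a)) - (\<Sum>a\<in>{1..<c}. \<eta> (c - a) \<otimes>\<^bsub>ZT N\<^esub> \<xi> a) = (\<Sum>a\<in>{1..<c}. \<beta> a)"
    by (simp add: \<beta>_def sum_subtractf)
  finally have 1: "(x \<otimes>\<^bsub>gr_alg N :: ('k, _) module\<^esub> y \<ominus>\<^bsub>gr_alg N :: ('k, _) module\<^esub> y \<otimes>\<^bsub>gr_alg N :: ('k, _) module\<^esub> x) c =
        acs (augI N (c + 1)) (\<Sum>a\<in>{1..<c}. \<beta> a)" .
  have 2: "\<beta> a \<in> augI N c \<and> acs (augI N (c + 1)) (\<beta> a) = gr_bracket N a (c - a) (x a) (y (c - a))" if a: "a \<in> {1..<c}" for a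
  proof
    have a1: "a \<ge> 1" "c - a \<ge> 1" "a + (c - a) = c" "c - a + a = c" using a by auto
    show "\<beta> a \<in> augI N c" unfolding \<beta>_def by (rule augI_closed(3)[OF xy(3)[OF a] yx3[OF a]])
    have "gr_mult N a (c - a) (x a) (y (c - a)) = acs (augI N (c + 1)) (\<xi> a \<otimes>\<^bsub>ZT N\<^esub> \<eta> (c - a))"
      using gr_mult_acs[OF N1 \<xi>(1)[OF a1(1)] \<eta>(1)[OF a1(2)]] unfolding \<xi>(2)[OF a1(1)] \<eta>(2)[OF a1(2)] a1(3) .
    moreover have "gr_mult N (c - a) a (y (c - a)) (x a) = acs (augI N (c + 1)) (\<eta> (c - a) \<otimes>\<^bsub>ZT N\<^esub> \<xi> a)"
      using gr_mult_acs[OF N1 \<eta>(1)[OF a1(2)] \<xi>(1)[OF a1(1)]] unfolding \<xi>(2)[OF a1(1)] \<eta>(2)[OF a1(2)] a1(4) .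
    ultimately show "acs (augI N (c + 1)) (\<beta> a) = gr_bracket N a (c - a) (x a) (y (c - a))"
      unfolding gr_bracket_def a1(3) \<beta>_def
      using gr_minus[OF N1 sur_int xy(3)[OF a] yx3[OF a]] by (simp only:)
  qed
  show "\<exists>\<beta>. (x \<otimes>\<^bsub>gr_alg N :: ('k, _) module\<^esub> y \<ominus>\<^bsub>gr_alg N :: ('k, _) module\<^esub> y \<otimes>\<^bsub>gr_alg N :: ('k, _) module\<^esub> x) c =
        acs (augI N (c + 1)) (\<Sum>a\<in>{1..<c}. \<beta> a) \<and>
      (\<forall>a\<in>{1..<c}. \<beta> a \<in> augI N c \<and> acs (augI N (c + 1)) (\<beta> a) = gr_bracket N a (c - a) (x a) (y (c - a)))"
    using 1 2 by blast
qed

definition lie_brs :: "(nat \<Rightarrow> ('n, 'k) sym) set" where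
  "lie_brs = {x \<otimes>\<^bsub>gr_alg N :: ('k, _) module\<^esub> y \<ominus>\<^bsub>gr_alg N :: ('k, _) module\<^esub> y \<otimes>\<^bsub>gr_alg N :: ('k, _) module\<^esub> x |x y.
    x \<in> carrier (lie_lt N :: ('k, _) module) \<and> y \<in> carrier (lie_lt N :: ('k, _) module)}"

lemma lie_derived_eq: "lie_derived N = kspan (gr_alg N :: ('k, _) module) lie_brs"
  by (simp add: lie_derived_def lie_brs_def)

lemma lie_brs_subset: "lie_brs \<subseteq> lie_ex"
proof
  fix z assume "z \<in> lie_brs"
  then obtain x y where xy: "x \<in> carrier (lie_lt N :: ('k, _) module)" "y \<in> carrier (lie_lt N :: ('k, _) module)"
    and z: "z = x \<otimes>\<^bsub>gr_alg N :: ('k, _) module\<^esub> y \<ominus>\<^bsub>gr_alg N :: ('k, _) module\<^esub> y \<otimes>\<^bsub>gr_alg N :: ('k, _) module\<^esub> x"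
    unfolding lie_brs_def by blast
  have "z c \<in> (if c + 1 < N then XL N (c + 1) else {acs (augI N (c + 1)) 0})" if c: "c \<ge> 1" for c
  proof -
    let ?H = "if c + 1 < N then XL N (c + 1) else {acs (augI N (c + 1)) 0} :: ('n, 'k) sym set"
    note H = submodule_kringD[OF lie_ex_component_submodule[OF c]]
    obtain \<beta> where \<beta>: "z c = acs (augI N (c + 1)) (\<Sum>a\<in>{1..<c}. \<beta> a)"
      "\<And>a. a \<in> {1..<c} \<Longrightarrow> \<beta> a \<in> augI N c \<and> acs (augI N (c + 1)) (\<beta> a) = gr_bracket N a (c - a) (x a) (y (c - a))"
      using lie_lt_bracket(2)[OF xy c] unfolding z by blast
    have b: "acs (augI N (c + 1)) (\<beta> a) \<in> ?H" if a: "a \<in> {1..<c}" for a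
    proof -
      have "a \<ge> 1" "c - a \<ge> 1" "a + 1 \<ge> 2" "c - a + 1 \<ge> 2" "a + 1 + (c - a + 1) - 1 = c + 1" using a by auto
      then show ?thesis
        using bracket_in_XL[OF lie_lt_Lsym[OF xy(1), of a] lie_lt_Lsym[OF xy(2), of "c - a"]] \<beta>(2)[OF a] by (auto split: if_splits)
    qed
    have "acs (augI N (c + 1)) (\<Sum>a\<in>A. \<beta> a) \<in> ?H" if "finite A" "A \<subseteq> {1..<c}" for A
      using that
    proof (induction A)
      case empty
      then show ?case using H(2) by (simp only: gr_zero sum.empty)
    next
      case (insert a A)
      then have "acs (augI N (c + 1)) (\<beta> a) \<oplus>\<^bsub>gr N c :: ('k, ('n, 'k) sym) module\<^esub> acs (augI N (c + 1)) (\<Sum>a\<in>A. \<beta> a) \<in> ?H"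
        by (intro H(3) b) auto
      then show ?case unfolding sum.insert[OF insert(1,2)] by (simp only: gr_add[OF N1])
    qed
    then show ?thesis unfolding \<beta>(1) by blast
  qed
  then show "z \<in> lie_ex" using lie_lt_bracket(1)[OF xy] unfolding lie_ex_def z by blast
qed

lemma lie_derived_subset: "lie_derived N \<subseteq> lie_ex"
  unfolding lie_derived_eq by (rule kspan_subset[OF lie_ex_submodule lie_brs_subset])

lemma lie_derived_submodule: "submodule (lie_derived N) kring (gr_alg N :: ('k, nat \<Rightarrow> ('n, 'k) sym) module)"
  unfolding lie_derived_eq
  by (rule kspan_submodule[OF module_gr_alg]) (use lie_brs_subset submodule_kringD(1)[OF lie_ex_submodule] in blast)

lemma gr_incl_in:
  fixes u :: "('n, 'k) sym"
  assumes "a \<ge> 1" "u \<in> carrier (gr N a :: ('k, ('n, 'k) sym) module)"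
  shows "gr_incl N a u \<in> carrier (gr_alg N :: ('k, _) module)"
  by (rule gr_alg_carrierI[of _ "{a}"])
     (use assms in \<open>auto simp: gr_incl_def abelian_monoid.zero_closed[OF abelian_group.axioms(1)[OF Module.module.axioms(2)[OF module_grN]]]\<close>)

lemma gr_incl_in_lt:
  fixes u :: "('n, 'k) sym"
  assumes s: "2 \<le> s" "s < N" and u: "u \<in> Lsym N s"
  shows "gr_incl N (s - 1) u \<in> carrier (lie_lt N :: ('k, _) module)"
proof -
  have "u \<in> carrier (gr N (s - 1) :: ('k, ('n, 'k) sym) module)" using submodule_kringD(1)[OF Lsym_submodule[OF s(1)]] u by blast
  then have "gr_incl N (s - 1) u \<in> carrier (gr_alg N :: ('k, _) module)" using s by (intro gr_incl_in) auto
  then show ?thesis unfolding lie_lt_iff using s u zero_in_Lsym by (auto simp: gr_incl_def gr_zero)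
qed

lemma gr_incl_linear:
  fixes u v :: "('n, 'k) sym"
  assumes "a \<ge> 1"
  shows "gr_incl N a (u \<oplus>\<^bsub>gr N a :: ('k, ('n, 'k) sym) module\<^esub> v) = gr_incl N a u \<oplus>\<^bsub>gr_alg N :: ('k, _) module\<^esub> gr_incl N a v"
    "gr_incl N a (c \<odot>\<^bsub>gr N a :: ('k, ('n, 'k) sym) module\<^esub> u) = c \<odot>\<^bsub>gr_alg N :: ('k, _) module\<^esub> gr_incl N a u"
    "gr_incl N a (\<zero>\<^bsub>gr N a :: ('k, ('n, 'k) sym) module\<^esub>) = \<zero>\<^bsub>gr_alg N :: ('k, _) module\<^esub>"
proof -
  note M = module_grN
  note B = abelian_group.axioms(1)[OF Module.module.axioms(2)[OF M]]
  show "gr_incl N a (u \<oplus>\<^bsub>gr N a :: ('k, ('n, 'k) sym) module\<^esub> v) = gr_incl N a u \<oplus>\<^bsub>gr_alg N :: ('k, _) module\<^esub> gr_incl N a v"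
    by (rule gr_alg_eqI) (auto simp: gr_incl_def gr_alg_simps(4) abelian_monoid.l_zero[OF B] abelian_monoid.zero_closed[OF B])
  show "gr_incl N a (c \<odot>\<^bsub>gr N a :: ('k, ('n, 'k) sym) module\<^esub> u) = c \<odot>\<^bsub>gr_alg N :: ('k, _) module\<^esub> gr_incl N a u"
    using Module.module.smult_r_null[OF M, of c] by (intro gr_alg_eqI) (auto simp: gr_incl_def gr_alg_simps(5))
  show "gr_incl N a (\<zero>\<^bsub>gr N a :: ('k, ('n, 'k) sym) module\<^esub>) = \<zero>\<^bsub>gr_alg N :: ('k, _) module\<^esub>"
    by (rule gr_alg_eqI) (auto simp: gr_incl_def gr_alg_simps(3))
qed

text \<open>A zero symbol is represented by an element one step deeper in the filtration, so both
  products fall into the next step.\<close>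

lemma gr_bracket_zero:
  assumes u: "u \<in> (Lsym N (a + 1) :: ('n, 'k) sym set)" and v: "v \<in> Lsym N (b + 1)" and ab: "a \<ge> 1" "b \<ge> 1"
    and z: "u = acs (augI N (a + 1)) 0 \<or> v = acs (augI N (b + 1)) 0"
  shows "gr_bracket N a b u v = acs (augI N (a + b + 1)) 0"
proof -
  note S1 = submodule_kringD(1)[OF Lsym_submodule]
  have "u \<in> carrier (gr N a :: ('k, ('n, 'k) sym) module)" "v \<in> carrier (gr N b :: ('k, ('n, 'k) sym) module)"
    using S1[of "a + 1"] S1[of "b + 1"] u v ab by auto
  then obtain \<xi> \<eta> where x: "\<xi> \<in> augI N a" "u = acs (augI N (a + 1)) \<xi>" and y: "\<eta> \<in> augI N b" "v = acs (augI N (b + 1)) \<eta>"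
    unfolding gr_carrier by blast
  have "\<xi> \<in> augI N (a + 1) \<or> \<eta> \<in> augI N (b + 1)"
    using z unfolding x(2) y(2) acs_eq_iff[OF asub_augI[OF N1]] by simp
  then have "\<xi> \<otimes>\<^bsub>ZT N\<^esub> \<eta> \<in> augI N (a + b + 1) \<and> \<eta> \<otimes>\<^bsub>ZT N\<^esub> \<xi> \<in> augI N (a + b + 1)"
    using augI_mult[OF N1, of \<xi> "a + 1" \<eta> b] augI_mult[OF N1, of \<eta> b \<xi> "a + 1"]
      augI_mult[OF N1, of \<xi> a \<eta> "b + 1"] augI_mult[OF N1, of \<eta> "b + 1" \<xi> a] x(1) y(1)
    by (auto simp: ac_simps simp del: ZT_simps)
  then have "\<xi> \<otimes>\<^bsub>ZT N\<^esub> \<eta> - \<eta> \<otimes>\<^bsub>ZT N\<^esub> \<xi> \<in> augI N (a + b + 1)" using augI_closed(3) by blast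
  moreover have "gr_bracket N a b u v = acs (augI N (a + b + 1)) (\<xi> \<otimes>\<^bsub>ZT N\<^esub> \<eta> - \<eta> \<otimes>\<^bsub>ZT N\<^esub> \<xi>)"
    unfolding gr_bracket_def x(2) y(2) gr_mult_acs[OF N1 x(1) y(1)] gr_mult_acs[OF N1 y(1) x(1)] add.commute[of b a]
    using augI_mult[OF N1 y(1) x(1)] by (intro gr_minus[OF N1 sur_int augI_mult[OF N1 x(1) y(1)]]) (simp only: add.commute)
  ultimately show ?thesis by (simp add: acs_eq_iff[OF asub_augI[OF N1]] del: ZT_simps)
qed

text \<open>All brackets of L_a with L_b land in the exact part, which is already spanned by the
  brackets of L_2 with L_(d-1). Hence the degree d - 1 part of the derived algebra is this one
  bracket space, although the derived algebra uses arbitrary elements.\<close>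

lemma gr_incl_in_derived:
  assumes d: "3 \<le> d" "d < N"
  shows "gr_incl N (d - 1) u \<in> lie_derived N \<and> u \<in> Lsym N d \<longleftrightarrow> u \<in> (XL N d :: ('n, 'k) sym set)"
proof
  assume "gr_incl N (d - 1) u \<in> lie_derived N \<and> u \<in> Lsym N d"
  then have "gr_incl N (d - 1) u \<in> lie_ex" using lie_derived_subset by blast
  then have "\<forall>c\<ge>1. gr_incl N (d - 1) u c \<in> (if c + 1 < N then XL N (c + 1) else {acs (augI N (c + 1)) 0})"
    unfolding lie_ex_def by blast
  from this[rule_format, of "d - 1"] show "u \<in> XL N d" using d by (simp add: gr_incl_def)
next
  assume u: "u \<in> XL N d"
  define H where "H = {u \<in> carrier (gr N (d - 1) :: ('k, ('n, 'k) sym) module). gr_incl N (d - 1) u \<in> lie_derived N}"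
  define S where "S = {gr_bracket N 1 (d - 2) u v |u v. (u :: ('n, 'k) sym) \<in> Lsym N 2 \<and> v \<in> Lsym N (d - 1)}"
  interpret M: Module.module "kring :: 'k ring" "gr N (d - 1) :: ('k, ('n, 'k) sym) module" by (rule module_grN)
  have d1: "d - 1 \<ge> 1" using d by simp
  note I = gr_incl_linear[OF d1] and DD = submodule_kringD[OF lie_derived_submodule]
  have H: "submodule H kring (gr N (d - 1) :: ('k, ('n, 'k) sym) module)"
  proof (rule submodule_kringI[OF module_grN])
    show "c \<odot>\<^bsub>gr N (d - 1)\<^esub> x \<in> H" if "x \<in> H" for c :: 'k and x
      using that M.smult_closed[of c x] DD(4) by (simp add: H_def I)
  qed (use DD(2,3) in \<open>auto simp: H_def I\<close>)
  have "S \<subseteq> H"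
  proof
    fix w assume "w \<in> S"
    then obtain v1 v2 where v: "(v1 :: ('n, 'k) sym) \<in> Lsym N 2" "v2 \<in> Lsym N (d - 1)" "w = gr_bracket N 1 (d - 2) v1 v2"
      unfolding S_def by blast
    have wX: "w \<in> XL N d"
      proof -
      have "(2 :: nat) - 1 = 1" "d - 1 - 1 = d - 2" "2 + (d - 1) - 1 = d" "(2 :: nat) \<le> 2" "2 \<le> d - 1" using d by auto
      note e = this
      show ?thesis using bracket_in_XL[OF v(1,2) e(4,5)] d(2) unfolding e(1,2,3) v(3) by (simp only: if_True)
    qed
    then have wc: "w \<in> carrier (gr N (d - 1) :: ('k, ('n, 'k) sym) module)"
      using submodule_kringD(1)[OF XL_submodule[of d]] d by auto
    define x where "x = gr_incl N (2 - 1) v1"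
    define y where "y = gr_incl N (d - 1 - 1) v2"
    have x: "x \<in> carrier (lie_lt N :: ('k, _) module)" unfolding x_def by (rule gr_incl_in_lt) (use v d in auto)
    have y: "y \<in> carrier (lie_lt N :: ('k, _) module)" unfolding y_def by (rule gr_incl_in_lt) (use v d in auto)
    have "gr_incl N (d - 1) w = x \<otimes>\<^bsub>gr_alg N :: ('k, _) module\<^esub> y \<ominus>\<^bsub>gr_alg N :: ('k, _) module\<^esub> y \<otimes>\<^bsub>gr_alg N :: ('k, _) module\<^esub> x"
    proof (rule gr_alg_eqI)
      show "gr_incl N (d - 1) w \<in> extensional {1..}" by (simp add: gr_incl_def)
      show "x \<otimes>\<^bsub>gr_alg N :: ('k, _) module\<^esub> y \<ominus>\<^bsub>gr_alg N :: ('k, _) module\<^esub> y \<otimes>\<^bsub>gr_alg N :: ('k, _) module\<^esub> x \<in> extensional {1..}"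
        by (rule gr_alg_carrierD(1)[OF lie_lt_bracket(1)[OF x y]])
      fix c :: nat assume c: "c \<ge> 1"
      obtain \<beta> where \<beta>: "(x \<otimes>\<^bsub>gr_alg N :: ('k, _) module\<^esub> y \<ominus>\<^bsub>gr_alg N :: ('k, _) module\<^esub> y \<otimes>\<^bsub>gr_alg N :: ('k, _) module\<^esub> x) c = acs (augI N (c + 1)) (\<Sum>a\<in>{1..<c}. \<beta> a)"
        "\<And>a. a \<in> {1..<c} \<Longrightarrow> \<beta> a \<in> augI N c \<and> acs (augI N (c + 1)) (\<beta> a) = gr_bracket N a (c - a) (x a) (y (c - a))"
        using lie_lt_bracket(2)[OF x y c] by blast
      \<comment> \<open>x and y are concentrated in degrees 1 and d - 2, so only the pair (1, d - 2)
        can contribute to their commutator.\<close>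
      have small: "\<beta> a \<in> augI N (c + 1)" if a: "a \<in> {1..<c}" "a \<noteq> 1 \<or> c - a \<noteq> d - 2" for a
      proof -
        have a1: "a \<ge> 1" "c - a \<ge> 1" "a + (c - a) = c" using a(1) by auto
        have "x a = acs (augI N (a + 1)) 0 \<or> y (c - a) = acs (augI N (c - a + 1)) 0"
          using a a1 by (auto simp: x_def y_def gr_incl_def gr_zero)
        from gr_bracket_zero[OF lie_lt_Lsym[OF x a1(1)] lie_lt_Lsym[OF y a1(2)] a1(1,2) this]
        have "acs (augI N (c + 1)) (\<beta> a) = acs (augI N (c + 1)) 0" using \<beta>(2)[OF a(1)] unfolding a1(3) by simp
        then show ?thesis unfolding acs_eq_iff[OF asub_augI[OF N1]] by simp
      qed
      have sums: "(\<Sum>a\<in>A. \<beta> a) \<in> augI N (c + 1)" if "\<And>a. a \<in> A \<Longrightarrow> \<beta> a \<in> augI N (c + 1)" for A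
        using that
      proof (induction A rule: infinite_finite_induct)
        case (insert a A)
        then show ?case by (simp add: augI_closed)
      qed (simp_all add: augI_closed)
      show "gr_incl N (d - 1) w c = (x \<otimes>\<^bsub>gr_alg N :: ('k, _) module\<^esub> y \<ominus>\<^bsub>gr_alg N :: ('k, _) module\<^esub> y \<otimes>\<^bsub>gr_alg N :: ('k, _) module\<^esub> x) c"
      proof (cases "c = d - 1")
        case True
        have i1: "1 \<in> {1..<c}" using True d by auto
        have "(\<Sum>a\<in>{1..<c}. \<beta> a) = \<beta> 1 + (\<Sum>a\<in>{1..<c} - {1}. \<beta> a)" by (rule sum.remove) (use i1 in auto)
        moreover have "(\<Sum>a\<in>{1..<c} - {1}. \<beta> a) \<in> augI N (c + 1)" by (rule sums) (auto intro: small)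
        ultimately have "acs (augI N (c + 1)) (\<Sum>a\<in>{1..<c}. \<beta> a) = acs (augI N (c + 1)) (\<beta> 1)"
          by (simp add: acs_eq_iff[OF asub_augI[OF N1]])
        also have "\<dots> = gr_bracket N 1 (c - 1) (x 1) (y (c - 1))" using \<beta>(2)[OF i1] by simp
        also have "\<dots> = w"
        proof -
          have e: "(2 :: nat) - 1 = 1" "d - 1 - 1 = d - 2" "c - 1 = d - 2" "1 \<le> d - 2" using True d by auto
          show ?thesis unfolding v(3) x_def y_def gr_incl_def e(1-3) using e(4) by simp
        qed
        finally show ?thesis unfolding \<beta>(1) using True c by (simp add: gr_incl_def)
      next
        case False
        have "(\<Sum>a\<in>{1..<c}. \<beta> a) \<in> augI N (c + 1)"
          by (rule sums, rule small) (use False d in auto)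
        then have "acs (augI N (c + 1)) (\<Sum>a\<in>{1..<c}. \<beta> a) = acs (augI N (c + 1)) 0"
          by (simp add: acs_eq_iff[OF asub_augI[OF N1]])
        then show ?thesis unfolding \<beta>(1) using False c by (simp add: gr_incl_def gr_zero)
      qed
    qed
    then have "gr_incl N (d - 1) w \<in> lie_brs"
      unfolding lie_brs_def by (intro CollectI exI[of _ x] exI[of _ y] conjI x y)
    then have "gr_incl N (d - 1) w \<in> lie_derived N"
      unfolding lie_derived_eq by (rule subsetD[OF kspan_superset])
    then show "w \<in> H" unfolding H_def using wc by simp
  qed
  then have "kspan (gr N (d - 1) :: ('k, ('n, 'k) sym) module) S \<subseteq> H" by (rule kspan_subset[OF H])
  moreover have "kspan (gr N (d - 1) :: ('k, ('n, 'k) sym) module) S = lie_bracket N 2 (d - 1)"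
  proof -
    have e: "1 + (d - 2) = d - 1" "d - 1 - 1 = d - 2" "(2 :: nat) - 1 = 1" using d by auto
    show ?thesis unfolding lie_bracket_def S_def e ..
  qed
  ultimately have "u \<in> H" using u lie_bracket_eq_XL[OF d] by blast
  then show "gr_incl N (d - 1) u \<in> lie_derived N \<and> u \<in> Lsym N d" using u by (simp add: H_def XL_eq)
qed

text \<open>The map from L_d to the abelianization has as its kernel the symbols whose inclusion is
  in the derived algebra, which is the bracket space of the preceding result.\<close>

lemma lie_abel_iso:
  assumes d: "3 \<le> d" "d < N"
  shows "\<exists>\<theta>. lin_iso (lie_quot N d :: ('k, ('n, 'k) sym set) module) (lie_abel_comp N d) \<theta> \<and>
     (\<forall>u\<in>Lsym N d. \<theta> (lie_bracket N 2 (d - 1) +>\<^bsub>lie_mod N d\<^esub> u) = lie_to_abel N d u)"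
proof -
  let ?LT = "lie_lt N :: ('k, nat \<Rightarrow> ('n, 'k) sym) module"
  let ?I = "gr_incl N (d - 1) :: ('n, 'k) sym \<Rightarrow> _"
  have d2: "2 \<le> d" "d - 1 \<ge> 1" using d by auto
  have ops: "x \<oplus>\<^bsub>?LT\<^esub> y = x \<oplus>\<^bsub>gr_alg N :: ('k, _) module\<^esub> y" "c \<odot>\<^bsub>?LT\<^esub> x = c \<odot>\<^bsub>gr_alg N :: ('k, _) module\<^esub> x"
    "\<zero>\<^bsub>?LT\<^esub> = \<zero>\<^bsub>gr_alg N :: ('k, _) module\<^esub>" for x y c by (simp_all add: lie_lt_def)
  have LTeq: "?LT = (gr_alg N)\<lparr>carrier := carrier ?LT\<rparr>" by (simp add: lie_lt_def)
  have M: "Module.module kring ?LT"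
    by (subst LTeq) (rule submodule.submodule_is_module[OF lie_lt_submodule module_gr_alg])
  have U: "submodule (lie_derived N) kring ?LT"
    by (rule submodule_kringI[OF M])
       (use submodule_kringD[OF lie_derived_submodule] lie_derived_subset lie_ex_subset in \<open>auto simp: ops\<close>)
  note Q = quot_mod_simps[OF M U] and QM = quot_mod_module[OF M U]
  have ab: "lie_abel N = quot_mod ?LT (lie_derived N)" by (simp add: lie_abel_def)
  have I: "?I u \<in> carrier ?LT" if "u \<in> Lsym N d" for u by (rule gr_incl_in_lt[OF d2(1) d(2) that])
  note IL = gr_incl_linear[OF d2(2)]
  note L = submodule_kringD[OF Lsym_submodule[OF d2(1)]]
  have ta: "lie_to_abel N d u = lie_derived N +>\<^bsub>?LT\<^esub> ?I u" for u by (simp add: lie_to_abel_def)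
  have t: "lie_to_abel N d u \<in> carrier (lie_abel N :: ('k, (nat \<Rightarrow> ('n, 'k) sym) set) module)" if "u \<in> Lsym N d" for u
    unfolding ab Q(1) ta using I[OF that] by blast
  have tadd: "lie_to_abel N d (u \<oplus>\<^bsub>gr N (d - 1) :: ('k, ('n, 'k) sym) module\<^esub> v) = lie_to_abel N d u \<oplus>\<^bsub>lie_abel N :: ('k, (nat \<Rightarrow> ('n, 'k) sym) set) module\<^esub> lie_to_abel N d v"
    if "u \<in> Lsym N d" "v \<in> Lsym N d" for u v
    unfolding ab ta Q(3)[OF I[OF that(1)] I[OF that(2)]] IL ops ..
  have tsm: "lie_to_abel N d (c \<odot>\<^bsub>gr N (d - 1) :: ('k, ('n, 'k) sym) module\<^esub> u) = c \<odot>\<^bsub>lie_abel N :: ('k, (nat \<Rightarrow> ('n, 'k) sym) set) module\<^esub> lie_to_abel N d u"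
    if "u \<in> Lsym N d" for c :: 'k and u
    unfolding ab ta Q(4)[OF I[OF that]] IL ops ..
  interpret LM: Module.module "kring :: 'k ring" ?LT by (rule M)
  have tz: "lie_to_abel N d (\<zero>\<^bsub>gr N (d - 1) :: ('k, ('n, 'k) sym) module\<^esub>) = \<zero>\<^bsub>lie_abel N :: ('k, (nat \<Rightarrow> ('n, 'k) sym) set) module\<^esub>"
    unfolding ab ta Q(2) IL ops(3)[symmetric]
    using LM.a_coset_add_zero[OF submodule_kringD(1)[OF U]] .
  have sub: "submodule (lie_to_abel N d ` Lsym N d) kring (lie_abel N :: ('k, (nat \<Rightarrow> ('n, 'k) sym) set) module)"
  proof (rule submodule_kringI[OF QM[folded ab]])
    show "lie_to_abel N d ` Lsym N d \<subseteq> carrier (lie_abel N :: ('k, (nat \<Rightarrow> ('n, 'k) sym) set) module)" using t by auto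
    show "\<zero>\<^bsub>lie_abel N :: ('k, (nat \<Rightarrow> ('n, 'k) sym) set) module\<^esub> \<in> lie_to_abel N d ` (Lsym N d :: ('n, 'k) sym set)"
      unfolding tz[symmetric] using L(2) by (rule imageI)
    show "x \<oplus>\<^bsub>lie_abel N :: ('k, (nat \<Rightarrow> ('n, 'k) sym) set) module\<^esub> y \<in> lie_to_abel N d ` (Lsym N d :: ('n, 'k) sym set)"
      if "x \<in> lie_to_abel N d ` (Lsym N d :: ('n, 'k) sym set)" "y \<in> lie_to_abel N d ` (Lsym N d :: ('n, 'k) sym set)" for x y
      using that L(3) by (auto simp flip: tadd)
    show "c \<odot>\<^bsub>lie_abel N :: ('k, (nat \<Rightarrow> ('n, 'k) sym) set) module\<^esub> x \<in> lie_to_abel N d ` (Lsym N d :: ('n, 'k) sym set)"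
      if "x \<in> lie_to_abel N d ` (Lsym N d :: ('n, 'k) sym set)" for c :: 'k and x
      using that L(4) by (auto simp flip: tsm)
  qed
  have 1: "lin_map (lie_mod N d :: ('k, ('n, 'k) sym) module) (lie_abel_comp N d) (lie_to_abel N d)"
    unfolding lin_map_def
    using module_lie_mod[OF d2(1)] submodule.submodule_is_module[OF sub QM[folded ab]]
    by (auto simp: lie_mod_simps lie_abel_comp_def tadd tsm)
  have 2: "lie_to_abel N d ` carrier (lie_mod N d :: ('k, ('n, 'k) sym) module) = carrier (lie_abel_comp N d :: ('k, _) module)"
    by (simp add: lie_mod_simps lie_abel_comp_def)
  have 3: "{x \<in> carrier (lie_mod N d :: ('k, ('n, 'k) sym) module). lie_to_abel N d x = \<zero>\<^bsub>lie_abel_comp N d :: ('k, _) module\<^esub>} = lie_bracket N 2 (d - 1)"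
  proof -
    have "lie_to_abel N d u = \<zero>\<^bsub>lie_abel N :: ('k, (nat \<Rightarrow> ('n, 'k) sym) set) module\<^esub> \<longleftrightarrow> ?I u \<in> lie_derived N" if "u \<in> Lsym N d" for u
    proof -
      have "lie_derived N +>\<^bsub>?LT\<^esub> ?I u = lie_derived N +>\<^bsub>?LT\<^esub> \<zero>\<^bsub>?LT\<^esub> \<longleftrightarrow> ?I u \<ominus>\<^bsub>?LT\<^esub> \<zero>\<^bsub>?LT\<^esub> \<in> lie_derived N"
        by (rule quot_coset_eq_iff[OF M U I[OF that] LM.zero_closed])
      moreover have "?I u \<ominus>\<^bsub>?LT\<^esub> \<zero>\<^bsub>?LT\<^esub> = ?I u" using I[OF that] by (simp add: a_minus_def LM.minus_zero)
      ultimately show ?thesis unfolding ta ab Q(2) using LM.a_coset_add_zero[OF submodule_kringD(1)[OF U]] by simp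
    qed
    then show ?thesis
      unfolding lie_bracket_eq_XL[OF d] using gr_incl_in_derived[OF d]
      by (auto simp: lie_mod_simps lie_abel_comp_def)
  qed
  show ?thesis using first_isomorphism[OF 1 2 3] unfolding lie_quot_def lie_mod_simps(1) .
qed

end


section \<open>Formal tensors and rational modules\<close>

text \<open>Keys may cancel in a sum of formal tensors. Since F vanishes at 0, all three sums extend
  to the union of the key sets.\<close>

lemma keys_sum_add:
  assumes "\<And>m. F m 0 = (0 :: 'b::comm_monoid_add)" "\<And>m a b. F m (a + b) = F m a + F m b"
  shows "(\<Sum>m\<in>keys (s + t). F m (lookup (s + t) m)) =
    (\<Sum>m\<in>keys s. F m (lookup s m)) + (\<Sum>m\<in>keys t. F m (lookup t m))"
proof -
  have e: "(\<Sum>m\<in>keys u. F m (lookup u m)) = (\<Sum>m\<in>keys s \<union> keys t. F m (lookup u m))"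
    if "keys u \<subseteq> keys s \<union> keys t" for u
    using that by (intro sum.mono_neutral_left) (auto simp: assms(1) in_keys_iff)
  show ?thesis using e[of s] e[of t] e[of "s + t"] keys_add[of s t]
    by (simp add: lookup_add assms(2) sum.distrib)
qed

lemma single_sum: "Poly_Mapping.single y (sum f A) = (\<Sum>x\<in>A. Poly_Mapping.single y (f x))"
  by (induction A rule: infinite_finite_induct) (simp_all add: single_add)

lemma lookup_tscale [simp]: "lookup (tscale c t) m = c * lookup t m"
  by (simp add: tscale_def Poly_Mapping.map.rep_eq when_def)

interpretation tens: Modules.module "tscale :: 'c::comm_ring_1 \<Rightarrow> ('m \<Rightarrow>\<^sub>0 'c) \<Rightarrow> ('m \<Rightarrow>\<^sub>0 'c)"
  by standard (auto intro!: poly_mapping_eqI simp: lookup_add algebra_simps)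

lemma tscale_single: "tscale c (Poly_Mapping.single m a) = Poly_Mapping.single m (c * a)"
  by (rule poly_mapping_eqI) (simp add: lookup_single when_def)

lemma keys_tscale: "keys (tscale c t) \<subseteq> keys t"
  by (auto simp: in_keys_iff)

lemma tens_map_single: "tens_map f (Poly_Mapping.single m c) = Poly_Mapping.single (f m) c"
  by (simp add: tens_map_def)

lemma tens_map_0 [simp]: "tens_map f 0 = 0"
  by (simp add: tens_map_def)

lemma tens_map_add: "tens_map f (s + t) = tens_map f s + tens_map f t"
  unfolding tens_map_def by (rule keys_sum_add) (simp_all add: single_add)

lemma tens_map_sum: "tens_map f (sum h A) = (\<Sum>x\<in>A. tens_map f (h x))"
  by (induction A rule: infinite_finite_induct) (simp_all add: tens_map_add)

lemma tens_map_tscale: "tens_map f (tscale c t) = tscale c (tens_map f t)"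
proof (induction t rule: poly_mapping_single_induct)
  case (single m a)
  then show ?case by (simp add: tscale_single tens_map_single)
qed (simp_all add: tens_map_add tens.scale_right_distrib)

lemma tens_map_diff: "tens_map f (s - t) = tens_map f s - tens_map f t"
  using tens_map_add[of f "s - t" t] by (simp add: algebra_simps)

lemma keys_tens_map: "keys (tens_map f t) \<subseteq> f ` keys t"
  unfolding tens_map_def using keys_sum[of "\<lambda>m. Poly_Mapping.single (f m) (lookup t m)" "keys t"] by auto

lemma tens_map_cong: "(\<And>m. m \<in> keys t \<Longrightarrow> f m = h m) \<Longrightarrow> tens_map f t = tens_map h t"
  by (simp add: tens_map_def)

lemma tens_map_comp: "tens_map f (tens_map h t) = tens_map (\<lambda>x. f (h x)) t"
  unfolding tens_map_def[of h] tens_map_def[of "\<lambda>x. f (h x)"] by (simp add: tens_map_sum tens_map_single)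

lemma tens_map_ident: "tens_map (\<lambda>x. x) t = t"
  unfolding tens_map_def by (simp flip: poly_mapping_eq_sum_single)

lemma tens_extend_single: "tens_extend \<psi> (Poly_Mapping.single m c) = tscale c (\<psi> m)"
  by (simp add: tens_extend_def)

lemma tens_extend_add: "tens_extend \<psi> (s + t) = tens_extend \<psi> s + tens_extend \<psi> t"
  unfolding tens_extend_def by (rule keys_sum_add) (simp_all add: tens.scale_left_distrib)

lemma tens_extend_sum: "tens_extend \<psi> (sum h A) = (\<Sum>x\<in>A. tens_extend \<psi> (h x))"
  by (induction A rule: infinite_finite_induct) (simp_all add: tens_extend_add, simp_all add: tens_extend_def)

lemma tens_extend_tens_map: "tens_extend \<psi> (tens_map f t) = tens_extend (\<lambda>x. \<psi> (f x)) t"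
  unfolding tens_map_def tens_extend_sum tens_extend_single by (simp add: tens_extend_def)

lemma tens_map_tens_extend: "tens_map f (tens_extend \<psi> t) = tens_extend (\<lambda>x. tens_map f (\<psi> x)) t"
  by (simp add: tens_extend_def tens_map_sum tens_map_tscale)

lemma tens_extend_cong: "(\<And>m. m \<in> keys t \<Longrightarrow> \<psi> m = \<psi>' m) \<Longrightarrow> tens_extend \<psi> t = tens_extend \<psi>' t"
  by (simp add: tens_extend_def)

lemma tens_eq_refl [simp]: "tens_eq M t t"
  by (simp add: tens_eq_def tens.span_zero)

lemma tens_eq_sym: "tens_eq M t u \<Longrightarrow> tens_eq M u t"
  unfolding tens_eq_def using tens.span_neg[of "t - u"] by force

lemma tens_eq_trans: "tens_eq M t u \<Longrightarrow> tens_eq M u v \<Longrightarrow> tens_eq M t v"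
  unfolding tens_eq_def using tens.span_add[of "t - u" _ "u - v"] by force

lemma tens_eq_add: "tens_eq M t u \<Longrightarrow> tens_eq M t' u' \<Longrightarrow> tens_eq M (t + t') (u + u')"
  unfolding tens_eq_def using tens.span_add[of "t - u" _ "t' - u'"] by (simp add: algebra_simps)

lemma tens_eq_sum: "(\<And>x. x \<in> A \<Longrightarrow> tens_eq M (f x) (h x)) \<Longrightarrow> tens_eq M (sum f A) (sum h A)"
  by (induction A rule: infinite_finite_induct) (auto intro: tens_eq_add)

lemma tens_eq_single_add:
  assumes "x \<in> carrier M" "y \<in> carrier M"
  shows "tens_eq M (Poly_Mapping.single (x \<oplus>\<^bsub>M\<^esub> y) c) (Poly_Mapping.single x c + Poly_Mapping.single y c)"
proof -
  have "tscale c (Poly_Mapping.single (x \<oplus>\<^bsub>M\<^esub> y) 1 - Poly_Mapping.single x 1 - Poly_Mapping.single y 1)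
      \<in> tens.span (tens_rels M)"
    using assms by (intro tens.span_scale tens.span_base) (auto simp: tens_rels_def)
  then show ?thesis by (simp add: tens_eq_def tens.scale_right_diff_distrib tscale_single algebra_simps)
qed

lemma tens_eq_single_smult:
  assumes "x \<in> carrier M"
  shows "tens_eq M (Poly_Mapping.single (a \<odot>\<^bsub>M\<^esub> x) c) (Poly_Mapping.single x (to_ac a * c))"
proof -
  have "tscale c (Poly_Mapping.single (a \<odot>\<^bsub>M\<^esub> x) 1 - Poly_Mapping.single x (to_ac a))
      \<in> tens.span (tens_rels M)"
    using assms by (intro tens.span_scale tens.span_base) (auto simp: tens_rels_def)
  then show ?thesis by (simp add: tens_eq_def tens.scale_right_diff_distrib tscale_single mult.commute)
qed

lemma tens_eq_tens_map:
  assumes f: "lin_map M M' f" and tu: "tens_eq M t u"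
  shows "tens_eq M' (tens_map f t) (tens_map f u)"
proof -
  let ?T = "{z. tens_map f z \<in> tens.span (tens_rels M')}"
  have "tens_rels M \<subseteq> ?T"
  proof
    fix z assume "z \<in> tens_rels M"
    then consider x y where "x \<in> carrier M" "y \<in> carrier M"
        "z = Poly_Mapping.single (x \<oplus>\<^bsub>M\<^esub> y) 1 - Poly_Mapping.single x 1 - Poly_Mapping.single y 1"
      | c x where "x \<in> carrier M" "z = Poly_Mapping.single (c \<odot>\<^bsub>M\<^esub> x) 1 - Poly_Mapping.single x (to_ac c)"
      by (auto simp: tens_rels_def)
    then show "z \<in> ?T"
    proof cases
      case 1
      have "f x \<in> carrier M'" "f y \<in> carrier M'" "f (x \<oplus>\<^bsub>M\<^esub> y) = f x \<oplus>\<^bsub>M'\<^esub> f y"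
        using f 1(1,2) by (auto simp: lin_map_def)
      then have "tens_map f z \<in> tens_rels M'" unfolding 1(3) by (auto simp: tens_map_diff tens_map_single tens_rels_def)
      then show ?thesis by (simp add: tens.span_base)
    next
      case 2
      have "f x \<in> carrier M'" "f (c \<odot>\<^bsub>M\<^esub> x) = c \<odot>\<^bsub>M'\<^esub> f x"
        using f 2(1) by (auto simp: lin_map_def)
      then have "tens_map f z \<in> tens_rels M'" unfolding 2(2) by (auto simp: tens_map_diff tens_map_single tens_rels_def)
      then show ?thesis by (simp add: tens.span_base)
    qed
  qed
  moreover have "tens.subspace ?T"
    by (auto simp: tens.subspace_def tens_map_add tens_map_tscale tens.span_zero intro: tens.span_add tens.span_scale)
  ultimately have "tens.span (tens_rels M) \<subseteq> ?T" by (rule tens.span_minimal)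
  then show ?thesis using tu by (auto simp: tens_eq_def tens_map_diff)
qed

section \<open>Realization of formal tensors as vector fields over the closure\<close>

lemma lookup_vf_base_change [simp]: "lookup (vf_base_change D i) m = to_ac (lookup (D i) m)"
  by (simp add: vf_base_change_def Poly_Mapping.map.rep_eq when_def)

lemma lookup_vf_realize:
  "lookup (vf_realize t i) m = (\<Sum>D\<in>keys t. lookup t D * to_ac (lookup (D i) m))"
  by (simp add: vf_realize_def lookup_sum lookup_pconst_times)

lemma vf_realize_single: "vf_realize (Poly_Mapping.single D c) = (\<lambda>i. pconst c * vf_base_change D i)"
  by (rule ext) (simp add: vf_realize_def)

lemma vf_realize_add: "vf_realize (s + t) = (\<lambda>i. vf_realize s i + vf_realize t i)"
  unfolding vf_realize_def by (rule ext, rule keys_sum_add) (simp_all add: pconst_add algebra_simps)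

lemma vf_realize_0 [simp]: "vf_realize 0 = (\<lambda>i. 0)"
  by (rule ext) (simp add: vf_realize_def)

lemma vf_realize_sum: "vf_realize (sum f A) = (\<lambda>i. \<Sum>x\<in>A. vf_realize (f x) i)"
  by (induction A rule: infinite_finite_induct) (simp_all add: vf_realize_add)

lemma vf_realize_tscale: "vf_realize (tscale c t) = (\<lambda>i. pconst c * vf_realize t i)"
proof (induction t rule: poly_mapping_single_induct)
  case (single m a)
  then show ?case by (simp add: tscale_single vf_realize_single pconst_mult mult.assoc)
qed (simp_all add: vf_realize_add tens.scale_right_distrib algebra_simps)

definition vf_subspace :: "('n::finite, 'k::comm_ring_1) vf set \<Rightarrow> bool" where
  "vf_subspace C \<longleftrightarrow> (\<lambda>i. 0) \<in> C \<and> (\<forall>D\<in>C. \<forall>E\<in>C. (\<lambda>i. D i + E i) \<in> C) \<and>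
     (\<forall>c. \<forall>D\<in>C. (\<lambda>i. pconst c * D i) \<in> C)"

lemma vf_subspaceD:
  assumes "vf_subspace C"
  shows "(\<lambda>i. 0) \<in> C" "D \<in> C \<Longrightarrow> E \<in> C \<Longrightarrow> (\<lambda>i. D i + E i) \<in> C" "D \<in> C \<Longrightarrow> (\<lambda>i. pconst c * D i) \<in> C"
  using assms by (auto simp: vf_subspace_def)

lemma vf_subspace_diff:
  assumes "vf_subspace C" "D \<in> C" "E \<in> C"
  shows "(\<lambda>i. D i - pconst c * E i) \<in> C"
proof -
  have "(\<lambda>i. D i + pconst (- c) * E i) \<in> C"
    by (rule vf_subspaceD(2)[OF assms(1,2) vf_subspaceD(3)[OF assms(1,3)]])
  then show ?thesis by (simp add: pconst_uminus)
qed

text \<open>A finite-dimensional space of vector fields has a spanning set whose coordinate functionals are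
  combinations of coefficients; these combinations make sense after base change as well.\<close>

lemma finite_dual:
  fixes C :: "('n::finite, 'k::field) vf set"
  assumes "finite P" "vf_subspace C" "\<forall>D\<in>C. \<forall>i m. (i, m) \<notin> P \<longrightarrow> lookup (D i) m = 0"
  shows "\<exists>S l. finite S \<and> S \<subseteq> C \<and>
    (\<forall>D\<in>C. \<forall>i. D i = (\<Sum>y\<in>S. pconst (\<Sum>\<pi>\<in>P. l y \<pi> * lookup (D (fst \<pi>)) (snd \<pi>)) * y i))"
  using assms
proof (induction P arbitrary: C rule: finite_induct)
  case empty
  have "D i = 0" if "D \<in> C" for D i using empty(2) that by (intro poly_mapping_eqI) simp
  then show ?case by (intro exI[of _ "{}"] exI) auto
next
  case (insert \<pi> P)
  obtain a m where \<pi>: "\<pi> = (a, m)" by (cases \<pi>)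
  show ?case
  proof (cases "\<forall>D\<in>C. lookup (D a) m = 0")
    case True
    then have "\<forall>D\<in>C. \<forall>i m. (i, m) \<notin> P \<longrightarrow> lookup (D i) m = 0" using insert.prems(2) \<pi> by (metis insert_iff prod.inject)
    from insert.IH[OF insert.prems(1) this] obtain S l where
      "finite S" "S \<subseteq> C" "\<forall>D\<in>C. \<forall>i. D i = (\<Sum>y\<in>S. pconst (\<Sum>\<pi>\<in>P. l y \<pi> * lookup (D (fst \<pi>)) (snd \<pi>)) * y i)"
      by blast
    then show ?thesis using True insert.hyps by (intro exI[of _ S] exI[of _ l]) (simp add: \<pi>)
  next
    case False
    then obtain E where E: "E \<in> C" "lookup (E a) m \<noteq> 0" by blast
    \<comment> \<open>A pivot with coefficient 1 at \<pi>; subtracting its multiples moves every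
      field into the subspace C', which is supported on P.\<close>
    define D0 where "D0 = (\<lambda>i. pconst (inverse (lookup (E a) m)) * E i)"
    have D0: "D0 \<in> C" "lookup (D0 a) m = 1"
      using E insert.prems(1) by (auto simp: D0_def vf_subspace_def lookup_pconst_times)
    define C' where "C' = {D \<in> C. lookup (D a) m = 0}"
    have sub: "vf_subspace C'"
      using insert.prems(1) by (auto simp: vf_subspace_def C'_def lookup_add lookup_pconst_times)
    have supp: "\<forall>D\<in>C'. \<forall>i m. (i, m) \<notin> P \<longrightarrow> lookup (D i) m = 0"
    proof (intro ballI allI impI)
      fix D i m' assume "D \<in> C'" "(i, m') \<notin> P"
      then show "lookup (D i) m' = 0" using insert.prems(2) unfolding C'_def \<pi> by (cases "(i, m') = (a, m)") auto
    qed
    from insert.IH[OF sub supp] obtain S l where S: "finite S" "S \<subseteq> C'"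
      "\<forall>D\<in>C'. \<forall>i. D i = (\<Sum>y\<in>S. pconst (\<Sum>\<pi>\<in>P. l y \<pi> * lookup (D (fst \<pi>)) (snd \<pi>)) * y i)"
      by blast
    define L where "L y D = (\<Sum>\<pi>\<in>P. l y \<pi> * lookup (D (fst \<pi>)) (snd \<pi>))" for y and D :: "('n, 'k) vf"
    \<comment> \<open>The coordinate of D at D0 is c, its coefficient at \<pi>. The other
      coordinates are those of D - c D0, namely L y D - c L y D0, so the functional receives the
      weight - L y D0 at \<pi>.\<close>
    define l' where "l' y = (if y = D0 then (\<lambda>\<rho>. if \<rho> = \<pi> then 1 else 0) else (l y)(\<pi> := - L y D0))" for y
    have D0S: "D0 \<notin> S" using S(2) D0(2) by (auto simp: C'_def)
    have "D i = (\<Sum>y\<in>insert D0 S. pconst (\<Sum>\<pi>\<in>insert \<pi> P. l' y \<pi> * lookup (D (fst \<pi>)) (snd \<pi>)) * y i)"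
      if D: "D \<in> C" for D i
    proof -
      define c where "c = lookup (D a) m"
      define D' where "D' = (\<lambda>i. D i - pconst c * D0 i)"
      have "D' \<in> C'" using vf_subspace_diff[OF insert.prems(1) D D0(1), of c] D0(2)
        by (simp add: D'_def C'_def lookup_minus lookup_pconst_times c_def)
      then have D': "D' i = (\<Sum>y\<in>S. pconst (L y D') * y i)" using S(3) unfolding L_def by blast
      have L: "L y D' = L y D - c * L y D0" for y
        by (simp add: L_def D'_def lookup_minus lookup_pconst_times algebra_simps sum_subtractf sum_distrib_left)
      have 1: "(\<Sum>\<rho>\<in>insert \<pi> P. l' D0 \<rho> * lookup (D (fst \<rho>)) (snd \<rho>)) = c"
      proof -
        have "(\<Sum>\<rho>\<in>P. l' D0 \<rho> * lookup (D (fst \<rho>)) (snd \<rho>)) = 0"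
          using insert.hyps(2) by (intro sum.neutral) (auto simp: l'_def)
        then show ?thesis using insert.hyps by (simp add: l'_def \<pi> c_def)
      qed
      have 2: "(\<Sum>\<rho>\<in>insert \<pi> P. l' y \<rho> * lookup (D (fst \<rho>)) (snd \<rho>)) = L y D'" if "y \<in> S" for y
      proof -
        have "y \<noteq> D0" using that D0S by blast
        then have "(\<Sum>\<rho>\<in>P. l' y \<rho> * lookup (D (fst \<rho>)) (snd \<rho>)) = L y D"
          unfolding L_def using insert.hyps(2) by (intro sum.cong) (auto simp: l'_def)
        then show ?thesis using insert.hyps \<open>y \<noteq> D0\<close> by (simp add: l'_def \<pi> c_def L algebra_simps)
      qed
      have "D i = pconst c * D0 i + D' i" by (simp add: D'_def)
      also have "\<dots> = pconst c * D0 i + (\<Sum>y\<in>S. pconst (\<Sum>\<rho>\<in>insert \<pi> P. l' y \<rho> * lookup (D (fst \<rho>)) (snd \<rho>)) * y i)"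
        unfolding D' using 2 by simp
      finally show ?thesis using 1 D0S S(1) by simp
    qed
    then show ?thesis using S(1,2) D0(1) by (intro exI[of _ "insert D0 S"] exI[of _ l']) (auto simp: C'_def)
  qed
qed

lemma vf_mod_ops:
  "carrier (vf_mod C) = C" "D \<oplus>\<^bsub>vf_mod C\<^esub> E = (\<lambda>i. D i + E i)" "c \<odot>\<^bsub>vf_mod C\<^esub> D = (\<lambda>i. pconst c * D i)"
  "\<zero>\<^bsub>vf_mod C\<^esub> = (\<lambda>i. 0)"
  by (simp_all add: vf_mod_def)

lemma tens_eq_single_sum:
  assumes C: "vf_subspace (C :: ('n::finite, 'k::field) vf set)" and S: "finite S" "S \<subseteq> C"
  shows "(\<lambda>i. \<Sum>y\<in>S. pconst (a y) * y i) \<in> C \<and> tens_eq (vf_mod C)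
    (Poly_Mapping.single (\<lambda>i. \<Sum>y\<in>S. pconst (a y) * y i) c) (\<Sum>y\<in>S. Poly_Mapping.single y (to_ac (a y) * c))"
  using S
proof (induction S)
  case empty
  have z: "(\<lambda>i. 0) \<in> C" using C by (simp add: vf_subspace_def)
  then show ?case using tens_eq_single_smult[of "\<lambda>i. 0" "vf_mod C" 0 c] by (simp add: vf_mod_ops)
next
  case (insert y S)
  let ?D = "\<lambda>i. \<Sum>y\<in>S. pconst (a y) * y i" and ?Y = "\<lambda>i. pconst (a y) * y i"
  have IH: "?D \<in> C" "tens_eq (vf_mod C) (Poly_Mapping.single ?D c) (\<Sum>y\<in>S. Poly_Mapping.single y (to_ac (a y) * c))"
    using insert by auto
  have y: "y \<in> C" "?Y \<in> C" using insert.prems C by (auto simp: vf_subspace_def)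
  have e: "(\<lambda>i. \<Sum>y\<in>insert y S. pconst (a y) * y i) = (\<lambda>i. ?Y i + ?D i)" using insert.hyps by simp
  have 1: "(\<lambda>i. ?Y i + ?D i) \<in> C" by (rule vf_subspaceD(2)[OF C y(2) IH(1)])
  have 2: "tens_eq (vf_mod C) (Poly_Mapping.single (\<lambda>i. ?Y i + ?D i) c) (Poly_Mapping.single ?Y c + Poly_Mapping.single ?D c)"
    using tens_eq_single_add[of ?Y "vf_mod C" ?D c] y IH by (simp add: vf_mod_ops)
  have 3: "tens_eq (vf_mod C) (Poly_Mapping.single ?Y c) (Poly_Mapping.single y (to_ac (a y) * c))"
    using tens_eq_single_smult[of y "vf_mod C" "a y" c] y by (simp add: vf_mod_ops)
  show ?case unfolding e sum.insert[OF insert.hyps]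
    by (rule conjI[OF 1 tens_eq_trans[OF 2 tens_eq_add[OF 3 IH(2)]]])
qed

lemma SymV_finite_support:
  fixes C :: "('n::finite, 'k::field) vf set"
  assumes "C \<subseteq> SymV d"
  shows "\<forall>D\<in>C. \<forall>i m. (i, m) \<notin> UNIV \<times> {m. mdeg m \<le> d} \<longrightarrow> lookup (D i) m = 0"
proof (intro ballI allI impI)
  fix D :: "('n, 'k) vf" and i :: 'n and m :: "'n mono" assume "D \<in> C" and m: "(i, m) \<notin> UNIV \<times> {m. mdeg m \<le> d}"
  then have "D i \<in> homog d" using assms by (auto simp: SymV_def)
  then show "lookup (D i) m = 0" using m by (auto simp: homog_def in_keys_iff)
qed

text \<open>Every tensor is rewritten on the fixed finite set S, with coordinates read off from its
  realization by functionals defined over k.\<close>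

lemma vf_tens_normal_form:
  fixes C :: "('n::finite, 'k::field) vf set"
  assumes C: "vf_subspace C" "C \<subseteq> SymV d"
  shows "\<exists>S P l. finite S \<and> S \<subseteq> C \<and> (\<forall>t. keys t \<subseteq> C \<longrightarrow> tens_eq (vf_mod C) t
    (\<Sum>y\<in>S. Poly_Mapping.single y (\<Sum>\<pi>\<in>P. to_ac (l y \<pi>) * lookup (vf_realize t (fst \<pi>)) (snd \<pi>))))"
proof -
  let ?P = "(UNIV :: 'n set) \<times> {m :: 'n mono. mdeg m \<le> d}"
  have fin: "finite ?P" by (simp add: finite_mdeg_le)
  from finite_dual[OF fin C(1) SymV_finite_support[OF C(2)]] obtain S l where S: "finite S" "S \<subseteq> C"
    "\<forall>D\<in>C. \<forall>i. D i = (\<Sum>y\<in>S. pconst (\<Sum>\<pi>\<in>?P. l y \<pi> * lookup (D (fst \<pi>)) (snd \<pi>)) * y i)"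
    by (elim exE conjE) (rule that)
  define L where "L y D = (\<Sum>\<pi>\<in>?P. l y \<pi> * lookup (D (fst \<pi>)) (snd \<pi>))" for y and D :: "('n, 'k) vf"
  have "tens_eq (vf_mod C) t
    (\<Sum>y\<in>S. Poly_Mapping.single y (\<Sum>\<pi>\<in>?P. to_ac (l y \<pi>) * lookup (vf_realize t (fst \<pi>)) (snd \<pi>)))"
    if t: "keys t \<subseteq> C" for t :: "('n, 'k) vf \<Rightarrow>\<^sub>0 'k alg_closure"
  proof -
    have "tens_eq (vf_mod C) (\<Sum>D\<in>keys t. Poly_Mapping.single D (lookup t D))
      (\<Sum>D\<in>keys t. \<Sum>y\<in>S. Poly_Mapping.single y (to_ac (L y D) * lookup t D))"
    proof (rule tens_eq_sum)
      fix D assume "D \<in> keys t"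
      then have DC: "D \<in> C" using t by (rule subsetD[rotated])
      have e: "(\<lambda>i. \<Sum>y\<in>S. pconst (L y D) * y i) = D"
      proof
        fix i
        show "(\<Sum>y\<in>S. pconst (L y D) * y i) = D i" unfolding L_def using bspec[OF S(3) DC, rule_format, of i] by (rule sym)
      qed
      show "tens_eq (vf_mod C) (Poly_Mapping.single D (lookup t D)) (\<Sum>y\<in>S. Poly_Mapping.single y (to_ac (L y D) * lookup t D))"
        using tens_eq_single_sum[OF C(1) S(1,2), of "\<lambda>y. L y D" "lookup t D"] unfolding e by (rule conjunct2)
    qed
    also have "(\<Sum>D\<in>keys t. \<Sum>y\<in>S. Poly_Mapping.single y (to_ac (L y D) * lookup t D)) =
      (\<Sum>y\<in>S. Poly_Mapping.single y (\<Sum>D\<in>keys t. to_ac (L y D) * lookup t D))"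
      by (subst sum.swap) (simp add: single_sum)
    also have "(\<Sum>y\<in>S. Poly_Mapping.single y (\<Sum>D\<in>keys t. to_ac (L y D) * lookup t D)) =
      (\<Sum>y\<in>S. Poly_Mapping.single y (\<Sum>\<pi>\<in>?P. to_ac (l y \<pi>) * lookup (vf_realize t (fst \<pi>)) (snd \<pi>)))"
    proof -
      have "(\<Sum>D\<in>keys t. to_ac (L y D) * lookup t D) = (\<Sum>\<pi>\<in>?P. to_ac (l y \<pi>) * lookup (vf_realize t (fst \<pi>)) (snd \<pi>))" for y
      proof -
        have "(\<Sum>D\<in>keys t. to_ac (L y D) * lookup t D) =
            (\<Sum>D\<in>keys t. \<Sum>\<pi>\<in>?P. to_ac (l y \<pi>) * (lookup t D * to_ac (lookup (D (fst \<pi>)) (snd \<pi>))))"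
          by (simp add: L_def to_ac_sum sum_distrib_left sum_distrib_right ac_simps)
        also have "\<dots> = (\<Sum>\<pi>\<in>?P. \<Sum>D\<in>keys t. to_ac (l y \<pi>) * (lookup t D * to_ac (lookup (D (fst \<pi>)) (snd \<pi>))))"
          by (rule sum.swap)
        finally show ?thesis by (simp add: lookup_vf_realize sum_distrib_left)
      qed
      then show ?thesis by simp
    qed
    finally show ?thesis by (simp flip: poly_mapping_eq_sum_single)
  qed
  then show ?thesis using S(1,2) by (intro exI[of _ S] exI[of _ ?P] exI[of _ l]) simp
qed

text \<open>Injectivity of realization: equal realizations give equal normal forms. Congruences of
  formal tensors become equalities of vector fields over the closure.\<close>

lemma vf_tens_eqI:
  fixes C :: "('n::finite, 'k::field) vf set"
  assumes C: "vf_subspace C" "C \<subseteq> SymV d" and tu: "keys t \<subseteq> C" "keys u \<subseteq> C" "vf_realize t = vf_realize u"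
  shows "tens_eq (vf_mod C) t u"
proof -
  from vf_tens_normal_form[OF C] obtain S P l where N: "\<forall>t. keys t \<subseteq> C \<longrightarrow> tens_eq (vf_mod C) t
    (\<Sum>y\<in>S. Poly_Mapping.single y (\<Sum>\<pi>\<in>P. to_ac (l y \<pi>) * lookup (vf_realize t (fst \<pi>)) (snd \<pi>)))"
    by (elim exE conjE) (rule that)
  show ?thesis using tens_eq_trans[OF N[rule_format, OF tu(1), unfolded tu(3)] tens_eq_sym[OF N[rule_format, OF tu(2)]]] .
qed

lemma vf_realize_tens_extend:
  "vf_realize (tens_extend \<psi> t) = (\<lambda>i. \<Sum>D\<in>keys t. pconst (lookup t D) * vf_realize (\<psi> D) i)"
  by (simp add: tens_extend_def vf_realize_sum vf_realize_tscale)

lemma keys_tens_extend: "(\<And>m. m \<in> keys t \<Longrightarrow> keys (\<psi> m) \<subseteq> C) \<Longrightarrow> keys (tens_extend \<psi> t) \<subseteq> C"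
  unfolding tens_extend_def using keys_sum[of "\<lambda>m. tscale (lookup t m) (\<psi> m)" "keys t"] keys_tscale by fast

section \<open>Regular functions on the general linear group\<close>

lemma regular_fun_evp:
  "regular_fun \<phi> \<longleftrightarrow> (\<exists>F e. \<forall>g. invertible g \<longrightarrow> \<phi> g = evp to_ac (\<lambda>\<pi>. g $ fst \<pi> $ snd \<pi>) F / det g ^ e)"
  by (simp add: regular_fun_def evp_def case_prod_unfold)

lemma coef_hom_to_ac: "coef_hom (to_ac :: 'k::field \<Rightarrow> 'k alg_closure)"
  by (simp add: coef_hom_def)

lemma regular_fun_cong: "(\<And>g. invertible g \<Longrightarrow> \<phi> g = \<psi> g) \<Longrightarrow> regular_fun \<psi> \<Longrightarrow> regular_fun \<phi>"
  unfolding regular_fun_evp by (elim exE, intro exI allI impI) simp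

lemma regular_fun_const: "regular_fun (\<lambda>g. to_ac c)"
  unfolding regular_fun_evp
  by (rule exI[of _ "pconst c"], rule exI[of _ 0]) (simp add: evp_pconst[OF coef_hom_to_ac])

lemma regular_fun_entry: "regular_fun (\<lambda>g. g $ i $ j)"
  unfolding regular_fun_evp
  by (rule exI[of _ "pvar (i, j)"], rule exI[of _ 0]) (simp add: evp_pvar[OF coef_hom_to_ac])

text \<open>Presents the determinant as a polynomial over k in the matrix entries, so that fractions
  with different powers of det can be brought to a common denominator.\<close>

lemma evp_det:
  fixes g :: "('n::finite, 'k::field) matK"
  shows "evp to_ac (\<lambda>\<pi>. g $ fst \<pi> $ snd \<pi>) (det (\<chi> i j. pvar (i, j))) = det g"
  unfolding det_def
  by (simp add: evp_sum[OF coef_hom_to_ac] evp_mult[OF coef_hom_to_ac] evp_prod[OF coef_hom_to_ac] evp_pvar[OF coef_hom_to_ac])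
    (auto intro!: sum.cong simp: sign_def evp_1[OF coef_hom_to_ac] evp_pconst[OF coef_hom_to_ac]
       simp flip: pconst_1 pconst_uminus)

lemma regular_fun_inverse_det: "regular_fun (\<lambda>g. inverse (det g))"
  unfolding regular_fun_evp
  by (rule exI[of _ 1], rule exI[of _ 1]) (simp add: evp_1[OF coef_hom_to_ac] field_simps)

lemma regular_fun_mult:
  fixes \<phi> \<psi> :: "('n::finite, 'k::field) matK \<Rightarrow> 'k alg_closure"
  assumes "regular_fun \<phi>" "regular_fun \<psi>"
  shows "regular_fun (\<lambda>g. \<phi> g * \<psi> g)"
proof -
  obtain F e F' e' where
    "\<And>g. invertible g \<Longrightarrow> \<phi> g = evp to_ac (\<lambda>\<pi>. g $ fst \<pi> $ snd \<pi>) F / det g ^ e"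
    "\<And>g. invertible g \<Longrightarrow> \<psi> g = evp to_ac (\<lambda>\<pi>. g $ fst \<pi> $ snd \<pi>) F' / det g ^ e'"
    using assms unfolding regular_fun_evp by blast
  then show ?thesis unfolding regular_fun_evp
    by (intro exI[of _ "F * F'"] exI[of _ "e + e'"]) (simp add: evp_mult[OF coef_hom_to_ac] power_add)
qed

lemma regular_fun_add:
  fixes \<phi> \<psi> :: "('n::finite, 'k::field) matK \<Rightarrow> 'k alg_closure"
  assumes "regular_fun \<phi>" "regular_fun \<psi>"
  shows "regular_fun (\<lambda>g. \<phi> g + \<psi> g)"
proof -
  let ?d = "det (\<chi> i j. pvar (i, j)) :: ('n \<times> 'n, 'k) pol"
  obtain F e F' e' where
    "\<And>g. invertible g \<Longrightarrow> \<phi> g = evp to_ac (\<lambda>\<pi>. g $ fst \<pi> $ snd \<pi>) F / det g ^ e"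
    "\<And>g. invertible g \<Longrightarrow> \<psi> g = evp to_ac (\<lambda>\<pi>. g $ fst \<pi> $ snd \<pi>) F' / det g ^ e'"
    using assms unfolding regular_fun_evp by blast
  then show ?thesis unfolding regular_fun_evp
    by (intro exI[of _ "F * ?d ^ e' + F' * ?d ^ e"] exI[of _ "e + e'"])
      (simp add: evp_mult[OF coef_hom_to_ac] evp_add[OF coef_hom_to_ac] evp_power[OF coef_hom_to_ac] evp_det
        power_add invertible_det_nz field_simps)
qed

lemma regular_fun_0: "regular_fun (\<lambda>g. 0)" and regular_fun_1: "regular_fun (\<lambda>g. 1)"
  using regular_fun_const[of 0] regular_fun_const[of 1] by simp_all

lemma regular_fun_sum: "(\<And>x. x \<in> A \<Longrightarrow> regular_fun (\<phi> x)) \<Longrightarrow> regular_fun (\<lambda>g. \<Sum>x\<in>A. \<phi> x g)"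
  by (induction A rule: infinite_finite_induct) (simp_all add: regular_fun_0 regular_fun_add)

lemma regular_fun_prod: "(\<And>x. x \<in> A \<Longrightarrow> regular_fun (\<phi> x)) \<Longrightarrow> regular_fun (\<lambda>g. \<Prod>x\<in>A. \<phi> x g)"
  by (induction A rule: infinite_finite_induct) (simp_all add: regular_fun_1 regular_fun_mult)

lemma regular_fun_power: "regular_fun \<phi> \<Longrightarrow> regular_fun (\<lambda>g. \<phi> g ^ e)"
  by (induction e) (simp_all add: regular_fun_1 regular_fun_mult)

text \<open>Every axiom is an identity in the tensor product, hence can be checked on the honest
  action R over the closure. The matrix coefficients of the normal form are combinations over k of
  coefficients of R g D, so regularity of the latter suffices.\<close>

lemma rational_module_of_realization:
  fixes C :: "('n::finite, 'k::field) vf set" and \<rho> :: "('n, 'k, ('n, 'k) vf) action"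
    and R :: "('n, 'k) matK \<Rightarrow> ('n, 'k alg_closure) vf \<Rightarrow> ('n, 'k alg_closure) vf"
  assumes C: "vf_subspace C" "C \<subseteq> SymV d"
    and \<rho>: "\<And>g D. invertible g \<Longrightarrow> D \<in> C \<Longrightarrow> keys (\<rho> g D) \<subseteq> C"
      "\<And>g D. invertible g \<Longrightarrow> D \<in> C \<Longrightarrow> vf_realize (\<rho> g D) = R g (vf_base_change D)"
    and R: "\<And>g D E. R g (\<lambda>i. D i + E i) = (\<lambda>i. R g D i + R g E i)" "\<And>g c D. R g (\<lambda>i. pconst c * D i) = (\<lambda>i. pconst c * R g D i)"
    and one: "\<And>D. R (mat 1) D = D" and mult: "\<And>g h D. invertible g \<Longrightarrow> invertible h \<Longrightarrow> R (g ** h) D = R g (R h D)"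
    and reg: "\<And>D i m. D \<in> C \<Longrightarrow> regular_fun (\<lambda>g. lookup (R g (vf_base_change D) i) m)"
  shows "rational_module (vf_mod C) \<rho>"
  unfolding rational_module_def vf_mod_ops
proof (intro conjI allI impI ballI)
  show "Module.module kring (vf_mod C)" by (rule module_vf_mod) (use vf_subspaceD[OF C(1)] in blast)+
next
  fix g :: "('n, 'k) matK" and D assume gD: "invertible g" "D \<in> C"
  then show "keys (\<rho> g D) \<subseteq> C" by (rule \<rho>)
next
  fix g :: "('n, 'k) matK" and D E assume gD: "invertible g" "D \<in> C" "E \<in> C"
  have "vf_base_change (\<lambda>i. D i + E i) = (\<lambda>i. vf_base_change D i + vf_base_change E i)"
    by (intro ext poly_mapping_eqI) (simp add: lookup_add)
  then show "tens_eq (vf_mod C) (\<rho> g (\<lambda>i. D i + E i)) (\<rho> g D + \<rho> g E)"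
    using gD vf_subspaceD(2)[OF C(1) gD(2,3)] \<rho>(1)[OF gD(1)]
      order_trans[OF keys_add Un_least[OF \<rho>(1)[OF gD(1,2)] \<rho>(1)[OF gD(1,3)]]]
    by (intro vf_tens_eqI[OF C]) (simp_all add: \<rho>(2) vf_realize_add R)
next
  fix g :: "('n, 'k) matK" and D and c :: 'k assume gD: "invertible g" "D \<in> C"
  have "vf_base_change (\<lambda>i. pconst c * D i) = (\<lambda>i. pconst (to_ac c) * vf_base_change D i)"
    by (intro ext poly_mapping_eqI) (simp add: lookup_pconst_times)
  then show "tens_eq (vf_mod C) (\<rho> g (\<lambda>i. pconst c * D i)) (tscale (to_ac c) (\<rho> g D))"
    using gD vf_subspaceD(3)[OF C(1) gD(2)] \<rho>(1)[OF gD(1)] order_trans[OF keys_tscale \<rho>(1)[OF gD]]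
    by (intro vf_tens_eqI[OF C]) (simp_all add: \<rho>(2) vf_realize_tscale R)
next
  fix D assume D: "D \<in> C"
  have "invertible (mat 1 :: ('n, 'k) matK)" by (simp add: invertible_det_nz det_I)
  then show "tens_eq (vf_mod C) (\<rho> (mat 1) D) (Poly_Mapping.single D 1)"
    using D \<rho>(1) by (intro vf_tens_eqI[OF C]) (auto simp: \<rho>(2) vf_realize_single one)
next
  fix g h :: "('n, 'k) matK" and D assume g: "invertible g" and h: "invertible h" and D: "D \<in> C"
  have gh: "invertible (g ** h)" using g h by (simp add: invertible_det_nz det_mul)
  \<comment> \<open>The tensor for h is only a formal sum realizing R h D; linearity of R g lets g
    act on its terms one by one.\<close>
  have lin: "R g (\<lambda>i. \<Sum>E\<in>A. pconst (a E) * V E i) = (\<lambda>i. \<Sum>E\<in>A. pconst (a E) * R g (V E) i)"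
    for A :: "('n, 'k) vf set" and a V
  proof (induction A rule: infinite_finite_induct)
    case (insert E A)
    then show ?case using R by simp
  qed (use R(2)[of g 0 "\<lambda>i. 0"] in simp_all)
  let ?t = "\<rho> h D"
  have k: "keys ?t \<subseteq> C" by (rule \<rho>(1)[OF h D])
  have "vf_realize (tens_extend (\<rho> g) ?t) = (\<lambda>i. \<Sum>E\<in>keys ?t. pconst (lookup ?t E) * R g (vf_base_change E) i)"
    unfolding vf_realize_tens_extend using k by (intro ext sum.cong refl) (simp add: \<rho>(2)[OF g] subset_iff)
  also have "\<dots> = R g (vf_realize ?t)" by (simp flip: lin) (simp add: vf_realize_def[abs_def])
  also have "\<dots> = vf_realize (\<rho> (g ** h) D)" using D by (simp add: \<rho>(2) g h gh mult)
  finally show "tens_eq (vf_mod C) (\<rho> (g ** h) D) (tens_extend (\<rho> g) ?t)"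
    using k \<rho>(1)[OF g] \<rho>(1)[OF gh D] by (intro vf_tens_eqI[OF C] keys_tens_extend) auto
next
  fix D assume D: "D \<in> C"
  obtain S P l where S: "finite S" "S \<subseteq> C" "\<forall>t. keys t \<subseteq> C \<longrightarrow> tens_eq (vf_mod C) t
    (\<Sum>y\<in>S. Poly_Mapping.single y (\<Sum>\<pi>\<in>P. to_ac (l y \<pi>) * lookup (vf_realize t (fst \<pi>)) (snd \<pi>)))"
    using vf_tens_normal_form[OF C] by (elim exE conjE) (rule that)
  define a where "a y g = (\<Sum>\<pi>\<in>P. to_ac (l y \<pi>) * lookup (R g (vf_base_change D) (fst \<pi>)) (snd \<pi>))" for y g
  have "regular_fun (a y)" for y
    unfolding a_def by (intro regular_fun_sum regular_fun_mult regular_fun_const reg D)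
  moreover have "tens_eq (vf_mod C) (\<rho> g D) (\<Sum>y\<in>S. Poly_Mapping.single y (a y g))" if "invertible g" for g
    using S(3)[rule_format, OF \<rho>(1)[OF that D]] unfolding \<rho>(2)[OF that D] a_def .
  ultimately show "\<exists>S a. finite S \<and> S \<subseteq> C \<and> (\<forall>y\<in>S. regular_fun (a y)) \<and>
      (\<forall>g. invertible g \<longrightarrow> tens_eq (vf_mod C) (\<rho> g D) (\<Sum>y\<in>S. Poly_Mapping.single y (a y g)))"
    using S(1,2) by blast
qed

lemma lin_map_inv:
  assumes "lin_iso (M :: ('k::field, 'm) module) (M' :: ('k, 'l) module) \<phi>"
  shows "lin_map M' M (inv_into (carrier M) \<phi>)"
proof -
  let ?f = "inv_into (carrier M) \<phi>"
  have \<phi>: "lin_map M M' \<phi>" and b: "bij_betw \<phi> (carrier M) (carrier M')" using assms by (auto simp: lin_iso_def)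
  note L = \<phi>[unfolded lin_map_def]
  have inj: "inj_on \<phi> (carrier M)" using b by (simp add: bij_betw_def)
  have f: "?f y \<in> carrier M" "\<phi> (?f y) = y" if "y \<in> carrier M'" for y
    using that b by (auto simp: bij_betw_def inv_into_into f_inv_into_f)
  interpret M: Module.module "kring :: 'k ring" M using L by blast
  have e: "x = ?f y" if "x \<in> carrier M" "\<phi> x = y" for x y using inv_into_f_f[OF inj that(1)] that(2) by simp
  show ?thesis unfolding lin_map_def
  proof (intro conjI allI ballI)
    fix x y assume "x \<in> carrier M'" "y \<in> carrier M'"
    then show "?f (x \<oplus>\<^bsub>M'\<^esub> y) = ?f x \<oplus>\<^bsub>M\<^esub> ?f y" using L f by (intro e[symmetric]) auto
  next
    fix c x assume x: "x \<in> carrier M'"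
    have "c \<odot>\<^bsub>M\<^esub> ?f x \<in> carrier M" using M.smult_closed[of c "?f x"] f(1)[OF x] by simp
    then show "?f (c \<odot>\<^bsub>M'\<^esub> x) = c \<odot>\<^bsub>M\<^esub> ?f x" using L f[OF x] by (intro e[symmetric]) auto
  qed (use L f in auto)
qed

text \<open>The inverse of \<phi> carries tensor congruences back, and bijectivity carries the
  finite set S with its matrix coefficients.\<close>

lemma rational_module_transport:
  fixes M :: "('k::field, 'm) module" and \<rho> :: "('n::finite, 'k, 'l) action"
  assumes \<phi>: "lin_iso M M' \<phi>" and \<rho>: "rational_module M' \<rho>"
  shows "rational_module M (transport_action (carrier M) \<phi> \<rho>)"
proof -
  let ?f = "inv_into (carrier M) \<phi>"
  have F: "lin_map M' M ?f" by (rule lin_map_inv[OF \<phi>])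
  note T = tens_eq_tens_map[OF F]
  have L: "lin_map M M' \<phi>" and b: "bij_betw \<phi> (carrier M) (carrier M')" using \<phi> by (auto simp: lin_iso_def)
  have p: "\<phi> x \<in> carrier M'" "?f (\<phi> x) = x" if "x \<in> carrier M" for x
    using that b by (auto simp: bij_betw_def)
  have f: "?f y \<in> carrier M" "\<phi> (?f y) = y" if "y \<in> carrier M'" for y
    using that b by (auto simp: bij_betw_def inv_into_into f_inv_into_f)
  note R = \<rho>[unfolded rational_module_def]
  have k: "keys (\<rho> g y) \<subseteq> carrier M'" if "invertible g" "y \<in> carrier M'" for g y using R that by blast
  show ?thesis unfolding rational_module_def transport_action_def
  proof (intro conjI allI impI ballI)
    show "Module.module kring M" using L by (simp add: lin_map_def)
  next
    fix g :: "('n, 'k) matK" and x assume g: "invertible g" "x \<in> carrier M"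
    then show "keys (tens_map ?f (\<rho> g (\<phi> x))) \<subseteq> carrier M"
      using keys_tens_map[of ?f "\<rho> g (\<phi> x)"] k p f by blast
  next
    fix g :: "('n, 'k) matK" and x y assume g: "invertible g" "x \<in> carrier M" "y \<in> carrier M"
    have "\<phi> (x \<oplus>\<^bsub>M\<^esub> y) = \<phi> x \<oplus>\<^bsub>M'\<^esub> \<phi> y" using L g by (simp add: lin_map_def)
    then show "tens_eq M (tens_map ?f (\<rho> g (\<phi> (x \<oplus>\<^bsub>M\<^esub> y)))) (tens_map ?f (\<rho> g (\<phi> x)) + tens_map ?f (\<rho> g (\<phi> y)))"
      using R g p unfolding tens_map_add[symmetric] by (intro T) auto
  next
    fix g :: "('n, 'k) matK" and c x assume g: "invertible g" "x \<in> carrier M"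
    have "\<phi> (c \<odot>\<^bsub>M\<^esub> x) = c \<odot>\<^bsub>M'\<^esub> \<phi> x" using L g by (simp add: lin_map_def)
    then show "tens_eq M (tens_map ?f (\<rho> g (\<phi> (c \<odot>\<^bsub>M\<^esub> x)))) (tscale (to_ac c) (tens_map ?f (\<rho> g (\<phi> x))))"
      using R g p unfolding tens_map_tscale[symmetric] by (intro T) auto
  next
    fix x assume x: "x \<in> carrier M"
    then have "tens_eq M' (\<rho> (mat 1) (\<phi> x)) (Poly_Mapping.single (\<phi> x) 1)" using R p by blast
    from T[OF this] show "tens_eq M (tens_map ?f (\<rho> (mat 1) (\<phi> x))) (Poly_Mapping.single x 1)"
      using p(2)[OF x] by (simp add: tens_map_single)
  next
    fix g h :: "('n, 'k) matK" and x assume g: "invertible g" and h: "invertible h" and x: "x \<in> carrier M"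
    then have "tens_eq M' (\<rho> (g ** h) (\<phi> x)) (tens_extend (\<rho> g) (\<rho> h (\<phi> x)))" using R p by blast
    from T[OF this] have "tens_eq M (tens_map ?f (\<rho> (g ** h) (\<phi> x))) (tens_extend (\<lambda>y. tens_map ?f (\<rho> g y)) (\<rho> h (\<phi> x)))"
      by (simp add: tens_map_tens_extend)
    also have "tens_extend (\<lambda>y. tens_map ?f (\<rho> g y)) (\<rho> h (\<phi> x)) =
        tens_extend (\<lambda>y. tens_map ?f (\<rho> g (\<phi> y))) (tens_map ?f (\<rho> h (\<phi> x)))"
      unfolding tens_extend_tens_map using k[OF h p(1)[OF x]] f(2) by (intro tens_extend_cong) (simp add: subset_iff)
    finally show "tens_eq M (tens_map ?f (\<rho> (g ** h) (\<phi> x)))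
        (tens_extend (\<lambda>y. tens_map ?f (\<rho> g (\<phi> y))) (tens_map ?f (\<rho> h (\<phi> x))))" .
  next
    fix x assume x: "x \<in> carrier M"
    note Rx = bspec[OF R[THEN conjunct2, THEN conjunct2, THEN conjunct2, THEN conjunct2] p(1)[OF x]]
    from Rx obtain S a where S: "finite S" "S \<subseteq> carrier M'" "\<forall>y\<in>S. regular_fun (a y)"
      "\<forall>g. invertible g \<longrightarrow> tens_eq M' (\<rho> g (\<phi> x)) (\<Sum>y\<in>S. Poly_Mapping.single y (a y g))"
      by (elim exE conjE) (rule that)
    have inj: "inj_on ?f S" using S(2) f(2) by (intro inj_onI) (metis subsetD)
    have eq: "tens_eq M (tens_map ?f (\<rho> g (\<phi> x))) (\<Sum>y\<in>?f ` S. Poly_Mapping.single y (a (\<phi> y) g))" if "invertible g" for g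
    proof -
      have "tens_map ?f (\<Sum>y\<in>S. Poly_Mapping.single y (a y g)) = (\<Sum>y\<in>S. Poly_Mapping.single (?f y) (a (\<phi> (?f y)) g))"
        unfolding tens_map_sum tens_map_single using S(2) f(2) by (intro sum.cong) (auto simp: subset_iff)
      also have "\<dots> = (\<Sum>y\<in>?f ` S. Poly_Mapping.single y (a (\<phi> y) g))" by (simp add: sum.reindex[OF inj])
      finally show ?thesis using T[OF S(4)[rule_format, OF that]] by simp
    qed
    have reg: "regular_fun (a (\<phi> y))" if "y \<in> ?f ` S" for y using that S(2,3) f(2) by (auto simp: subset_iff)
    have sub: "?f ` S \<subseteq> carrier M" using S(2) f(1) by blast
    show "\<exists>S a. finite S \<and> S \<subseteq> carrier M \<and> (\<forall>y\<in>S. regular_fun (a y)) \<and>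
      (\<forall>g. invertible g \<longrightarrow> tens_eq M (tens_map ?f (\<rho> g (\<phi> x))) (\<Sum>y\<in>S. Poly_Mapping.single y (a y g)))"
      by (intro exI[of _ "?f ` S"] exI[of _ "\<lambda>y. a (\<phi> y)"] conjI ballI allI impI finite_imageI S(1) sub reg eq)
  qed
qed


section \<open>The action of the general linear group\<close>

lemma matrix_inv_eq:
  fixes g :: "'c::field ^ 'n::finite ^ 'n"
  assumes "invertible g"
  shows "g ** matrix_inv g = mat 1" "matrix_inv g ** g = mat 1"
  using someI_ex[OF assms[unfolded invertible_def]] unfolding matrix_inv_def by auto

lemma matrix_inv_unique:
  fixes g h :: "'c::field ^ 'n::finite ^ 'n"
  assumes "g ** h = mat 1"
  shows "matrix_inv g = h" "invertible g"
proof -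
  have hg: "h ** g = mat 1" using assms by (simp add: matrix_left_right_inverse)
  then show g: "invertible g" using assms unfolding invertible_def by blast
  have "matrix_inv g = matrix_inv g ** (g ** h)" by (simp add: assms)
  also have "\<dots> = h" by (simp add: matrix_mul_assoc matrix_inv_eq[OF g])
  finally show "matrix_inv g = h" .
qed

lemma matrix_inv_mult:
  fixes g h :: "'c::field ^ 'n::finite ^ 'n"
  assumes g: "invertible g" and h: "invertible h"
  shows "matrix_inv (g ** h) = matrix_inv h ** matrix_inv g"
proof (rule matrix_inv_unique)
  have "g ** h ** (matrix_inv h ** matrix_inv g) = g ** (h ** matrix_inv h) ** matrix_inv g"
    by (simp add: matrix_mul_assoc)
  then show "g ** h ** (matrix_inv h ** matrix_inv g) = mat 1" by (simp add: matrix_inv_eq g h)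
qed

definition frm :: "nat \<Rightarrow> 'c::field ^ 'n::finite ^ 'n \<Rightarrow> 'c ^ 'n ^ 'n" where
  "frm p g = (\<chi> i j. (g $ i $ j) ^ p)"

lemma frm_mult:
  fixes g h :: "'c::field ^ 'n::finite ^ 'n"
  assumes "prime p" "CHAR('c) = p"
  shows "frm p (g ** h) = frm p g ** frm p h"
proof -
  have "(\<Sum>k\<in>UNIV. g $ i $ k * h $ k $ j) ^ p = (\<Sum>k\<in>UNIV. (g $ i $ k) ^ p * (h $ k $ j) ^ p)" for i j
    by (subst freshmans_dream_sum) (simp_all add: assms power_mult_distrib)
  then show ?thesis by (simp add: frm_def matrix_matrix_mult_def vec_eq_iff)
qed

lemma frm_1: "prime p \<Longrightarrow> frm p (mat 1 :: 'c::field ^ 'n::finite ^ 'n) = mat 1"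
  by (simp add: frm_def mat_def vec_eq_iff power_0_left prime_gt_0_nat)

text \<open>The p-th power is additive, so it passes through the Leibniz formula; p odd fixes the
  signs.\<close>

lemma det_frm:
  fixes g :: "'c::field ^ 'n::finite ^ 'n"
  assumes p: "prime p" "CHAR('c) = p" "odd p"
  shows "det (frm p g) = det g ^ p"
proof -
  have s: "of_int (sign \<sigma>) ^ p = (of_int (sign \<sigma>) :: 'c)" for \<sigma> :: "'n \<Rightarrow> 'n"
    using p(3) by (auto simp: sign_def)
  have "det g ^ p = (\<Sum>\<sigma>\<in>{\<sigma>. \<sigma> permutes UNIV}. (of_int (sign \<sigma>) * (\<Prod>i\<in>UNIV. g $ i $ \<sigma> i)) ^ p)"
    unfolding det_def using p by (intro freshmans_dream_sum) auto
  also have "\<dots> = det (frm p g)"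
    unfolding det_def by (simp add: power_mult_distrib s prod_power_distrib frm_def)
  finally show ?thesis by simp
qed

lemma frm_inv:
  fixes g :: "'c::field ^ 'n::finite ^ 'n"
  assumes p: "prime p" "CHAR('c) = p" and g: "invertible g"
  shows "matrix_inv (frm p g) = frm p (matrix_inv g)" "invertible (frm p g)"
proof -
  have "frm p g ** frm p (matrix_inv g) = mat 1"
    by (simp add: matrix_inv_eq[OF g] frm_1[OF p(1)] flip: frm_mult[OF p])
  then show "matrix_inv (frm p g) = frm p (matrix_inv g)" "invertible (frm p g)" by (rule matrix_inv_unique)+
qed

section \<open>Linear forms and the substitution action\<close>

definition lform :: "'c::field ^ 'n ^ 'n \<Rightarrow> 'n \<Rightarrow> ('n::finite, 'c) pol" where
  "lform h i = (\<Sum>j\<in>UNIV. pconst (h $ i $ j) * pvar j)"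

lemma lform_mult: "lform (A ** B) i = (\<Sum>j\<in>UNIV. pconst (A $ i $ j) * lform B j)"
proof -
  have "lform (A ** B) i = (\<Sum>l\<in>UNIV. \<Sum>j\<in>UNIV. pconst (A $ i $ j) * (pconst (B $ j $ l) * pvar l))"
    by (simp add: lform_def matrix_matrix_mult_def pconst_sum pconst_mult sum_distrib_right mult.assoc)
  also have "\<dots> = (\<Sum>j\<in>UNIV. \<Sum>l\<in>UNIV. pconst (A $ i $ j) * (pconst (B $ j $ l) * pvar l))" by (rule sum.swap)
  finally show ?thesis by (simp add: lform_def sum_distrib_left)
qed

lemma lform_1: "lform (mat 1) i = pvar i"
  by (simp add: lform_def mat_def if_distrib[of pconst] if_distrib[of "\<lambda>x. x * _"] sum.delta cong: if_cong)

lemma gl_pol_evp: "gl_pol g = evp pconst (lform (matrix_inv g))"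
  by (simp add: gl_pol_def psubst_evp lform_def[abs_def])

lemmas gl_pol_hom =
  evp_add[OF coef_hom_pconst] evp_mult[OF coef_hom_pconst] evp_pconst[OF coef_hom_pconst]
  evp_pvar[OF coef_hom_pconst] evp_sum[OF coef_hom_pconst] evp_power[OF coef_hom_pconst]
  evp_prod[OF coef_hom_pconst] evp_1[OF coef_hom_pconst] evp_single[OF coef_hom_pconst]

text \<open>Substitution reverses products, and so does inversion; together they give a left
  action.\<close>

lemma gl_pol_mult:
  fixes g h :: "'c::field ^ 'n::finite ^ 'n"
  assumes g: "invertible g" and h: "invertible h"
  shows "gl_pol (g ** h) f = gl_pol g (gl_pol h f)"
proof (induction f rule: pol_ring_induct)
  case (pvar i)
  have "gl_pol g (gl_pol h (pvar i)) = (\<Sum>j\<in>UNIV. pconst (matrix_inv h $ i $ j) * lform (matrix_inv g) j)"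
    by (simp add: gl_pol_evp gl_pol_hom lform_def[of "matrix_inv h"])
  then show ?case by (simp add: gl_pol_evp gl_pol_hom matrix_inv_mult[OF g h] lform_mult)
qed (simp_all add: gl_pol_evp gl_pol_hom)

lemma matrix_inv_1: "matrix_inv (mat 1 :: 'c::field ^ 'n::finite ^ 'n) = mat 1"
  by (rule matrix_inv_unique) simp

lemma gl_pol_1: "gl_pol (mat 1) f = f"
  by (induction f rule: pol_ring_induct) (simp_all add: gl_pol_evp gl_pol_hom matrix_inv_1 lform_1)

lemma gl_vf_1: "gl_vf (mat 1) D = D"
  by (rule ext, simp only: gl_vf_def gl_pol_1, simp add: mat_def if_distrib[of pconst] if_distrib[of "\<lambda>x. x * _"] sum.delta cong: if_cong)

lemma gl_vf_mult:
  fixes g h :: "'c::field ^ 'n::finite ^ 'n"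
  assumes g: "invertible g" and h: "invertible h"
  shows "gl_vf (g ** h) D = gl_vf g (gl_vf h D)"
proof
  fix i
  have gh: "(g ** h) $ i $ j = (\<Sum>l\<in>UNIV. g $ i $ l * h $ l $ j)" for j by (simp add: matrix_matrix_mult_def)
  have "gl_vf (g ** h) D i = (\<Sum>j\<in>UNIV. \<Sum>l\<in>UNIV. pconst (g $ i $ l) * (pconst (h $ l $ j) * gl_pol g (gl_pol h (D j))))"
    by (simp add: gl_vf_def gl_pol_mult[OF g h] gh pconst_sum pconst_mult sum_distrib_right mult.assoc)
  also have "\<dots> = (\<Sum>l\<in>UNIV. \<Sum>j\<in>UNIV. pconst (g $ i $ l) * (pconst (h $ l $ j) * gl_pol g (gl_pol h (D j))))" by (rule sum.swap)
  also have "\<dots> = gl_vf g (gl_vf h D) i"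
    by (simp add: gl_vf_def gl_pol_evp gl_pol_hom sum_distrib_left)
  finally show "gl_vf (g ** h) D i = gl_vf g (gl_vf h D) i" .
qed

lemma gl_vf_add: "gl_vf g (\<lambda>i. D i + E i) = (\<lambda>i. gl_vf g D i + gl_vf g E i)"
  by (rule ext) (simp add: gl_vf_def gl_pol_evp gl_pol_hom algebra_simps sum.distrib)

lemma gl_vf_scale: "gl_vf g (\<lambda>i. pconst c * D i) = (\<lambda>i. pconst c * gl_vf g D i)"
  by (rule ext) (simp add: gl_vf_def gl_pol_evp gl_pol_hom algebra_simps sum_distrib_left)

lemma gl_vf_0: "gl_vf g (\<lambda>i. 0) = (\<lambda>i. 0)"
  using gl_vf_scale[of g 0 "\<lambda>i. 0"] by simp

lemma pdiff_gl_pol: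
  fixes g :: "'c::field ^ 'n::finite ^ 'n"
  shows "pdiff k (gl_pol g f) = (\<Sum>i\<in>UNIV. pconst (matrix_inv g $ i $ k) * gl_pol g (pdiff i f))"
proof -
  have "pdiff k (lform h i) = pconst (h $ i $ k)" for h :: "'c ^ 'n ^ 'n" and i
    by (simp add: lform_def pdiff_sum pdiff_pconst_times pdiff_pvar if_distrib[of "\<lambda>x. _ * x"] sum.delta cong: if_cong)
  then show ?thesis
    unfolding gl_pol_def lform_def[symmetric] by (simp add: pdiff_psubst mult.commute)
qed

lemma homog_lform: "lform h i \<in> homog 1"
  unfolding lform_def by (intro homog_sum homog_pconst_mult) (simp add: pvar_def homog_single)

lemma homog_power: "f \<in> homog a \<Longrightarrow> f ^ e \<in> homog (e * a)"
proof (induction e)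
  case 0
  then show ?case by (simp add: homog_def flip: single_one)
qed (auto dest: homog_mult)

lemma homog_prod: "(\<And>i. i \<in> A \<Longrightarrow> f i \<in> homog (a i)) \<Longrightarrow> finite A \<Longrightarrow> prod f A \<in> homog (sum a A)"
proof (induction A rule: infinite_finite_induct)
  case empty
  then show ?case by (simp add: homog_def flip: single_one)
qed (auto intro: homog_mult)

lemma homog_gl_pol: "f \<in> homog d \<Longrightarrow> gl_pol g f \<in> homog d"
  unfolding gl_pol_evp evp_def
proof (intro homog_sum homog_pconst_mult)
  fix m assume "f \<in> homog d" "m \<in> keys f"
  then have "d = (\<Sum>i\<in>UNIV. lookup m i * 1)" by (simp add: homog_def mdeg_def)
  then show "(\<Prod>i\<in>UNIV. lform (matrix_inv g) i ^ lookup m i) \<in> homog d"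
    by (simp only:) (intro homog_prod homog_power homog_lform finite)
qed

lemma gl_vf_SymV: "D \<in> SymV d \<Longrightarrow> gl_vf g D \<in> SymV d"
  by (auto simp: SymV_def gl_vf_def intro!: homog_sum homog_pconst_mult homog_gl_pol)

text \<open>The inverse matrix produced by the chain rule cancels the matrix g acting on the factor
  V, so divergence commutes with the action.\<close>

lemma gl_vf_Lvf:
  fixes g :: "'c::field ^ 'n::finite ^ 'n"
  assumes g: "invertible g" and D: "D \<in> Lvf d"
  shows "gl_vf g D \<in> Lvf d"
proof -
  let ?h = "matrix_inv g"
  have hg: "(\<Sum>i\<in>UNIV. ?h $ l $ i * g $ i $ j) = (if l = j then 1 else 0)" for l j
    using matrix_inv_eq(2)[OF g] by (simp add: matrix_matrix_mult_def mat_def vec_eq_iff)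
  have "(\<Sum>i\<in>UNIV. pdiff i (gl_vf g D i)) =
      (\<Sum>i\<in>UNIV. \<Sum>j\<in>UNIV. \<Sum>l\<in>UNIV. pconst (?h $ l $ i * g $ i $ j) * gl_pol g (pdiff l (D j)))"
    unfolding gl_vf_def pdiff_sum pdiff_pconst_times pdiff_gl_pol sum_distrib_left by (simp add: pconst_mult ac_simps)
  also have "\<dots> = (\<Sum>j\<in>UNIV. \<Sum>i\<in>UNIV. \<Sum>l\<in>UNIV. pconst (?h $ l $ i * g $ i $ j) * gl_pol g (pdiff l (D j)))"
    by (rule sum.swap)
  also have "\<dots> = (\<Sum>j\<in>UNIV. \<Sum>l\<in>UNIV. \<Sum>i\<in>UNIV. pconst (?h $ l $ i * g $ i $ j) * gl_pol g (pdiff l (D j)))"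
    by (rule sum.cong[OF refl], rule sum.swap)
  also have "\<dots> = (\<Sum>j\<in>UNIV. \<Sum>l\<in>UNIV. if l = j then gl_pol g (pdiff l (D j)) else 0)"
    by (intro sum.cong refl) (simp add: hg flip: sum_distrib_right pconst_sum)
  also have "\<dots> = gl_pol g (\<Sum>j\<in>UNIV. pdiff j (D j))" by (simp add: gl_pol_evp gl_pol_hom)
  also have "\<dots> = 0" using D by (simp add: Lvf_def gl_pol_evp)
  finally show ?thesis using gl_vf_SymV[of D d g] D by (simp add: Lvf_def)
qed

lemma vf_base_change_SymV: "D \<in> SymV d \<Longrightarrow> vf_base_change D \<in> SymV d"
  by (auto simp: SymV_def homog_def in_keys_iff)

lemma vf_base_change_Lvf:
  assumes "D \<in> Lvf d"
  shows "vf_base_change D \<in> Lvf d"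
proof -
  have "pdiff i (vf_base_change D i) = vf_base_change (\<lambda>i. pdiff i (D i)) i" for i
    by (rule poly_mapping_eqI) (simp add: lookup_pdiff)
  then have "(\<Sum>i\<in>UNIV. pdiff i (vf_base_change D i)) = vf_base_change (\<lambda>i. \<Sum>i\<in>UNIV. pdiff i (D i)) undefined"
    by (intro poly_mapping_eqI) (simp add: lookup_sum to_ac_sum)
  moreover have "vf_base_change (\<lambda>i. 0) undefined = 0" by (rule poly_mapping_eqI) simp
  ultimately show ?thesis using assms vf_base_change_SymV[of D d] by (simp add: Lvf_def)
qed

text \<open>Over the closure, divergence-free fields are combinations of Hamiltonian and critical
  monomial fields, and these are defined over k. This gives the choice in \<open>vf_action\<close>
  something to choose from.\<close>

lemma Lvf_realizable:
  fixes E :: "('n::finite, 'k::field alg_closure) vf"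
  assumes "E \<in> Lvf d"
  shows "\<exists>t. keys t \<subseteq> Lvf d \<and> vf_realize t = E"
  using assms refl[of "CHAR('k alg_closure)"]
proof (induction E rule: Lvf_induct)
  case zero
  then show ?case by (intro exI[of _ 0]) simp
next
  case (add D E)
  then obtain t u where t: "keys t \<subseteq> Lvf d" "vf_realize t = D" and u: "keys u \<subseteq> Lvf d" "vf_realize u = E" by blast
  then have "keys (t + u) \<subseteq> Lvf d" by (intro order_trans[OF keys_add]) simp
  then show ?case using t u by (intro exI[of _ "t + u"]) (simp add: vf_realize_add)
next
  case (ham i j M c)
  have "ham (Poly_Mapping.single M 1) i j \<in> (Lvf d :: ('n, 'k) vf set)" using ham by (intro Lvf_ham homog_single) auto
  moreover have "(\<lambda>l. pconst c * vf_base_change (ham (Poly_Mapping.single M 1) i j) l) = ham (Poly_Mapping.single M c) i j"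
    by (intro ext poly_mapping_eqI) (simp add: lookup_pconst_times ham_def pdiff_single lookup_single when_def)
  ultimately show ?case
    by (intro exI[of _ "Poly_Mapping.single (ham (Poly_Mapping.single M 1) i j) c"]) (simp add: vf_realize_single)
next
  case (crit i M c)
  have "of_nat (lookup M i) = (0 :: 'k)"
    using crit(1) by (simp add: crit_def of_nat_eq_0_iff_char_dvd)
  then have "mf 1 M i \<in> (Lvf d :: ('n, 'k) vf set)" using crit(2) by (intro Lvf_mf) auto
  moreover have "(\<lambda>l. pconst c * vf_base_change (mf 1 M i) l) = mf c M i"
    by (intro ext poly_mapping_eqI) (simp add: lookup_pconst_times mf_def lookup_single when_def)
  ultimately show ?case
    by (intro exI[of _ "Poly_Mapping.single (mf 1 M i) c"]) (simp add: vf_realize_single)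
qed

lemma SymV_realizable:
  fixes E :: "('n::finite, 'k::field alg_closure) vf"
  assumes E: "E \<in> SymV d"
  shows "\<exists>t. keys t \<subseteq> SymV d \<and> vf_realize t = E"
proof (intro exI conjI)
  let ?t = "\<Sum>i\<in>UNIV. \<Sum>m\<in>keys (E i). Poly_Mapping.single (mf 1 m i :: ('n, 'k) vf) (lookup (E i) m)"
  have "mf 1 m i \<in> (SymV d :: ('n, 'k) vf set)" if "m \<in> keys (E i)" for m i
    using that E by (auto simp: SymV_def mf_def homog_def)
  then have "keys (\<Sum>m\<in>keys (E i). Poly_Mapping.single (mf 1 m i :: ('n, 'k) vf) (lookup (E i) m)) \<subseteq> SymV d" for i
    by (intro order_trans[OF keys_sum]) auto
  then show "keys ?t \<subseteq> SymV d" by (intro order_trans[OF keys_sum]) auto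
  show "vf_realize ?t = E"
  proof
    fix l
    have b: "pconst c * vf_base_change (mf 1 m i :: ('n, 'k) vf) l = (if l = i then Poly_Mapping.single m c else 0)" for c m i
      by (rule poly_mapping_eqI) (simp add: lookup_pconst_times mf_def lookup_single when_def)
    have "vf_realize ?t l = (\<Sum>i\<in>UNIV. \<Sum>m\<in>keys (E i). if l = i then Poly_Mapping.single m (lookup (E i) m) else 0)"
      by (simp add: vf_realize_sum vf_realize_single b)
    also have "\<dots> = (\<Sum>i\<in>UNIV. if l = i then E i else 0)"
      by (intro sum.cong refl) (simp flip: poly_mapping_eq_sum_single)
    finally show "vf_realize ?t l = E l" by simp
  qed
qed

lemma vf_action_spec:
  assumes "\<exists>t. keys t \<subseteq> C \<and> vf_realize t = gl_vf g (vf_base_change D)"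
  shows "keys (vf_action C g D) \<subseteq> C" "vf_realize (vf_action C g D) = gl_vf g (vf_base_change D)"
  using someI_ex[OF assms] by (auto simp: vf_action_def)

lemmas vf_action_Lvf = vf_action_spec[OF Lvf_realizable[OF gl_vf_Lvf[OF _ vf_base_change_Lvf]]]
  and vf_action_SymV = vf_action_spec[OF SymV_realizable[OF gl_vf_SymV[OF vf_base_change_SymV]]]

section \<open>Regularity of the matrix coefficients\<close>

definition reg_pol :: "(('n::finite, 'k::field) matK \<Rightarrow> ('m, 'k alg_closure) pol) \<Rightarrow> bool" where
  "reg_pol P \<longleftrightarrow> (\<forall>m. regular_fun (\<lambda>g. lookup (P g) m))"

lemma reg_pol_pconst: "regular_fun a \<Longrightarrow> reg_pol (\<lambda>g. pconst (a g))"
proof (unfold reg_pol_def, rule allI)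
  fix m assume "regular_fun a"
  then show "regular_fun (\<lambda>g. lookup (pconst (a g)) m)"
    by (cases "m = 0") (simp_all add: pconst_def lookup_single when_def regular_fun_0)
qed

lemma reg_pol_sum: "(\<And>x. x \<in> A \<Longrightarrow> reg_pol (P x)) \<Longrightarrow> reg_pol (\<lambda>g. \<Sum>x\<in>A. P x g)"
  by (auto simp: reg_pol_def lookup_sum intro: regular_fun_sum)

lemma lookup_mult_splits:
  fixes f h :: "('m::finite, 'c::comm_ring_1) pol"
  shows "lookup (f * h) m = (\<Sum>x\<in>splits m. lookup f (fst x) * lookup h (snd x))"
proof -
  have "mcoeff (mfps_of_pol (f * h)) m = (\<Sum>x\<in>splits m. lookup f (fst x) * lookup h (snd x))"
    unfolding mfps_of_pol_mult by (simp add: times_mfps.rep_eq case_prod_unfold)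
  then show ?thesis by simp
qed

lemma reg_pol_mult:
  fixes P Q :: "('n::finite, 'k::field) matK \<Rightarrow> ('m::finite, 'k alg_closure) pol"
  shows "reg_pol P \<Longrightarrow> reg_pol Q \<Longrightarrow> reg_pol (\<lambda>g. P g * Q g)"
  by (auto simp: reg_pol_def lookup_mult_splits intro!: regular_fun_sum regular_fun_mult)

lemma reg_pol_const: "reg_pol (\<lambda>g. pconst (to_ac c))" "reg_pol (\<lambda>g. pvar i)" "reg_pol (\<lambda>g. 1)"
proof -
  show "reg_pol (\<lambda>g. pconst (to_ac c))" by (intro reg_pol_pconst regular_fun_const)
  show "reg_pol (\<lambda>g. pvar i)"
    by (auto simp: reg_pol_def pvar_def lookup_single when_def regular_fun_0 regular_fun_1)
  show "reg_pol (\<lambda>g. 1)" by (auto simp: reg_pol_def lookup_one when_def regular_fun_0 regular_fun_1)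
qed

lemma reg_pol_power:
  fixes P :: "('n::finite, 'k::field) matK \<Rightarrow> ('m::finite, 'k alg_closure) pol"
  shows "reg_pol P \<Longrightarrow> reg_pol (\<lambda>g. P g ^ e)"
  by (induction e) (simp_all add: reg_pol_mult reg_pol_const)

lemma reg_pol_prod:
  fixes P :: "'i \<Rightarrow> ('n::finite, 'k::field) matK \<Rightarrow> ('m::finite, 'k alg_closure) pol"
  shows "(\<And>x. x \<in> A \<Longrightarrow> reg_pol (P x)) \<Longrightarrow> reg_pol (\<lambda>g. \<Prod>x\<in>A. P x g)"
  by (induction A rule: infinite_finite_induct) (simp_all add: reg_pol_mult reg_pol_const)

lemma regular_fun_det:
  fixes A :: "('n::finite, 'k::field) matK \<Rightarrow> 'k alg_closure ^ 'm::finite ^ 'm"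
  assumes "\<And>i j. regular_fun (\<lambda>g. A g $ i $ j)"
  shows "regular_fun (\<lambda>g. det (A g))"
proof -
  have "regular_fun (\<lambda>g :: ('n, 'k) matK. of_int s)" for s using regular_fun_const[of "of_int s :: 'k"] by simp
  then show ?thesis unfolding det_def by (intro regular_fun_sum regular_fun_mult regular_fun_prod assms)
qed

text \<open>Cramer's rule writes the entry as a determinant in the entries of g and constants,
  divided by det g.\<close>

lemma regular_fun_matrix_inv:
  "regular_fun (\<lambda>g :: ('n::finite, 'k::field) matK. matrix_inv g $ i $ j)"
proof (rule regular_fun_cong)
  fix g :: "('n, 'k) matK" assume g: "invertible g"
  have "g *v (\<chi> a. matrix_inv g $ a $ j) = axis j 1"
    using matrix_inv_eq(1)[OF g]
    by (simp add: vec_eq_iff matrix_vector_mult_def matrix_matrix_mult_def mat_def axis_def)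
  moreover have "det g \<noteq> 0" using g by (simp add: invertible_det_nz)
  ultimately have "(\<chi> a. matrix_inv g $ a $ j) = (\<chi> k. det (\<chi> a b. if b = k then axis j 1 $ a else g $ a $ b) / det g)"
    by (simp add: cramer)
  then have "(\<chi> a. matrix_inv g $ a $ j) $ i = (\<chi> k. det (\<chi> a b. if b = k then axis j 1 $ a else g $ a $ b) / det g) $ i"
    by simp
  then show "matrix_inv g $ i $ j = det (\<chi> a b. if b = i then axis j 1 $ a else g $ a $ b) * inverse (det g)"
    by (simp add: divide_inverse)
next
  have e: "regular_fun (\<lambda>g :: ('n, 'k) matK. (\<chi> a b. if b = i then axis j 1 $ a else g $ a $ b) $ a $ b)" for a b
    by (cases "b = i"; cases "a = j") (simp_all add: axis_def regular_fun_0 regular_fun_1 regular_fun_entry)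
  show "regular_fun (\<lambda>g :: ('n, 'k) matK. det (\<chi> a b. if b = i then axis j 1 $ a else g $ a $ b) * inverse (det g))"
    by (intro regular_fun_mult regular_fun_det regular_fun_inverse_det e)
qed

lemma regular_fun_gl_vf:
  "regular_fun (\<lambda>g :: ('n::finite, 'k::field) matK. lookup (gl_vf g (vf_base_change D) i) m)"
proof -
  have k: "keys (vf_base_change D j) = keys (D j)" for j by (auto simp: in_keys_iff)
  have l: "reg_pol (\<lambda>g :: ('n, 'k) matK. lform (matrix_inv g) j)" for j
    unfolding lform_def by (intro reg_pol_sum reg_pol_mult reg_pol_pconst regular_fun_matrix_inv reg_pol_const)
  have "reg_pol (\<lambda>g :: ('n, 'k) matK. gl_vf g (vf_base_change D) i)"
    unfolding gl_vf_def gl_pol_evp evp_def k lookup_vf_base_change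
    by (intro reg_pol_sum reg_pol_mult reg_pol_pconst regular_fun_entry reg_pol_const reg_pol_prod reg_pol_power l)
  then show ?thesis by (simp add: reg_pol_def)
qed

text \<open>Polynomials in p-th powers of the entries are still polynomials, and the denominator
  becomes a power of det^p by \<open>det_frm\<close>.\<close>

lemma regular_fun_frm:
  fixes \<phi> :: "('n::finite, 'k::field) matK \<Rightarrow> 'k alg_closure"
  assumes p: "prime p" "CHAR('k) = p" "odd p" and \<phi>: "regular_fun \<phi>"
  shows "regular_fun (\<lambda>g. \<phi> (frm p g))"
proof -
  have p': "CHAR('k alg_closure) = p" using p by simp
  obtain F e where F: "\<And>g. invertible g \<Longrightarrow> \<phi> g = evp to_ac (\<lambda>\<pi>. g $ fst \<pi> $ snd \<pi>) F / det g ^ e"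
    using \<phi> unfolding regular_fun_evp by blast
  show ?thesis
  proof (rule regular_fun_cong)
    fix g :: "('n, 'k) matK" assume g: "invertible g"
    show "\<phi> (frm p g) = (\<Sum>m\<in>keys F. to_ac (lookup F m) * (\<Prod>\<pi>\<in>UNIV. ((g $ fst \<pi> $ snd \<pi>) ^ p) ^ lookup m \<pi>)) * (inverse (det g) ^ p) ^ e"
      unfolding F[OF frm_inv(2)[OF p(1) p' g]] det_frm[OF p(1) p' p(3)] evp_def
      by (simp add: frm_def divide_inverse power_inverse)
  next
    show "regular_fun (\<lambda>g. (\<Sum>m\<in>keys F. to_ac (lookup F m) * (\<Prod>\<pi>\<in>UNIV. ((g $ fst \<pi> $ snd \<pi>) ^ p) ^ lookup m \<pi>)) * (inverse (det g) ^ p) ^ e)"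
      by (intro regular_fun_mult regular_fun_sum regular_fun_const regular_fun_prod regular_fun_power regular_fun_entry regular_fun_inverse_det)
  qed
qed

lemma vf_subspace_Lvf: "vf_subspace (Lvf d)" and vf_subspace_SymV: "vf_subspace (SymV d)"
  by (auto simp: vf_subspace_def Lvf_0 Lvf_add Lvf_scale SymV_0 SymV_add SymV_scale)

lemma rational_module_Lvf: "rational_module (vf_mod (Lvf d)) (vf_action (Lvf d) :: ('n::finite, 'k::field, _) action)"
proof (rule rational_module_of_realization[OF vf_subspace_Lvf, of d d _ gl_vf])
  show "Lvf d \<subseteq> SymV d" by (auto simp: Lvf_def)
qed (simp_all add: vf_action_Lvf gl_vf_add gl_vf_scale gl_vf_1 gl_vf_mult regular_fun_gl_vf)

text \<open>The twisted action on vector fields over the closure, of which \<open>W_action\<close>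
  is the formal-tensor version.\<close>

definition W_real :: "nat \<Rightarrow> 'c::field ^ 'n ^ 'n \<Rightarrow> ('n::finite, 'c) vf \<Rightarrow> ('n, 'c) vf" where
  "W_real p g D = (\<lambda>i. pconst (inverse (det g) ^ (p - 1)) * gl_vf (frm p g) D i)"

lemma W_action_realize:
  assumes "D \<in> SymV r"
  shows "keys (W_action p r g D) \<subseteq> SymV r" "vf_realize (W_action p r g D) = W_real p g (vf_base_change D)"
proof -
  have e: "W_action p r g D = tscale (inverse (det g) ^ (p - 1)) (vf_action (SymV r) (frm p g) D)"
    by (simp add: W_action_def det_dual_twist_def frobenius_twist_def frm_def)
  show "keys (W_action p r g D) \<subseteq> SymV r" unfolding e
    using keys_tscale vf_action_SymV(1)[OF assms] by (rule order_trans)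
  show "vf_realize (W_action p r g D) = W_real p g (vf_base_change D)"
    unfolding e vf_realize_tscale vf_action_SymV(2)[OF assms] W_real_def ..
qed

lemma rational_module_W:
  assumes p: "prime p" "CHAR('k::field) = p" "odd p"
  shows "rational_module (vf_mod (SymV r)) (W_action p r :: ('n::finite, 'k, _) action)"
proof (rule rational_module_of_realization[OF vf_subspace_SymV order_refl, of _ _ "W_real p"])
  have p': "CHAR('k alg_closure) = p" using p by simp
  show "W_real p g (\<lambda>i. D i + E i) = (\<lambda>i. W_real p g D i + W_real p g E i)" for g :: "('n, 'k) matK" and D E
    by (simp add: W_real_def gl_vf_add algebra_simps)
  show "W_real p g (\<lambda>i. pconst c * D i) = (\<lambda>i. pconst c * W_real p g D i)" for g :: "('n, 'k) matK" and c D
    unfolding W_real_def gl_vf_scale by (rule ext) (simp add: ac_simps)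
  show "W_real p (mat 1) D = D" for D :: "('n, 'k alg_closure) vf" by (simp add: W_real_def frm_1[OF p(1)] gl_vf_1)
  show "W_real p (g ** h) D = W_real p g (W_real p h D)" if "invertible g" "invertible h" for g h :: "('n, 'k) matK" and D
    using that by (simp add: W_real_def frm_mult[OF p(1) p'] gl_vf_mult frm_inv[OF p(1) p'] gl_vf_scale det_mul
        inverse_mult_distrib power_mult_distrib pconst_mult mult.assoc)
  show "regular_fun (\<lambda>g :: ('n, 'k) matK. lookup (W_real p g (vf_base_change D) i) m)" for D i m
    unfolding W_real_def lookup_pconst_times
    by (intro regular_fun_mult regular_fun_power regular_fun_inverse_det regular_fun_frm[OF p regular_fun_gl_vf])
qed (simp_all add: W_action_realize)


section \<open>Equivariance of the residual coefficients\<close>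

text \<open>Makes additivity of the p-th power available for sums of polynomials, in particular for
  linear forms.\<close>

lemma CHAR_pol: "CHAR(('n, 'c::comm_ring_1) pol) = CHAR('c)"
proof (rule CHAR_eqI)
  have e: "of_nat m = (pconst (of_nat m) :: ('n, 'c) pol)" for m
    by (induction m) (simp_all add: pconst_add)
  show "of_nat CHAR('c) = (0 :: ('n, 'c) pol)" by (simp add: e)
  show "CHAR('c) dvd m" if "of_nat m = (0 :: ('n, 'c) pol)" for m
  proof -
    have "lookup (pconst (of_nat m) :: ('n, 'c) pol) 0 = of_nat m" unfolding pconst_def by (rule lookup_single_eq)
    then have "of_nat m = (0 :: 'c)" using that unfolding e by simp
    then show ?thesis by (simp only: of_nat_eq_0_iff_char_dvd)
  qed
qed

lemma lookup_single_mult_add: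
  fixes f :: "('n, 'c::comm_ring_1) pol"
  shows "lookup (Poly_Mapping.single a c * f) (a + b) = c * lookup f b"
proof (induction f rule: poly_mapping_single_induct)
  case (single m d)
  then show ?case by (simp add: mult_single lookup_single when_def)
qed (simp_all add: algebra_simps lookup_add)

lemma lookup_single_mult_eq_0:
  fixes f :: "('n, 'c::comm_ring_1) pol"
  assumes "\<And>b. b \<in> keys f \<Longrightarrow> a + b \<noteq> m"
  shows "lookup (Poly_Mapping.single a c * f) m = 0"
proof (rule ccontr)
  assume "lookup (Poly_Mapping.single a c * f) m \<noteq> 0"
  then have "m \<in> keys (Poly_Mapping.single a c * f)" by (simp add: in_keys_iff)
  then obtain a' b where "m = a' + b" "a' \<in> keys (Poly_Mapping.single a c)" "b \<in> keys f"
    using keys_mult[of "Poly_Mapping.single a c" f] by blast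
  then show False using assms[of b] by (auto split: if_splits)
qed

text \<open>\<open>crm p l e\<close> is \<open>p e + (p - 1) (1, \<dots>, 1, 0, 1, \<dots>, 1)\<close> with the \<open>0\<close> in position \<open>l\<close>.\<close>
definition crm :: "nat \<Rightarrow> 'n \<Rightarrow> 'n::finite mono \<Rightarrow> 'n mono" where
  "crm p l e = (\<Sum>j\<in>UNIV. Poly_Mapping.single j (p * lookup e j + (if j = l then 0 else p - 1)))"

lemma lookup_sum_single [simp]:
  "lookup (\<Sum>j\<in>UNIV. Poly_Mapping.single j (u j)) i = (u (i :: 'n::finite) :: 'c::comm_monoid_add)"
  by (simp add: lookup_sum lookup_single when_def)

lemma lookup_crm [simp]: "lookup (crm p l e) j = p * lookup e j + (if j = l then 0 else p - 1)"
  by (simp add: crm_def)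

lemma crit_crm: "p > 0 \<Longrightarrow> crit p l (crm p l e)"
  by (simp add: crit_def flip: mult_Suc_right)

lemma crit_obtain_crm:
  assumes p: "p > 0" and M: "crit p l M"
  obtains e where "M = crm p l e"
proof
  let ?e = "\<Sum>j\<in>UNIV. Poly_Mapping.single j (lookup M j div p)"
  show "M = crm p l ?e"
  proof (rule poly_mapping_eqI)
    fix j
    show "lookup M j = lookup (crm p l ?e) j"
    proof (cases "j = l")
      case True
      then show ?thesis using M by (simp add: crit_def)
    next
      case False
      then obtain q where q: "lookup M j + 1 = p * q" using M by (auto simp: crit_def)
      then obtain q' where q': "q = q' + 1" by (cases q) auto
      have m: "lookup M j = p * q' + (p - 1)" using q p unfolding q' by (simp add: algebra_simps)
      have "lookup M j div p = q'" unfolding m by (rule div_nat_eqI) (use p in \<open>simp_all add: algebra_simps\<close>)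
      then show ?thesis using False m by simp
    qed
  qed
qed

lemma crm_inj: "p > 0 \<Longrightarrow> crm p l e = crm p l e' \<Longrightarrow> e = e'"
  by (rule poly_mapping_eqI) (metis lookup_crm add_right_cancel mult_cancel1 nat_neq_iff)

lemma mdeg_crm: "mdeg (crm p l e) = p * mdeg e + (p - 1) * (CARD('n) - 1)" for e :: "'n::finite mono"
proof -
  have "(\<Sum>j\<in>UNIV. if j = l then 0 else p - 1) = (\<Sum>j\<in>UNIV - {l}. p - 1)"
    by (intro sum.mono_neutral_cong_right) auto
  then show ?thesis by (simp add: mdeg_def sum.distrib sum_distrib_left)
qed

text \<open>The residue map onto the space of W_r: critical coefficients re-indexed by e. Each
  component has its own family of exponents \<open>crm p i\<close>, whose injectivity keeps the
  support finite. The kernel is the noncritical fields.\<close>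

definition cproj :: "nat \<Rightarrow> ('n::finite, 'c::comm_ring_1) vf \<Rightarrow> ('n, 'c) vf" where
  "cproj p D = (\<lambda>i. Abs_poly_mapping (\<lambda>e. lookup (D i) (crm p i e)))"

lemma lookup_cproj: "p > 0 \<Longrightarrow> lookup (cproj p D i) e = lookup (D i) (crm p i e)"
proof -
  assume p: "p > 0"
  have "{e. lookup (D i) (crm p i e) \<noteq> 0} = crm p i -` keys (D i)" by (auto simp: in_keys_iff)
  moreover have "inj (crm p i)" using crm_inj[OF p] by (auto simp: inj_def)
  ultimately have "finite {e. lookup (D i) (crm p i e) \<noteq> 0}" by (simp add: finite_vimageI)
  then show ?thesis by (simp add: cproj_def Abs_poly_mapping_inverse)
qed

lemma cproj_add: "p > 0 \<Longrightarrow> cproj p (\<lambda>i. D i + E i) = (\<lambda>i. cproj p D i + cproj p E i)"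
  by (intro ext poly_mapping_eqI) (simp add: lookup_cproj lookup_add)

lemma cproj_scale: "p > 0 \<Longrightarrow> cproj p (\<lambda>i. pconst c * D i) = (\<lambda>i. pconst c * cproj p D i)"
  by (intro ext poly_mapping_eqI) (simp add: lookup_cproj lookup_pconst_times)

lemma cproj_eq_0_iff:
  fixes D :: "('n::finite, 'c::comm_ring_1) vf"
  shows "p > 0 \<Longrightarrow> cproj p D = (\<lambda>i. 0) \<longleftrightarrow> noncrit p D"
proof
  assume p: "p > 0" and "noncrit p D"
  then show "cproj p D = (\<lambda>i. 0)"
    by (intro ext poly_mapping_eqI) (auto simp: lookup_cproj noncrit_def crit_crm)
next
  assume p: "p > 0" and z: "cproj p D = (\<lambda>i. 0)"
  show "noncrit p D" unfolding noncrit_def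
  proof (intro allI impI)
    fix i :: 'n and M :: "'n mono" assume "crit p i M"
    with p obtain e where "M = crm p i e" by (rule crit_obtain_crm)
    then show "lookup (D i) M = 0" using lookup_cproj[OF p, of D i e] z by simp
  qed
qed

lemma cproj_mf:
  assumes p: "p > 0"
  shows "cproj p (mf c (crm p i e) i) = mf c e i"
proof (intro ext poly_mapping_eqI)
  fix j e'
  have "crm p i e = crm p i e' \<longleftrightarrow> e = e'" using crm_inj[OF p] by metis
  then show "lookup (cproj p (mf c (crm p i e) i) j) e' = lookup (mf c e i j) e'"
    by (simp add: lookup_cproj[OF p] mf_def lookup_single when_def)
qed

text \<open>The p-th power of a linear form is a combination of the x_j^p, so every monomial of a
  multiple has some exponent >= p.\<close>

lemma lookup_lform_power_p:
  fixes h :: "'c::field ^ 'n::finite ^ 'n"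
  assumes p: "prime p" "CHAR('c) = p" and M: "\<And>j. lookup M j < p"
  shows "lookup (lform h k ^ p * f) M = 0"
proof -
  have p': "CHAR(('n, 'c) pol) = p" by (simp add: CHAR_pol p(2))
  have pw: "pvar j ^ p = Poly_Mapping.single (Poly_Mapping.single j p) (1 :: 'c)" for j :: 'n
    by (simp add: single_eq_prod_pvar[of "Poly_Mapping.single j p"] lookup_single when_def if_distrib prod.delta cong: if_cong)
  have "lform h k ^ p = (\<Sum>j\<in>UNIV. (pconst (h $ k $ j) * pvar j) ^ p)"
    unfolding lform_def by (rule freshmans_dream_sum) (simp_all add: p' p(1))
  also have "\<dots> = (\<Sum>j\<in>UNIV. Poly_Mapping.single (Poly_Mapping.single j p) ((h $ k $ j) ^ p))"
    by (simp add: power_mult_distrib pw pconst_times_single flip: pconst_power)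
  finally have e: "lform h k ^ p = (\<Sum>j\<in>UNIV. Poly_Mapping.single (Poly_Mapping.single j p) ((h $ k $ j) ^ p))" .
  have "lookup (Poly_Mapping.single (Poly_Mapping.single j p) c * f) M = 0" for j c
  proof (rule lookup_single_mult_eq_0)
    fix b
    have "lookup (Poly_Mapping.single j p + b) j \<ge> p" by (simp add: lookup_add)
    then show "Poly_Mapping.single j p + b \<noteq> M" using M[of j] by auto
  qed
  then show ?thesis unfolding e by (simp add: sum_distrib_right lookup_sum)
qed

lemma power_add_mult_expand: "\<exists>q. (a + s * b) ^ m = a ^ m + b * (q :: 'r::comm_ring_1)"
proof (induction m)
  case (Suc m)
  then obtain q where "(a + s * b) ^ m = a ^ m + b * q" by blast
  then have "(a + s * b) ^ Suc m = a ^ Suc m + b * (a * q + s * a ^ m + s * b * q)" by (simp add: algebra_simps)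
  then show ?case by blast
qed (auto intro: exI[of _ 0])

section \<open>The top coefficient of a product of powers of linear forms\<close>

definition topc :: "nat \<Rightarrow> 'c::field ^ 'n::finite ^ 'n \<Rightarrow> 'c" where
  "topc p A = lookup (\<Prod>i\<in>UNIV. lform A i ^ (p - 1)) (\<Sum>j\<in>UNIV. Poly_Mapping.single j (p - 1))"

definition rowop :: "'n \<Rightarrow> 'n \<Rightarrow> 'c::field \<Rightarrow> 'c ^ 'n ^ 'n \<Rightarrow> 'c ^ 'n ^ 'n::finite" where
  "rowop i k c A = (\<chi> r. if r = i then row i A + c *s row k A else row r A)"

lemma rowop_nth: "rowop i k c A $ r $ j = (if r = i then A $ i $ j + c * A $ k $ j else A $ r $ j)"
  by (simp add: rowop_def row_def)

text \<open>In (a + c b)^(p-1) b^(p-1) all terms except a^(p-1) b^(p-1) contain b^p, which does not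
  reach exponents below p.\<close>

lemma topc_rowop:
  fixes A :: "'c::field ^ 'n::finite ^ 'n"
  assumes p: "prime p" "CHAR('c) = p" and ik: "i \<noteq> k"
  shows "topc p (rowop i k c A) = topc p A"
proof -
  let ?M = "\<Sum>j\<in>UNIV. Poly_Mapping.single (j :: 'n) (p - 1)"
  let ?a = "lform A i" and ?b = "lform A k" and ?R = "\<Prod>r\<in>UNIV - {i} - {k}. lform A r ^ (p - 1)"
  have p1: "p - 1 + 1 = p" "p > 0" using prime_gt_0_nat[OF p(1)] by auto
  have f: "(\<Prod>r\<in>UNIV. F r) = F i * (F k * prod F (UNIV - {i} - {k}))" for F :: "'n \<Rightarrow> ('n, 'c) pol"
    using ik by (simp add: prod.remove[of UNIV i] prod.remove[of "UNIV - {i}" k])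
  have l: "lform (rowop i k c A) r = (if r = i then ?a + pconst c * ?b else lform A r)" for r
    by (simp add: lform_def rowop_nth pconst_add pconst_mult algebra_simps sum.distrib sum_distrib_left)
  obtain q where q: "(?a + pconst c * ?b) ^ (p - 1) = ?a ^ (p - 1) + ?b * q" using power_add_mult_expand by blast
  have "(\<Prod>r\<in>UNIV. lform (rowop i k c A) r ^ (p - 1)) = (?a + pconst c * ?b) ^ (p - 1) * (?b ^ (p - 1) * ?R)"
    unfolding f[of "\<lambda>r. lform (rowop i k c A) r ^ (p - 1)"] using ik by (simp add: l)
  also have "\<dots> = ?a ^ (p - 1) * (?b ^ (p - 1) * ?R) + ?b ^ (p - 1 + 1) * (q * ?R)"
    unfolding q by (simp add: algebra_simps power_add)
  also have "\<dots> = (\<Prod>r\<in>UNIV. lform A r ^ (p - 1)) + ?b ^ p * (q * ?R)"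
    unfolding p1 f[of "\<lambda>r. lform A r ^ (p - 1)"] ..
  finally have e: "(\<Prod>r\<in>UNIV. lform (rowop i k c A) r ^ (p - 1)) = (\<Prod>r\<in>UNIV. lform A r ^ (p - 1)) + ?b ^ p * (q * ?R)" .
  have "lookup (?b ^ p * (q * ?R)) ?M = 0" by (rule lookup_lform_power_p[OF p]) (use p1 in simp)
  then show ?thesis unfolding topc_def e by (simp add: lookup_add)
qed

lemma det_rowop: "i \<noteq> k \<Longrightarrow> det (rowop i k c A) = det A"
  unfolding rowop_def by (rule det_row_operation)

text \<open>Both sides are invariant under row operations, so Gaussian elimination reduces to diagonal matrices
  and matrices with a zero row.\<close>

lemma topc_eq_det_aux:
  fixes A :: "'c::field ^ 'n::finite ^ 'n"
  assumes p: "prime p" "CHAR('c) = p"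
  shows "(\<forall>i j. j \<notin> K \<longrightarrow> i \<noteq> j \<longrightarrow> A $ i $ j = 0) \<Longrightarrow> topc p A = det A ^ (p - 1)"
proof (induction "card K" arbitrary: K A rule: less_induct)
  case less
  have p1: "p - 1 > 0" using prime_gt_1_nat[OF p(1)] by simp
  \<comment> \<open>K is the set of columns not yet reduced to the diagonal; L bounds the rows that
    may still be nonzero in the pivot column k. When L is exhausted, k leaves K and the outer
    induction applies.\<close>
  have clear: "topc p B = det B ^ (p - 1)"
    if k: "k \<in> K" and "B $ k $ k \<noteq> 0" "\<forall>i j. j \<notin> K \<longrightarrow> i \<noteq> j \<longrightarrow> B $ i $ j = 0"
      "\<forall>i. i \<notin> L \<longrightarrow> i \<noteq> k \<longrightarrow> B $ i $ k = 0" for B :: "'c ^ 'n ^ 'n" and k L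
    using finite[of L] that(2-)
  proof (induction L arbitrary: B rule: finite_induct)
    case empty
    have "card (K - {k}) < card K" using k by (intro psubset_card_mono) auto
    then show ?case by (rule less.hyps) (use empty in auto)
  next
    case (insert r L)
    show ?case
    proof (cases "r = k")
      case True
      then show ?thesis using insert.prems by (intro insert.IH) auto
    next
      case False
      \<comment> \<open>The entry (r, k) is cleared by the pivot row. Columns already reduced stay
        so, because row k is 0 in all of them.\<close>
      let ?B = "rowop r k (- (B $ r $ k / B $ k $ k)) B"
      have "B $ k $ j = 0" if "j \<notin> K" for j using insert.prems(2) k that by metis
      then have "topc p ?B = det ?B ^ (p - 1)"
        using insert.prems False k by (intro insert.IH) (auto simp: rowop_nth)
      then show ?thesis by (simp add: topc_rowop[OF p False] det_rowop[OF False])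
    qed
  qed
  show ?case
  proof (cases "K = {}")
    case True
    then have off: "A $ i $ j = 0" if "i \<noteq> j" for i j using less.prems that by auto
    have "lform A i = pconst (A $ i $ i) * pvar i" for i
    proof -
      have "lform A i = (\<Sum>j\<in>UNIV. if j = i then pconst (A $ i $ i) * pvar i else 0)"
        unfolding lform_def by (intro sum.cong) (auto simp: off)
      then show ?thesis by simp
    qed
    then have "(\<Prod>i\<in>UNIV. lform A i ^ (p - 1)) = pconst (\<Prod>i\<in>UNIV. (A $ i $ i) ^ (p - 1)) * (\<Prod>i\<in>UNIV. pvar i ^ (p - 1))"
      by (simp add: power_mult_distrib prod.distrib pconst_prod pconst_power)
    also have "\<dots> = Poly_Mapping.single (\<Sum>j\<in>UNIV. Poly_Mapping.single j (p - 1)) (\<Prod>i\<in>UNIV. (A $ i $ i) ^ (p - 1))"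
      by (simp add: single_eq_prod_pvar[of "\<Sum>j\<in>UNIV. Poly_Mapping.single j (p - 1)"])
    finally show ?thesis unfolding topc_def by (simp add: det_diagonal[OF off] prod_power_distrib)
  next
    case False
    then obtain k0 where k0: "k0 \<in> K" by blast
    show ?thesis
    proof (cases "\<forall>l\<in>K. \<forall>k\<in>K. A $ l $ k = 0")
      case True
      \<comment> \<open>Row k0 vanishes inside K by the case assumption and outside K because those
        columns are already diagonal; hence det and the product of linear forms are both 0.\<close>
      then have z: "A $ k0 $ j = 0" for j using less.prems k0 by (cases "j \<in> K") auto
      have "row k0 A = 0" by (simp add: row_def vec_eq_iff z)
      then have "det A = 0" by (rule det_zero_row(2))
      moreover have "(\<Prod>i\<in>UNIV. lform A i ^ (p - 1)) = 0"
      proof (rule prod_zero)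
        have "lform A k0 = 0" by (simp add: lform_def z)
        then have "lform A k0 ^ (p - 1) = 0" by (simp only:) (rule zero_power[OF p1])
        then show "\<exists>i\<in>UNIV. lform A i ^ (p - 1) = 0" by (intro bexI[of _ k0]) auto
      qed simp
      ultimately show ?thesis using zero_power[OF p1, where ?'a = 'c] by (simp only: topc_def lookup_zero)
    next
      case False
      then obtain l k where lk: "l \<in> K" "k \<in> K" "A $ l $ k \<noteq> 0" by blast
      show ?thesis
      proof (cases "A $ k $ k = 0")
        case True
        then have kl: "k \<noteq> l" using lk by auto
        \<comment> \<open>Adding row l puts the nonzero entry (l, k) on the diagonal, so rows need
          no exchange and no sign appears.\<close>
        have "topc p (rowop k l 1 A) = det (rowop k l 1 A) ^ (p - 1)"
        proof (rule clear[OF lk(2), of _ UNIV])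
          have "A $ l $ j = 0" if "j \<notin> K" for j using less.prems lk that by metis
          then show "\<forall>i j. j \<notin> K \<longrightarrow> i \<noteq> j \<longrightarrow> rowop k l 1 A $ i $ j = 0" using less.prems by (simp add: rowop_nth)
        qed (use True lk in \<open>auto simp: rowop_nth\<close>)
        then show ?thesis by (simp add: topc_rowop[OF p kl] det_rowop[OF kl])
      qed (rule clear[OF lk(2), of _ UNIV]; use less.prems in auto)
    qed
  qed
qed

lemma topc_eq_det:
  fixes A :: "'c::field ^ 'n::finite ^ 'n"
  assumes "prime p" "CHAR('c) = p"
  shows "topc p A = det A ^ (p - 1)"
  using topc_eq_det_aux[OF assms, of UNIV A] by simp

text \<open>By Cramer's rule the minor of \<open>h\<close> that arises is \<open>det h\<close> times an entry of the inverse.\<close>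

lemma minor_coeff:
  fixes g h :: "'c::field ^ 'n::finite ^ 'n"
  assumes p: "prime p" "CHAR('c) = p" and gh: "g ** h = mat 1"
  shows "lookup (\<Prod>j\<in>UNIV - {i}. lform h j ^ (p - 1)) (crm p l 0) = (g $ l $ i * det h) ^ (p - 1)"
proof -
  \<comment> \<open>Replacing row i by the unit vector turns the missing linear form into x_l, so
    the coefficient sought is the top coefficient for a full matrix.\<close>
  let ?A = "(\<chi> r. if r = i then axis l 1 else row r h) :: 'c ^ 'n ^ 'n"
  have S: "(\<Sum>r\<in>UNIV. row l g $ r *s row r h) = axis l 1"
  proof -
    have "(\<Sum>r\<in>UNIV. g $ l $ r * h $ r $ m) = (if l = m then 1 else 0)" for m
      using gh by (simp add: vec_eq_iff matrix_matrix_mult_def mat_def)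
    then show ?thesis by (auto simp: vec_eq_iff row_def axis_def)
  qed
  then have d: "det ?A = g $ l $ i * det h" using cramer_lemma_transpose[of i "row l g" h] unfolding S by (simp add: row_def[of l g])
  have li: "lform ?A i = pvar l"
    by (simp add: lform_def axis_def if_distrib[of pconst] if_distrib[of "\<lambda>x. x * _"] sum.delta cong: if_cong)
  have lr: "lform ?A r = lform h r" if "r \<noteq> i" for r using that by (simp add: lform_def row_def)
  have pw: "pvar l ^ e = Poly_Mapping.single (Poly_Mapping.single l e) (1 :: 'c)" for e
    by (simp add: single_eq_prod_pvar[of "Poly_Mapping.single l e"] lookup_single when_def if_distrib prod.delta cong: if_cong)
  have "(\<Prod>r\<in>UNIV. lform ?A r ^ (p - 1)) = Poly_Mapping.single (Poly_Mapping.single l (p - 1)) 1 * (\<Prod>j\<in>UNIV - {i}. lform h j ^ (p - 1))"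
    by (simp add: prod.remove[of UNIV i] li lr pw)
  moreover have "(\<Sum>j\<in>UNIV. Poly_Mapping.single j (p - 1)) = Poly_Mapping.single l (p - 1) + crm p l 0"
    by (rule poly_mapping_eqI) (simp add: lookup_add lookup_single when_def)
  ultimately have "topc p ?A = lookup (\<Prod>j\<in>UNIV - {i}. lform h j ^ (p - 1)) (crm p l 0)"
    by (simp add: topc_def lookup_single_mult_add)
  then show ?thesis by (simp add: topc_eq_det[OF p] d)
qed

text \<open>If p a plus an exponent of B equals \<open>crm p l e\<close>, then p a_j <= p e_j + p -
  1 gives a_j <= e_j, and the degree of B gives equal total degrees, so a = e. Only one monomial of
  Q contributes and the coefficient factors.\<close>

lemma lookup_frobenius_mult:
  fixes Q B :: "('n::finite, 'c::field) pol"
  assumes p: "p > 0" and B: "B \<in> homog ((p - 1) * (CARD('n) - 1))"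
  shows "lookup (evp pconst (\<lambda>m. pvar m ^ p) Q * B) (crm p l e) = lookup Q e * lookup B (crm p l 0)"
proof (induction Q rule: poly_mapping_single_induct)
  case (single a q)
  let ?a = "\<Sum>j\<in>UNIV. Poly_Mapping.single j (p * lookup a j)"
  have s: "evp pconst (\<lambda>m. pvar m ^ p) (Poly_Mapping.single a q) = Poly_Mapping.single ?a q"
    by (simp add: gl_pol_hom single_eq_prod_pvar[of ?a] power_mult)
  show ?case
  proof (cases "a = e")
    case True
    have "crm p l e = ?a + crm p l 0" by (rule poly_mapping_eqI) (simp add: lookup_add True)
    then show ?thesis unfolding s by (simp add: lookup_single_mult_add True)
  next
    case False
    have "?a + b \<noteq> crm p l e" if b: "b \<in> keys B" for b
    proof
      assume eq: "?a + b = crm p l e"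
      have "lookup a j \<le> lookup e j" for j
      proof -
        have "p * lookup a j \<le> lookup (?a + b) j" by (simp add: lookup_add)
        also have "\<dots> \<le> p * lookup e j + (p - 1)" unfolding eq by simp
        also have "\<dots> < p * (lookup e j + 1)" using p by (simp add: algebra_simps)
        finally have "lookup a j < lookup e j + 1" using p by simp
        then show ?thesis by simp
      qed
      moreover have "mdeg e = mdeg a"
      proof -
        have "mdeg ?a = p * mdeg a" by (simp add: mdeg_def sum_distrib_left)
        moreover have "mdeg b = (p - 1) * (CARD('n) - 1)" using B b by (simp add: homog_def)
        ultimately have "p * mdeg a = p * mdeg e" using arg_cong[OF eq, of mdeg] by (simp add: mdeg_crm)
        then show ?thesis using p by simp
      qed
      ultimately have "lookup a j = lookup e j" for j
        unfolding mdeg_def using sum_mono_inv[of "lookup a" UNIV "lookup e" j] by simp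
      then show False using False by (metis poly_mapping_eqI)
    qed
    then show ?thesis unfolding s using False by (simp add: lookup_single_mult_eq_0 lookup_single)
  qed
qed (simp_all add: gl_pol_hom lookup_add algebra_simps)

text \<open>With H = g f, the component l of the transformed field is the sum over m of a 2 by 2
  minor of g times \<partial>_m H. The minor is 0 for m = l, and for m \<noteq> l the derivative has
  no coefficient at a critical exponent.\<close>

lemma noncrit_gl_vf_ham:
  fixes g :: "'c::field ^ 'n::finite ^ 'n"
  assumes p: "CHAR('c) = p" and g: "invertible g" and ij: "i \<noteq> j"
  shows "noncrit p (gl_vf g (ham f i j))"
proof -
  let ?h = "matrix_inv g" and ?H = "gl_pol g f"
  have hg: "(\<Sum>m\<in>UNIV. g $ j $ m * ?h $ m $ k) = (if j = k then 1 else 0)" for j k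
    using matrix_inv_eq(1)[OF g] by (simp add: matrix_matrix_mult_def mat_def vec_eq_iff)
  \<comment> \<open>The chain rule for H, solved for the transformed derivatives by multiplying with
    g.\<close>
  have d: "gl_pol g (pdiff j f) = (\<Sum>m\<in>UNIV. pconst (g $ m $ j) * pdiff m ?H)" for j
  proof -
    have hg: "(\<Sum>m\<in>UNIV. ?h $ k $ m * g $ m $ j) = (if k = j then 1 else 0)" for k
      using matrix_inv_eq(2)[OF g] by (simp add: matrix_matrix_mult_def mat_def vec_eq_iff)
    have "(\<Sum>m\<in>UNIV. pconst (g $ m $ j) * pdiff m ?H) =
        (\<Sum>m\<in>UNIV. \<Sum>k\<in>UNIV. pconst (?h $ k $ m * g $ m $ j) * gl_pol g (pdiff k f))"
      by (simp add: pdiff_gl_pol sum_distrib_left pconst_mult ac_simps)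
    also have "\<dots> = (\<Sum>k\<in>UNIV. \<Sum>m\<in>UNIV. pconst (?h $ k $ m * g $ m $ j) * gl_pol g (pdiff k f))" by (rule sum.swap)
    also have "\<dots> = (\<Sum>k\<in>UNIV. if k = j then gl_pol g (pdiff k f) else 0)"
      by (intro sum.cong refl) (simp add: hg flip: sum_distrib_right pconst_sum)
    finally show ?thesis by simp
  qed
  have D: "gl_vf g (ham f i j) l = (\<Sum>m\<in>UNIV. pconst (g $ l $ i * g $ m $ j - g $ l $ j * g $ m $ i) * pdiff m ?H)" for l
  proof -
    have "gl_vf g (ham f i j) l = (\<Sum>r\<in>UNIV. (if r = i then pconst (g $ l $ i) * gl_pol g (pdiff j f) else 0) +
        (if r = j then - (pconst (g $ l $ j) * gl_pol g (pdiff i f)) else 0))"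
      unfolding gl_vf_def
    proof (rule sum.cong[OF refl])
      fix r
      have "gl_pol g (- u) = - gl_pol g u" for u using evp_add[OF coef_hom_pconst, of "lform (matrix_inv g)" u "- u"]
        by (simp add: gl_pol_evp eq_neg_iff_add_eq_0 add.commute)
      then show "pconst (g $ l $ r) * gl_pol g (ham f i j r) = (if r = i then pconst (g $ l $ i) * gl_pol g (pdiff j f) else 0) +
        (if r = j then - (pconst (g $ l $ j) * gl_pol g (pdiff i f)) else 0)"
        using ij by (auto simp: ham_def gl_pol_evp)
    qed
    then have "gl_vf g (ham f i j) l = pconst (g $ l $ i) * gl_pol g (pdiff j f) - pconst (g $ l $ j) * gl_pol g (pdiff i f)"
      by (simp add: sum.distrib)
    also have "\<dots> = (\<Sum>m\<in>UNIV. pconst (g $ l $ i) * (pconst (g $ m $ j) * pdiff m ?H) -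
        pconst (g $ l $ j) * (pconst (g $ m $ i) * pdiff m ?H))"
      by (simp only: d sum_distrib_left sum_subtractf)
    also have "\<dots> = (\<Sum>m\<in>UNIV. pconst (g $ l $ i * g $ m $ j - g $ l $ j * g $ m $ i) * pdiff m ?H)"
    proof -
      have pd: "pconst (a - b) = (pconst a - pconst b :: ('n, 'c) pol)" for a b :: 'c
        unfolding diff_conv_add_uminus pconst_add pconst_uminus ..
      have "pconst x * (pconst y * u) - pconst z * (pconst w * u) = pconst (x * y - z * w) * u"
        for x y z w :: 'c and u :: "('n, 'c) pol"
        by (simp only: pd pconst_mult left_diff_distrib mult.assoc)
      then show ?thesis by (simp only:)
    qed
    finally show ?thesis .
  qed
  show ?thesis unfolding noncrit_def
  proof (intro allI impI)
    fix l :: 'n and M :: "'n mono" assume M: "crit p l M"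
    have z: "of_nat (lookup M m + 1) = (0 :: 'c)" if "m \<noteq> l" for m
      using M that p by (simp only: of_nat_eq_0_iff_char_dvd) (simp add: crit_def)
    have "(g $ l $ i * g $ m $ j - g $ l $ j * g $ m $ i) * lookup (pdiff m ?H) M = 0" for m
    proof (cases "m = l")
      case False
      show ?thesis by (simp only: lookup_pdiff z[OF False] mult_zero_left mult_zero_right)
    qed simp
    then show "lookup (gl_vf g (ham f i j) l) M = 0" by (simp only: D lookup_sum lookup_pconst_times sum.neutral_const)
  qed
qed

text \<open>The exponents p \<mu>_j + p - 1 split the transformed monomial into a polynomial in the
  x_m^p, namely the Frobenius-twisted action on x^\<mu>, and the product of the (p-1)-st powers of
  the linear forms other than the i-th. The first gives the twist, the second the power of the
  determinant.\<close>

lemma cproj_gl_vf_mf: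
  fixes g :: "'c::field ^ 'n::finite ^ 'n"
  assumes p: "prime p" "CHAR('c) = p" and g: "invertible g"
  shows "cproj p (gl_vf g (mf c (crm p i \<mu>) i)) = W_real p g (mf c \<mu> i)"
proof (intro ext poly_mapping_eqI)
  fix l e
  let ?h = "matrix_inv g" and ?F = "evp pconst (\<lambda>m. pvar m ^ p) :: ('n, 'c) pol \<Rightarrow> ('n, 'c) pol"
  let ?Q = "gl_pol (frm p g) (Poly_Mapping.single \<mu> 1)"
  let ?B = "\<Prod>j\<in>UNIV - {i}. lform ?h j ^ (p - 1)"
  have p0: "p > 0" using prime_gt_0_nat[OF p(1)] .
  have p': "CHAR(('n, 'c) pol) = p" by (simp add: CHAR_pol p(2))
  have dh: "det ?h = inverse (det g)"
    using arg_cong[OF matrix_inv_eq(1)[OF g], of det] by (simp add: det_mul inverse_unique)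
  have B: "?B \<in> homog ((p - 1) * (CARD('n) - 1))"
  proof -
    have "?B \<in> homog (\<Sum>j\<in>UNIV - {i}. (p - 1) * 1)" by (intro homog_prod homog_power homog_lform) auto
    then show ?thesis by (simp add: mult.commute)
  qed
  \<comment> \<open>The p-th power of a linear form is the linear form of the Frobenius matrix with
    x_m^p substituted for x_m.\<close>
  have lp: "lform ?h j ^ p = ?F (lform (frm p ?h) j)" for j
  proof -
    have "lform ?h j ^ p = (\<Sum>m\<in>UNIV. (pconst (?h $ j $ m) * pvar m) ^ p)"
      unfolding lform_def by (rule freshmans_dream_sum) (simp_all add: p' p(1))
    then show ?thesis by (simp add: lform_def gl_pol_hom frm_def power_mult_distrib pconst_power)
  qed
  have s: "gl_pol g (Poly_Mapping.single (crm p i \<mu>) c) = pconst c * (?F ?Q * ?B)"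
  proof -
    have "(\<Prod>j\<in>UNIV. lform ?h j ^ lookup (crm p i \<mu>) j) =
        (\<Prod>j\<in>UNIV. ?F (lform (frm p ?h) j) ^ lookup \<mu> j * (if j = i then 1 else lform ?h j ^ (p - 1)))"
      by (intro prod.cong refl) (simp add: power_add power_mult lp)
    also have "\<dots> = ?F ?Q * (\<Prod>j\<in>UNIV. if j = i then 1 else lform ?h j ^ (p - 1))"
      by (simp add: prod.distrib gl_pol_evp gl_pol_hom frm_inv(1)[OF p g])
    also have "(\<Prod>j\<in>UNIV. if j = i then 1 else lform ?h j ^ (p - 1)) = ?B"
      by (simp add: prod.remove[of UNIV i])
    finally show ?thesis by (simp add: gl_pol_evp gl_pol_hom)
  qed
  have m: "gl_vf A (mf c M i) l = pconst (A $ l $ i) * gl_pol A (Poly_Mapping.single M c)" for A :: "'c ^ 'n ^ 'n" and M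
  proof -
    have "gl_vf A (mf c M i) l = (\<Sum>j\<in>UNIV. if j = i then pconst (A $ l $ i) * gl_pol A (Poly_Mapping.single M c) else 0)"
      unfolding gl_vf_def by (intro sum.cong) (auto simp: mf_def gl_pol_evp)
    then show ?thesis by simp
  qed
  have "lookup (cproj p (gl_vf g (mf c (crm p i \<mu>) i)) l) e = g $ l $ i * (c * (lookup ?Q e * lookup ?B (crm p l 0)))"
    by (simp add: lookup_cproj[OF p0] m s lookup_pconst_times lookup_frobenius_mult[OF p0 B])
  \<comment> \<open>One factor g_li comes from the action on V and p - 1 factors from the minor;
    together they form the Frobenius-twisted matrix entry.\<close>
  also have "\<dots> = (g $ l $ i) ^ (p - 1 + 1) * inverse (det g) ^ (p - 1) * c * lookup ?Q e"
    by (simp add: minor_coeff[OF p matrix_inv_eq(1)[OF g]] dh power_mult_distrib power_add)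
  also have "\<dots> = lookup (W_real p g (mf c \<mu> i) l) e"
  proof -
    have "gl_pol (frm p g) (Poly_Mapping.single \<mu> c) = pconst c * ?Q"
      by (simp add: gl_pol_evp gl_pol_hom)
    moreover have "p - 1 + 1 = p" using p0 by simp
    ultimately show ?thesis by (simp add: W_real_def m lookup_pconst_times frm_def[of p g])
  qed
  finally show "lookup (cproj p (gl_vf g (mf c (crm p i \<mu>) i)) l) e = lookup (W_real p g (mf c \<mu> i) l) e" .
qed

text \<open>Both sides vanish on Hamiltonian fields, so equivariance is decided on critical
  monomials.\<close>

lemma cproj_gl_vf:
  fixes g :: "'c::field ^ 'n::finite ^ 'n"
  assumes E: "E \<in> Lvf d" and p: "prime p" "CHAR('c) = p" and g: "invertible g"
  shows "cproj p (gl_vf g E) = W_real p g (cproj p E)"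
proof -
  have p0: "p > 0" using prime_gt_0_nat[OF p(1)] .
  have nc: "noncrit p (\<lambda>i. 0 :: ('n, 'c) pol)" by (simp add: noncrit_def)
  have W0: "W_real p g (\<lambda>i. 0) = (\<lambda>i. 0)" by (simp add: W_real_def gl_vf_0)
  show ?thesis using E p(2)
  proof (induction E rule: Lvf_induct)
    case zero
    then show ?case using nc by (simp add: gl_vf_0 W0 cproj_eq_0_iff[OF p0, THEN iffD2])
  next
    case (add D E)
    then show ?case by (simp add: gl_vf_add cproj_add[OF p0] W_real_def algebra_simps)
  next
    case (ham i j M c)
    have "cproj p (gl_vf g (ham (Poly_Mapping.single M c) i j)) = (\<lambda>i. 0)"
      using noncrit_gl_vf_ham[OF p(2) g ham(1)] by (simp add: cproj_eq_0_iff[OF p0])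
    moreover have "cproj p (ham (Poly_Mapping.single M c) i j) = (\<lambda>i. 0)"
      using noncrit_ham[OF p(2) ham(1)] by (simp add: cproj_eq_0_iff[OF p0])
    ultimately show ?case by (simp add: W0)
  next
    case (crit i M c)
    obtain e where "M = crm p i e" using crit_obtain_crm[OF p0 crit(1)] .
    then show ?case by (simp add: cproj_gl_vf_mf[OF p g] cproj_mf[OF p0])
  qed
qed


text \<open>The characteristic is a prime dividing the number of elements. The residues 0, ..., p -
  1 have distinct images, so they exhaust k by counting.\<close>

lemma CHAR_prime_field:
  assumes p: "prime p" "CARD('k::field) = p"
  shows "CHAR('k) = p" "\<exists>m :: nat. of_nat m = (c :: 'k)"
proof -
  have fin: "finite (UNIV :: 'k set)" using p prime_gt_0_nat by (metis card_gt_0_iff)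
  then have "prime CHAR('k)" by (intro prime_CHAR_semidom finite_imp_CHAR_pos)
  moreover have "CHAR('k) dvd p" using CHAR_dvd_CARD[where 'a = 'k] p by simp
  ultimately show C: "CHAR('k) = p" using p(1) by (metis prime_nat_iff not_prime_1)
  have "inj_on (of_nat :: nat \<Rightarrow> 'k) {..<p}"
    by (rule inj_onI) (simp add: of_nat_eq_iff_cong_CHAR C cong_def)
  then have "card ((of_nat :: nat \<Rightarrow> 'k) ` {..<p}) = CARD('k)" using p by (simp add: card_image)
  then have "(of_nat :: nat \<Rightarrow> 'k) ` {..<p} = UNIV" using fin by (intro card_subset_eq) auto
  then show "\<exists>m :: nat. of_nat m = (c :: 'k)" by (metis imageE UNIV_I)
qed

lemma lin_map_comp: "lin_map M M' f \<Longrightarrow> lin_map M' M'' h \<Longrightarrow> lin_map M M'' (\<lambda>x. h (f x))"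
  unfolding lin_map_def by (auto simp: Pi_iff)

lemma quot_proj:
  fixes M :: "('k::field, 'm) module"
  assumes M: "Module.module kring M" and U: "submodule U kring M"
  shows "lin_map M (quot_mod M U) (\<lambda>x. U +>\<^bsub>M\<^esub> x)"
    "x \<in> carrier M \<Longrightarrow> U +>\<^bsub>M\<^esub> x = \<zero>\<^bsub>quot_mod M U\<^esub> \<longleftrightarrow> x \<in> U"
proof -
  note S = quot_mod_simps[OF M U]
  interpret M: Module.module "kring :: 'k ring" M by (rule M)
  show "lin_map M (quot_mod M U) (\<lambda>x. U +>\<^bsub>M\<^esub> x)"
    unfolding lin_map_def using M quot_mod_module[OF M U] by (auto simp: S)
  have A: "abelian_group M" using M by (rule Module.module.axioms(2))
  note B = abelian_group.axioms(1)[OF A]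
  have z: "\<ominus>\<^bsub>M\<^esub> \<zero>\<^bsub>M\<^esub> = \<zero>\<^bsub>M\<^esub>"
    using abelian_group.r_neg[OF A abelian_monoid.zero_closed[OF B]]
      abelian_monoid.l_zero[OF B abelian_group.a_inv_closed[OF A abelian_monoid.zero_closed[OF B]]] by simp
  assume x: "x \<in> carrier M"
  have "U +>\<^bsub>M\<^esub> x = U +>\<^bsub>M\<^esub> \<zero>\<^bsub>M\<^esub> \<longleftrightarrow> x \<ominus>\<^bsub>M\<^esub> \<zero>\<^bsub>M\<^esub> \<in> U" by (rule quot_coset_eq_iff[OF M U x M.zero_closed])
  then show "U +>\<^bsub>M\<^esub> x = \<zero>\<^bsub>quot_mod M U\<^esub> \<longleftrightarrow> x \<in> U"
    using x submodule_kringD(1)[OF U] z by (simp add: S(2) a_minus_def)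
qed

lemma vf_base_change_cproj: "p > 0 \<Longrightarrow> vf_base_change (cproj p D) = cproj p (vf_base_change D)"
  by (intro ext poly_mapping_eqI) (simp add: lookup_cproj)

lemma vf_realize_cproj:
  fixes t :: "('n::finite, 'k::field) vf \<Rightarrow>\<^sub>0 'k alg_closure"
  assumes p: "p > 0"
  shows "vf_realize (tens_map (cproj p) t) = cproj p (vf_realize t)"
proof (induction t rule: poly_mapping_single_induct)
  case (single D c)
  show ?case by (simp add: tens_map_single vf_realize_single vf_base_change_cproj[OF p] cproj_scale[OF p])
qed (simp_all add: tens_map_add vf_realize_add cproj_add[OF p] cproj_eq_0_iff[OF p, THEN iffD2] noncrit_def)

lemma cproj_SymV:
  fixes D :: "('n::finite, 'c::comm_ring_1) vf"
  assumes p: "p > 0" and d: "d = (p - 1) * (CARD('n) - 1) + p * r" and D: "D \<in> SymV d"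
  shows "cproj p D \<in> SymV r"
proof -
  have "mdeg e = r" if "e \<in> keys (cproj p D i)" for e i
  proof -
    have "crm p i e \<in> keys (D i)" using that by (simp add: in_keys_iff lookup_cproj[OF p])
    then have "mdeg (crm p i e) = d" using D by (auto simp: SymV_def homog_def)
    then show ?thesis using p by (simp add: mdeg_crm d)
  qed
  then show ?thesis by (simp add: SymV_def homog_def)
qed

text \<open>The monomials of each E_i are lifted separately to critical exponents. The exponent of
  x_i in component i is divisible by p, so each summand of the divergence is 0.\<close>

lemma cproj_surj:
  fixes E :: "('n::finite, 'c::field) vf"
  assumes p: "p > 0" "CHAR('c) = p" and d: "d = (p - 1) * (CARD('n) - 1) + p * r" and E: "E \<in> SymV r"
  shows "\<exists>D\<in>Lvf d. cproj p D = E"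
proof
  let ?D = "\<lambda>i. \<Sum>m\<in>keys (E i). Poly_Mapping.single (crm p i m) (lookup (E i) m)"
  have "Poly_Mapping.single (crm p i m) (lookup (E i) m) \<in> homog d" if "m \<in> keys (E i)" for i m
    using that E by (intro homog_single) (auto simp: SymV_def homog_def mdeg_crm d)
  then have "?D \<in> SymV d" unfolding SymV_def by (auto intro: homog_sum)
  moreover have "pdiff i (?D i) = 0" for i
  proof -
    have "of_nat (lookup (crm p i m) i) = (0 :: 'c)" for m
      using p(2) by (simp only: of_nat_eq_0_iff_char_dvd) simp
    then show ?thesis by (simp add: pdiff_sum pdiff_single del: lookup_crm)
  qed
  ultimately show "?D \<in> Lvf d" by (simp add: Lvf_def)
  show "cproj p ?D = E"
  proof (intro ext poly_mapping_eqI)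
    fix i e
    have "lookup (cproj p ?D i) e = (\<Sum>m\<in>keys (E i). if m = e then lookup (E i) m else 0)"
      unfolding lookup_cproj[OF p(1)] lookup_sum
      by (intro sum.cong refl) (auto simp: lookup_single when_def dest: crm_inj[OF p(1)])
    then show "lookup (cproj p ?D i) e = lookup (E i) e" by (simp add: in_keys_iff)
  qed
qed

lemma noncrit_of_degree:
  fixes D :: "('n::finite, 'c::comm_ring_1) vf"
  assumes p: "p > 0" and d: "\<nexists>r. d = (p - 1) * (CARD('n) - 1) + p * r" and D: "D \<in> SymV d"
  shows "noncrit p D"
  unfolding noncrit_def
proof (intro allI impI)
  fix i :: 'n and M :: "'n mono" assume "crit p i M"
  with p obtain e where M: "M = crm p i e" by (rule crit_obtain_crm)
  have "mdeg M \<noteq> d" using d by (auto simp: M mdeg_crm add.commute)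
  then have "M \<notin> keys (D i)" using D by (auto simp: SymV_def homog_def)
  then show "lookup (D i) M = 0" by (simp add: in_keys_iff)
qed

section \<open>The quotients: exact fields, vanishing, and the rational structure\<close>

context lie_setting
begin

lemma lead_lin_iso:
  assumes "2 \<le> s" "s < N"
  shows "lin_iso (lie_mod N s :: ('k, ('n, 'k) sym) module) (vf_mod (Lvf s)) (lead N s)"
  using lead_lin_map[OF assms] lead_bij[OF assms] by (simp add: lin_iso_def lie_mod_simps vf_mod_ops)

lemma lead_closed: "2 \<le> s \<Longrightarrow> s < N \<Longrightarrow> u \<in> Lsym N s \<Longrightarrow> lead N s u \<in> (Lvf s :: ('n, 'k) vf set)"
  using lead_bij[of s] by (auto simp: bij_betw_def)

lemma lie_bracket_submodule:
  assumes "3 \<le> d" "d < N"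
  shows "submodule (lie_bracket N 2 (d - 1)) kring (lie_mod N d :: ('k, ('n, 'k) sym) module)"
proof -
  have d: "2 \<le> d" using assms by simp
  note H = submodule_kringD[OF XL_submodule[OF d assms(2)]]
  show ?thesis unfolding lie_bracket_eq_XL[OF assms]
  proof (rule submodule_kringI[OF module_lie_mod[OF d]])
    show "XL N d \<subseteq> carrier (lie_mod N d :: ('k, ('n, 'k) sym) module)" by (auto simp: XL_eq lie_mod_simps)
  qed (use H(2-4) in \<open>simp_all add: lie_mod_simps\<close>)
qed

lemma lie_quot_iso_exact:
  assumes d: "3 \<le> d" "d < N"
  shows "\<exists>\<psi>. lin_iso (lie_quot N d :: ('k, ('n, 'k) sym set) module)
      (quot_mod (vf_mod (Lvf d)) (Evf d) :: ('k, ('n, 'k) vf set) module) \<psi> \<and>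
    (\<forall>u\<in>Lsym N d. \<psi> (lie_bracket N 2 (d - 1) +>\<^bsub>lie_mod N d\<^esub> u) = Evf d +>\<^bsub>vf_mod (Lvf d)\<^esub> lead N d u)"
proof -
  have d2: "2 \<le> d" using d by simp
  let ?M = "lie_mod N d :: ('k, ('n, 'k) sym) module" and ?V = "vf_mod (Lvf d) :: ('k, ('n, 'k) vf) module"
  let ?f = "\<lambda>u :: ('n, 'k) sym. Evf d +>\<^bsub>?V\<^esub> lead N d u"
  note q = quot_proj[OF module_Lvf Evf_submodule[of d]] and b = lead_bij[OF d2 d(2)]
  have 1: "lin_map ?M (quot_mod ?V (Evf d)) ?f" by (rule lin_map_comp[OF lead_lin_map[OF d2 d(2)] q(1)])
  have 2: "?f ` carrier ?M = carrier (quot_mod ?V (Evf d))"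
  proof -
    have "?f ` Lsym N d = (\<lambda>D. Evf d +>\<^bsub>?V\<^esub> D) ` (lead N d ` Lsym N d)" by (simp only: image_image)
    also have "lead N d ` Lsym N d = (Lvf d :: ('n, 'k) vf set)" using b by (simp only: bij_betw_def)
    finally show ?thesis unfolding quot_mod_simps(1)[OF module_Lvf Evf_submodule] lie_mod_simps(1) vf_mod_ops(1) .
  qed
  have 3: "{u \<in> carrier ?M. ?f u = \<zero>\<^bsub>quot_mod ?V (Evf d)\<^esub>} = lie_bracket N 2 (d - 1)"
    unfolding lie_bracket_eq_XL[OF d] XL_eq using q(2) lead_closed[OF d2 d(2)]
    by (auto simp: lie_mod_simps vf_mod_ops)
  show ?thesis using first_isomorphism[OF 1 2 3] unfolding lie_quot_def lie_mod_simps(1) .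
qed

lemma lie_quot_trivial:
  assumes d: "3 \<le> d" "d < N" and no: "\<nexists>r. d = (CHAR('k) - 1) * (CARD('n) - 1) + CHAR('k) * r"
  shows "carrier (lie_quot N d :: ('k, ('n, 'k) sym set) module) = {\<zero>\<^bsub>lie_quot N d :: ('k, ('n, 'k) sym set) module\<^esub>}"
proof -
  have d2: "2 \<le> d" using d by simp
  have p0: "CHAR('k) > 0" using p by simp
  let ?M = "lie_mod N d :: ('k, ('n, 'k) sym) module" and ?U = "lie_bracket N 2 (d - 1) :: ('n, 'k) sym set"
  note M = module_lie_mod[OF d2] and U = lie_bracket_submodule[OF d]
  have "u \<in> ?U" if "u \<in> Lsym N d" for u
    using that lead_closed[OF d2 d(2) that] noncrit_of_degree[OF p0 no]
    unfolding lie_bracket_eq_XL[OF d] XL_eq Evf_eq by (auto simp: Lvf_def)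
  then have "?U +>\<^bsub>?M\<^esub> u = \<zero>\<^bsub>quot_mod ?M ?U\<^esub>" if "u \<in> carrier ?M" for u
    using quot_proj(2)[OF M U that] that by (simp add: lie_mod_simps)
  moreover have "\<zero>\<^bsub>?M\<^esub> \<in> carrier ?M" using submodule_kringD(1,2)[OF U] by blast
  ultimately show ?thesis unfolding lie_quot_def quot_mod_simps(1)[OF M U] by auto
qed

text \<open>The action on the quotient is transported from the twisted module along the isomorphism
  induced by the residue map. What remains to be shown is that the projection from the symbols is
  equivariant, and this is the equivariance of \<open>cproj\<close>.\<close>

lemma lie_quot_rational:
  assumes d: "d = (CHAR('k) - 1) * (CARD('n) - 1) + CHAR('k) * r" "d < N" and prm: "prime CHAR('k)"
  shows "\<exists>\<rho> :: ('n, 'k, ('n, 'k) sym set) action.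
    rational_hom (lie_mod N d) (lie_action N d) (lie_quot N d) \<rho> (\<lambda>u. lie_bracket N 2 (d - 1) +>\<^bsub>lie_mod N d\<^esub> u) \<and>
    (\<exists>\<phi>. rational_iso (lie_quot N d) \<rho> (vf_mod (SymV r)) (W_action CHAR('k) r) \<phi>)"
proof -
  let ?p = "CHAR('k)"
  let ?M = "lie_mod N d :: ('k, ('n, 'k) sym) module" and ?U = "lie_bracket N 2 (d - 1) :: ('n, 'k) sym set"
  let ?Q = "lie_quot N d :: ('k, ('n, 'k) sym set) module" and ?S = "vf_mod (SymV r) :: ('k, ('n, 'k) vf) module"
  let ?V = "vf_mod (Lvf d) :: ('k, ('n, 'k) vf) module"
  let ?q = "\<lambda>u. ?U +>\<^bsub>?M\<^esub> u" and ?l = "lead N d :: ('n, 'k) sym \<Rightarrow> _"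
  have p0: "?p > 0" using p by simp
  have odd: "odd ?p" using prime_odd_nat[OF prm] p by simp
  have pK: "CHAR('k alg_closure) = ?p" by simp
  \<comment> \<open>Every degree d_r is at least 8, so the results stated for d >= 3 apply.\<close>
  have "4 * 2 \<le> (?p - 1) * (CARD('n) - 1)" using p n by (intro mult_le_mono) auto
  then have d3: "3 \<le> d" and d2: "2 \<le> d" using d(1) by auto
  note M = module_lie_mod[OF d2] and U = lie_bracket_submodule[OF d3 d(2)]
  note lcl = lead_closed[OF d2 d(2)] and lb = lead_bij[OF d2 d(2)]
  have LS: "D \<in> SymV d" if "D \<in> Lvf d" for D :: "('n, 'k) vf" using that by (simp add: Lvf_def)
  note cS = cproj_SymV[OF p0 d(1) LS]
  have c: "lin_map ?V ?S (cproj ?p)"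
    unfolding lin_map_def using module_Lvf module_SymV cS by (auto simp: vf_mod_ops cproj_add[OF p0] cproj_scale[OF p0])
  have 1: "lin_map ?M ?S (\<lambda>u. cproj ?p (?l u))" by (rule lin_map_comp[OF lead_lin_map[OF d2 d(2)] c])
  have 2: "(\<lambda>u. cproj ?p (?l u)) ` carrier ?M = carrier ?S"
  proof -
    have "cproj ?p ` Lvf d = (SymV r :: ('n, 'k) vf set)" 
    proof (intro equalityI subsetI)
      fix E assume "E \<in> cproj ?p ` (Lvf d :: ('n, 'k) vf set)"
      then show "E \<in> SymV r" using cS by (elim imageE) (simp only:)
    next
      fix E :: "('n, 'k) vf" assume "E \<in> SymV r"
      from cproj_surj[OF p0 refl d(1) this] show "E \<in> cproj ?p ` Lvf d" by (elim bexE) (intro image_eqI, rule sym)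
    qed
    moreover have "?l ` Lsym N d = Lvf d" using lb by (simp add: bij_betw_def)
    ultimately have "cproj ?p ` (?l ` Lsym N d) = SymV r" by (simp only:)
    then show ?thesis unfolding lie_mod_simps(1) vf_mod_ops(1) image_image .
  qed
  have 3: "{u \<in> carrier ?M. cproj ?p (?l u) = \<zero>\<^bsub>?S\<^esub>} = ?U"
    unfolding lie_bracket_eq_XL[OF d3 d(2)] XL_eq Evf_eq lie_mod_simps vf_mod_ops cproj_eq_0_iff[OF p0] using lcl by auto
  obtain \<phi> where \<phi>: "lin_iso ?Q ?S \<phi>" "\<forall>u\<in>Lsym N d. \<phi> (?q u) = cproj ?p (?l u)"
    using first_isomorphism[OF 1 2 3, folded lie_quot_def, unfolded lie_mod_simps(1)]
    by (elim exE conjE) (rule that)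
  define \<rho> :: "('n, 'k, ('n, 'k) sym set) action" where "\<rho> = transport_action (carrier ?Q) \<phi> (W_action ?p r)"
  let ?inv = "inv_into (carrier ?Q) \<phi>"
  have \<phi>b: "bij_betw \<phi> (carrier ?Q) (SymV r)" and \<phi>l: "lin_map ?Q ?S \<phi>" using \<phi>(1) by (auto simp: lin_iso_def vf_mod_ops)
  have \<phi>i: "\<phi> (?inv E) = E" if "E \<in> SymV r" for E using that \<phi>b by (simp add: bij_betw_def f_inv_into_f)
  have iq: "?inv (cproj ?p (?l u)) = ?q u" if "u \<in> Lsym N d" for u
  proof -
    have "?q u \<in> carrier ?Q" unfolding lie_quot_def quot_mod_simps(1)[OF M U] using that by (simp add: lie_mod_simps)
    then show ?thesis using inv_into_f_f[OF bij_betw_imp_inj_on[OF \<phi>b], of "?q u"] bspec[OF \<phi>(2) that] by simp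
  qed
  have rW: "rational_module ?S (W_action ?p r :: ('n, 'k, _) action)" by (rule rational_module_W[OF prm refl odd])
  have r\<rho>: "rational_module ?Q \<rho>" unfolding \<rho>_def by (rule rational_module_transport[OF \<phi>(1) rW])
  have iso: "rational_iso ?Q \<rho> ?S (W_action ?p r) \<phi>"
    unfolding rational_iso_def rational_hom_def
  proof (intro conjI r\<rho> rW \<phi>l allI impI ballI)
    show "bij_betw \<phi> (carrier ?Q) (carrier ?S)" using \<phi>b by (simp add: vf_mod_ops)
    fix g :: "('n, 'k) matK" and x assume "invertible g" and x: "x \<in> carrier ?Q"
    have "\<phi> x \<in> SymV r" using x \<phi>b by (auto simp: bij_betw_def)
    then have k: "keys (W_action ?p r g (\<phi> x)) \<subseteq> SymV r" by (rule W_action_realize)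
    have "tens_map \<phi> (\<rho> g x) = tens_map (\<lambda>E. \<phi> (?inv E)) (W_action ?p r g (\<phi> x))"
      by (simp add: \<rho>_def transport_action_def tens_map_comp)
    also have "\<dots> = tens_map (\<lambda>E. E) (W_action ?p r g (\<phi> x))" by (rule tens_map_cong) (use k \<phi>i in auto)
    finally show "tens_eq ?S (W_action ?p r g (\<phi> x)) (tens_map \<phi> (\<rho> g x))" by (simp add: tens_map_ident)
  qed
  have la: "lie_action N d = (transport_action (carrier ?M) ?l (vf_action (Lvf d)) :: ('n, 'k, ('n, 'k) sym) action)"
    by (simp add: lie_action_def lie_mod_simps)
  have "rational_hom ?M (lie_action N d) ?Q \<rho> ?q"
    unfolding rational_hom_def
  proof (intro conjI r\<rho> allI impI ballI)
    show "rational_module ?M (lie_action N d)"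
      unfolding la by (rule rational_module_transport[OF lead_lin_iso[OF d2 d(2)] rational_module_Lvf])
    show "lin_map ?M ?Q ?q" unfolding lie_quot_def by (rule quot_proj(1)[OF M U])
    fix g :: "('n, 'k) matK" and x assume g: "invertible g" and "x \<in> carrier ?M"
    then have x: "x \<in> Lsym N d" by (simp add: lie_mod_simps)
    let ?D = "?l x" and ?li = "inv_into (Lsym N d) ?l"
    let ?t = "vf_action (Lvf d) g ?D"
    have D: "?D \<in> Lvf d" by (rule lcl[OF x])
    note t = vf_action_Lvf[OF g D]
    have li: "?li E \<in> Lsym N d \<and> ?l (?li E) = E" if "E \<in> Lvf d" for E
      using that lb by (auto simp: bij_betw_def inv_into_into f_inv_into_f)
    \<comment> \<open>Two routes from divergence-free fields to the quotient agree: back to symbols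
      and project, or take residues and invert \<phi>.\<close>
    have qli: "?q (?li E) = ?inv (cproj ?p E)" if "E \<in> Lvf d" for E
      using iq[of "?li E"] li[OF that] by simp
    have "tens_map ?q (lie_action N d g x) = tens_map (\<lambda>E. ?q (?li E)) ?t"
      by (simp add: lie_action_def transport_action_def tens_map_comp)
    also have "\<dots> = tens_map (\<lambda>E. ?inv (cproj ?p E)) ?t" by (rule tens_map_cong) (use t(1) qli in auto)
    also have "\<dots> = tens_map ?inv (tens_map (cproj ?p) ?t)" by (simp add: tens_map_comp)
    finally have R: "tens_map ?q (lie_action N d g x) = tens_map ?inv (tens_map (cproj ?p) ?t)" .
    have cD: "cproj ?p ?D \<in> SymV r" by (rule cS[OF D])
    \<comment> \<open>Compared in the space of W_r, where realization is injective; the realizations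
      agree because \<open>cproj\<close> intertwines the two actions over the closure.\<close>
    have "tens_eq ?S (W_action ?p r g (cproj ?p ?D)) (tens_map (cproj ?p) ?t)"
    proof (rule vf_tens_eqI[OF vf_subspace_SymV order_refl W_action_realize(1)[OF cD]])
      show "keys (tens_map (cproj ?p) ?t) \<subseteq> SymV r"
        using keys_tens_map[of "cproj ?p" ?t] t(1) cS by blast
      show "vf_realize (W_action ?p r g (cproj ?p ?D)) = vf_realize (tens_map (cproj ?p) ?t)"
        unfolding W_action_realize(2)[OF cD] vf_realize_cproj[OF p0] t(2) vf_base_change_cproj[OF p0]
        using cproj_gl_vf[OF vf_base_change_Lvf[OF D] prm pK g] by simp
    qed
    then have "tens_eq ?Q (tens_map ?inv (W_action ?p r g (cproj ?p ?D))) (tens_map ?inv (tens_map (cproj ?p) ?t))"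
      by (rule tens_eq_tens_map[OF lin_map_inv[OF \<phi>(1)]])
    then show "tens_eq ?Q (\<rho> g (?q x)) (tens_map ?q (lie_action N d g x))"
      unfolding R \<rho>_def transport_action_def bspec[OF \<phi>(2) x] .
  qed
  then show ?thesis using iso by blast
qed

end

theorem theorem1p2:
  fixes p N :: nat
  assumes "prime p" and "p \<ge> 5" and "CARD('k::field) = p"
    and "CARD('n::{finite,linorder}) \<ge> 3" and "N \<ge> 3"
  shows
    "(\<forall>d. 3 \<le> d \<and> d < N \<longrightarrow>
        (lie_bracket N 2 (d - 1) :: ('n, 'k) sym set) = XL N d \<and>
        (\<exists>\<psi>. lin_iso (lie_quot N d :: ('k, ('n, 'k) sym set) module)
                 (quot_mod (vf_mod (Lvf d)) (Evf d) :: ('k, ('n, 'k) vf set) module) \<psi> \<and>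
             (\<forall>u\<in>Lsym N d. \<psi> (lie_bracket N 2 (d - 1) +>\<^bsub>lie_mod N d\<^esub> u) =
                Evf d +>\<^bsub>vf_mod (Lvf d)\<^esub> lead N d u)) \<and>
        (\<exists>\<theta>. lin_iso (lie_quot N d :: ('k, ('n, 'k) sym set) module) (lie_abel_comp N d) \<theta> \<and>
             (\<forall>u\<in>Lsym N d. \<theta> (lie_bracket N 2 (d - 1) +>\<^bsub>lie_mod N d\<^esub> u) = lie_to_abel N d u)) \<and>
        ((\<nexists>r. d = (p - 1) * (CARD('n) - 1) + p * r) \<longrightarrow>
           carrier (lie_quot N d :: ('k, ('n, 'k) sym set) module) =
             {\<zero>\<^bsub>lie_quot N d :: ('k, ('n, 'k) sym set) module\<^esub>})) \<and>
     (\<forall>r d. d = (p - 1) * (CARD('n) - 1) + p * r \<and> d < N \<longrightarrow>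
        (\<exists>\<rho> :: ('n, 'k, ('n, 'k) sym set) action.
           rational_hom (lie_mod N d) (lie_action N d) (lie_quot N d) \<rho>
             (\<lambda>u. lie_bracket N 2 (d - 1) +>\<^bsub>lie_mod N d\<^esub> u) \<and>
           (\<exists>\<phi>. rational_iso (lie_quot N d) \<rho> (vf_mod (SymV r)) (W_action p r) \<phi>)))"
proof -
  have C: "CHAR('k) = p" by (rule CHAR_prime_field(1)) fact+
  \<comment> \<open>A field with p elements satisfies the locale: its characteristic is p >= 5 and
    every element is the image of a natural number.\<close>
  interpret lie_setting N "TYPE('n \<times> 'k)"
  proof
    show "\<exists>m :: nat. of_nat m = c" for c :: 'k by (rule CHAR_prime_field(2)) fact+
  qed (use assms C in auto)
  show ?thesis
  proof (intro conjI allI impI; (elim conjE)?)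
    fix d assume d: "3 \<le> d" "d < N"
    show "(lie_bracket N 2 (d - 1) :: ('n, 'k) sym set) = XL N d" by (rule lie_bracket_eq_XL[OF d])
    show "\<exists>\<psi>. lin_iso (lie_quot N d :: ('k, ('n, 'k) sym set) module)
                 (quot_mod (vf_mod (Lvf d)) (Evf d) :: ('k, ('n, 'k) vf set) module) \<psi> \<and>
             (\<forall>u\<in>Lsym N d. \<psi> (lie_bracket N 2 (d - 1) +>\<^bsub>lie_mod N d\<^esub> u) =
                Evf d +>\<^bsub>vf_mod (Lvf d)\<^esub> lead N d u)"
      by (rule lie_quot_iso_exact[OF d])
    show "\<exists>\<theta>. lin_iso (lie_quot N d :: ('k, ('n, 'k) sym set) module) (lie_abel_comp N d) \<theta> \<and>
             (\<forall>u\<in>Lsym N d. \<theta> (lie_bracket N 2 (d - 1) +>\<^bsub>lie_mod N d\<^esub> u) = lie_to_abel N d u)"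
      by (rule lie_abel_iso[OF d])
    assume "\<nexists>r. d = (p - 1) * (CARD('n) - 1) + p * r"
    then show "carrier (lie_quot N d :: ('k, ('n, 'k) sym set) module) =
        {\<zero>\<^bsub>lie_quot N d :: ('k, ('n, 'k) sym set) module\<^esub>}"
      by (intro lie_quot_trivial[OF d]) (simp only: C not_False_eq_True)
  next
    fix r d assume "d = (p - 1) * (CARD('n) - 1) + p * r" "d < N"
    then show "\<exists>\<rho> :: ('n, 'k, ('n, 'k) sym set) action.
           rational_hom (lie_mod N d) (lie_action N d) (lie_quot N d) \<rho>
             (\<lambda>u. lie_bracket N 2 (d - 1) +>\<^bsub>lie_mod N d\<^esub> u) \<and>
           (\<exists>\<phi>. rational_iso (lie_quot N d) \<rho> (vf_mod (SymV r)) (W_action p r) \<phi>)"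
      using lie_quot_rational[of d r] assms(1) unfolding C by blast
  qed
qed

end
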